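(* Given an edge-weighted directed graph on at most $n$ vertices undergoing online vertex insertions and predicted vertex deletions, one can maintain exact weighted all-pairs shortest paths such that a vertex insertion is performed in $O(n^2\log^2 n)$ worst-case time, and the deletion of the $i$-th inserted vertex $v_i$ is performed in $O(n^2(\eta_i\log^2 n+1))$ worst-case time, where the error $\eta_i\in[0,n]$ is the number of vertices that were predicted to be deleted before $v_i$ but are actually deleted after $v_i$.
   Context: Model: vertices are inserted online (together with their incident weighted edges to existing vertices); when a vertex is inserted, a predicted deletion time for it is supplied, so that at any time there is a predicted order of deletion of the current vertices. Deletions arrive online and may deviate from the predicted order. After each update the data structure must maintain the exact shortest-path distances between all pairs of current vertices. *)

theory Defs
  imports Complex_Main "HOL-Library.Extended_Real"
begin

section \<open>Machine model\<close>

text \<open>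
  A word RAM extended by weight cells in the comparison-addition model, programmed in a small
  structured language. Integer words lie in \<open>{..<W}\<close>; an operation whose result is not a word has
  no execution, so nothing can be packed into oversized integers. Weights (extended reals) can only
  be moved, added and compared; \<open>\<infinity> + (-\<infinity>) = \<infinity>\<close> as in the library. The name of a register or an
  array is a constant of the program text, so a program uses finitely many of them, and only array
  indices are computed.
\<close>

datatype iop = Add | Sub | Mul | Div | Mod

fun iop_val :: "iop \<Rightarrow> nat \<Rightarrow> nat \<Rightarrow> nat" where
  "iop_val Add a b = a + b"
| "iop_val Sub a b = a - b"
| "iop_val Mul a b = a * b"
| "iop_val Div a b = a div b"
| "iop_val Mod a b = a mod b"

datatype test = ILess nat nat | IEq nat nat | WLess nat nat

datatype com =
    Skip
  | IConst nat nat          \<comment> \<open>\<open>IConst x k\<close>: \<open>x := k\<close>\<close>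
  | IMove nat nat           \<comment> \<open>\<open>IMove x y\<close>: \<open>x := y\<close>\<close>
  | IOp iop nat nat nat     \<comment> \<open>\<open>IOp f x y z\<close>: \<open>x := f y z\<close>\<close>
  | ILoad nat nat nat       \<comment> \<open>\<open>ILoad x a i\<close>: \<open>x := a[i]\<close>\<close>
  | IStore nat nat nat      \<comment> \<open>\<open>IStore a i x\<close>: \<open>a[i] := x\<close>\<close>
  | WConst nat ereal
  | WMove nat nat
  | WAdd nat nat nat
  | WLoad nat nat nat       \<comment> \<open>weight register, weight array, integer register\<close>
  | WStore nat nat nat      \<comment> \<open>weight array, integer register, weight register\<close>
  | Seq com com
  | If test com com
  | While test com

record state =
  ireg :: "nat \<Rightarrow> nat"
  wreg :: "nat \<Rightarrow> ereal"
  iarr :: "nat \<Rightarrow> nat \<Rightarrow> nat"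
  warr :: "nat \<Rightarrow> nat \<Rightarrow> ereal"

definition init_state :: state where
  "init_state = \<lparr>ireg = (\<lambda>_. 0), wreg = (\<lambda>_. 0), iarr = (\<lambda>_ _. 0), warr = (\<lambda>_ _. 0)\<rparr>"

fun holds :: "test \<Rightarrow> state \<Rightarrow> bool" where
  "holds (ILess x y) s \<longleftrightarrow> ireg s x < ireg s y"
| "holds (IEq x y) s \<longleftrightarrow> ireg s x = ireg s y"
| "holds (WLess x y) s \<longleftrightarrow> wreg s x < wreg s y"

definition set_i :: "nat \<Rightarrow> nat \<Rightarrow> state \<Rightarrow> state" where
  "set_i x k s = s\<lparr>ireg := (ireg s)(x := k)\<rparr>"

definition set_w :: "nat \<Rightarrow> ereal \<Rightarrow> state \<Rightarrow> state" where
  "set_w x w s = s\<lparr>wreg := (wreg s)(x := w)\<rparr>"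

text \<open>\<open>exec W c s t s'\<close>: with words in \<open>{..<W}\<close>, the program \<open>c\<close> started in \<open>s\<close> terminates in \<open>s'\<close>
  after \<open>t\<close> unit-cost steps (elementary commands and tests).\<close>

inductive exec :: "nat \<Rightarrow> com \<Rightarrow> state \<Rightarrow> nat \<Rightarrow> state \<Rightarrow> bool" for W :: nat where
  Skip: "exec W Skip s 1 s"
| IConst: "k < W \<Longrightarrow> exec W (IConst x k) s 1 (set_i x k s)"
| IMove: "exec W (IMove x y) s 1 (set_i x (ireg s y) s)"
| IOp: "iop_val f (ireg s y) (ireg s z) < W \<Longrightarrow>
    exec W (IOp f x y z) s 1 (set_i x (iop_val f (ireg s y) (ireg s z)) s)"
| ILoad: "exec W (ILoad x a i) s 1 (set_i x (iarr s a (ireg s i)) s)"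
| IStore: "exec W (IStore a i x) s 1
    (s\<lparr>iarr := (iarr s)(a := (iarr s a)(ireg s i := ireg s x))\<rparr>)"
| WConst: "w \<in> {0, \<infinity>, -\<infinity>} \<Longrightarrow> exec W (WConst x w) s 1 (set_w x w s)"
| WMove: "exec W (WMove x y) s 1 (set_w x (wreg s y) s)"
| WAdd: "exec W (WAdd x y z) s 1 (set_w x (wreg s y + wreg s z) s)"
| WLoad: "exec W (WLoad x a i) s 1 (set_w x (warr s a (ireg s i)) s)"
| WStore: "exec W (WStore a i x) s 1
    (s\<lparr>warr := (warr s)(a := (warr s a)(ireg s i := wreg s x))\<rparr>)"
| Seq: "exec W c1 s t1 s1 \<Longrightarrow> exec W c2 s1 t2 s2 \<Longrightarrow> exec W (Seq c1 c2) s (t1 + t2) s2"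
| IfTrue: "holds b s \<Longrightarrow> exec W c1 s t s1 \<Longrightarrow> exec W (If b c1 c2) s (Suc t) s1"
| IfFalse: "\<not> holds b s \<Longrightarrow> exec W c2 s t s1 \<Longrightarrow> exec W (If b c1 c2) s (Suc t) s1"
| WhileFalse: "\<not> holds b s \<Longrightarrow> exec W (While b c) s 1 s"
| WhileTrue: "holds b s \<Longrightarrow> exec W c s t1 s1 \<Longrightarrow> exec W (While b c) s1 t2 s2 \<Longrightarrow>
    exec W (While b c) s (Suc (t1 + t2)) s2"

inductive_cases exec_elims:
  "exec W Skip s t s'"
  "exec W (IConst x k) s t s'"
  "exec W (IMove x y) s t s'"
  "exec W (IOp f x y z) s t s'"
  "exec W (ILoad x a i) s t s'"
  "exec W (IStore a i x) s t s'"
  "exec W (WConst x w) s t s'"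
  "exec W (WMove x y) s t s'"
  "exec W (WAdd x y z) s t s'"
  "exec W (WLoad x a i) s t s'"
  "exec W (WStore a i x) s t s'"
inductive_cases exec_SeqE: "exec W (Seq c1 c2) s t s'"
inductive_cases exec_IfE: "exec W (If b c1 c2) s t s'"
inductive_cases exec_WhileE: "exec W (While b c) s t s'"

text \<open>Execution is deterministic; hence the machine state after some updates depends on these
  updates only and not on later ones, which makes every program an online algorithm.\<close>

lemma exec_deterministic:
  "exec W c s t s' \<Longrightarrow> exec W c s u s'' \<Longrightarrow> u = t \<and> s'' = s'"
proof (induction arbitrary: u s'' rule: exec.induct)
  case (Seq c1 s t1 s1 c2 t2 s2)
  from Seq.prems show ?case by (rule exec_SeqE) (use Seq.IH in blast)
next
  case (IfTrue b s c1 t s1 c2)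
  from IfTrue.prems show ?case by (rule exec_IfE) (use IfTrue in blast)+
next
  case (IfFalse b s c2 t s1 c1)
  from IfFalse.prems show ?case by (rule exec_IfE) (use IfFalse in blast)+
next
  case (WhileFalse b s c)
  from WhileFalse.prems show ?case by (rule exec_WhileE) (use WhileFalse in auto)
next
  case (WhileTrue b s c t1 s1 t2 s2)
  from WhileTrue.prems show ?case by (rule exec_WhileE) (use WhileTrue in blast)+
qed (auto elim: exec_elims)


section \<open>Dynamic graphs with predicted deletions\<close>

text \<open>Vertices carry names below \<open>n\<close>; the name of a deleted vertex may be given to a vertex inserted
  later. An insertion supplies the predicted deletion time and the weights of the edges to and from
  the vertices present (\<open>None\<close>: no edge).\<close>

datatype update =
    Insert (vertex: nat) (predicted: real) (out_edges: "nat \<Rightarrow> real option")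
      (in_edges: "nat \<Rightarrow> real option")
  | Delete (vertex: nat)

record graph =
  verts :: "nat set"
  weight :: "nat \<Rightarrow> nat \<Rightarrow> real option"
  pred_time :: "nat \<Rightarrow> real"

definition empty_graph :: graph where
  "empty_graph = \<lparr>verts = {}, weight = (\<lambda>_ _. None), pred_time = (\<lambda>_. 0)\<rparr>"

fun apply_update :: "update \<Rightarrow> graph \<Rightarrow> graph" where
  "apply_update (Insert v p f g) G =
    \<lparr>verts = insert v (verts G),
     weight = (\<lambda>x y. if x = v then f y else if y = v then g x else weight G x y),
     pred_time = (pred_time G)(v := p)\<rparr>"
| "apply_update (Delete v) G =
    \<lparr>verts = verts G - {v},
     weight = (\<lambda>x y. if x = v \<or> y = v then None else weight G x y),
     pred_time = pred_time G\<rparr>"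

text \<open>The predicted deletion times of the current vertices are distinct, so that they define an
  order of deletion.\<close>

fun valid_update :: "nat \<Rightarrow> graph \<Rightarrow> update \<Rightarrow> bool" where
  "valid_update n G (Insert v p f g) \<longleftrightarrow>
    v < n \<and> v \<notin> verts G \<and> dom f \<subseteq> verts G \<and> dom g \<subseteq> verts G \<and> p \<notin> pred_time G ` verts G"
| "valid_update n G (Delete v) \<longleftrightarrow> v \<in> verts G"

definition graph_after :: "update list \<Rightarrow> nat \<Rightarrow> graph" where
  "graph_after us k = fold apply_update (take k us) empty_graph"

definition valid_updates :: "nat \<Rightarrow> update list \<Rightarrow> bool" where
  "valid_updates n us \<longleftrightarrow> (\<forall>k < length us. valid_update n (graph_after us k) (us ! k))"

text \<open>An inserted vertex is identified by the position \<open>i\<close> of its insertion in the update sequence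
  (names are reused). Its deletion is the first later deletion of its name, \<open>\<infinity>\<close> if there is none.\<close>

definition deletion_pos :: "update list \<Rightarrow> nat \<Rightarrow> enat" where
  "deletion_pos us i =
    Inf (enat ` {k. i < k \<and> k < length us \<and> us ! k = Delete (vertex (us ! i))})"

text \<open>Vertices inserted only after the deletion of vertex \<open>i\<close> do not count: the predicted
  order is an order on the vertices present, and the error is at most \<open>n\<close>.\<close>

definition prediction_error :: "update list \<Rightarrow> nat \<Rightarrow> nat" where
  "prediction_error us i =
    card {j. j < length us \<and> is_Insert (us ! j) \<and> enat j < deletion_pos us i \<and>
      predicted (us ! j) < predicted (us ! i) \<and> deletion_pos us i < deletion_pos us j}"


section \<open>Shortest-path distances\<close>

definition walks :: "graph \<Rightarrow> nat \<Rightarrow> nat \<Rightarrow> nat list set" where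
  "walks G u v = {xs. xs \<noteq> [] \<and> hd xs = u \<and> last xs = v \<and> set xs \<subseteq> verts G \<and>
    successively (\<lambda>x y. weight G x y \<noteq> None) xs}"

fun walk_weight :: "graph \<Rightarrow> nat list \<Rightarrow> real" where
  "walk_weight G (x # y # xs) = the (weight G x y) + walk_weight G (y # xs)"
| "walk_weight G _ = 0"

text \<open>\<open>\<infinity>\<close> if \<open>v\<close> is not reachable from \<open>u\<close>, and \<open>-\<infinity>\<close> if some walk from \<open>u\<close> to \<open>v\<close> meets a
  negative cycle.\<close>

definition distance :: "graph \<Rightarrow> nat \<Rightarrow> nat \<Rightarrow> ereal" where
  "distance G u v = (INF xs \<in> walks G u v. ereal (walk_weight G xs))"


section \<open>Interface between updates and machine\<close>

fun edge_cell :: "real option \<Rightarrow> ereal" where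
  "edge_cell None = \<infinity>"
| "edge_cell (Some r) = ereal r"

text \<open>Integer registers 0 and 1 receive \<open>n\<close> and the vertex; for an insertion, weight register 0
  receives the predicted deletion time and the weight arrays 0 and 1 the outgoing and incoming
  edges. All other cells persist between updates.\<close>

fun feed :: "nat \<Rightarrow> update \<Rightarrow> state \<Rightarrow> state" where
  "feed n (Insert v p f g) s =
    s\<lparr>ireg := (ireg s)(0 := n, 1 := v),
      wreg := (wreg s)(0 := ereal p),
      warr := (warr s)(0 := (\<lambda>u. edge_cell (f u)), 1 := (\<lambda>u. edge_cell (g u)))\<rparr>"
| "feed n (Delete v) s = s\<lparr>ireg := (ireg s)(0 := n, 1 := v)\<rparr>"

text \<open>The distances are maintained explicitly, as the \<open>n \<times> n\<close> matrix in weight array 2.\<close>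

definition stores_distances :: "nat \<Rightarrow> graph \<Rightarrow> state \<Rightarrow> bool" where
  "stores_distances n G s \<longleftrightarrow>
    (\<forall>u \<in> verts G. \<forall>v \<in> verts G. warr s 2 (u * n + v) = distance G u v)"

lemma graph_after_Suc:
  "k < length us \<Longrightarrow> graph_after us (Suc k) = apply_update (us ! k) (graph_after us k)"
  by (simp add: graph_after_def take_Suc_conv_app_nth)

lemma verts_graph_after:
  assumes "valid_updates n us" "k \<le> length us"
  shows "verts (graph_after us k) \<subseteq> {..<n}"
  using assms(2)
proof (induction k)
  case (Suc k)
  then have "valid_update n (graph_after us k) (us ! k)"
    using assms(1) by (simp add: valid_updates_def)
  with Suc show ?case by (cases "us ! k") (auto simp: graph_after_Suc)
qed (simp add: graph_after_def empty_graph_def)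

lemma present_inserted:
  assumes "valid_updates n us" "k \<le> length us" "v \<in> verts (graph_after us k)"
  shows "\<exists>i<k. is_Insert (us ! i) \<and> vertex (us ! i) = v \<and> (\<forall>l. i < l \<and> l < k \<longrightarrow> us ! l \<noteq> Delete v)"
  using assms(2,3)
proof (induction k)
  case (Suc k)
  show ?case
  proof (cases "v \<in> verts (graph_after us k) \<and> us ! k \<noteq> Delete v")
    case True
    with Suc obtain i where "i < k" "is_Insert (us ! i)" "vertex (us ! i) = v"
      "\<forall>l. i < l \<and> l < k \<longrightarrow> us ! l \<noteq> Delete v" by auto
    with True show ?thesis by (intro exI[of _ i]) (auto simp: less_Suc_eq)
  next
    case False
    with Suc.prems have "is_Insert (us ! k) \<and> vertex (us ! k) = v"
      by (cases "us ! k") (auto simp: graph_after_Suc)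
    then show ?thesis by (intro exI[of _ k]) auto
  qed
qed (simp add: graph_after_def empty_graph_def)

text \<open>Every deletion in a valid sequence is the deletion of some inserted vertex.\<close>

lemma deletion_of_inserted:
  assumes "valid_updates n us" "k < length us" "us ! k = Delete v"
  shows "\<exists>i<k. is_Insert (us ! i) \<and> vertex (us ! i) = v \<and> deletion_pos us i = enat k"
proof -
  from assms have "v \<in> verts (graph_after us k)"
    unfolding valid_updates_def by fastforce
  from present_inserted[OF assms(1) less_imp_le[OF assms(2)] this] obtain i where
    i: "i < k" "is_Insert (us ! i)" "vertex (us ! i) = v"
      "\<forall>l. i < l \<and> l < k \<longrightarrow> us ! l \<noteq> Delete v" by blast
  have "deletion_pos us i = enat k"
    unfolding deletion_pos_def
  proof (rule antisym)
    show "Inf (enat ` {l. i < l \<and> l < length us \<and> us ! l = Delete (vertex (us ! i))}) \<le> enat k"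
      using i assms by (intro Inf_lower) auto
    show "enat k \<le> Inf (enat ` {l. i < l \<and> l < length us \<and> us ! l = Delete (vertex (us ! i))})"
      using i by (intro Inf_greatest) (auto simp: not_less[symmetric])
  qed
  with i show ?thesis by blast
qed

lemma inserted_present:
  assumes "valid_updates n us" "k \<le> length us" "j < k" "is_Insert (us ! j)"
    and "enat k \<le> deletion_pos us j"
  shows "vertex (us ! j) \<in> verts (graph_after us k)"
  using assms(2,3,5)
proof (induction k)
  case (Suc k)
  show ?case
  proof (cases "j = k")
    case True
    with Suc.prems assms(4) show ?thesis by (cases "us ! k") (auto simp: graph_after_Suc)
  next
    case False
    have "enat k \<le> deletion_pos us j"
      by (rule order_trans[OF _ Suc.prems(3)]) simp
    with Suc.IH Suc.prems False have present: "vertex (us ! j) \<in> verts (graph_after us k)"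
      by simp
    have "us ! k \<noteq> Delete (vertex (us ! j))"
    proof
      assume "us ! k = Delete (vertex (us ! j))"
      then have "deletion_pos us j \<le> enat k"
        unfolding deletion_pos_def using False Suc.prems by (intro Inf_lower) auto
      with Suc.prems(3) have "enat (Suc k) \<le> enat k" by (rule order_trans)
      then show False by simp
    qed
    with present Suc.prems show ?thesis by (cases "us ! k") (auto simp: graph_after_Suc)
  qed
qed simp

lemma prediction_error_le:
  assumes "valid_updates n us" "k < length us" "deletion_pos us i = enat k"
  shows "prediction_error us i \<le> n"
proof -
  define J where "J = {j. j < length us \<and> is_Insert (us ! j) \<and> enat j < deletion_pos us i \<and>
      predicted (us ! j) < predicted (us ! i) \<and> deletion_pos us i < deletion_pos us j}"
  have J: "j < k \<and> is_Insert (us ! j) \<and> enat k < deletion_pos us j" if "j \<in> J" for j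
    using that assms(3) by (auto simp: J_def)
  have no_clash: "vertex (us ! j) \<noteq> vertex (us ! l)" if "j \<in> J" "l \<in> J" "j < l" for j l
  proof -
    have "enat l \<le> enat k" using J[OF that(2)] by simp
    then have "enat l \<le> deletion_pos us j" using J[OF that(1)] by (meson less_imp_le order_trans)
    then have "vertex (us ! j) \<in> verts (graph_after us l)"
      using J that assms by (intro inserted_present) (auto dest: J)
    moreover have "valid_update n (graph_after us l) (us ! l)"
      using assms J[OF that(2)] by (auto simp: valid_updates_def)
    ultimately show ?thesis using J[OF that(2)] by (cases "us ! l") auto
  qed
  have "inj_on (\<lambda>j. vertex (us ! j)) J"
    by (rule inj_onI) (metis no_clash linorder_neqE_nat)
  moreover have "(\<lambda>j. vertex (us ! j)) ` J \<subseteq> {..<n}"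
  proof (intro image_subsetI)
    fix j assume "j \<in> J"
    then have "vertex (us ! j) \<in> verts (graph_after us k)"
      using J[of j] assms by (intro inserted_present) auto
    then show "vertex (us ! j) \<in> {..<n}"
      using verts_graph_after[OF assms(1), of k] assms(2) by auto
  qed
  ultimately have "card J \<le> card {..<n}" by (intro card_inj_on_le) auto
  then show ?thesis by (simp add: prediction_error_def J_def)
qed

end

theory Submission
  imports Defs
begin

text \<open>
  The present vertices are kept in the predicted order of deletion, and the algorithm stores, for
  \<open>O(log\<^sup>2 n)\<close> ranks \<open>r\<close>, the matrix of the distances along walks whose interior avoids the first
  \<open>r\<close> vertices of that order; rank 0 gives the distances. Inserting a vertex keeps all ranks, and one
  pivot updates each matrix in \<open>O(n\<^sup>2)\<close> time. Deleting the first vertex lowers all ranks by one. The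
  ranks are spaced geometrically: level \<open>l\<close> holds a circular buffer of \<open>2d\<close> matrices at distance \<open>d\<^sup>l\<close>
  and a walker that prepares the next ones, starting from a matrix of level \<open>l + 1\<close>. Each of the \<open>O(d)\<close>
  levels advances once in \<open>d\<close> deletions, so that a deletion advances \<open>O(1)\<close> walkers.

  A walker advances by a batch of at most \<open>d\<close> pivots, where \<open>d\<close> is about the largest number with
  \<open>d\<^bsup>8d\<^esup> \<le> n\<close>. By Fredman's trick, comparing \<open>a(x,b) + c(b,y)\<close> with \<open>a(x,b') + c(b',y)\<close> amounts to
  comparing \<open>a(x,b) - a(x,b')\<close> with \<open>c(b',y) - c(b,y)\<close>; the positions of the latter among \<open>d\<^sup>3\<close> rows
  encode a column in a small integer, so that columns are treated by class and a batch costs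
  \<open>O(n\<^sup>2)\<close> like a single pivot.

  To delete \<open>v\<close> out of order, delete the first vertex until \<open>v\<close> is gone and insert the other
  deleted vertices again: they were predicted before \<open>v\<close> and are counted by its error.
\<close>

section \<open>Weakest preconditions with running time\<close>

text \<open>Per block of \<open>d\<close> deletions each level has to make \<open>d\<close> pivots.
  Made singly, these would cost about \<open>t\<close> pivots per deletion, a factor
  \<open>t\<close> too many for a deletion in predicted order. As \<open>t\<close> is of order
  \<open>d\<close>, it is enough that \<open>d\<close> pivots together cost as much as one: this is
  the task of the min-plus product, and its cost dictates the parameters. In a tile,
  \<open>n\<close> columns are compared for \<open>d * d\<close> pairs of middle indices by binary
  searches of depth at most \<open>3 * d\<close>; with the tile height \<open>m = d ^ 3\<close> the
  \<open>m * n\<close> entries of the tile pay for this. There are at most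
  \<open>(m + 1) ^ d\<close> codes, and testing all of them for every row must not cost more than
  visiting the columns; \<open>d ^ (8 * d) <= n\<close> leaves room for that. Conversely,
  \<open>d\<close> is taken almost as large as possible, so that \<open>t <= 24 * d\<close>; the
  number of matrices is then of order \<open>d * d\<close>, which gives the logarithmic factor of
  insertions. Some buffer slots have unspecified contents at times. Insertions process them all the
  same, so termination and time are proved for arbitrary contents, and correctness of a slot is
  carried as a separate premise.\<close>

definition wp :: "nat => com => state => (nat => state => bool) => bool" where
  "wp W c s Q \<longleftrightarrow> (\<exists>t s'. exec W c s t s' & Q t s')"

text \<open>By determinism the existence of one execution is as strong as a claim about all of them,
  so the rules are equations. Together with \<open>wp_Seq\<close> and \<open>wp_If\<close> they let
  simplification run straight-line code symbolically; the side conditions that remain say that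
  results are words.\<close>

lemma wp_atomic [simp]:
  "wp W Skip s Q \<longleftrightarrow> Q 1 s"
  "wp W (IConst x k) s Q \<longleftrightarrow> k < W & Q 1 (set_i x k s)"
  "wp W (IMove x y) s Q \<longleftrightarrow> Q 1 (set_i x (ireg s y) s)"
  "wp W (IOp f x y z) s Q \<longleftrightarrow> iop_val f (ireg s y) (ireg s z) < W &
     Q 1 (set_i x (iop_val f (ireg s y) (ireg s z)) s)"
  "wp W (ILoad x a i) s Q \<longleftrightarrow> Q 1 (set_i x (iarr s a (ireg s i)) s)"
  "wp W (IStore a i x) s Q \<longleftrightarrow>
     Q 1 (s\<lparr>iarr := (iarr s)(a := (iarr s a)(ireg s i := ireg s x))\<rparr>)"
  "wp W (WConst x w) s Q \<longleftrightarrow> w \<in> {0, \<infinity>, -\<infinity>} & Q 1 (set_w x w s)"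
  "wp W (WMove x y) s Q \<longleftrightarrow> Q 1 (set_w x (wreg s y) s)"
  "wp W (WAdd x y z) s Q \<longleftrightarrow> Q 1 (set_w x (wreg s y + wreg s z) s)"
  "wp W (WLoad x a i) s Q \<longleftrightarrow> Q 1 (set_w x (warr s a (ireg s i)) s)"
  "wp W (WStore a i x) s Q \<longleftrightarrow>
     Q 1 (s\<lparr>warr := (warr s)(a := (warr s a)(ireg s i := wreg s x))\<rparr>)"
proof -
  have wpI: "exec W c s 1 s' ==> (wp W c s Q \<longleftrightarrow> Q 1 s')" for c s' Q
    unfolding wp_def using exec_deterministic by blast
  show "wp W (IConst x k) s Q \<longleftrightarrow> k < W & Q 1 (set_i x k s)"
    using wpI[OF exec.IConst] by (cases "k < W") (auto simp: wp_def elim: exec_elims)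
  show "wp W (IOp f x y z) s Q \<longleftrightarrow> iop_val f (ireg s y) (ireg s z) < W &
     Q 1 (set_i x (iop_val f (ireg s y) (ireg s z)) s)"
    using wpI[OF exec.IOp]
    by (cases "iop_val f (ireg s y) (ireg s z) < W") (auto simp: wp_def elim: exec_elims)
  show "wp W (WConst x w) s Q \<longleftrightarrow> w \<in> {0, \<infinity>, -\<infinity>} & Q 1 (set_w x w s)"
    using wpI[OF exec.WConst]
    by (cases "w \<in> {0, \<infinity>, -\<infinity>}") (auto simp: wp_def elim: exec_elims)
qed (auto simp only: wp_def intro: exec.intros dest: exec_deterministic[OF exec.Skip]
  exec_deterministic[OF exec.IMove] exec_deterministic[OF exec.ILoad]
  exec_deterministic[OF exec.IStore] exec_deterministic[OF exec.WMove]
  exec_deterministic[OF exec.WAdd] exec_deterministic[OF exec.WLoad]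
  exec_deterministic[OF exec.WStore])

lemma wp_Seq [simp]:
  "wp W (Seq c1 c2) s Q \<longleftrightarrow> wp W c1 s (%t1 s1. wp W c2 s1 (%t2 s2. Q (t1 + t2) s2))"
  unfolding wp_def by (auto intro: exec.intros elim!: exec_SeqE)

lemma wp_If [simp]:
  "wp W (If b c1 c2) s Q \<longleftrightarrow>
     (if holds b s then wp W c1 s (%t. Q (Suc t)) else wp W c2 s (%t. Q (Suc t)))"
  unfolding wp_def by (auto intro: exec.intros elim!: exec_IfE)

text \<open>A single unrolling, kept out of the simplifier, which would unroll forever. Loops are
  proved by induction and use the equation once per round.\<close>

lemma wp_While:
  "wp W (While b c) s Q \<longleftrightarrow>
     (if holds b s then wp W c s (%t1 s1. wp W (While b c) s1 (%t2. Q (Suc (t1 + t2))))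
      else Q 1 s)"
proof
  assume "wp W (While b c) s Q"
  then obtain t s' where e: "exec W (While b c) s t s'" "Q t s'" by (auto simp: wp_def)
  have "(t = 1 & s' = s & \<not> holds b s) \<or> (\<exists>t1 s1 t2. t = Suc (t1 + t2) & holds b s &
      exec W c s t1 s1 & exec W (While b c) s1 t2 s')"
    using e(1) unfolding One_nat_def by (rule exec_WhileE) blast+
  then show "if holds b s then wp W c s (%t1 s1. wp W (While b c) s1 (%t2. Q (Suc (t1 + t2))))
      else Q 1 s"
  proof (elim disjE exE conjE)
    assume "t = 1" "s' = s" "\<not> holds b s"
    with e show ?thesis by simp
  next
    fix t1 s1 t2
    assume 2: "t = Suc (t1 + t2)" "holds b s" "exec W c s t1 s1" "exec W (While b c) s1 t2 s'"
    then have "wp W (While b c) s1 (%t2. Q (Suc (t1 + t2)))" using e by (auto simp: wp_def)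
    then show ?thesis using 2 by (simp only: if_True) (unfold wp_def[of W c], blast)
  qed
next
  assume a: "if holds b s then wp W c s (%t1 s1. wp W (While b c) s1 (%t2. Q (Suc (t1 + t2))))
      else Q 1 s"
  show "wp W (While b c) s Q"
  proof (cases "holds b s")
    case True
    then obtain t1 s1 t2 s2 where "exec W c s t1 s1" "exec W (While b c) s1 t2 s2" "Q (Suc (t1 + t2)) s2"
      using a by (auto simp: wp_def)
    then show ?thesis using True unfolding wp_def by (blast intro: exec.WhileTrue)
  next
    case False
    then have "exec W (While b c) s 1 s" "Q 1 s" using a by (auto intro: exec.WhileFalse simp only: if_False)
    then show ?thesis unfolding wp_def by blast
  qed
qed

lemma wp_mono: "wp W c s P ==> (\<And>t s'. P t s' ==> Q t s') ==> wp W c s Q"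
  unfolding wp_def by blast

lemma set_i_sel [simp]:
  "ireg (set_i x k s) = (ireg s)(x := k)" "wreg (set_i x k s) = wreg s"
  "iarr (set_i x k s) = iarr s" "warr (set_i x k s) = warr s"
  by (simp_all add: set_i_def)

lemma set_w_sel [simp]:
  "ireg (set_w x w s) = ireg s" "wreg (set_w x w s) = (wreg s)(x := w)"
  "iarr (set_w x w s) = iarr s" "warr (set_w x w s) = warr s"
  by (simp_all add: set_w_def)

subsection \<open>Frames\<close>

fun iw :: "com => nat set" where
  "iw (IConst x _) = {x}" | "iw (IMove x _) = {x}" | "iw (IOp _ x _ _) = {x}"
| "iw (ILoad x _ _) = {x}" | "iw (Seq a b) = iw a \<union> iw b" | "iw (If _ a b) = iw a \<union> iw b"
| "iw (While _ a) = iw a" | "iw _ = {}"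

fun ww :: "com => nat set" where
  "ww (WConst x _) = {x}" | "ww (WMove x _) = {x}" | "ww (WAdd x _ _) = {x}"
| "ww (WLoad x _ _) = {x}" | "ww (Seq a b) = ww a \<union> ww b" | "ww (If _ a b) = ww a \<union> ww b"
| "ww (While _ a) = ww a" | "ww _ = {}"

fun iaw :: "com => nat set" where
  "iaw (IStore a _ _) = {a}" | "iaw (Seq a b) = iaw a \<union> iaw b" | "iaw (If _ a b) = iaw a \<union> iaw b"
| "iaw (While _ a) = iaw a" | "iaw _ = {}"

fun waw :: "com => nat set" where
  "waw (WStore a _ _) = {a}" | "waw (Seq a b) = waw a \<union> waw b" | "waw (If _ a b) = waw a \<union> waw b"
| "waw (While _ a) = waw a" | "waw _ = {}"

text \<open>The sets bound what may change: integer registers, weight registers, integer arrays and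
  weight arrays, an array being taken as a whole. With the syntactic write sets of a program, this
  spares loop invariants the mention of everything that the body leaves alone.\<close>

definition same :: "nat set => nat set => nat set => nat set => state => state => bool" where
  "same X Y A B s s' \<longleftrightarrow> (\<forall>x. x \<notin> X --> ireg s' x = ireg s x) & (\<forall>x. x \<notin> Y --> wreg s' x = wreg s x) &
     (\<forall>a. a \<notin> A --> iarr s' a = iarr s a) & (\<forall>a. a \<notin> B --> warr s' a = warr s a)"

abbreviation frame :: "com => state => state => bool" where
  "frame c \<equiv> same (iw c) (ww c) (iaw c) (waw c)"

abbreviation loop_frame :: "nat => com => state => state => bool" where
  "loop_frame i c \<equiv> same (insert i (iw c)) (ww c) (iaw c) (waw c)"

lemma sameD:
  assumes "same X Y A B s s'"
  shows "x \<notin> X ==> ireg s' x = ireg s x" "x \<notin> Y ==> wreg s' x = wreg s x"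
    "a \<notin> A ==> iarr s' a = iarr s a" "a \<notin> B ==> warr s' a = warr s a"
  using assms by (auto simp: same_def)

lemma same_trans: "same X Y A B s s' ==> same X Y A B s' s'' ==> same X Y A B s s''"
  by (simp add: same_def)

lemma same_mono:
  "same X Y A B s s' ==> X \<subseteq> X' ==> Y \<subseteq> Y' ==> A \<subseteq> A' ==> B \<subseteq> B' ==> same X' Y' A' B' s s'"
  unfolding same_def by blast

lemma exec_frame: "exec W c s t s' ==> frame c s s'"
proof (induction rule: exec.induct)
  case (Seq c1 s t1 s1 c2 t2 s2)
  then show ?case
    by (auto intro: same_trans[of _ _ _ _ s s1 s2] elim: same_mono)
next
  case (IfTrue b s c1 t s1 c2)
  then show ?case by (auto elim: same_mono)
next
  case (IfFalse b s c2 t s1 c1)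
  then show ?case by (auto elim: same_mono)
next
  case (WhileTrue b s c t1 s1 t2 s2)
  then show ?case by (auto intro: same_trans)
qed (auto simp: same_def)

lemma wp_frame: "wp W c s P ==> (\<And>t s'. P t s' ==> frame c s s' ==> Q t s') ==> wp W c s Q"
  unfolding wp_def using exec_frame by blast

lemma wp_same:
  assumes "wp W c s P" "iw c \<subseteq> X" "ww c \<subseteq> Y" "iaw c \<subseteq> A" "waw c \<subseteq> B"
    and "\<And>t s'. P t s' ==> same X Y A B s s' ==> Q t s'"
  shows "wp W c s Q"
  using assms(1) by (rule wp_frame) (auto intro: assms(6) same_mono[OF _ assms(2-5)])

subsection \<open>Counting loops\<close>

text \<open>Integer register 2 holds the constant 1 while a program runs.\<close>

definition For :: "nat => nat => com => com" where
  "For i N c = Seq (IConst i 0) (While (ILess i N) (Seq c (IOp Add i i 2)))"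

lemma For_mods [simp]:
  "iw (For i N c) = insert i (iw c)" "ww (For i N c) = ww c"
  "iaw (For i N c) = iaw c" "waw (For i N c) = waw c"
  by (auto simp: For_def)

text \<open>The invariant is indexed by the value of the counter and is established after the
  increment. A round pays 2 beyond its body, for the test and the increment; the final 2 is for the
  initial assignment and the failing test.\<close>

lemma wp_For:
  fixes T :: "nat => nat"
  assumes "i \<notin> iw c" "N \<notin> iw c" "2 \<notin> iw c" "i \<noteq> N" "i \<noteq> 2"
    and "ireg s 2 = 1" "ireg s N = m" "m < W"
    and init: "I 0 (set_i i 0 s)"
    and step: "\<And>j s1. j < m ==> I j s1 ==> ireg s1 i = j ==>
      loop_frame i c s s1 ==>
      wp W c s1 (%t s2. t <= T j & I (Suc j) (set_i i (Suc j) s2))"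
  shows "wp W (For i N c) s (%t s'. t <= (\<Sum>j<m. T j + 2) + 2 & I m s' & ireg s' i = m &
    loop_frame i c s s')"
proof -
  let ?F = "loop_frame i c"
  let ?L = "While (ILess i N) (Seq c (IOp Add i i 2))"
  \<comment> \<open>Generalised to a loop entered with counter \<open>j0\<close>, so that the
    induction can run on the number of rounds left.\<close>
  have loop: "wp W ?L s1 (%t s'. t <= (\<Sum>j=j0..<m. T j + 2) + 1 & I m s' & ireg s' i = m & ?F s s')"
    if "j0 <= m" "I j0 s1" "ireg s1 i = j0" "?F s s1" for j0 s1
    using that
  proof (induction "m - j0" arbitrary: j0 s1)
    case 0
    then have "j0 = m" by simp
    moreover have "ireg s1 N = m" using 0 assms by (auto simp: same_def)
    ultimately show ?case using 0 by (subst wp_While) simp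
  next
    case (Suc x)
    then have lt: "j0 < m" by simp
    have N: "ireg s1 N = m" using Suc assms by (auto simp: same_def)
    have "wp W c s1 (%t1 s2. 1 + ireg s2 i < W & ireg s2 2 = 1 &
       wp W ?L (set_i i (Suc (ireg s2 i)) s2)
        (%t2 s'. Suc (t1 + 1 + t2) <= (\<Sum>j=j0..<m. T j + 2) + 1 & I m s' & ireg s' i = m & ?F s s'))"
    proof (rule wp_frame[OF step[OF lt Suc.prems(2-4)]])
      fix t s2 assume a: "t <= T j0 & I (Suc j0) (set_i i (Suc j0) s2)" "frame c s1 s2"
      have i2: "ireg s2 i = j0" using a(2) assms(1) Suc.prems by (simp add: same_def)
      have F2: "?F s (set_i i (Suc j0) s2)"
        using a(2) Suc.prems(4) by (auto simp: same_def)
      have one: "ireg s2 2 = 1"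
        using a(2) Suc.prems(4) assms by (simp add: same_def)
      have "wp W ?L (set_i i (Suc j0) s2)
         (%t s'. t <= (\<Sum>j=Suc j0..<m. T j + 2) + 1 & I m s' & ireg s' i = m & ?F s s')"
        using Suc.hyps(1)[of "Suc j0"] Suc.hyps(2) a(1) F2 lt by simp
      then show "1 + ireg s2 i < W & ireg s2 2 = 1 &
        wp W ?L (set_i i (Suc (ireg s2 i)) s2)
        (%t2 s'. Suc (t + 1 + t2) <= (\<Sum>j=j0..<m. T j + 2) + 1 & I m s' & ireg s' i = m & ?F s s')"
        unfolding i2 using one lt \<open>m < W\<close> a(1)
        by (auto elim!: wp_mono simp: sum.atLeast_Suc_lessThan[OF lt])
    qed
    then show ?case
      using N Suc.prems lt by (subst wp_While) (auto elim!: wp_mono)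
  qed
  have "wp W ?L (set_i i 0 s) (%t s'. t <= (\<Sum>j=0..<m. T j + 2) + 1 & I m s' & ireg s' i = m & ?F s s')"
    by (rule loop) (auto simp: init same_def)
  then show ?thesis
    using \<open>m < W\<close> by (auto simp: For_def atLeast0LessThan elim!: wp_mono)
qed

lemma wp_For_const:
  fixes T :: nat
  assumes "i \<notin> iw c" "N \<notin> iw c" "2 \<notin> iw c" "i \<noteq> N" "i \<noteq> 2"
    and "ireg s 2 = 1" "ireg s N = m" "m < W"
    and init: "I 0 (set_i i 0 s)"
    and step: "\<And>j s1. j < m ==> I j s1 ==> ireg s1 i = j ==>
      loop_frame i c s s1 ==>
      wp W c s1 (%t s2. t <= T & I (Suc j) (set_i i (Suc j) s2))"
  shows "wp W (For i N c) s (%t s'. t <= m * (T + 2) + 2 & I m s' & ireg s' i = m &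
    loop_frame i c s s')"
proof -
  have eq: "m * (T + 2) + 2 = (\<Sum>j<m. T + 2) + 2" by simp
  show ?thesis unfolding eq by (rule wp_For[where T = "%_. T"]) (fact assms)+
qed

section \<open>Walks with restricted interior\<close>

fun path_weight :: "(nat => nat => ereal) => nat list => ereal" where
  "path_weight w (x # y # xs) = w x y + path_weight w (y # xs)"
| "path_weight w _ = 0"

text \<open>Only the interior is confined to \<open>A\<close>, not the end points. It may repeat
  vertices, so that a negative cycle drives the infimum to \<open>-\<infinity>\<close>. The extra 0
  is the empty walk.\<close>

definition path_weights :: "(nat => nat => ereal) => nat set => nat => nat => ereal set" where
  "path_weights w A x y = {path_weight w (x # xs @ [y]) | xs. set xs \<subseteq> A} \<union> (if x = y then {0} else {})"

text \<open>With \<open>A\<close> as the set of pivots made so far, this is the matrix of the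
  Floyd-Warshall algorithm.\<close>

definition fw :: "(nat => nat => ereal) => nat set => nat => nat => ereal" where
  "fw w A x y = Inf (path_weights w A x y)"

lemma path_weight_append:
  "path_weight w (xs @ z # ys) = path_weight w (xs @ [z]) + path_weight w (z # ys)"
proof (induction xs)
  case (Cons a xs)
  then show ?case by (cases xs) (auto simp: add.assoc)
qed simp

lemma fw_le: "set xs \<subseteq> A ==> fw w A x y <= path_weight w (x # xs @ [y])"
  unfolding fw_def path_weights_def by (intro Inf_lower) auto

lemma fw_le_0: "fw w A x x <= 0"
  unfolding fw_def path_weights_def by (intro Inf_lower) auto

lemma fw_le_edge: "fw w A x y <= w x y"
  using fw_le[of "[]"] by simp

lemma fw_greatest:
  "(\<And>xs. set xs \<subseteq> A ==> c <= path_weight w (x # xs @ [y])) ==> (x = y ==> c <= 0) ==> c <= fw w A x y"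
  unfolding fw_def path_weights_def by (intro Inf_greatest) (auto split: if_splits)

lemma fw_mono: "A \<subseteq> B ==> fw w B x y <= fw w A x y"
  by (rule fw_greatest) (auto intro: fw_le fw_le_0)

lemma path_weight_cong:
  "(\<And>x y. x \<in> set xs ==> y \<in> set xs ==> w x y = w' x y) ==> path_weight w xs = path_weight w' xs"
  by (induction w xs rule: path_weight.induct) auto

lemma fw_cong:
  assumes "\<And>u v. u \<in> insert x (insert y A) ==> v \<in> insert x (insert y A) ==> w u v = w' u v"
  shows "fw w A x y = fw w' A x y"
proof -
  have "path_weight w (x # xs @ [y]) = path_weight w' (x # xs @ [y])" if "set xs \<subseteq> A" for xs
    using that by (intro path_weight_cong assms) auto
  then have "path_weights w A x y = path_weights w' A x y"
    unfolding path_weights_def by (auto; metis)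
  then show ?thesis by (simp add: fw_def)
qed

text \<open>If both infima are below \<open>\<infinity>\<close>, each set has an element below
  \<open>\<infinity>\<close>, which is finite because \<open>-\<infinity>\<close> is excluded.
  Finite terms may be subtracted on both sides, which moves one infimum at a time.\<close>

lemma le_Inf_add_Inf:
  fixes c :: ereal
  assumes "\<And>a b. a \<in> V1 ==> b \<in> V2 ==> c <= a + b" "-\<infinity> \<notin> V1" "-\<infinity> \<notin> V2"
  shows "c <= Inf V1 + Inf V2"
proof (cases "Inf V1 = \<infinity> \<or> Inf V2 = \<infinity>")
  case False
  then obtain a0 b0 where a0: "a0 \<in> V1" "a0 < \<infinity>" and b0: "b0 \<in> V2" "b0 < \<infinity>"
    by (metis Inf_less_iff ereal_infty_less(1))
  have 1: "c <= a + Inf V2" if "a \<in> V1" "a < \<infinity>" for a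
  proof -
    have fin: "\<bar>a\<bar> \<noteq> \<infinity>" using that assms(2) by auto
    have "c - a <= b" if "b \<in> V2" for b
      using assms(1)[OF \<open>a \<in> V1\<close> that] fin by (cases a; cases b; cases c) (auto simp: ereal_minus_le_iff add.commute)
    then have "c - a <= Inf V2" by (rule Inf_greatest)
    then show ?thesis using fin by (cases a; cases "Inf V2"; cases c) auto
  qed
  show ?thesis
  proof (cases "Inf V2 = -\<infinity>")
    case True
    then have "c = -\<infinity>" using 1[OF a0] a0 assms(2) by (cases a0) auto
    then show ?thesis by simp
  next
    case f2: False
    then have fin: "\<bar>Inf V2\<bar> \<noteq> \<infinity>" using False by auto
    have "c - Inf V2 <= a" if "a \<in> V1" for a
      using 1[OF that] fin by (cases a; cases "Inf V2"; cases c) auto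
    then have "c - Inf V2 <= Inf V1" by (rule Inf_greatest)
    then show ?thesis using fin by (cases "Inf V1"; cases "Inf V2"; cases c) auto
  qed
qed auto

text \<open>Edges weigh a real or \<open>\<infinity>\<close>, hence so does every walk:
  \<open>-\<infinity>\<close> arises as an infimum only, through negative cycles.\<close>

locale weights =
  fixes w :: "nat => nat => ereal"
  assumes w_not_MInf: "w x y \<noteq> -\<infinity>"
begin

lemma path_weight_not_MInf: "path_weight w xs \<noteq> -\<infinity>"
proof (induction xs)
  case (Cons a xs)
  then show ?case by (cases xs) (auto simp: w_not_MInf)
qed simp

lemma MInf_notin_path_weights: "-\<infinity> \<notin> path_weights w A x y"
  unfolding path_weights_def using path_weight_not_MInf
  by (auto split: if_splits dest: sym[of "-\<infinity>"])

text \<open>Walks are concatenated at \<open>z\<close>, which thereby becomes an interior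
  vertex.\<close>

lemma fw_triangle:
  assumes "z \<in> A"
  shows "fw w A x y <= fw w A x z + fw w A z y"
  unfolding fw_def[of w A x z] fw_def[of w A z y]
proof (rule le_Inf_add_Inf)
  fix a b assume ab: "a \<in> path_weights w A x z" "b \<in> path_weights w A z y"
  consider (pp) xs ys where "a = path_weight w (x # xs @ [z])" "set xs \<subseteq> A"
      "b = path_weight w (z # ys @ [y])" "set ys \<subseteq> A"
    | (l) "x = z" "a = 0" | (r) "z = y" "b = 0"
    using ab unfolding path_weights_def by (auto split: if_splits)
  then show "fw w A x y <= a + b"
  proof cases
    case pp
    have "fw w A x y <= path_weight w (x # (xs @ z # ys) @ [y])"
      using pp assms by (intro fw_le) auto
    also have "\<dots> = a + b"
      using path_weight_append[of w "x # xs" z "ys @ [y]"] pp by simp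
    finally show ?thesis .
  next
    case l
    then show ?thesis using ab by (auto simp: fw_def intro: Inf_lower)
  next
    case r
    then show ?thesis using ab by (auto simp: fw_def intro: Inf_lower)
  qed
qed (rule MInf_notin_path_weights)+

text \<open>A negative closed walk can be repeated: the triangle inequality reads
  \<open>a <= a + a\<close>, which leaves only \<open>-\<infinity>\<close> for negative
  \<open>a\<close>.\<close>

lemma fw_self: "z \<in> A ==> fw w A z z < 0 ==> fw w A z z = -\<infinity>"
  using fw_triangle[of z A z z] by (cases "fw w A z z") auto

text \<open>The star of the entry \<open>fw w A z z\<close> in the min-plus semiring: the infimum
  over all numbers of repetitions of closed walks at \<open>z\<close>.\<close>

definition loop_cost :: "nat set => nat => ereal" where
  "loop_cost A z = (if fw w A z z < 0 then -\<infinity> else 0)"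

lemma path_from_pivot:
  assumes "set xs \<subseteq> insert z A"
  shows "loop_cost A z + fw w A z y <= path_weight w (z # xs @ [y])"
  using assms
proof (induction xs rule: length_induct)
  case (1 xs)
  show ?case
  proof (cases "z \<in> set xs")
    case False
    then have "fw w A z y <= path_weight w (z # xs @ [y])" using 1 by (intro fw_le) auto
    moreover have "loop_cost A z + fw w A z y <= fw w A z y"
      by (cases "fw w A z y") (auto simp: loop_cost_def)
    ultimately show ?thesis by (rule order_trans[rotated])
  next
    case True
    then obtain ys zs where xs: "xs = ys @ z # zs" "z \<notin> set ys" by (meson split_list_first)
    have IH: "loop_cost A z + fw w A z y <= path_weight w (z # zs @ [y])"
      using 1 xs by auto
    have ysA: "set ys \<subseteq> A" using 1 xs by auto
    then have l: "fw w A z z <= path_weight w (z # ys @ [z])" by (intro fw_le)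
    have eq: "path_weight w (z # xs @ [y]) = path_weight w (z # ys @ [z]) + path_weight w (z # zs @ [y])"
      using path_weight_append[of w "z # ys" z "zs @ [y]"] xs by simp
    show ?thesis
    proof (cases "fw w A z z < 0")
      case False
      then have "0 <= path_weight w (z # ys @ [z])" using l by auto
      then show ?thesis using IH eq add_mono[OF _ IH, of 0] by simp
    next
      case True
      show ?thesis
      proof (cases "fw w A z y = \<infinity>")
        case True
        then have "path_weight w (z # zs @ [y]) = \<infinity>" using IH by simp
        then show ?thesis using eq by simp
      next
        case F: False
        then have "loop_cost A z + fw w A z y = -\<infinity>" using True by (cases "fw w A z y") (auto simp: loop_cost_def)
        then show ?thesis by (simp only: ereal_less_eq)
      qed
    qed
  qed
qed

text \<open>The Floyd-Warshall pivot in the presence of negative cycles. If \<open>z\<close> is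
  unreachable from \<open>x\<close>, or \<open>y\<close> from \<open>z\<close>, the convention
  \<open>\<infinity> + (-\<infinity>) = \<infinity>\<close> makes the second term infinite even when
  the loop at \<open>z\<close> is negative.\<close>

theorem fw_insert:
  "fw w (insert z A) x y = min (fw w A x y) (fw w A x z + loop_cost A z + fw w A z y)"
proof (rule antisym)
  let ?A = "insert z A"
  have "fw w ?A x y <= fw w A x z + loop_cost A z + fw w A z y"
  proof (cases "fw w A x z = \<infinity> \<or> fw w A z y = \<infinity>")
    case False
    have tri: "fw w ?A x y <= fw w ?A x z + (fw w ?A z z + fw w ?A z y)"
      by (intro order_trans[OF fw_triangle[of z] add_mono] fw_triangle) auto
    have m: "fw w ?A x z <= fw w A x z" "fw w ?A z y <= fw w A z y" "fw w ?A z z <= fw w A z z"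
      by (auto intro: fw_mono)
    show ?thesis
    proof (cases "fw w A z z < 0")
      case True
      then have "fw w ?A z z = -\<infinity>" using m by (intro fw_self) auto
      moreover have "fw w ?A x z \<noteq> \<infinity>" "fw w ?A z y \<noteq> \<infinity>" using m False by auto
      ultimately have "fw w ?A x y = -\<infinity>" using tri by (cases "fw w ?A x z"; cases "fw w ?A z y") auto
      then show ?thesis by simp
    next
      case F: False
      have "fw w ?A x y <= fw w ?A x z + fw w ?A z y" by (intro fw_triangle) auto
      also have "\<dots> <= fw w A x z + fw w A z y" by (intro add_mono m)
      finally show ?thesis using F by (simp add: loop_cost_def)
    qed
  qed auto
  then show "fw w ?A x y <= min (fw w A x y) (fw w A x z + loop_cost A z + fw w A z y)"
    by (auto intro: fw_mono)
  show "min (fw w A x y) (fw w A x z + loop_cost A z + fw w A z y) <= fw w ?A x y"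
  proof (rule fw_greatest)
    fix xs assume xs: "set xs \<subseteq> ?A"
    show "min (fw w A x y) (fw w A x z + loop_cost A z + fw w A z y) <= path_weight w (x # xs @ [y])"
    proof (cases "z \<in> set xs")
      case False
      then show ?thesis using xs by (intro min.coboundedI1 fw_le) auto
    next
      case True
      then obtain ys zs where e: "xs = ys @ z # zs" "z \<notin> set ys" by (meson split_list_first)
      have "fw w A x z + (loop_cost A z + fw w A z y) <= path_weight w (x # ys @ [z]) + path_weight w (z # zs @ [y])"
        using xs e by (intro add_mono fw_le path_from_pivot) auto
      also have "\<dots> = path_weight w (x # xs @ [y])"
        using path_weight_append[of w "x # ys" z "zs @ [y]"] e by simp
      finally show ?thesis by (simp add: add.assoc min.coboundedI2)
    qed
  next
    assume "x = y" then show "min (fw w A x y) (fw w A x z + loop_cost A z + fw w A z y) <= 0"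
      by (auto intro: min.coboundedI1 fw_le_0)
  qed
qed

lemma fw_Un_le:
  assumes "z \<in> Z"
  shows "fw w (A \<union> Z) x y <= fw w (A \<union> Z) x z + fw w (A \<union> Z) z y"
  using assms by (intro fw_triangle) auto

text \<open>A walk either avoids \<open>Z\<close>, or is cut at one of its vertices in
  \<open>Z\<close>. Hence, once the rows and columns of \<open>Z\<close> are final, one min-plus
  product makes the whole matrix final.\<close>

lemma fw_Un_cases:
  assumes "\<And>z. z \<in> Z ==> c <= fw w (A \<union> Z) x z + fw w (A \<union> Z) z y" "c <= fw w A x y"
  shows "c <= fw w (A \<union> Z) x y"
proof (rule fw_greatest)
  fix xs assume xs: "set xs \<subseteq> A \<union> Z"
  show "c <= path_weight w (x # xs @ [y])"
  proof (cases "\<exists>z\<in>set xs. z \<in> Z")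
    case False
    then have "fw w A x y <= path_weight w (x # xs @ [y])" using xs by (intro fw_le) auto
    then show ?thesis using assms(2) by (rule order_trans[rotated])
  next
    case True
    then obtain z ys zs where z: "z \<in> Z" "xs = ys @ z # zs" by (meson split_list)
    have "c <= fw w (A \<union> Z) x z + fw w (A \<union> Z) z y" using z assms by blast
    also have "\<dots> <= path_weight w (x # ys @ [z]) + path_weight w (z # zs @ [y])"
      using xs z by (intro add_mono fw_le) auto
    also have "\<dots> = path_weight w (x # xs @ [y])"
      using path_weight_append[of w "x # ys" z "zs @ [y]"] z by simp
    finally show ?thesis .
  qed
next
  assume "x = y" then show "c <= 0" using assms(2) fw_le_0[of w A y] by auto
qed

text \<open>Gives the column of a new vertex \<open>y\<close> from a matrix over the old vertices;
  \<open>x \<noteq> y\<close> rules out the empty walk. The row and the diagonal entry come from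
  \<open>fw_first_edge\<close>.\<close>

lemma fw_last_edge:
  assumes "x \<noteq> y"
  shows "fw w A x y = min (w x y) (INF u\<in>A. fw w A x u + w u y)"
proof (rule antisym)
  have "fw w A x y <= fw w A x u + w u y" if u: "u \<in> A" for u
    using fw_triangle[OF u, of x y] add_mono[OF order_refl fw_le_edge, of "fw w A x u" w A u y]
    by (rule order_trans)
  then show "fw w A x y <= min (w x y) (INF u\<in>A. fw w A x u + w u y)"
    by (auto intro: INF_greatest fw_le_edge)
  show "min (w x y) (INF u\<in>A. fw w A x u + w u y) <= fw w A x y"
  proof (rule fw_greatest)
    fix xs assume xs: "set xs \<subseteq> A"
    show "min (w x y) (INF u\<in>A. fw w A x u + w u y) <= path_weight w (x # xs @ [y])"
    proof (cases xs rule: rev_cases)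
      case (snoc ys u)
      have "(INF u\<in>A. fw w A x u + w u y) <= fw w A x u + w u y" using xs snoc by (intro INF_lower) auto
      also have "\<dots> <= path_weight w (x # ys @ [u]) + path_weight w (u # [y])"
        using xs snoc by (intro add_mono fw_le) auto
      also have "\<dots> = path_weight w (x # xs @ [y])"
        using path_weight_append[of w "x # ys" u "[y]"] snoc by simp
      finally show ?thesis by (rule min.coboundedI2)
    qed simp
  qed (use assms in simp)
qed

lemma fw_first_edge:
  "fw w A x y = min (if x = y then 0 else \<infinity>) (min (w x y) (INF u\<in>A. w x u + fw w A u y))"
proof (rule antisym)
  have "fw w A x y <= w x u + fw w A u y" if u: "u \<in> A" for u
    using fw_triangle[OF u, of x y] add_mono[OF fw_le_edge order_refl, of w A x u "fw w A u y"]
    by (rule order_trans)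
  then show "fw w A x y <= min (if x = y then 0 else \<infinity>) (min (w x y) (INF u\<in>A. w x u + fw w A u y))"
    by (auto intro: INF_greatest fw_le_edge fw_le_0)
  show "min (if x = y then 0 else \<infinity>) (min (w x y) (INF u\<in>A. w x u + fw w A u y)) <= fw w A x y"
  proof (rule fw_greatest)
    fix xs assume xs: "set xs \<subseteq> A"
    show "min (if x = y then 0 else \<infinity>) (min (w x y) (INF u\<in>A. w x u + fw w A u y)) <= path_weight w (x # xs @ [y])"
    proof (cases xs)
      case (Cons u ys)
      have "(INF u\<in>A. w x u + fw w A u y) <= w x u + fw w A u y" using xs Cons by (intro INF_lower) auto
      also have "\<dots> <= w x u + path_weight w (u # ys @ [y])"
        using xs Cons by (intro add_mono fw_le) auto
      also have "\<dots> = path_weight w (x # xs @ [y])" using Cons by simp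
      finally show ?thesis by (intro min.coboundedI2)
    qed (simp add: min.coboundedI2)
  qed (auto simp: min.coboundedI1)
qed

end

text \<open>A sequence that uses a missing edge weighs \<open>\<infinity>\<close> and leaves the
  infimum alone; the walk with a single vertex corresponds to the extra 0.\<close>

lemma distance_eq_fw:
  assumes "u \<in> verts G" "v \<in> verts G"
  shows "distance G u v = fw (%x y. edge_cell (weight G x y)) (verts G) u v"
proof -
  let ?w = "%x y. edge_cell (weight G x y)"
  have pw: "path_weight ?w xs = ereal (walk_weight G xs)"
    if "successively (%x y. weight G x y \<noteq> None) xs" for xs
    using that by (induction xs rule: walk_weight.induct[of _ G]) auto
  have pinf: "path_weight ?w xs = \<infinity>"
    if "\<not> successively (%x y. weight G x y \<noteq> None) xs" for xs
    using that by (induction xs rule: walk_weight.induct[of _ G]) auto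
  show ?thesis
  proof (rule antisym)
    show "distance G u v <= fw ?w (verts G) u v"
    proof (rule fw_greatest)
      fix xs assume xs: "set xs \<subseteq> verts G"
      show "distance G u v <= path_weight ?w (u # xs @ [v])"
      proof (cases "successively (%x y. weight G x y \<noteq> None) (u # xs @ [v])")
        case True
        then have "u # xs @ [v] \<in> walks G u v" using xs assms by (auto simp: walks_def)
        then show ?thesis unfolding distance_def pw[OF True] by (rule INF_lower)
      qed (simp add: pinf)
    next
      assume "u = v"
      then have "[u] \<in> walks G u v" using assms by (auto simp: walks_def)
      from INF_lower[OF this, of "%xs. ereal (walk_weight G xs)"]
      show "distance G u v <= 0" by (simp add: distance_def zero_ereal_def)
    qed
    show "fw ?w (verts G) u v <= distance G u v"
      unfolding distance_def
    proof (rule INF_greatest)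
      fix p assume p: "p \<in> walks G u v"
      show "fw ?w (verts G) u v <= ereal (walk_weight G p)"
      proof (cases "length p = 1")
        case True
        then obtain a where "p = [a]" by (auto simp: length_Suc_conv)
        then show ?thesis using p fw_le_0[of ?w "verts G" u] by (auto simp: walks_def zero_ereal_def)
      next
        case False
        then obtain xs where e: "p = u # xs @ [v]"
          using p unfolding walks_def
          by (cases p; cases "tl p" rule: rev_cases) auto
        then have "fw ?w (verts G) u v <= path_weight ?w p"
          using p by (auto simp: walks_def intro!: fw_le)
        then show ?thesis using pw[of p] p by (auto simp: walks_def)
      qed
    qed
  qed
qed

section \<open>Comparing sums of extended reals\<close>

text \<open>Sums of two extended reals are compared through the key \<open>(class, real part)\<close>, an element of an
  ordered group, so that inequalities between sums can be rearranged into inequalities between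
  differences. With the classes 0, 1, 3 for \<^term>\<open>-\<infinity>::ereal\<close>, reals and \<^term>\<open>\<infinity>::ereal\<close> the
  class of a sum is at most 1, equal to 2 and at least 3 in the three cases, in accordance
  with \<open>\<infinity> + (-\<infinity>) = \<infinity>\<close>.\<close>

definition ecls :: "ereal => nat" where
  "ecls e = (if e = -\<infinity> then 0 else if e = \<infinity> then 3 else 1)"

definition klt :: "ereal => ereal => ereal => ereal => bool" where
  "klt a b c d \<longleftrightarrow> ecls a + ecls b < ecls c + ecls d \<or>
     ecls a + ecls b = ecls c + ecls d & real_of_ereal a + real_of_ereal b < real_of_ereal c + real_of_ereal d"

lemma ecls_le: "ecls e <= 3" by (simp add: ecls_def)

text \<open>The order of keys refines the order of sums. As \<open>real_of_ereal\<close> is 0 at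
  both infinities, the key also separates some equal infinite sums, but a minimal key still belongs
  to a minimal sum.\<close>

lemma not_klt_imp_le: "\<not> klt c d a b ==> a + b <= c + d"
  by (cases a; cases b; cases c; cases d) (auto simp: klt_def ecls_def split: if_splits)

lemma klt_imp_le: "klt a b c d ==> a + b <= c + d"
  by (rule not_klt_imp_le) (auto simp: klt_def)

text \<open>Ties go to the smaller index, so that for each entry the middle indices are linearly
  ordered. Every entry then has exactly one winner and is charged once.\<close>

definition beats :: "(nat => nat => ereal) => (nat => nat => ereal) => nat => nat => nat => nat => bool" where
  "beats A R k j x y \<longleftrightarrow> (if j < k then klt (A x k) (R k y) (A x j) (R j y)
     else \<not> klt (A x j) (R j y) (A x k) (R k y))"

text \<open>The rows are ordered by the difference between the keys of \<open>A x k\<close> and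
  \<open>A x j\<close>, ties by row number. Moving the subtracted terms to the other side leaves
  sums only, which the machine can form.\<close>

definition row_le :: "(nat => nat => ereal) => nat => nat => nat => nat => bool" where
  "row_le A k j x' x \<longleftrightarrow> (if x < x' then klt (A x' k) (A x j) (A x k) (A x' j)
     else \<not> klt (A x k) (A x' j) (A x' k) (A x j))"

lemma row_le_refl: "row_le A k j x x" by (auto simp: row_le_def klt_def)

lemma row_le_total: "row_le A k j x y \<or> row_le A k j y x"
  by (auto simp: row_le_def klt_def)

lemma row_le_antisym: "row_le A k j x y ==> row_le A k j y x ==> x = y"
  by (auto simp: row_le_def klt_def split: if_splits)

lemma row_le_trans: "row_le A k j x y ==> row_le A k j y z ==> row_le A k j x z"
  unfolding row_le_def klt_def by (auto split: if_splits)

text \<open>Fredman's trick: in a fixed column the row enters only through the difference that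
  orders the rows, and a smaller difference favours \<open>k\<close>. The tie rule of
  \<open>beats\<close> does not involve the row.\<close>

lemma beats_row_le: "row_le A k j x' x ==> beats A R k j x y ==> beats A R k j x' y"
  unfolding row_le_def beats_def klt_def by (auto split: if_splits)

lemma beats_imp_le: "beats A R k j x y ==> A x k + R k y <= A x j + R j y"
  by (auto simp: beats_def not_klt_imp_le klt_imp_le split: if_splits)

lemma beats_refl: "beats A R k k x y" by (auto simp: beats_def klt_def)

lemma beats_antisym: "beats A R k j x y ==> beats A R j k x y ==> j = k"
  by (auto simp: beats_def klt_def split: if_splits)

lemma beats_total: "beats A R k j x y \<or> beats A R j k x y"
  by (auto simp: beats_def klt_def)

lemma beats_trans: "beats A R k j x y ==> beats A R j l x y ==> beats A R k l x y"
  unfolding beats_def klt_def by (auto split: if_splits)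

definition best :: "(nat => nat => ereal) => (nat => nat => ereal) => nat => nat => nat => nat" where
  "best A R s x y = (THE k. k < s & (\<forall>j<s. beats A R k j x y))"

lemma best_exists: "s > 0 ==> \<exists>k<s. \<forall>j<s. beats A R k j x y"
proof (induction s)
  case (Suc s)
  show ?case
  proof (cases "s = 0")
    case True
    then show ?thesis by (auto simp: beats_refl)
  next
    case False
    with Suc obtain k where k: "k < s" "\<forall>j<s. beats A R k j x y" by auto
    show ?thesis
    proof (cases "beats A R k s x y")
      case True
      then show ?thesis using k by (auto simp: less_Suc_eq)
    next
      case False
      then have "beats A R s k x y" using beats_total by blast
      then have "\<forall>j<Suc s. beats A R s j x y"
        using k by (auto simp: less_Suc_eq beats_refl intro: beats_trans)
      then show ?thesis by blast
    qed
  qed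
qed simp

lemma best_eq_iff:
  assumes "k < s"
  shows "best A R s x y = k \<longleftrightarrow> (\<forall>j<s. beats A R k j x y)"
proof -
  have u: "k = k'" if "k < s & (\<forall>j<s. beats A R k j x y)" "k' < s & (\<forall>j<s. beats A R k' j x y)" for k k'
    using that beats_antisym by blast
  obtain b where b: "b < s & (\<forall>j<s. beats A R b j x y)"
    using best_exists[of s A R x y] assms by auto
  have "best A R s x y = b"
    unfolding best_def using b u by (intro the_equality) auto
  then show ?thesis using b u assms by blast
qed

lemma best_less: "s > 0 ==> best A R s x y < s"
  using best_exists[of s A R x y] best_eq_iff[of _ s A R x y] by metis

lemma best_le: "j < s ==> A x (best A R s x y) + R (best A R s x y) y <= A x j + R j y"
  using best_less[of s A R x y] best_eq_iff[of "best A R s x y" s A R x y]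
  by (auto intro: beats_imp_le)

lemma best_min:
  assumes "s > 0"
  shows "A x (best A R s x y) + R (best A R s x y) y = (MIN k\<in>{..<s}. A x k + R k y)"
  using best_less[OF assms, of A R x y] best_le[of _ s A x R y] assms
  by (intro Min_eqI[symmetric]) auto

section \<open>Ranks, codes and linked lists\<close>

text \<open>A row counts itself by \<open>row_le_refl\<close>; the subtraction makes ranks start at
  0.\<close>

definition row_rank :: "(nat => nat => ereal) => nat => nat => nat => nat => nat => nat" where
  "row_rank A i0 mm k j i = card {i'. i' < mm & row_le A k j (i0 + i') (i0 + i)} - 1"

lemma row_rank_Suc:
  assumes "i < mm"
  shows "Suc (row_rank A i0 mm k j i) = card {i'. i' < mm & row_le A k j (i0 + i') (i0 + i)}"
proof -
  have "card {i'. i' < mm & row_le A k j (i0 + i') (i0 + i)} > 0"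
    using assms row_le_refl by (subst card_gt_0_iff) auto
  then show ?thesis by (simp add: row_rank_def)
qed

lemma row_rank_less: "i < mm ==> row_rank A i0 mm k j i < mm"
proof -
  assume i: "i < mm"
  have "card {i'. i' < mm & row_le A k j (i0 + i') (i0 + i)} <= card {..<mm}"
    by (intro card_mono) auto
  then show ?thesis using row_rank_Suc[OF i, of A i0 k j] by simp
qed

lemma row_rank_le_iff:
  assumes "i < mm" "i' < mm"
  shows "row_rank A i0 mm k j i' <= row_rank A i0 mm k j i \<longleftrightarrow> row_le A k j (i0 + i') (i0 + i)"
proof
  assume le: "row_le A k j (i0 + i') (i0 + i)"
  have "card {x. x < mm & row_le A k j (i0 + x) (i0 + i')} <= card {x. x < mm & row_le A k j (i0 + x) (i0 + i)}"
    using le by (intro card_mono) (auto intro: row_le_trans)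
  then show "row_rank A i0 mm k j i' <= row_rank A i0 mm k j i"
    using assms row_rank_Suc by (metis Suc_le_mono)
next
  assume rk: "row_rank A i0 mm k j i' <= row_rank A i0 mm k j i"
  show "row_le A k j (i0 + i') (i0 + i)"
  proof (rule ccontr)
    assume n: "\<not> row_le A k j (i0 + i') (i0 + i)"
    then have le: "row_le A k j (i0 + i) (i0 + i')" using row_le_total by blast
    have "{x. x < mm & row_le A k j (i0 + x) (i0 + i)} \<subset> {x. x < mm & row_le A k j (i0 + x) (i0 + i')}"
      using le n assms row_le_refl[of A k j "i0 + i'"] by (auto intro: row_le_trans)
    then have "card {x. x < mm & row_le A k j (i0 + x) (i0 + i)} < card {x. x < mm & row_le A k j (i0 + x) (i0 + i')}"
      by (intro psubset_card_mono) auto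
    then show False using rk assms row_rank_Suc by (metis Suc_le_mono not_le)
  qed
qed

lemma row_rank_inj:
  assumes "i < mm" "i' < mm" "row_rank A i0 mm k j i' = row_rank A i0 mm k j i"
  shows "i' = i"
  using row_rank_le_iff[OF assms(1,2)] row_rank_le_iff[OF assms(2,1)] assms(3) row_le_antisym
  by (metis add_left_cancel order_refl)

text \<open>An injection of \<open>{..<mm}\<close> into itself is onto. The binary search relies on
  there being a row of every rank.\<close>

lemma row_rank_surj:
  assumes "r < mm" obtains i where "i < mm" "row_rank A i0 mm k j i = r"
proof -
  have "inj_on (row_rank A i0 mm k j) {..<mm}" by (auto intro!: inj_onI dest: row_rank_inj)
  then have "row_rank A i0 mm k j ` {..<mm} = {..<mm}"
    by (intro card_subset_eq) (auto simp: card_image row_rank_less)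
  then show ?thesis using that assms by (metis imageE lessThan_iff)
qed

definition beat_count :: "(nat => nat => ereal) => (nat => nat => ereal) => nat => nat => nat => nat => nat => nat" where
  "beat_count A R i0 mm k j y = card {i. i < mm & beats A R k j (i0 + i) y}"

lemma beat_count_le: "beat_count A R i0 mm k j y <= mm"
  unfolding beat_count_def by (rule order_trans[OF card_mono[of "{..<mm}"]]) auto

text \<open>The rows on which \<open>k\<close> beats \<open>j\<close> in a fixed column form an initial segment of the rows.\<close>

lemma beats_iff_rank:
  assumes "i < mm"
  shows "beats A R k j (i0 + i) y \<longleftrightarrow> row_rank A i0 mm k j i < beat_count A R i0 mm k j y"
proof
  let ?S = "{i. i < mm & beats A R k j (i0 + i) y}"
  have fin: "finite ?S" by simp
  assume b: "beats A R k j (i0 + i) y"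
  have "{i'. i' < mm & row_le A k j (i0 + i') (i0 + i)} \<subseteq> ?S"
    using b by (auto intro: beats_row_le)
  from card_mono[OF fin this] show "row_rank A i0 mm k j i < beat_count A R i0 mm k j y"
    using row_rank_Suc[OF assms, of A i0 k j] by (simp add: beat_count_def)
next
  let ?S = "{i. i < mm & beats A R k j (i0 + i) y}"
  assume r: "row_rank A i0 mm k j i < beat_count A R i0 mm k j y"
  show "beats A R k j (i0 + i) y"
  proof (rule ccontr)
    assume n: "\<not> beats A R k j (i0 + i) y"
    have "?S \<subseteq> {i'. i' < mm & row_le A k j (i0 + i') (i0 + i)} - {i}"
      using n row_le_total beats_row_le by blast
    then have "card ?S <= card ({i'. i' < mm & row_le A k j (i0 + i') (i0 + i)} - {i})"
      by (intro card_mono) auto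
    also have "\<dots> = row_rank A i0 mm k j i"
      using assms row_le_refl by (simp add: row_rank_def)
    finally show False using r by (simp add: beat_count_def)
  qed
qed

text \<open>Whether \<open>k\<close> wins is decided by \<open>s\<close> comparisons of integers,
  each between a number of the row and a number of the column. Columns with the same
  \<open>s\<close> thresholds therefore behave alike in all rows of the tile.\<close>

lemma best_eq_iff_rank:
  assumes "k < s" "i < mm"
  shows "best A R s (i0 + i) y = k \<longleftrightarrow>
    (\<forall>j<s. row_rank A i0 mm k j i < beat_count A R i0 mm k j y)"
  using assms by (simp add: best_eq_iff beats_iff_rank)

fun horner :: "nat => (nat => nat) => nat => nat" where
  "horner b f 0 = 0"
| "horner b f (Suc j) = horner b f j * b + f j"

lemma horner_less: "(\<And>j. j < s ==> f j < b) ==> horner b f s < b ^ s"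
proof (induction s)
  case (Suc s)
  then have "horner b f s + 1 <= b ^ s" by force
  then have "(horner b f s + 1) * b <= b ^ s * b" by (intro mult_le_mono1)
  then show ?case using Suc.prems[of s] by (simp add: algebra_simps)
qed simp

lemma horner_inj:
  assumes "\<And>j. j < s ==> f j < b" "\<And>j. j < s ==> g j < b" "horner b f s = horner b g s" "j < s"
  shows "f j = g j"
  using assms
proof (induction s arbitrary: j)
  case (Suc s)
  have b: "f s < b" "g s < b" using Suc.prems by auto
  have "(horner b f s * b + f s) mod b = (horner b g s * b + g s) mod b" using Suc.prems by simp
  then have fs: "f s = g s" using b by simp
  then have "horner b f s = horner b g s" using Suc.prems b by simp
  then show ?case using Suc fs by (cases "j = s") auto
qed simp

text \<open>Positions are shifted by one so that 0 can be the null pointer. When columns are put in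
  front of the list of their key, \<open>lastp f c Y\<close> is the head of the list of
  \<open>c\<close> after \<open>Y\<close> columns, and \<open>lastp f (f y) y\<close> is the
  successor of column \<open>y\<close>.\<close>

fun lastp :: "(nat => nat) => nat => nat => nat" where
  "lastp f c 0 = 0"
| "lastp f c (Suc y) = (if f y = c then Suc y else lastp f c y)"

lemma lastp_nonzero:
  assumes "lastp f c Y \<noteq> 0"
  shows "f (lastp f c Y - 1) = c" "lastp f c Y <= Y"
    "\<And>y. y < Y ==> f y = c ==> y < lastp f c Y"
  using assms by (induction Y) (auto split: if_splits simp: less_Suc_eq)

lemma lastp_zero: "lastp f c Y = 0 ==> y < Y ==> f y \<noteq> c"
  by (induction Y) (auto split: if_splits simp: less_Suc_eq)

lemma mult_add_inj:
  fixes j m :: nat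
  assumes "j * m + i = j' * m + i'" "i < m" "i' < m"
  shows "j = j' & i = i'"
proof -
  have "(j * m + i) div m = (j' * m + i') div m" using assms(1) by (rule arg_cong)
  then have "j = j'" using assms(2,3) by simp
  then show ?thesis using assms(1) by simp
qed

lemma mult_add_less:
  fixes x n :: nat
  assumes "x < n" "k < s" shows "x * s + k < n * s"
proof -
  have "Suc x * s <= n * s" using assms by (intro mult_le_mono1) simp
  then show ?thesis using assms by simp
qed

section \<open>Rectangular min-plus product\<close>

abbreviation seq_syntax :: "com => com => com" (infixr \<open>;;\<close> 60) where
  "c ;; d \<equiv> Seq c d"

text \<open>Weight array 6 holds the \<open>n \<times> s\<close> factor followed by the \<open>s \<times> n\<close> factor, and weight array 8 and
  integer array 9 hold the keys of these entries; the product is taken into the matrix at offset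
  register 19 of weight array 3. For the current tile of \<open>m\<close> rows and the current middle index,
  integer arrays 5 and 6 hold the rank of each row and its inverse, 10 the digits of the code
  of each column, and 7 and 8 the linked lists of the columns with equal code.\<close>

definition cmp_sums :: "nat => nat => nat => nat => com" where
  "cmp_sums a b c d =
    ILoad 71 9 a ;; ILoad 72 9 b ;; IOp Add 71 71 72 ;;
    ILoad 73 9 c ;; ILoad 74 9 d ;; IOp Add 73 73 74 ;;
    If (ILess 71 73) (IConst 70 1)
      (If (ILess 73 71) (IConst 70 0)
        (WLoad 10 8 a ;; WLoad 11 8 b ;; WAdd 10 10 11 ;;
         WLoad 11 8 c ;; WLoad 13 8 d ;; WAdd 11 11 13 ;;
         If (WLess 10 11) (IConst 70 1) (IConst 70 0)))"

definition cmp_tie :: "nat => nat => com" where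
  "cmp_tie x y = If (ILess x y) (cmp_sums 60 61 62 63) (cmp_sums 62 63 60 61 ;; IOp Sub 70 2 70)"

definition rank_count :: com where
  "rank_count =
    IOp Add 64 42 47 ;; IOp Mul 64 64 20 ;; IOp Add 60 64 44 ;; IOp Add 63 64 45 ;;
    IOp Add 65 42 46 ;; IOp Mul 65 65 20 ;; IOp Add 61 65 45 ;; IOp Add 62 65 44 ;;
    cmp_tie 46 47 ;; IOp Add 48 48 70"

text \<open>Sorting by counting takes quadratic time in the tile height. Over all tiles and pairs of
  middle indices this is about \<open>n * m * s * s\<close> comparisons, and the parameters make
  \<open>s * s * m\<close> linear in \<open>n\<close>.\<close>

definition rank_row :: com where
  "rank_row = IConst 48 0 ;; For 47 43 rank_count ;; IOp Sub 48 48 2 ;;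
    IOp Add 64 49 46 ;; IStore 5 64 48 ;; IOp Add 64 49 48 ;; IStore 6 64 46"

definition rank_rows :: com where
  "rank_rows = IOp Mul 49 45 11 ;; For 46 43 rank_row"

definition search_step :: com where
  "search_step = IOp Add 54 52 53 ;; IOp Div 54 54 75 ;; IOp Add 64 49 54 ;; ILoad 46 6 64 ;;
    IOp Add 64 42 46 ;; IOp Mul 64 64 20 ;; IOp Add 60 64 44 ;; IOp Add 62 64 45 ;;
    IOp Mul 61 44 0 ;; IOp Add 61 61 50 ;; IOp Add 61 61 21 ;;
    IOp Mul 63 45 0 ;; IOp Add 63 63 50 ;; IOp Add 63 63 21 ;;
    cmp_tie 45 44 ;; If (IEq 70 2) (IOp Add 52 54 2) (IMove 53 54)"

definition count_beaten :: com where
  "count_beaten = IConst 52 0 ;; IMove 53 43 ;; IOp Mul 49 45 11 ;; While (ILess 52 53) search_step ;;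
    IOp Mul 64 50 20 ;; IOp Add 64 64 45 ;; IStore 10 64 52 ;; IOp Mul 51 51 12 ;; IOp Add 51 51 52"

definition classify_col :: com where
  "classify_col = IConst 51 0 ;; For 45 20 count_beaten ;;
    ILoad 64 7 51 ;; IStore 8 50 64 ;; IOp Add 64 50 2 ;; IStore 7 51 64"

definition relax_col :: com where
  "relax_col = IOp Sub 50 57 2 ;; IOp Add 64 42 46 ;; IOp Mul 64 64 0 ;; IOp Add 64 64 50 ;; IOp Add 64 64 19 ;;
    WLoad 10 3 64 ;; IOp Mul 65 44 0 ;; IOp Add 65 65 50 ;; IOp Add 65 65 21 ;; WLoad 11 6 65 ;;
    WAdd 11 12 11 ;; If (WLess 11 10) (WStore 3 64 11) Skip ;; ILoad 57 8 50"

definition check_digit :: com where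
  "check_digit = IOp Mul 64 45 11 ;; IOp Add 64 64 46 ;; ILoad 64 5 64 ;; IOp Mul 65 58 20 ;; IOp Add 65 65 45 ;;
    ILoad 65 10 65 ;; If (ILess 64 65) Skip (IConst 59 0)"

definition relax_class :: com where
  "relax_class = ILoad 57 7 56 ;; If (IEq 57 3) Skip
     (IOp Sub 58 57 2 ;; IConst 59 1 ;; For 45 20 check_digit ;;
      If (IEq 59 2)
        (IOp Add 64 42 46 ;; IOp Mul 64 64 20 ;; IOp Add 64 64 44 ;; WLoad 12 6 64 ;;
         While (ILess 3 57) relax_col) Skip)"

definition relax_via :: com where
  "relax_via = For 45 20 rank_rows ;; For 56 13 (IStore 7 56 3) ;; For 50 0 classify_col ;;
     For 46 43 (For 56 13 relax_class)"

definition relax_tile :: com where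
  "relax_tile = IOp Mul 42 40 11 ;; IOp Sub 43 0 42 ;; If (ILess 11 43) (IMove 43 11) Skip ;;
     For 44 20 relax_via"

definition min_plus :: com where
  "min_plus = IConst 75 2 ;; IOp Sub 41 0 2 ;; IOp Div 41 41 11 ;; IOp Add 41 41 2 ;; For 40 41 relax_tile"

lemma cmp_mods [simp]:
  "iw (cmp_sums a b c d) = {70, 71, 72, 73, 74}" "ww (cmp_sums a b c d) = {10, 11, 13}"
  "iaw (cmp_sums a b c d) = {}" "waw (cmp_sums a b c d) = {}"
  "iw (cmp_tie x y) = {70, 71, 72, 73, 74}" "ww (cmp_tie x y) = {10, 11, 13}"
  "iaw (cmp_tie x y) = {}" "waw (cmp_tie x y) = {}"
  by (auto simp: cmp_sums_def cmp_tie_def)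

lemma rank_mods [simp]:
  "iw rank_count = {48, 60, 61, 62, 63, 64, 65, 70, 71, 72, 73, 74}" "ww rank_count = {10, 11, 13}"
  "iaw rank_count = {}" "waw rank_count = {}"
  "iw rank_row = {47, 48, 60, 61, 62, 63, 64, 65, 70, 71, 72, 73, 74}" "ww rank_row = {10, 11, 13}"
  "iaw rank_row = {5, 6}" "waw rank_row = {}"
  "iw rank_rows = {46, 47, 48, 49, 60, 61, 62, 63, 64, 65, 70, 71, 72, 73, 74}" "ww rank_rows = {10, 11, 13}"
  "iaw rank_rows = {5, 6}" "waw rank_rows = {}"
  by (auto simp: rank_count_def rank_row_def rank_rows_def)

lemma classify_mods [simp]:
  "iw search_step = {46, 52, 53, 54, 60, 61, 62, 63, 64, 70, 71, 72, 73, 74}" "ww search_step = {10, 11, 13}"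
  "iaw search_step = {}" "waw search_step = {}"
  "iw count_beaten = {46, 49, 51, 52, 53, 54, 60, 61, 62, 63, 64, 70, 71, 72, 73, 74}"
  "ww count_beaten = {10, 11, 13}" "iaw count_beaten = {10}" "waw count_beaten = {}"
  "iw classify_col = {45, 46, 49, 51, 52, 53, 54, 60, 61, 62, 63, 64, 70, 71, 72, 73, 74}"
  "ww classify_col = {10, 11, 13}" "iaw classify_col = {7, 8, 10}" "waw classify_col = {}"
  by (auto simp: search_step_def count_beaten_def classify_col_def)

lemma relax_mods [simp]:
  "iw relax_col = {50, 57, 64, 65}" "ww relax_col = {10, 11}" "iaw relax_col = {}" "waw relax_col = {3}"
  "iw check_digit = {59, 64, 65}" "ww check_digit = {}" "iaw check_digit = {}" "waw check_digit = {}"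
  "iw relax_class = {45, 50, 57, 58, 59, 64, 65}" "ww relax_class = {10, 11, 12}" "iaw relax_class = {}"
  "waw relax_class = {3}"
  "iw relax_via = {45, 46, 47, 48, 49, 50, 51, 52, 53, 54, 56, 57, 58, 59, 60, 61, 62, 63, 64, 65, 70, 71, 72, 73, 74}" "ww relax_via = {10, 11, 12, 13}"
  "iaw relax_via = {5, 6, 7, 8, 10}" "waw relax_via = {3}"
  "iw relax_tile = {42, 43, 44, 45, 46, 47, 48, 49, 50, 51, 52, 53, 54, 56, 57, 58, 59, 60, 61, 62, 63, 64, 65, 70, 71, 72, 73, 74}" "ww relax_tile = {10, 11, 12, 13}"
  "iaw relax_tile = {5, 6, 7, 8, 10}" "waw relax_tile = {3}"
  "iw min_plus = {40, 41, 42, 43, 44, 45, 46, 47, 48, 49, 50, 51, 52, 53, 54, 56, 57, 58, 59, 60, 61, 62, 63, 64, 65, 70, 71, 72, 73, 74, 75}" "ww min_plus = {10, 11, 12, 13}"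
  "iaw min_plus = {5, 6, 7, 8, 10}" "waw min_plus = {3}"
  by (auto simp: relax_col_def check_digit_def relax_class_def relax_via_def relax_tile_def min_plus_def)

text \<open>The summands are for ranking the rows, clearing the list heads, classifying the columns,
  and testing each class for each row. Relaxations are charged separately, per entry.\<close>

definition via_time :: "nat => nat => nat => nat => nat => nat" where
  "via_time n s m K lg = s * (m * (m * 40 + 12) + 5) + K * 3 + n * (s * (lg * 60 + 12) + 10) + m * (K * (s * 12 + 17) + 4) + 10"

locale product =
  fixes W n s m K sb lg :: nat and cr :: "nat => ereal"
  assumes n_pos: "0 < n" and s_pos: "0 < s" and m_pos: "0 < m"
    and bounds: "sb + n * n < W" "2 * (n * s) < W" "s * m < W" "n * m + n < W" "2 * m + 7 < W" "K < W" "n + 1 < W"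
    and codes: "(m + 1) ^ s <= K" and m_lg: "m < 2 ^ lg"
begin

abbreviation vtime :: nat where "vtime \<equiv> via_time n s m K lg"

definition A :: "nat => nat => ereal" where "A x k = cr (x * s + k)"
definition R :: "nat => nat => ereal" where "R k y = cr (n * s + (k * n + y))"

definition ctx :: "state => bool" where
  "ctx st \<longleftrightarrow> ireg st 0 = n & ireg st 2 = 1 & ireg st 3 = 0 & ireg st 11 = m & ireg st 12 = m + 1 &
    ireg st 13 = K & ireg st 19 = sb & ireg st 20 = s & ireg st 21 = n * s & ireg st 75 = 2 &
    (\<forall>q < 2 * (n * s). iarr st 9 q = ecls (cr q) & warr st 8 q = ereal (real_of_ereal (cr q)) & warr st 6 q = cr q)"

lemma ctxD:
  assumes "ctx st"
  shows "ireg st 0 = n" "ireg st 2 = 1" "ireg st 3 = 0" "ireg st 11 = m" "ireg st 12 = m + 1"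
    "ireg st 13 = K" "ireg st 19 = sb" "ireg st 20 = s" "ireg st 21 = n * s" "ireg st 75 = 2"
    "q < 2 * (n * s) ==> iarr st 9 q = ecls (cr q)" "q < 2 * (n * s) ==> warr st 8 q = ereal (real_of_ereal (cr q))"
    "q < 2 * (n * s) ==> warr st 6 q = cr q"
  using assms by (auto simp: ctx_def)

lemma ctx_same:
  assumes "ctx st" "same X Y B D st st'"
    "X \<inter> {0, 2, 3, 11, 12, 13, 19, 20, 21, 75} = {}" "9 \<notin> B" "6 \<notin> D" "8 \<notin> D"
  shows "ctx st'"
  using assms unfolding ctx_def same_def by (auto simp: disjoint_iff)

lemma wp_cmp_sums:
  assumes "ctx st" "a < 70" "b < 70" "c < 70" "d < 70"
    "ireg st a < 2 * (n * s)" "ireg st b < 2 * (n * s)" "ireg st c < 2 * (n * s)" "ireg st d < 2 * (n * s)"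
  shows "wp W (cmp_sums a b c d) st (%t s'. t <= 20 &
    ireg s' 70 = of_bool (klt (cr (ireg st a)) (cr (ireg st b)) (cr (ireg st c)) (cr (ireg st d))) &
    same {70, 71, 72, 73, 74} {10, 11, 13} {} {} st s')"
proof -
  have b: "ecls x + ecls y < W" for x y
    using ecls_le[of x] ecls_le[of y] bounds by linarith
  have W: "Suc 0 < W" "0 < W" using bounds by simp_all
  have ne: "x \<noteq> 70" "x \<noteq> 71" "x \<noteq> 72" "x \<noteq> 73" "x \<noteq> 74" if "x < 70" for x :: nat using that by auto
  note ne' = ne[OF assms(2)] ne[OF assms(3)] ne[OF assms(4)] ne[OF assms(5)]
  note cl = ctxD(11,12)[OF assms(1) assms(6)] ctxD(11,12)[OF assms(1) assms(7)]
    ctxD(11,12)[OF assms(1) assms(8)] ctxD(11,12)[OF assms(1) assms(9)]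
  have "wp W (cmp_sums a b c d) st (%t s'. t <= 20 &
    ireg s' 70 = of_bool (klt (cr (ireg st a)) (cr (ireg st b)) (cr (ireg st c)) (cr (ireg st d))))"
    unfolding cmp_sums_def klt_def
    by (simp add: ne' cl b W)
  then show ?thesis by (rule wp_frame) simp
qed

lemma wp_cmp_tie:
  assumes "ctx st" "x < 60" "y < 60"
    "ireg st 60 < 2 * (n * s)" "ireg st 61 < 2 * (n * s)" "ireg st 62 < 2 * (n * s)" "ireg st 63 < 2 * (n * s)"
    and "\<And>t s'. t <= 25 ==>
      ireg s' 70 = of_bool (if ireg st x < ireg st y
        then klt (cr (ireg st 60)) (cr (ireg st 61)) (cr (ireg st 62)) (cr (ireg st 63))
        else \<not> klt (cr (ireg st 62)) (cr (ireg st 63)) (cr (ireg st 60)) (cr (ireg st 61))) ==>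
      same {70, 71, 72, 73, 74} {10, 11, 13} {} {} st s' ==> Q t s'"
  shows "wp W (cmp_tie x y) st Q"
proof -
  have W: "1 < W" using bounds by simp
  have "wp W (cmp_tie x y) st (%t s'. t <= 25 &
      ireg s' 70 = of_bool (if ireg st x < ireg st y
        then klt (cr (ireg st 60)) (cr (ireg st 61)) (cr (ireg st 62)) (cr (ireg st 63))
        else \<not> klt (cr (ireg st 62)) (cr (ireg st 63)) (cr (ireg st 60)) (cr (ireg st 61))))"
  proof (cases "ireg st x < ireg st y")
    case True
    then show ?thesis unfolding cmp_tie_def
      by (simp only: wp_If holds.simps if_True)
        (rule wp_mono[OF wp_cmp_sums[OF assms(1)]], use assms in auto)
  next
    case False
    then show ?thesis unfolding cmp_tie_def
      by (simp only: wp_If holds.simps if_False wp_Seq)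
        (rule wp_mono[OF wp_cmp_sums[OF assms(1)]], use assms W ctxD[OF assms(1)] in \<open>auto simp: same_def\<close>)
  qed
  then show ?thesis by (rule wp_frame) (auto intro: assms(8))
qed

section \<open>Ranking the rows of a tile, and thresholds by binary search\<close>

lemma wp_rank_row:
  assumes ctx: "ctx st" and r: "ireg st 42 = i0" "ireg st 43 = mm" "ireg st 44 = k" "ireg st 45 = j"
    "ireg st 46 = i" "ireg st 49 = j * m"
    and h: "i0 + mm <= n" "k < s" "j < s" "i < mm" "mm <= m"
  shows "wp W rank_row st (%t s'. t <= mm * 40 + 10 &
     iarr s' = (iarr st)(5 := (iarr st 5)(j * m + i := row_rank A i0 mm k j i),
       6 := (iarr st 6)(j * m + row_rank A i0 mm k j i := i)))"
proof -
  have mmW: "mm < W" using h bounds by linarith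
  have jm: "j * m + m < W" using mult_add_less[of j s 0 m] bounds h
    by (metis Suc_leI add.commute mult_Suc mult_le_mono1 le_less_trans)
  let ?st = "set_i 48 0 st"
  have "wp W (For 47 43 rank_count) ?st (%t s'. t <= mm * (38 + 2) + 2 &
     ireg s' 48 = card {i'. i' < mm & row_le A k j (i0 + i') (i0 + i)} & ireg s' 47 = mm &
     loop_frame 47 rank_count ?st s')"
  proof (rule wp_For_const[where I = "%x s1. ireg s1 48 = card {i'. i' < x & row_le A k j (i0 + i') (i0 + i)}"])
    fix x s1
    assume x: "x < mm" "ireg s1 48 = card {i'. i' < x & row_le A k j (i0 + i') (i0 + i)}" "ireg s1 47 = x"
      and sm: "loop_frame 47 rank_count ?st s1"
    have regs: "ireg s1 42 = i0" "ireg s1 44 = k" "ireg s1 45 = j" "ireg s1 46 = i" "ireg s1 20 = s"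
      using sm r ctxD[OF ctx] by (auto simp: same_def)
    have c1: "ctx s1" by (rule ctx_same[OF ctx, of "insert 48 (insert 47 (iw rank_count))" "ww rank_count" "{}" "{}"])
        (use sm in \<open>auto simp: same_def\<close>)
    have ix: "(i0 + a) * s + b < n * s" if "a < mm" "b < s" for a b
      using that h by (intro mult_add_less) auto
    have ix': "(i0 + a) * s + b < W" if "a < mm" "b < s" for a b
      using ix[OF that] bounds by auto
    have ix0: "(i0 + a) * s < W" if "a < mm" for a using ix'[OF that s_pos] by simp
    have nW: "i0 + a < W" if "a < mm" for a using that h bounds by auto
    have cle: "card {i'. i' < x & row_le A k j (i0 + i') (i0 + i)} <= x"
      by (rule order_trans[OF card_mono[of "{..<x}"]]) auto
    have cS: "card {i'. i' < Suc x & row_le A k j (i0 + i') (i0 + i)} =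
        card {i'. i' < x & row_le A k j (i0 + i') (i0 + i)} + of_bool (row_le A k j (i0 + x) (i0 + i))"
    proof (cases "row_le A k j (i0 + x) (i0 + i)")
      case True
      then have "{i'. i' < Suc x & row_le A k j (i0 + i') (i0 + i)} =
        insert x {i'. i' < x & row_le A k j (i0 + i') (i0 + i)}" by (auto simp: less_Suc_eq)
      then show ?thesis using True by simp
    next
      case False
      then have "{i'. i' < Suc x & row_le A k j (i0 + i') (i0 + i)} =
        {i'. i' < x & row_le A k j (i0 + i') (i0 + i)}" by (auto simp: less_Suc_eq)
      then show ?thesis using False by simp
    qed
    have b: "Suc (card {i'. i' < x & row_le A k j (i0 + i') (i0 + i)}) < W" using cle x mmW by linarith
    show "wp W rank_count s1 (%t s2. t <= 38 & ireg (set_i 47 (Suc x) s2) 48 = card {i'. i' < Suc x & row_le A k j (i0 + i') (i0 + i)})"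
      unfolding rank_count_def
      apply (simp add: regs x ix' ix0 nW h)
      apply (rule wp_cmp_tie)
      subgoal by (rule ctx_same[OF c1, of "{60..65}" "{}" "{}" "{}"]) (auto simp: same_def)
      subgoal by simp
      subgoal by simp
      subgoal using ix[of x k] x h by simp
      subgoal using ix[of i j] x h by simp
      subgoal using ix[of i k] x h by simp
      subgoal using ix[of x j] x h by simp
      subgoal premises p for t s'
      proof -
        have e70: "ireg s' 70 = of_bool (row_le A k j (i0 + x) (i0 + i))"
          using p(2) by (simp add: row_le_def A_def regs x)
        have e48: "ireg s' 48 = card {i'. i' < x & row_le A k j (i0 + i') (i0 + i)}"
          using sameD(1)[OF p(3), of 48] x by simp
        show ?thesis unfolding cS e70 e48 using p(1) b by (cases "row_le A k j (i0 + x) (i0 + i)") auto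
      qed
      done
  qed (use mmW r ctxD[OF ctx] in auto)
  then have for_loop: "wp W (For 47 43 rank_count) ?st (%t s'. t <= mm * 40 + 2 & 
     ireg s' 48 = Suc (row_rank A i0 mm k j i) &
     loop_frame 47 rank_count ?st s')"
    by (rule wp_mono) (simp add: row_rank_Suc h)
  have rr: "row_rank A i0 mm k j i < mm" using h row_rank_less by blast
  show ?thesis
    unfolding rank_row_def
    apply (simp add: mmW)
    apply (intro conjI)
    subgoal using mmW by simp
    apply (rule wp_mono[OF for_loop])
    subgoal premises p for t s'
    proof -
      have e: "ireg s' 48 = Suc (row_rank A i0 mm k j i)" "ireg s' 49 = j * m" "ireg s' 46 = i" "ireg s' 2 = 1"
        "iarr s' = iarr st"
        using p r ctxD[OF ctx] by (auto simp: same_def)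
      show ?thesis using rr jm mmW h p by (simp add: e fun_upd_twist)
    qed
    done
qed

lemma wp_rank_rows:
  assumes ctx: "ctx st" and r: "ireg st 42 = i0" "ireg st 43 = mm" "ireg st 44 = k" "ireg st 45 = j"
    and h: "i0 + mm <= n" "k < s" "j < s" "mm <= m"
  shows "wp W rank_rows st (%t s'. t <= mm * (mm * 40 + 12) + 3 &
     (\<forall>i<mm. iarr s' 5 (j * m + i) = row_rank A i0 mm k j i & iarr s' 6 (j * m + row_rank A i0 mm k j i) = i) &
     (\<forall>q<j * m. iarr s' 5 q = iarr st 5 q & iarr s' 6 q = iarr st 6 q))"
proof -
  have mmW: "mm < W" using h bounds by linarith
  have jm: "j * m < W" using mult_add_less[of j s 0 m] bounds h m_pos by linarith
  let ?I = "%x s1. (\<forall>i<x. iarr s1 5 (j * m + i) = row_rank A i0 mm k j i &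
       iarr s1 6 (j * m + row_rank A i0 mm k j i) = i) &
     (\<forall>q<j * m. iarr s1 5 q = iarr st 5 q & iarr s1 6 q = iarr st 6 q)"
  let ?st = "set_i 49 (j * m) st"
  have "wp W (For 46 43 rank_row) ?st (%t s'. t <= mm * (mm * 40 + 10 + 2) + 2 & ?I mm s' & ireg s' 46 = mm &
     loop_frame 46 rank_row ?st s')"
  proof (rule wp_For_const[where I = ?I])
    fix x s1
    assume x: "x < mm" "?I x s1" "ireg s1 46 = x"
      and sm: "loop_frame 46 rank_row ?st s1"
    have c1: "ctx s1"
      by (rule ctx_same[OF ctx, of "insert 49 (insert 46 (iw rank_row))" "ww rank_row" "{5,6}" "{}"])
        (use sm in \<open>auto simp: same_def\<close>)
    have regs: "ireg s1 42 = i0" "ireg s1 43 = mm" "ireg s1 44 = k" "ireg s1 45 = j" "ireg s1 49 = j * m"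
      using sm r by (auto simp: same_def)
    show "wp W rank_row s1 (%t s2. t <= mm * 40 + 10 & ?I (Suc x) (set_i 46 (Suc x) s2))"
    proof (rule wp_mono[OF wp_rank_row[OF c1 regs(1,2,3,4) x(3) regs(5) h(1,2,3) x(1) h(4)]], elim conjE, intro conjI)
      fix t and s2 :: state
      assume e: "iarr s2 = (iarr s1)(5 := (iarr s1 5)(j * m + x := row_rank A i0 mm k j x),
           6 := (iarr s1 6)(j * m + row_rank A i0 mm k j x := x))"
      \<comment> \<open>Distinct rows have distinct ranks, so the new store into array 6 spares the
        inverse ranks written before.\<close>
      have ne: "row_rank A i0 mm k j i \<noteq> row_rank A i0 mm k j x" if "i < x" for i
        using row_rank_inj[of x mm i] that x(1) by fastforce
      show "\<forall>i<Suc x. iarr (set_i 46 (Suc x) s2) 5 (j * m + i) = row_rank A i0 mm k j i &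
          iarr (set_i 46 (Suc x) s2) 6 (j * m + row_rank A i0 mm k j i) = i"
        using x(2) ne by (auto simp: e less_Suc_eq)
      show "\<forall>q<j * m. iarr (set_i 46 (Suc x) s2) 5 q = iarr st 5 q & iarr (set_i 46 (Suc x) s2) 6 q = iarr st 6 q"
        using x(2) by (auto simp: e)
    qed simp_all
  qed (use mmW r ctxD[OF ctx] in auto)
  then show ?thesis
    unfolding rank_rows_def by (simp add: r ctxD[OF ctx] jm) (erule wp_mono, simp add: add.commute)
qed

definition ranked :: "nat => nat => nat => nat => state => bool" where
  "ranked i0 mm k J st \<longleftrightarrow> (\<forall>j<J. \<forall>i<mm. iarr st 5 (j * m + i) = row_rank A i0 mm k j i &
     iarr st 6 (j * m + row_rank A i0 mm k j i) = i)"

lemma wp_rank_all: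
  assumes ctx: "ctx st" and r: "ireg st 42 = i0" "ireg st 43 = mm" "ireg st 44 = k"
    and h: "i0 + mm <= n" "k < s" "mm <= m"
  shows "wp W (For 45 20 rank_rows) st (%t s'. t <= s * (mm * (mm * 40 + 12) + 5) + 2 & ranked i0 mm k s s')"
proof -
  have sW: "s < W" using n_pos bounds(2) by (cases n) auto
  have "wp W (For 45 20 rank_rows) st (%t s'. t <= s * (mm * (mm * 40 + 12) + 3 + 2) + 2 & ranked i0 mm k s s' &
    ireg s' 45 = s & loop_frame 45 rank_rows st s')"
  proof (rule wp_For_const[where I = "ranked i0 mm k"])
    fix x s1
    assume x: "x < s" "ranked i0 mm k x s1" "ireg s1 45 = x"
      and sm: "loop_frame 45 rank_rows st s1"
    have c1: "ctx s1" by (rule ctx_same[OF ctx sm]) auto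
    have regs: "ireg s1 42 = i0" "ireg s1 43 = mm" "ireg s1 44 = k" using sm r by (auto simp: same_def)
    show "wp W rank_rows s1 (%t s2. t <= mm * (mm * 40 + 12) + 3 & ranked i0 mm k (Suc x) (set_i 45 (Suc x) s2))"
    proof (rule wp_mono[OF wp_rank_rows[OF c1 regs x(3) h(1,2) x(1) h(3)]], elim conjE, intro conjI)
      fix t and s2 :: state
      assume a: "\<forall>i<mm. iarr s2 5 (x * m + i) = row_rank A i0 mm k x i & iarr s2 6 (x * m + row_rank A i0 mm k x i) = i"
        "\<forall>q<x * m. iarr s2 5 q = iarr s1 5 q & iarr s2 6 q = iarr s1 6 q"
      have lt: "j * m + i < x * m" if "j < x" "i < mm" for j i
        using that h by (intro mult_add_less) auto
      show "ranked i0 mm k (Suc x) (set_i 45 (Suc x) s2)"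
        using a x(2) lt row_rank_less[of _ mm A i0 k] by (auto simp: ranked_def less_Suc_eq)
    qed
  qed (use sW ctxD[OF ctx] in \<open>auto simp: ranked_def\<close>)
  then show ?thesis by (rule wp_mono) (simp add: add.commute)
qed

text \<open>The exponent \<open>q\<close> bounds the rounds left through the length of the interval.
  By \<open>beats_iff_rank\<close> the row of rank \<open>mid\<close> tells on which side the
  threshold lies, so one comparison of sums halves the interval.\<close>

lemma wp_search:
  assumes h: "i0 + mm <= n" "k < s" "j < s" "mm <= m" "y < n"
  shows "ctx st ==> ranked i0 mm k s st ==> ireg st 42 = i0 ==> ireg st 44 = k ==> ireg st 45 = j ==>
     ireg st 49 = j * m ==> ireg st 50 = y ==> ireg st 52 <= beat_count A R i0 mm k j y ==>
     beat_count A R i0 mm k j y <= ireg st 53 ==> ireg st 53 <= mm ==> ireg st 53 - ireg st 52 < 2 ^ q ==>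
   wp W (While (ILess 52 53) search_step) st (%t s'. t <= q * 60 + 1 & ireg s' 52 = beat_count A R i0 mm k j y)"
proof (induction q arbitrary: st)
  case 0
  then show ?case by (subst wp_While) simp
next
  case (Suc q)
  note ctx = ctxD[OF Suc.prems(1)]
  show ?case
  proof (cases "ireg st 52 < ireg st 53")
    case False
    then show ?thesis using Suc.prems by (subst wp_While) simp
  next
    case True
    define lo where "lo = ireg st 52"
    define hi where "hi = ireg st 53"
    define mid where "mid = (lo + hi) div 2"
    have mid: "lo <= mid" "mid < hi" using True by (auto simp: mid_def lo_def hi_def)
    have hi: "hi <= mm" using Suc.prems by (simp add: hi_def)
    have "mid < mm" using mid hi by simp
    then obtain i where i: "i < mm" "row_rank A i0 mm k j i = mid" by (rule row_rank_surj)
    have srt: "iarr st 6 (j * m + mid) = i" using Suc.prems(2) h i by (auto simp: ranked_def)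
    have jm: "j * m + mid < W" using mult_add_less[of j s mid m] bounds h \<open>mid < mm\<close> by linarith
    have ix: "(i0 + i) * s + b < n * s" if "b < s" for b
      using that h i by (intro mult_add_less) auto
    have ixW: "(i0 + i) * s + b < W" if "b < s" for b using ix[OF that] bounds by linarith
    have ix0: "(i0 + i) * s < W" using ixW[OF s_pos] by simp
    have iy: "b * n + y < n * s" if "b < s" for b
      using mult_add_less[of b s y n] that h by (simp add: mult.commute)
    have iyW: "b * n + y < W" "b * n < W" if "b < s" for b using iy[OF that] bounds by linarith+
    have iyW': "b * n + y + n * s < W" if "b < s" for b using iy[OF that] bounds by linarith
    have lohi: "lo + hi < W" "mid < W" "i0 + i < W" "Suc mid < W" using mid hi h bounds i by linarith+
    have step: "wp W search_step st (%t s'. t <= 55 & 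
        (if mid < beat_count A R i0 mm k j y then ireg s' 52 = Suc mid & ireg s' 53 = hi
         else ireg s' 52 = lo & ireg s' 53 = mid))"
      unfolding search_step_def
      apply (simp add: ctx Suc.prems(3-7) flip: lo_def hi_def mid_def)
      apply (simp add: srt lohi jm ix0 ixW h iyW iyW')
      apply (rule wp_cmp_tie)
      subgoal by (rule ctx_same[OF Suc.prems(1), of "{46,54,60,61,62,63,64}" "{}" "{}" "{}"]) (auto simp: same_def)
      subgoal by simp
      subgoal by simp
      subgoal using ix[of k] h by simp
      subgoal using iy[of k] h by simp
      subgoal using ix[of j] h by simp
      subgoal using iy[of j] h by simp
      subgoal premises p for t s'
      proof -
        have e: "ireg s' 52 = lo" "ireg s' 53 = hi" "ireg s' 54 = mid" "ireg s' 2 = 1"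
          using sameD(1)[OF p(3), of 52] sameD(1)[OF p(3), of 53] sameD(1)[OF p(3), of 54] sameD(1)[OF p(3), of 2]
            ctx by (auto simp: lo_def hi_def)
        have "ireg s' 70 = of_bool (beats A R k j (i0 + i) y)"
          using p(2) by (simp add: beats_def A_def R_def Suc.prems ac_simps)
        then have e70: "ireg s' 70 = of_bool (mid < beat_count A R i0 mm k j y)"
          using beats_iff_rank[OF i(1), of A R k j i0 y] i by simp
        show ?thesis using p(1) lohi by (simp add: e e70)
      qed
      done
    show ?thesis
      apply (subst wp_While)
      apply (simp add: True)
      apply (rule wp_frame[OF step])
      subgoal premises p for t s'
      proof -
        have "wp W (While (ILess 52 53) search_step) s' (%t s'. t <= q * 60 + 1 & ireg s' 52 = beat_count A R i0 mm k j y)"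
        proof (rule Suc.IH)
          show "ctx s'" by (rule ctx_same[OF Suc.prems(1) p(2)]) auto
          show "ranked i0 mm k s s'" using Suc.prems(2) p(2) by (auto simp: ranked_def same_def)
          show "ireg s' 42 = i0" "ireg s' 44 = k" "ireg s' 45 = j" "ireg s' 49 = j * m" "ireg s' 50 = y"
            using Suc.prems p(2) by (auto simp: same_def)
          show "ireg s' 52 <= beat_count A R i0 mm k j y" "beat_count A R i0 mm k j y <= ireg s' 53" "ireg s' 53 <= mm"
            using p(1) Suc.prems hi mid by (auto simp: lo_def hi_def split: if_splits)
          show "ireg s' 53 - ireg s' 52 < 2 ^ q"
            using p(1) Suc.prems(11) mid by (auto simp: lo_def[symmetric] hi_def[symmetric] mid_def split: if_splits)
        qed
        then show ?thesis by (rule wp_mono) (use p(1) in auto)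
      qed
      done
  qed
qed

lemma wp_count_beaten:
  assumes ctx: "ctx st" and rk: "ranked i0 mm k s st"
    and r: "ireg st 42 = i0" "ireg st 43 = mm" "ireg st 44 = k" "ireg st 45 = j" "ireg st 50 = y"
    and h: "i0 + mm <= n" "k < s" "j < s" "mm <= m" "y < n"
    and c: "ireg st 51 * (m + 1) + m < W"
  shows "wp W count_beaten st (%t s'. t <= lg * 60 + 10 &
      ireg s' 51 = ireg st 51 * (m + 1) + beat_count A R i0 mm k j y &
      iarr s' 10 = (iarr st 10)(y * s + j := beat_count A R i0 mm k j y))"
proof -
  have W: "0 < W" using bounds by simp
  have jm: "j * m < W" using mult_add_less[of j s 0 m] bounds h m_pos by linarith
  have ys: "y * s + j < W" "y * s < W" using mult_add_less[of y n j s] bounds h by linarith+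
  let ?st = "set_i 49 (j * m) (set_i 53 mm (set_i 52 0 st))"
  have c': "ctx ?st" by (rule ctx_same[OF ctx, of "{49,52,53}" "{}" "{}" "{}"]) (auto simp: same_def)
  have bc: "beat_count A R i0 mm k j y <= m" using beat_count_le h order_trans by blast
  have "wp W (While (ILess 52 53) search_step) ?st (%t s'. t <= lg * 60 + 1 & ireg s' 52 = beat_count A R i0 mm k j y)"
    by (rule wp_search[OF h c']) (use rk r h m_lg beat_count_le in \<open>auto simp: ranked_def\<close>)
  from this show ?thesis
    unfolding count_beaten_def
    apply (simp add: W r ctxD[OF ctx] jm)
    apply (rule wp_frame, assumption)
    subgoal premises p for t s'
    proof -
      have e: "ireg s' 50 = y" "ireg s' 45 = j" "ireg s' 20 = s" "ireg s' 51 = ireg st 51" "ireg s' 12 = m + 1"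
        "iarr s' = iarr st"
        using p(3) ctxD[OF ctx] r by (auto simp: same_def)
      show ?thesis using p(2) c bc ys by (simp add: e)
    qed
    done
qed

section \<open>Codes of columns and their classes\<close>

definition code :: "nat => nat => nat => nat => nat" where
  "code i0 mm k y = horner (m + 1) (%j. beat_count A R i0 mm k j y) s"

lemma code_less: "mm <= m ==> code i0 mm k y < K"
  unfolding code_def
  by (rule less_le_trans[OF horner_less codes]) (use beat_count_le[of A R i0 mm k _ y] in \<open>auto simp: less_Suc_eq_le intro: order_trans\<close>)

text \<open>The thresholds are at most \<open>m\<close>, hence digits in base \<open>m + 1\<close>,
  and a number determines its digits.\<close>

lemma code_inj:
  assumes "mm <= m" "code i0 mm k y = code i0 mm k y'" "j < s"
  shows "beat_count A R i0 mm k j y = beat_count A R i0 mm k j y'"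
proof -
  have "beat_count A R i0 mm k j z < m + 1" for j z
    using beat_count_le[of A R i0 mm k j z] assms(1) by linarith
  then show ?thesis using horner_inj[OF _ _ assms(2)[unfolded code_def] assms(3)] by blast
qed

definition classified :: "nat => nat => nat => nat => state => bool" where
  "classified i0 mm k Y st \<longleftrightarrow> (\<forall>y<Y. \<forall>j<s. iarr st 10 (y * s + j) = beat_count A R i0 mm k j y) &
     (\<forall>c<K. iarr st 7 c = lastp (code i0 mm k) c Y) & (\<forall>y<Y. iarr st 8 y = lastp (code i0 mm k) (code i0 mm k y) y)"

lemma wp_classify_col:
  assumes ctx: "ctx st" and rk: "ranked i0 mm k s st" and cl: "classified i0 mm k y st"
    and r: "ireg st 42 = i0" "ireg st 43 = mm" "ireg st 44 = k" "ireg st 50 = y"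
    and h: "i0 + mm <= n" "k < s" "mm <= m" "y < n"
  shows "wp W classify_col st (%t s'. t <= s * (lg * 60 + 12) + 8 & classified i0 mm k (Suc y) s')"
proof -
  have sW: "s < W" using n_pos bounds(2) by (cases n) auto
  have W: "0 < W" using bounds by simp
  let ?f = "%j. beat_count A R i0 mm k j y"
  have bc: "?f j < m + 1" for j using beat_count_le[of A R i0 mm k j y] h by linarith
  let ?I = "%J s1. ireg s1 51 = horner (m + 1) ?f J & (\<forall>j<J. iarr s1 10 (y * s + j) = ?f j) &
     (\<forall>q<y * s. iarr s1 10 q = iarr st 10 q)"
  let ?st = "set_i 51 0 st"
  have "wp W (For 45 20 count_beaten) ?st (%t s'. t <= s * (lg * 60 + 10 + 2) + 2 & ?I s s' & ireg s' 45 = s &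
     loop_frame 45 count_beaten ?st s')"
  proof (rule wp_For_const[where I = ?I])
    fix x s1
    assume x: "x < s" "?I x s1" "ireg s1 45 = x"
      and sm: "loop_frame 45 count_beaten ?st s1"
    have c1: "ctx s1"
      by (rule ctx_same[OF ctx, of "insert 51 (insert 45 (iw count_beaten))" "ww count_beaten" "{10}" "{}"])
        (use sm in \<open>auto simp: same_def\<close>)
    have regs: "ireg s1 42 = i0" "ireg s1 43 = mm" "ireg s1 44 = k" "ireg s1 50 = y" "ranked i0 mm k s s1"
      using sm r rk by (auto simp: same_def ranked_def)
    \<comment> \<open>Appending any digit to a partial code stays below \<open>(m + 1) ^ s\<close>,
      which is a word because it is bounded by \<open>K\<close>.\<close>
    have "horner (m + 1) ?f x * (m + 1) + m < (m + 1) ^ Suc x"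
    proof -
      have "horner (m + 1) ?f x < (m + 1) ^ x" using bc by (rule horner_less)
      from mult_add_less[OF this, of m "m + 1"] show ?thesis by (simp add: mult.commute)
    qed
    also have "(m + 1) ^ Suc x <= (m + 1) ^ s" using x by (intro power_increasing) auto
    finally have "horner (m + 1) ?f x * (m + 1) + m < W" using codes bounds by linarith
    then have c: "ireg s1 51 * (m + 1) + m < W" using x(2) by (elim conjE) (simp only:)
    show "wp W count_beaten s1 (%t s2. t <= lg * 60 + 10 & ?I (Suc x) (set_i 45 (Suc x) s2))"
      by (rule wp_mono[OF wp_count_beaten[OF c1 regs(5,1,2,3) x(3) regs(4) h(1,2) x(1) h(3,4) c]])
        (use x(2) in \<open>auto simp: less_Suc_eq\<close>)
  qed (use sW ctxD[OF ctx] in auto)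
  then show ?thesis
    unfolding classify_col_def
    apply (simp add: W)
    apply (rule wp_mono, assumption)
    subgoal premises p for t s'
    proof -
      have e: "ireg s' 50 = y" "ireg s' 51 = code i0 mm k y" "ireg s' 2 = 1" "iarr s' 7 = iarr st 7" "iarr s' 8 = iarr st 8"
        using p(2) r ctxD[OF ctx] by (auto simp: same_def code_def)
      have lt: "y' * s + j < y * s" if "y' < y" "j < s" for y' j using that by (rule mult_add_less)
      have cK: "code i0 mm k y < K" using h by (intro code_less)
      have "classified i0 mm k (Suc y) (set_i 64 (Suc y) s'\<lparr>iarr := (iarr s')
          (8 := (iarr s' 8)(y := iarr s' 7 (code i0 mm k y)), 7 := (iarr s' 7)(code i0 mm k y := Suc y))\<rparr>)"
        using p(2) cl lt cK by (auto simp: classified_def e less_Suc_eq)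
      moreover have "t <= s * (lg * 60 + 12) + 2" using p(2) by (simp add: add.commute)
      moreover have "Suc y < W" using bounds h by simp
      ultimately show ?thesis by (simp add: e classified_def)
    qed
    done
qed

lemma wp_classify_all:
  assumes ctx: "ctx st" and rk: "ranked i0 mm k s st" and cl: "classified i0 mm k 0 st"
    and r: "ireg st 42 = i0" "ireg st 43 = mm" "ireg st 44 = k"
    and h: "i0 + mm <= n" "k < s" "mm <= m"
  shows "wp W (For 50 0 classify_col) st (%t s'. t <= n * (s * (lg * 60 + 12) + 10) + 2 & classified i0 mm k n s')"
proof -
  have "wp W (For 50 0 classify_col) st (%t s'. t <= n * (s * (lg * 60 + 12) + 8 + 2) + 2 & classified i0 mm k n s' &
    ireg s' 50 = n & loop_frame 50 classify_col st s')"
  proof (rule wp_For_const[where I = "classified i0 mm k"])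
    fix x s1
    assume x: "x < n" "classified i0 mm k x s1" "ireg s1 50 = x"
      and sm: "loop_frame 50 classify_col st s1"
    have c1: "ctx s1" by (rule ctx_same[OF ctx sm]) auto
    have regs: "ireg s1 42 = i0" "ireg s1 43 = mm" "ireg s1 44 = k" "ranked i0 mm k s s1"
      using sm r rk by (auto simp: same_def ranked_def)
    show "wp W classify_col s1 (%t s2. t <= s * (lg * 60 + 12) + 8 & classified i0 mm k (Suc x) (set_i 50 (Suc x) s2))"
      by (rule wp_mono[OF wp_classify_col[OF c1 regs(4) x(2) regs(1,2,3) x(3) h x(1)]]) (simp add: classified_def)
  qed (use cl bounds ctxD[OF ctx] in \<open>auto simp: classified_def\<close>)
  then show ?thesis by (rule wp_mono) (simp add: add.commute)
qed

lemma sum_affine: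
  fixes f :: "nat => nat"
  shows "(\<Sum>x<N. c + b * f x + 2) = N * (c + 2) + b * (\<Sum>x<N. f x)"
  by (induction N) (auto simp: algebra_simps)

section \<open>Relaxing entries class by class\<close>

definition opt :: "nat => nat => ereal" where
  "opt x y = A x (best A R s x y) + R (best A R s x y) y"

text \<open>Describing the array by the set of entries relaxed so far makes the order irrelevant in
  which rows, classes and middle indices visit them.\<close>

definition relaxed :: "(nat => ereal) => (nat \<times> nat) set => nat => ereal" where
  "relaxed F D q = (if sb <= q & q < sb + n * n & ((q - sb) div n, (q - sb) mod n) \<in> D
     then min (F q) (opt ((q - sb) div n) ((q - sb) mod n)) else F q)"

lemma relaxed_at:
  assumes "x < n" "y < n"
  shows "relaxed F D (sb + (x * n + y)) =
    (if (x, y) \<in> D then min (F (sb + (x * n + y))) (opt x y) else F (sb + (x * n + y)))"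
  using mult_add_less[OF assms] assms by (simp add: relaxed_def)

lemma relaxed_insert:
  assumes "x < n" "y < n"
  shows "(relaxed F D)(sb + (x * n + y) := min (relaxed F D (sb + (x * n + y))) (opt x y)) = relaxed F (insert (x, y) D)"
proof
  fix q
  show "((relaxed F D)(sb + (x * n + y) := min (relaxed F D (sb + (x * n + y))) (opt x y))) q =
    relaxed F (insert (x, y) D) q"
  proof (cases "q = sb + (x * n + y)")
    case True
    then show ?thesis using relaxed_at[OF assms, of F] by simp
  next
    case False
    have "(q - sb) div n \<noteq> x \<or> (q - sb) mod n \<noteq> y" if "sb <= q"
    proof (rule ccontr)
      assume "\<not> ((q - sb) div n \<noteq> x \<or> (q - sb) mod n \<noteq> y)"
      then have "q - sb = x * n + y" using div_mult_mod_eq[of "q - sb" n] by simp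
      then show False using False that by simp
    qed
    then show ?thesis using False by (auto simp: relaxed_def)
  qed
qed

text \<open>The induction runs over columns, not along the list. If column \<open>Y\<close> is
  outside the class, neither the pointer nor the set changes; otherwise the pointer is
  \<open>Suc Y\<close>, and array 8 leads on to \<open>lastp f c Y\<close>.\<close>

lemma wp_relax_list:
  assumes h: "x < n" "k < s" "x = i0 + i" "c < K"
  shows "ctx st ==> ireg st 42 = i0 ==> ireg st 46 = i ==> ireg st 44 = k ==> wreg st 12 = A x k ==>
     (\<forall>y<n. iarr st 8 y = lastp f (f y) y) ==> ireg st 57 = lastp f c Y ==> Y <= n ==>
     (\<forall>y<Y. f y = c --> best A R s x y = k) ==> warr st 3 = relaxed F D ==>
   wp W (While (ILess 3 57) relax_col) st (%t s'. t <= 20 * card {y. y < Y & f y = c} + 1 &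
     warr s' 3 = relaxed F (D \<union> {(x, y) |y. y < Y & f y = c}))"
proof (induction Y arbitrary: st D)
  case 0
  then show ?case using ctxD[OF 0(1)] by (subst wp_While) simp
next
  case (Suc Y)
  show ?case
  proof (cases "f Y = c")
    case False
    have "wp W (While (ILess 3 57) relax_col) st (%t s'. t <= 20 * card {y. y < Y & f y = c} + 1 &
     warr s' 3 = relaxed F (D \<union> {(x, y) |y. y < Y & f y = c}))"
      by (rule Suc.IH) (use Suc.prems False in auto)
    moreover have "{y. y < Suc Y & f y = c} = {y. y < Y & f y = c}"
      "{(x, y) |y. y < Suc Y & f y = c} = {(x, y) |y. y < Y & f y = c}"
      using False by (auto simp: less_Suc_eq)
    ultimately show ?thesis by (simp only:)
  next
    case True
    have Yn: "Y < n" using Suc.prems by simp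
    have p: "ireg st 57 = Suc Y" using Suc.prems True by simp
    have bk: "best A R s x Y = k" using Suc.prems True by simp
    have xn: "x * n + Y < n * n" using h Yn by (intro mult_add_less)
    have kn: "k * n + Y < n * s" using mult_add_less[of k s Y n] h Yn by (simp add: mult.commute)
    have w: "x < W" "x * n < W" "x * n + Y < W" "x * n + Y + sb < W" "k * n < W" "k * n + Y < W" "k * n + Y + n * s < W"
      using xn kn h bounds by linarith+
    have step: "wp W relax_col st (%t s'. t <= 18 & warr s' 3 = relaxed F (insert (x, Y) D) &
        ireg s' 57 = lastp f c Y)"
    proof -
      have cr: "warr st 6 (k * n + Y + n * s) = R k Y"
        using ctxD(13)[OF Suc.prems(1), of "n * s + (k * n + Y)"] kn by (simp add: R_def add.commute)
      have nxt: "iarr st 8 Y = lastp f c Y" using Suc.prems Yn True by simp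
      have op: "opt x Y = A x k + R k Y" by (simp add: opt_def bk)
      have ri: "relaxed F (insert (x, Y) D) = (relaxed F D)(x * n + Y + sb := min (relaxed F D (x * n + Y + sb)) (A x k + R k Y))"
        using relaxed_insert[OF h(1) Yn, of F D] by (simp add: op add.commute)
      show ?thesis
        unfolding relax_col_def
        using w by (cases "A x k + R k Y < relaxed F D (x * n + Y + sb)")
          (auto simp: p ctxD[OF Suc.prems(1)] Suc.prems(2-5,10) h(3)[symmetric] cr nxt ri min_def not_le)
    qed
    have cS: "card {y. y < Suc Y & f y = c} = Suc (card {y. y < Y & f y = c})"
    proof -
      have "{y. y < Suc Y & f y = c} = insert Y {y. y < Y & f y = c}" using True by (auto simp: less_Suc_eq)
      then show ?thesis by simp
    qed
    have dS: "D \<union> {(x, y) |y. y < Suc Y & f y = c} = insert (x, Y) D \<union> {(x, y) |y. y < Y & f y = c}"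
      using True by (auto simp: less_Suc_eq)
    show ?thesis
      unfolding cS dS
      apply (subst wp_While)
      apply (simp add: p ctxD[OF Suc.prems(1)])
      apply (rule wp_frame[OF step])
      subgoal premises q for t s'
      proof -
        have "wp W (While (ILess 3 57) relax_col) s' (%t s''. t <= 20 * card {y. y < Y & f y = c} + 1 &
           warr s'' 3 = relaxed F (insert (x, Y) D \<union> {(x, y) |y. y < Y & f y = c}))"
        proof (rule Suc.IH)
          show "ctx s'" by (rule ctx_same[OF Suc.prems(1) q(2)]) auto
          show "\<forall>y<n. iarr s' 8 y = lastp f (f y) y" using Suc.prems(6) q(2) by (simp add: same_def)
          show "\<forall>y<Y. f y = c --> best A R s x y = k" using Suc.prems(9) by simp
        qed (use Suc.prems q in \<open>auto simp: same_def\<close>)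
        then show ?thesis by (rule wp_mono) (use q(1) in auto)
      qed
      done
  qed
qed

lemma wp_check_digits:
  assumes ctx: "ctx st" and rk: "ranked i0 mm k s st" and cl: "classified i0 mm k n st"
    and r: "ireg st 46 = i" "ireg st 58 = y" "ireg st 59 = 1" and h: "i < mm" "mm <= m" "y < n" "k < s"
  shows "wp W (For 45 20 check_digit) st (%t s'. t <= s * 12 + 2 &
     ireg s' 59 = of_bool (best A R s (i0 + i) y = k))"
proof -
  have sW: "s < W" using n_pos bounds(2) by (cases n) auto
  let ?P = "%j. row_rank A i0 mm k j i < beat_count A R i0 mm k j y"
  let ?I = "%J s1. ireg s1 59 = of_bool (\<forall>j<J. ?P j)"
  have "wp W (For 45 20 check_digit) st (%t s'. t <= s * (10 + 2) + 2 & ?I s s' & ireg s' 45 = s &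
     loop_frame 45 check_digit st s')"
  proof (rule wp_For_const[where I = ?I])
    fix j s1
    assume j: "j < s" "?I j s1" "ireg s1 45 = j"
      and sm: "loop_frame 45 check_digit st s1"
    have regs: "ireg s1 46 = i" "ireg s1 58 = y" "ireg s1 11 = m" "ireg s1 20 = s"
      "iarr s1 5 (j * m + i) = row_rank A i0 mm k j i" "iarr s1 10 (y * s + j) = beat_count A R i0 mm k j y"
      using sm r ctxD[OF ctx] rk cl j h by (auto simp: same_def ranked_def classified_def)
    have w: "j * m + i < W" "j * m < W" "y * s + j < W" "y * s < W" "0 < W"
      using mult_add_less[of j s i m] mult_add_less[of y n j s] bounds h j by linarith+
    show "wp W check_digit s1 (%t s2. t <= 10 & ?I (Suc j) (set_i 45 (Suc j) s2))"
      unfolding check_digit_def using j(2) by (simp add: regs j(3) w) (auto simp: less_Suc_eq)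
  qed (use sW ctxD[OF ctx] r in auto)
  then show ?thesis by (rule wp_mono) (simp add: best_eq_iff_rank[OF h(4,1)])
qed

text \<open>The head \<open>y0\<close> of the list answers for its class: by \<open>code_inj\<close>
  all columns with its code have the same thresholds, so \<open>k\<close> wins in all of them or in
  none. An empty class costs only the look at its head.\<close>

lemma wp_relax_class:
  assumes ctx: "ctx st" and rk: "ranked i0 mm k s st" and cl: "classified i0 mm k n st"
    and r: "ireg st 42 = i0" "ireg st 44 = k" "ireg st 46 = i" "ireg st 56 = c"
    and h: "i0 + mm <= n" "k < s" "i < mm" "mm <= m" "c < K" and F: "warr st 3 = relaxed F D"
  shows "wp W relax_class st (%t s'. t <= s * 12 + 15 + 20 * card {y. y < n & code i0 mm k y = c & best A R s (i0 + i) y = k} &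
     warr s' 3 = relaxed F (D \<union> {(i0 + i, y) |y. y < n & code i0 mm k y = c & best A R s (i0 + i) y = k}))"
proof -
  let ?f = "code i0 mm k"
  have W: "0 < W" "Suc 0 < W" using bounds by simp_all
  have hd: "iarr st 7 c = lastp ?f c n" using cl h by (simp add: classified_def)
  show ?thesis
  proof (cases "lastp ?f c n = 0")
    case True
    then have "{(i0 + i, y) |y. y < n & ?f y = c & best A R s (i0 + i) y = k} = {}"
      using lastp_zero[OF True] by auto
    then show ?thesis unfolding relax_class_def using F by (simp only:) (simp add: r hd True ctxD[OF ctx])
  next
    case False
    define y0 where "y0 = lastp ?f c n - Suc 0"
    have y0: "?f y0 = c" "y0 < n" using lastp_nonzero[OF False] False by (auto simp: y0_def)
    have same_best: "best A R s (i0 + i) y = k \<longleftrightarrow> best A R s (i0 + i) y0 = k" if "?f y = c" for y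
      using that y0 code_inj[OF h(4), of i0 k y y0] best_eq_iff_rank[OF h(2,3)] by auto
    have p0: "lastp ?f c n < W" using lastp_nonzero(2)[OF False] bounds by simp
    let ?st = "set_i 59 1 (set_i 58 y0 (set_i 57 (lastp ?f c n) st))"
    have c': "ctx ?st" by (rule ctx_same[OF ctx, of "{57,58,59}" "{}" "{}" "{}"]) (auto simp: same_def)
    have chk: "wp W (For 45 20 check_digit) ?st (%t s'. t <= s * 12 + 2 & ireg s' 59 = of_bool (best A R s (i0 + i) y0 = k))"
      by (rule wp_check_digits[OF c']) (use rk cl r h y0 in \<open>auto simp: ranked_def classified_def\<close>)
    have xi: "(i0 + i) * s + k < n * s" using h by (intro mult_add_less) auto
    have w: "i0 + i < W" "(i0 + i) * s < W" "(i0 + i) * s + k < W" using xi h bounds by linarith+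
    have y0W: "y0 < W" using y0 bounds by simp
    show ?thesis
      unfolding relax_class_def
      apply (simp add: r hd False ctxD[OF ctx] W y0W flip: y0_def)
      apply (rule wp_frame[OF chk[unfolded One_nat_def]])
      subgoal premises p for t s'
      proof -
        have e: "ireg s' 42 = i0" "ireg s' 44 = k" "ireg s' 46 = i" "ireg s' 57 = lastp ?f c n" "ireg s' 20 = s"
          "ireg s' 2 = 1" "warr s' = warr st" "iarr s' = iarr st" "ireg s' 59 = of_bool (best A R s (i0 + i) y0 = k)"
          using p ctxD[OF ctx] r by (auto simp: same_def)
        have c2: "ctx s'" by (rule ctx_same[OF c' p(2)[unfolded One_nat_def[symmetric]]]) auto
        show ?thesis
        proof (cases "best A R s (i0 + i) y0 = k")
          case F2: False
          then have E: "{(i0 + i, y) |y. y < n & ?f y = c & best A R s (i0 + i) y = k} = {}"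
            using same_best by auto
          show ?thesis unfolding E using F2 p(1) F by (simp add: e)
        next
          case True
          have sets: "{y. y < n & ?f y = c & best A R s (i0 + i) y = k} = {y. y < n & ?f y = c}"
            "{(i0 + i, y) |y. y < n & ?f y = c & best A R s (i0 + i) y = k} = {(i0 + i, y) |y. y < n & ?f y = c}"
            using same_best True by auto
          let ?st2 = "set_w 12 (A (i0 + i) k) (set_i 64 ((i0 + i) * s + k) (set_i 64 ((i0 + i) * s) (set_i 64 (i0 + i) s')))"
          have c3: "ctx ?st2" by (rule ctx_same[OF c2, of "{64}" "{12}" "{}" "{}"]) (auto simp: same_def)
          have "wp W (While (ILess 3 57) relax_col) ?st2 (%t s'. t <= 20 * card {y. y < n & ?f y = c} + 1 &
             warr s' 3 = relaxed F (D \<union> {(i0 + i, y) |y. y < n & ?f y = c}))"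
          proof (rule wp_relax_list[where ?i0.0 = i0 and i = i and k = k])
            show "i0 + i < n" using h by simp
            show "\<forall>y<n. ?f y = c --> best A R s (i0 + i) y = k" using True same_best by auto
            show "\<forall>y<n. iarr ?st2 8 y = lastp ?f (?f y) y" using cl by (simp add: e classified_def)
          qed (use e h c3 F in auto)
          moreover have "warr st 6 ((i0 + i) * s + k) = A (i0 + i) k"
            using ctxD(13)[OF ctx, of "(i0 + i) * s + k"] xi by (simp add: A_def)
          ultimately show ?thesis
            unfolding sets using True w p(1) by (simp add: e) (erule wp_mono, auto)
        qed
      qed
      done
  qed
qed

lemma wp_relax_row:
  assumes ctx: "ctx st" and rk: "ranked i0 mm k s st" and cl: "classified i0 mm k n st"
    and r: "ireg st 42 = i0" "ireg st 44 = k" "ireg st 46 = i"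
    and h: "i0 + mm <= n" "k < s" "i < mm" "mm <= m" and F: "warr st 3 = relaxed F D"
  shows "wp W (For 56 13 relax_class) st (%t s'.
     t <= K * (s * 12 + 17) + 2 + 20 * card {y. y < n & best A R s (i0 + i) y = k} &
     warr s' 3 = relaxed F (D \<union> {(i0 + i, y) |y. y < n & best A R s (i0 + i) y = k}))"
proof -
  let ?f = "code i0 mm k"
  let ?b = "%y. best A R s (i0 + i) y = k"
  let ?I = "%c s1. warr s1 3 = relaxed F (D \<union> {(i0 + i, y) |y. y < n & ?f y < c & ?b y})"
  let ?T = "%c. s * 12 + 15 + 20 * card {y. y < n & ?f y = c & ?b y}"
  have "wp W (For 56 13 relax_class) st (%t s'. t <= (\<Sum>c<K. ?T c + 2) + 2 & ?I K s' & ireg s' 56 = K &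
     loop_frame 56 relax_class st s')"
  proof (rule wp_For[where I = ?I])
    fix c s1
    assume c: "c < K" "?I c s1" "ireg s1 56 = c"
      and sm: "loop_frame 56 relax_class st s1"
    have c1: "ctx s1" by (rule ctx_same[OF ctx sm]) auto
    have regs: "ireg s1 42 = i0" "ireg s1 44 = k" "ireg s1 46 = i" "ranked i0 mm k s s1" "classified i0 mm k n s1"
      using sm r rk cl by (auto simp: same_def ranked_def classified_def)
    have D: "D \<union> {(i0 + i, y) |y. y < n & ?f y < c & ?b y} \<union> {(i0 + i, y) |y. y < n & ?f y = c & ?b y} =
       D \<union> {(i0 + i, y) |y. y < n & ?f y < Suc c & ?b y}" by (auto simp: less_Suc_eq)
    show "wp W relax_class s1 (%t s2. t <= ?T c & ?I (Suc c) (set_i 56 (Suc c) s2))"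
      using wp_relax_class[OF c1 regs(4,5,1,2,3) c(3) h c(1,2)] unfolding D by simp
  qed (use F bounds ctxD[OF ctx] in auto)
  \<comment> \<open>The classes partition the columns, so the lengths of the lists traversed add up
    to the number of columns in which \<open>k\<close> wins.\<close>
  moreover have "(\<Sum>c<K. ?T c + 2) = K * (s * 12 + 17) + 20 * card {y. y < n & ?b y}"
  proof -
    have "(\<Sum>c<K. card {y. y < n & ?f y = c & ?b y}) = card (\<Union>c\<in>{..<K}. {y. y < n & ?f y = c & ?b y})"
      by (subst card_UN_disjoint) auto
    also have "(\<Union>c\<in>{..<K}. {y. y < n & ?f y = c & ?b y}) = {y. y < n & ?b y}"
      using code_less[OF h(4)] by auto
    finally show ?thesis unfolding sum_affine by simp
  qed
  moreover have "{(i0 + i, y) |y. y < n & ?f y < K & ?b y} = {(i0 + i, y) |y. y < n & ?b y}"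
    using code_less[OF h(4)] by auto
  ultimately show ?thesis by simp (erule wp_mono, simp)
qed

lemma wp_relax_via:
  assumes ctx: "ctx st" and r: "ireg st 42 = i0" "ireg st 43 = mm" "ireg st 44 = k"
    and h: "i0 + mm <= n" "k < s" "mm <= m" and F: "warr st 3 = relaxed F D"
  shows "wp W relax_via st (%t s'. t <= vtime + 20 * card {(i, y). i < mm & y < n & best A R s (i0 + i) y = k} &
     warr s' 3 = relaxed F (D \<union> {(i0 + i, y) |i y. i < mm & y < n & best A R s (i0 + i) y = k}))"
proof -
  have mmW: "mm < W" using h bounds by linarith
  let ?b = "%i y. best A R s (i0 + i) y = k"
  let ?Q4 = "%t s'. t <= mm * (K * (s * 12 + 17) + 4) + 2 + 20 * card {(i, y). i < mm & y < n & ?b i y} &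
     warr s' 3 = relaxed F (D \<union> {(i0 + i, y) |i y. i < mm & y < n & ?b i y})"
  have four: "wp W (For 46 43 (For 56 13 relax_class)) st' ?Q4"
    if c': "ctx st'" and r': "ireg st' 42 = i0" "ireg st' 43 = mm" "ireg st' 44 = k" "ranked i0 mm k s st'" "classified i0 mm k n st'"
      and F': "warr st' 3 = relaxed F D" for st'
  proof -
    let ?I = "%i s1. warr s1 3 = relaxed F (D \<union> {(i0 + i', y) |i' y. i' < i & y < n & ?b i' y})"
    let ?T = "%i. K * (s * 12 + 17) + 2 + 20 * card {y. y < n & ?b i y}"
    let ?c = "For 56 13 relax_class"
    have "wp W (For 46 43 ?c) st' (%t s'. t <= (\<Sum>i<mm. ?T i + 2) + 2 & ?I mm s' & ireg s' 46 = mm &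
       same (insert 46 (iw ?c)) (ww ?c) (iaw ?c) (waw ?c) st' s')"
    proof (rule wp_For[where I = ?I])
      fix i s1
      assume i: "i < mm" "?I i s1" "ireg s1 46 = i"
        and sm: "same (insert 46 (iw ?c)) (ww ?c) (iaw ?c) (waw ?c) st' s1"
      have c1: "ctx s1" by (rule ctx_same[OF c' sm]) auto
      have regs: "ireg s1 42 = i0" "ireg s1 44 = k" "ranked i0 mm k s s1" "classified i0 mm k n s1"
        using sm r' by (auto simp: same_def ranked_def classified_def)
      have D: "D \<union> {(i0 + i', y) |i' y. i' < i & y < n & ?b i' y} \<union> {(i0 + i, y) |y. y < n & ?b i y} =
         D \<union> {(i0 + i', y) |i' y. i' < Suc i & y < n & ?b i' y}" by (auto simp: less_Suc_eq)
      show "wp W ?c s1 (%t s2. t <= ?T i & ?I (Suc i) (set_i 46 (Suc i) s2))"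
        using wp_relax_row[OF c1 regs(3,4,1,2) i(3) h(1,2) i(1) h(3) i(2)] unfolding D by simp
    qed (use F' mmW r' ctxD[OF c'] in auto)
    moreover have "(\<Sum>i<mm. ?T i + 2) = mm * (K * (s * 12 + 17) + 4) + 20 * card {(i, y). i < mm & y < n & ?b i y}"
    proof -
      have "{(i, y). i < mm & y < n & ?b i y} = (SIGMA i:{..<mm}. {y. y < n & ?b i y})" by auto
      then have "card {(i, y). i < mm & y < n & ?b i y} = (\<Sum>i<mm. card {y. y < n & ?b i y})" by simp
      then show ?thesis unfolding sum_affine by (simp add: algebra_simps)
    qed
    ultimately show ?thesis by simp (erule wp_mono, simp)
  qed
  have clr: "wp W (For 56 13 (IStore 7 56 3)) st' (%t s'. t <= K * 3 + 2 & classified i0 mm k 0 s')"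
    if c': "ctx st'" for st'
  proof -
    have "wp W (For 56 13 (IStore 7 56 3)) st' (%t s'. t <= K * (1 + 2) + 2 & (\<forall>c<K. iarr s' 7 c = 0) & ireg s' 56 = K &
       loop_frame 56 (IStore 7 56 3) st' s')"
      by (rule wp_For_const[where I = "%x s1. \<forall>c<x. iarr s1 7 c = 0"])
        (use bounds ctxD[OF c'] in \<open>auto simp: less_Suc_eq same_def\<close>)
    then show ?thesis by (rule wp_mono) (simp add: classified_def)
  qed
  show ?thesis
    unfolding relax_via_def wp_Seq
  proof (rule wp_frame[OF wp_rank_all[OF ctx r h]])
    fix t1 s1
    assume a1: "t1 <= s * (mm * (mm * 40 + 12) + 5) + 2 & ranked i0 mm k s s1" "frame (For 45 20 rank_rows) st s1"
    have c1: "ctx s1" by (rule ctx_same[OF ctx a1(2)]) auto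
    have r1: "ireg s1 42 = i0" "ireg s1 43 = mm" "ireg s1 44 = k" "warr s1 = warr st"
      using a1(2) r by (auto simp: same_def)
    show "wp W (For 56 13 (IStore 7 56 3)) s1 (%t1a s1. wp W (For 50 0 classify_col) s1 (%t1b s1.
        wp W (For 46 43 (For 56 13 relax_class)) s1 (%t2 s2.
        t1 + (t1a + (t1b + t2)) <= vtime + 20 * card {(i, y). i < mm & y < n & ?b i y} &
        warr s2 3 = relaxed F (D \<union> {(i0 + i, y) |i y. i < mm & y < n & ?b i y}))))"
    proof (rule wp_frame[OF clr[OF c1]])
      fix t2 s2
      assume a2: "t2 <= K * 3 + 2 & classified i0 mm k 0 s2" "frame (For 56 13 (IStore 7 56 3)) s1 s2"
      have c2: "ctx s2" by (rule ctx_same[OF c1 a2(2)]) auto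
      have r2: "ireg s2 42 = i0" "ireg s2 43 = mm" "ireg s2 44 = k" "ranked i0 mm k s s2" "warr s2 = warr st"
        using a2(2) r1 a1(1) by (auto simp: same_def ranked_def)
      show "wp W (For 50 0 classify_col) s2 (%t1b s1.
        wp W (For 46 43 (For 56 13 relax_class)) s1 (%t2' s2.
        t1 + (t2 + (t1b + t2')) <= vtime + 20 * card {(i, y). i < mm & y < n & ?b i y} &
        warr s2 3 = relaxed F (D \<union> {(i0 + i, y) |i y. i < mm & y < n & ?b i y})))"
      proof (rule wp_frame[OF wp_classify_all[OF c2 r2(4) conjunct2[OF a2(1)] r2(1-3) h]])
        fix t3 s3
        assume a3: "t3 <= n * (s * (lg * 60 + 12) + 10) + 2 & classified i0 mm k n s3" "frame (For 50 0 classify_col) s2 s3"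
        have c3: "ctx s3" by (rule ctx_same[OF c2 a3(2)]) auto
        have r3: "ireg s3 42 = i0" "ireg s3 43 = mm" "ireg s3 44 = k" "ranked i0 mm k s s3" "warr s3 = warr st"
          using a3(2) r2 by (auto simp: same_def ranked_def)
        have m1: "s * (mm * (mm * 40 + 12) + 5) <= s * (m * (m * 40 + 12) + 5)"
          "mm * (K * (s * 12 + 17) + 4) <= m * (K * (s * 12 + 17) + 4)"
          using h by (auto intro!: mult_le_mono add_le_mono)
        show "wp W (For 46 43 (For 56 13 relax_class)) s3 (%t2' s2.
          t1 + (t2 + (t3 + t2')) <= vtime + 20 * card {(i, y). i < mm & y < n & ?b i y} &
          warr s2 3 = relaxed F (D \<union> {(i0 + i, y) |i y. i < mm & y < n & ?b i y}))"
          by (rule wp_mono[OF four[OF c3 r3(1-4) conjunct2[OF a3(1)]]])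
            (use r3(5) F in simp, elim conjE, intro conjI,
             (unfold via_time_def, use a1(1) a2(1) a3(1) m1 in linarith), assumption)
      qed
    qed
  qed
qed

lemma wp_relax_tile:
  assumes ctx: "ctx st" and r: "ireg st 40 = q" and h: "q * m < n"
    and F: "warr st 3 = relaxed F ({..<q * m} \<times> {..<n})"
  shows "wp W relax_tile st (%t s'. t <= s * (vtime + 2) + 20 * (m * n) + 10 &
     warr s' 3 = relaxed F ({..<min n (Suc q * m)} \<times> {..<n}))"
proof -
  define i0 where "i0 = q * m"
  define mm where "mm = min m (n - i0)"
  have hh: "i0 + mm <= n" "mm <= m" using h by (auto simp: mm_def i0_def)
  have i0mm: "i0 + mm = min n (Suc q * m)" using h by (auto simp: mm_def i0_def)
  have sW: "s < W" using n_pos bounds(2) by (cases n) auto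
  let ?I = "%k s1. warr s1 3 = relaxed F ({..<i0} \<times> {..<n} \<union> {(i0 + i, y) |i y. i < mm & y < n & best A R s (i0 + i) y < k})"
  let ?T = "%k. vtime + 20 * card {(i, y). i < mm & y < n & best A R s (i0 + i) y = k}"
  have loop: "wp W (For 44 20 relax_via) st' (%t s'. t <= (\<Sum>k<s. ?T k + 2) + 2 & ?I s s' & ireg s' 44 = s &
     loop_frame 44 relax_via st' s')"
    if c': "ctx st'" and r': "ireg st' 42 = i0" "ireg st' 43 = mm" "warr st' = warr st" for st'
  proof (rule wp_For[where I = ?I])
    fix k s1
    assume k: "k < s" "?I k s1" "ireg s1 44 = k"
      and sm: "loop_frame 44 relax_via st' s1"
    have c1: "ctx s1" by (rule ctx_same[OF c' sm]) auto
    have regs: "ireg s1 42 = i0" "ireg s1 43 = mm" using sm r' by (auto simp: same_def)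
    have D: "{..<i0} \<times> {..<n} \<union> {(i0 + i, y) |i y. i < mm & y < n & best A R s (i0 + i) y < k} \<union>
        {(i0 + i, y) |i y. i < mm & y < n & best A R s (i0 + i) y = k} =
      {..<i0} \<times> {..<n} \<union> {(i0 + i, y) |i y. i < mm & y < n & best A R s (i0 + i) y < Suc k}" by (auto simp: less_Suc_eq)
    show "wp W relax_via s1 (%t s2. t <= ?T k & ?I (Suc k) (set_i 44 (Suc k) s2))"
      using wp_relax_via[OF c1 regs k(3) hh(1) k(1) hh(2) k(2)] unfolding D by simp
  qed (use F r' sW ctxD[OF c'] in \<open>auto simp: i0_def\<close>)
  \<comment> \<open>Each entry of the tile has exactly one winner, so over all middle indices the
    relaxations cost a constant per entry.\<close>
  have tm: "(\<Sum>k<s. ?T k + 2) = s * (vtime + 2) + 20 * (mm * n)"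
  proof -
    have "(\<Sum>k<s. card {(i, y). i < mm & y < n & best A R s (i0 + i) y = k}) =
        card (\<Union>k\<in>{..<s}. {(i, y). i < mm & y < n & best A R s (i0 + i) y = k})"
      by (subst card_UN_disjoint) (auto intro: finite_subset[of _ "{..<mm} \<times> {..<n}"])
    also have "(\<Union>k\<in>{..<s}. {(i, y). i < mm & y < n & best A R s (i0 + i) y = k}) = {..<mm} \<times> {..<n}"
      using best_less[OF s_pos] by auto
    finally show ?thesis unfolding sum_affine by simp
  qed
  have D: "{..<i0} \<times> {..<n} \<union> {(i0 + i, y) |i y. i < mm & y < n & best A R s (i0 + i) y < s} = {..<i0 + mm} \<times> {..<n}"
  proof -
    have "x < i0 \<or> (\<exists>i. x = i0 + i & i < mm)" if "x < i0 + mm" for x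
      using that by (metis add.commute add_less_cancel_left le_iff_add not_le)
    then show ?thesis using best_less[OF s_pos] by auto
  qed
  have mn: "mm * n <= m * n" using hh by simp
  have loop': "wp W (For 44 20 relax_via) st' (%t s'. t <= s * (vtime + 2) + 20 * (m * n) + 2 &
      warr s' 3 = relaxed F ({..<min n (Suc q * m)} \<times> {..<n}))"
    if "ctx st'" "ireg st' 42 = i0" "ireg st' 43 = mm" "warr st' = warr st" for st'
    by (rule wp_mono[OF loop[OF that, unfolded tm D i0mm]])
      (elim conjE, intro conjI, (use mn in linarith), assumption)
  have w: "i0 < W" "n - i0 < W" using h bounds by (auto simp: i0_def)
  show ?thesis
    unfolding relax_tile_def
    apply (simp add: r ctxD[OF ctx] w flip: i0_def)
    apply (intro conjI impI)
    subgoal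
    proof (rule wp_mono[OF loop'])
      show "ctx (set_i 43 m (set_i 43 (n - i0) (set_i 42 i0 st)))"
        by (rule ctx_same[OF ctx, of "{42,43}" "{}" "{}" "{}"]) (auto simp: same_def)
    qed (auto simp: mm_def i0_def)
    subgoal
    proof (rule wp_mono[OF loop'])
      show "ctx (set_i 43 (n - i0) (set_i 42 i0 st))"
        by (rule ctx_same[OF ctx, of "{42,43}" "{}" "{}" "{}"]) (auto simp: same_def)
    qed (auto simp: mm_def i0_def)
    done
qed

lemma wp_min_plus:
  assumes ctx: "ctx (set_i 75 2 st)"
  shows "wp W min_plus st (%t s'. t <= ((n - 1) div m + 1) * (s * (vtime + 2) + 20 * (m * n) + 12) + 6 &
     warr s' 3 = relaxed (warr st 3) ({..<n} \<times> {..<n}))"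
proof -
  \<comment> \<open>\<open>N\<close> is the quotient of \<open>n\<close> and \<open>m\<close>
    rounded up; the last tile may be shorter.\<close>
  define N where "N = (n - 1) div m + 1"
  have N: "q * m < n \<longleftrightarrow> q < N" for q
  proof -
    have "q * m < n \<longleftrightarrow> q * m <= n - 1" using n_pos by linarith
    also have "\<dots> \<longleftrightarrow> q <= (n - 1) div m" using m_pos by (simp add: less_eq_div_iff_mult_less_eq)
    finally show ?thesis by (simp add: N_def less_Suc_eq_le)
  qed
  have "N <= n" unfolding N_def using n_pos div_le_dividend[of "n - 1" m] by linarith
  then have NW: "N < W" using bounds by simp
  let ?st = "set_i 41 N (set_i 41 ((n - 1) div m) (set_i 41 (n - 1) (set_i 75 2 st)))"
  have c': "ctx ?st" by (rule ctx_same[OF ctx, of "{41}" "{}" "{}" "{}"]) (auto simp: same_def)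
  let ?I = "%q s1. warr s1 3 = relaxed (warr st 3) ({..<min n (q * m)} \<times> {..<n})"
  have "wp W (For 40 41 relax_tile) ?st (%t s'. t <= N * (s * (vtime + 2) + 20 * (m * n) + 10 + 2) + 2 & ?I N s' & ireg s' 40 = N &
     loop_frame 40 relax_tile ?st s')"
  proof (rule wp_For_const[where I = ?I])
    fix q s1
    assume q: "q < N" "?I q s1" "ireg s1 40 = q"
      and sm: "loop_frame 40 relax_tile ?st s1"
    have c1: "ctx s1" by (rule ctx_same[OF c' sm]) auto
    have qm: "q * m < n" using q N by simp
    then have "min n (q * m) = q * m" by simp
    with q(2) have F: "warr s1 3 = relaxed (warr st 3) ({..<q * m} \<times> {..<n})" by simp
    show "wp W relax_tile s1 (%t s2. t <= s * (vtime + 2) + 20 * (m * n) + 10 & ?I (Suc q) (set_i 40 (Suc q) s2))"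
      using wp_relax_tile[OF c1 q(3) qm F] by simp
  qed (use NW ctxD[OF c'] in \<open>auto simp: relaxed_def fun_eq_iff\<close>)
  moreover have "min n (N * m) = n" using N[of N] by simp
  moreover have w: "2 < W" "(n - 1) div m < W" "n - 1 < W" "Suc ((n - 1) div m) < W"
    using NW bounds by (auto simp: N_def)
  moreover have "ireg st 0 = n" "ireg st 2 = 1" "ireg st 11 = m" using ctxD[OF ctx] by auto
  ultimately show ?thesis
    unfolding min_plus_def N_def[symmetric] by (simp add: N_def) (erule wp_mono, simp add: add.commute)
qed

lemma relaxed_all:
  assumes "x < n" "y < n"
  shows "relaxed F ({..<n} \<times> {..<n}) (sb + (x * n + y)) = min (F (sb + (x * n + y))) (MIN k\<in>{..<s}. A x k + R k y)"
  using relaxed_at[OF assms, of F] assms best_min[OF s_pos, of A x R y] by (simp add: opt_def)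

lemma relaxed_outside: "q < sb \<or> sb + n * n <= q ==> relaxed F D q = F q"
  by (auto simp: relaxed_def)

end

section \<open>Adding a batch of vertices to a matrix\<close>

text \<open>For loops that fill a segment of a weight array. The invariant describes the array
  completely, so that bodies may also read cells of the same array that are still unchanged.\<close>

lemma wp_fill:
  fixes T :: nat
  assumes "i \<notin> iw c" "N \<notin> iw c" "2 \<notin> iw c" "i \<noteq> N" "i \<noteq> 2"
    and "ireg s 2 = 1" "ireg s N = m" "m < W"
    and step: "\<And>j s1. j < m ==> ireg s1 i = j ==> loop_frame i c s s1 ==>
      warr s1 a = (%q. if off <= q & q < off + j then g (q - off) else warr s a q) ==>
      wp W c s1 (%t s2. t <= T & warr s2 a = (warr s1 a)(off + j := g j))"
  shows "wp W (For i N c) s (%t s'. t <= m * (T + 2) + 2 &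
    warr s' a = (%q. if off <= q & q < off + m then g (q - off) else warr s a q) &
    loop_frame i c s s')"
proof -
  let ?I = "%j s1. warr s1 a = (%q. if off <= q & q < off + j then g (q - off) else warr s a q)"
  have "wp W (For i N c) s (%t s'. t <= m * (T + 2) + 2 & ?I m s' & ireg s' i = m &
    loop_frame i c s s')"
  proof (rule wp_For_const[where I = ?I])
    fix j s1
    assume a: "j < m" "?I j s1" "ireg s1 i = j" "loop_frame i c s s1"
    show "wp W c s1 (%t s2. t <= T & ?I (Suc j) (set_i i (Suc j) s2))"
      by (rule wp_mono[OF step[OF a(1,3,4,2)]]) (auto simp: fun_eq_iff a(2))
  qed (use assms(1-8) in \<open>auto simp: fun_eq_iff\<close>)
  then show ?thesis by (rule wp_mono) simp
qed

definition load_col :: com where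
  "load_col = IOp Div 47 46 20 ;; IOp Mod 48 46 20 ;; ILoad 48 3 48 ;; IOp Mul 47 47 0 ;; IOp Add 47 47 48 ;;
    IOp Add 47 47 19 ;; WLoad 10 3 47 ;; WStore 6 46 10"

definition load_row :: com where
  "load_row = IOp Div 47 46 0 ;; IOp Mod 48 46 0 ;; ILoad 47 3 47 ;; IOp Mul 47 47 0 ;; IOp Add 47 47 48 ;;
    IOp Add 47 47 19 ;; WLoad 10 3 47 ;; IOp Add 49 46 21 ;; WStore 6 49 10"

definition save_col :: com where
  "save_col = IOp Mul 47 46 20 ;; IOp Add 47 47 45 ;; WLoad 10 6 47 ;; WAdd 10 10 12 ;; WStore 9 46 10"

definition save_row :: com where
  "save_row = IOp Add 47 49 46 ;; WLoad 10 6 47 ;; WStore 10 46 10"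

definition relax_col_entry :: com where
  "relax_col_entry = IOp Div 47 46 20 ;; IOp Mod 48 46 20 ;; ILoad 48 3 48 ;; WLoad 10 9 47 ;; WLoad 11 10 48 ;;
    WAdd 10 10 11 ;; WLoad 11 6 46 ;; If (WLess 10 11) (WStore 6 46 10) Skip"

definition relax_row_entry :: com where
  "relax_row_entry = IOp Div 47 46 0 ;; IOp Mod 48 46 0 ;; ILoad 47 3 47 ;; WLoad 10 9 47 ;; WLoad 11 10 48 ;;
    WAdd 10 10 11 ;; IOp Add 49 46 21 ;; WLoad 11 6 49 ;; If (WLess 10 11) (WStore 6 49 10) Skip"

definition pivot_loops :: com where
  "pivot_loops = For 46 0 save_col ;; For 46 0 save_row ;; For 46 21 relax_col_entry ;; For 46 21 relax_row_entry"

text \<open>A Floyd-Warshall pivot confined to the columns and the rows of the batch, at a cost of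
  order \<open>n * s\<close>; the full matrix is updated only once per batch, by the product. The
  pivot's own column and row are saved first, since the relaxation overwrites them, and the loop
  cost is added to the saved column.\<close>

definition pivot :: com where
  "pivot = ILoad 47 3 45 ;; IOp Mul 48 47 20 ;; IOp Add 48 48 45 ;; WLoad 12 6 48 ;; WConst 13 0 ;;
    If (WLess 12 13) (WConst 12 (-\<infinity>)) (WConst 12 0) ;;
    IOp Mul 49 45 0 ;; IOp Add 49 49 21 ;; pivot_loops"

text \<open>The real part stored for an infinite entry is 0, in agreement with
  \<open>real_of_ereal\<close>.\<close>

definition split_key :: com where
  "split_key = WLoad 10 6 46 ;; WConst 11 \<infinity> ;; WConst 13 (-\<infinity>) ;;
    If (WLess 10 11) (If (WLess 13 10) (IConst 47 1) (IConst 47 0 ;; WConst 10 0)) (IConst 47 3 ;; WConst 10 0) ;;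
    IStore 9 46 47 ;; WStore 8 46 10"

text \<open>The product takes a minimum over at least one middle index, hence the test for an empty
  batch.\<close>

definition batch :: com where
  "batch = IOp Mul 21 0 20 ;; If (ILess 3 20)
    (For 46 21 load_col ;; For 46 21 load_row ;; For 45 20 pivot ;; IOp Add 49 21 21 ;; For 46 49 split_key ;; min_plus)
    Skip"

lemma load_mods [simp]:
  "iw load_col = {47, 48}" "ww load_col = {10}" "iaw load_col = {}" "waw load_col = {6}"
  "iw load_row = {47, 48, 49}" "ww load_row = {10}" "iaw load_row = {}" "waw load_row = {6}"
  "iw save_col = {47}" "ww save_col = {10}" "iaw save_col = {}" "waw save_col = {9}"
  "iw save_row = {47}" "ww save_row = {10}" "iaw save_row = {}" "waw save_row = {10}"
  "iw relax_col_entry = {47, 48}" "ww relax_col_entry = {10, 11}" "iaw relax_col_entry = {}" "waw relax_col_entry = {6}"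
  "iw relax_row_entry = {47, 48, 49}" "ww relax_row_entry = {10, 11}" "iaw relax_row_entry = {}" "waw relax_row_entry = {6}"
  "iw pivot = {46, 47, 48, 49}" "ww pivot = {10, 11, 12, 13}" "iaw pivot = {}" "waw pivot = {6, 9, 10}"
  "iw split_key = {47}" "ww split_key = {10, 11, 13}" "iaw split_key = {9}" "waw split_key = {8}"
  by (auto simp: load_col_def load_row_def save_col_def save_row_def relax_col_entry_def relax_row_entry_def
      pivot_def pivot_loops_def split_key_def)

lemma batch_mods:
  "iw batch \<subseteq> insert 21 {40..<76}" "ww batch = {10, 11, 12, 13}" "iaw batch = {5, 6, 7, 8, 9, 10}"
  "waw batch = {3, 6, 8, 9, 10}"
  by (auto simp: batch_def)

definition batch_time :: "nat => nat => nat => nat => nat => nat" where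
  "batch_time n m K lg s = n * s * 50 + s * (n * s * 25 + n * 12 + 32) +
    ((n - 1) div m + 1) * (s * (via_time n s m K lg + 2) + 20 * (m * n) + 12) + 30"

lemma batch_time_mono: "s <= d ==> batch_time n m K lg s <= batch_time n m K lg d"
  unfolding batch_time_def via_time_def by (intro add_mono mult_le_mono order_refl)

locale machine =
  fixes W n d m K lg :: nat
  assumes n_pos: "0 < n" and d_pos: "0 < d" and m_pos: "0 < m"
    and bounds: "2 * (n * d) < W" "d * m < W" "n * m + n < W" "2 * m + 7 < W" "K < W" "n + 1 < W" "n * n < W"
    and codes: "(m + 1) ^ d <= K" and m_lg: "m < 2 ^ lg"
begin

definition regs :: "state => bool" where
  "regs st \<longleftrightarrow> ireg st 0 = n & ireg st 2 = 1 & ireg st 3 = 0 & ireg st 11 = m & ireg st 12 = m + 1 & ireg st 13 = K"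

lemma regsD:
  assumes "regs st"
  shows "ireg st 0 = n" "ireg st 2 = 1" "ireg st 3 = 0" "ireg st 11 = m" "ireg st 12 = m + 1" "ireg st 13 = K"
  using assms by (auto simp: regs_def)

end

locale batch_call = machine +
  fixes s sb :: nat and Z :: "nat => nat"
  assumes s_pos: "0 < s" and s_le: "s <= d" and sb: "sb + n * n < W" and Z: "b < s ==> Z b < n"
begin

lemma ns: "2 * (n * s) < W" "n * s < W" "s < W"
proof -
  have "n * s <= n * d" using s_le by simp
  then show "2 * (n * s) < W" "n * s < W" using bounds by linarith+
  have "s <= n * s" using n_pos by (cases n) auto
  then show "s < W" using \<open>n * s < W\<close> by (rule le_less_trans)
qed

definition call :: "state => bool" where
  "call st \<longleftrightarrow> regs st & ireg st 19 = sb & ireg st 20 = s & ireg st 21 = n * s & (\<forall>b<s. iarr st 3 b = Z b)"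

lemma callD:
  assumes "call st"
  shows "regs st" "ireg st 19 = sb" "ireg st 20 = s" "ireg st 21 = n * s" "b < s ==> iarr st 3 b = Z b"
    "ireg st 0 = n" "ireg st 2 = 1" "ireg st 3 = 0"
  using assms by (auto simp: call_def regs_def)

lemma call_same:
  "call st ==> same X Y A B st st' ==> X \<inter> {0, 2, 3, 11, 12, 13, 19, 20, 21} = {} ==> 3 \<notin> A ==> call st'"
  unfolding call_def regs_def same_def by (auto simp: disjoint_iff)

definition cols :: "(nat => nat => ereal) => state => bool" where
  "cols C st \<longleftrightarrow> (\<forall>x<n. \<forall>b<s. warr st 6 (x * s + b) = C x b)"

definition rows :: "(nat => nat => ereal) => state => bool" where
  "rows R st \<longleftrightarrow> (\<forall>b<s. \<forall>y<n. warr st 6 (n * s + (b * n + y)) = R b y)"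

lemma ix: "x < n ==> b < s ==> x * s + b < n * s" by (rule mult_add_less)
lemma iy: "y < n ==> b < s ==> b * n + y < n * s" using mult_add_less[of b s y n] by (simp add: mult.commute)

lemma div_mod_s: "q < n * s ==> q div s < n & q mod s < s"
  using s_pos by (simp add: less_mult_imp_div_less)
lemma div_mod_n: "q < n * s ==> q div n < s & q mod n < n"
  using n_pos by (simp add: less_mult_imp_div_less mult.commute)

lemma xnW: "x < n ==> y < n ==> x * n < W & x * n + y < W & x * n + y + sb < W"
  using mult_add_less[of x n y n] sb by linarith

section \<open>Pivots on the columns and rows of a batch\<close>

lemma wp_load_cols:
  assumes c: "call st"
  shows "wp W (For 46 21 load_col) st (%t s'. t <= n * s * 10 + 2 & cols (%x b. warr st 3 (sb + (x * n + Z b))) s')"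
proof -
  let ?g = "%q. warr st 3 (sb + (q div s * n + Z (q mod s)))"
  have "wp W (For 46 21 load_col) st (%t s'. t <= n * s * (8 + 2) + 2 &
    warr s' 6 = (%q. if 0 <= q & q < 0 + n * s then ?g (q - 0) else warr st 6 q) &
    loop_frame 46 load_col st s')"
  proof (rule wp_fill)
    fix j s1 assume j: "j < n * s" "ireg s1 46 = j"
      and sm: "loop_frame 46 load_col st s1"
    have c1: "call s1" by (rule call_same[OF c sm]) auto
    have e: "warr s1 3 = warr st 3" using sm by (simp add: same_def)
    note dm = div_mod_s[OF j(1)]
    have Zb: "Z (j mod s) < n" using Z dm by simp
    have w: "j div s < W" "j mod s < W" "j div s * n < W" "j div s * n + Z (j mod s) < W" "j div s * n + Z (j mod s) + sb < W"
      using xnW[of "j div s" "Z (j mod s)"] dm Zb ns bounds by linarith+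
    show "wp W load_col s1 (%t s2. t <= 8 & warr s2 6 = (warr s1 6)(0 + j := ?g j))"
      unfolding load_col_def by (simp add: j callD[OF c1] w e dm add.commute[of sb])
  qed (use ns callD[OF c] in auto)
  then show ?thesis
    by (rule wp_mono) (use ix in \<open>auto simp: cols_def s_pos\<close>)
qed

lemma wp_load_rows:
  assumes c: "call st" and C: "cols C st"
  shows "wp W (For 46 21 load_row) st (%t s'. t <= n * s * 11 + 2 & cols C s' &
    rows (%b y. warr st 3 (sb + (Z b * n + y))) s')"
proof -
  let ?g = "%q. warr st 3 (sb + (Z (q div n) * n + q mod n))"
  have "wp W (For 46 21 load_row) st (%t s'. t <= n * s * (9 + 2) + 2 &
    warr s' 6 = (%q. if n * s <= q & q < n * s + n * s then ?g (q - n * s) else warr st 6 q) &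
    loop_frame 46 load_row st s')"
  proof (rule wp_fill)
    fix j s1 assume j: "j < n * s" "ireg s1 46 = j"
      and sm: "loop_frame 46 load_row st s1"
    have c1: "call s1" by (rule call_same[OF c sm]) auto
    have e: "warr s1 3 = warr st 3" using sm by (simp add: same_def)
    note dm = div_mod_n[OF j(1)]
    have Zb: "Z (j div n) < n" using Z dm by simp
    have w: "j div n < W" "j mod n < W" "Z (j div n) * n < W" "Z (j div n) * n + j mod n < W" "Z (j div n) * n + j mod n + sb < W"
      "j + n * s < W"
      using xnW[of "Z (j div n)" "j mod n"] dm Zb ns bounds j by linarith+
    show "wp W load_row s1 (%t s2. t <= 9 & warr s2 6 = (warr s1 6)(n * s + j := ?g j))"
      unfolding load_row_def by (simp add: j callD[OF c1] w e dm add.commute[of sb] add.commute[of "n * s"])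
  qed (use ns callD[OF c] in auto)
  then show ?thesis
    by (rule wp_mono) (use ix[unfolded not_le[symmetric]] iy C in \<open>auto simp: cols_def rows_def\<close>)
qed

lemma wp_save_col:
  assumes c: "call st" and C: "cols C st" and a: "ireg st 45 = a" "a < s" and pv: "wreg st 12 = p"
  shows "wp W (For 46 0 save_col) st (%t s'. t <= n * 7 + 2 & (\<forall>x<n. warr s' 9 x = C x a + p))"
proof -
  have "wp W (For 46 0 save_col) st (%t s'. t <= n * (5 + 2) + 2 &
    warr s' 9 = (%q. if 0 <= q & q < 0 + n then C (q - 0) a + p else warr st 9 q) &
    loop_frame 46 save_col st s')"
  proof (rule wp_fill)
    fix j s1 assume j: "j < n" "ireg s1 46 = j"
      and sm: "loop_frame 46 save_col st s1"
    have c1: "call s1" by (rule call_same[OF c sm]) auto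
    have e: "warr s1 6 = warr st 6" "ireg s1 45 = a" "wreg s1 12 = p" using sm a pv by (simp_all add: same_def)
    have w: "j * s + a < W" "j * s < W" using ix[OF j(1) a(2)] ns by linarith+
    show "wp W save_col s1 (%t s2. t <= 5 & warr s2 9 = (warr s1 9)(0 + j := C j a + p))"
      unfolding save_col_def using C j a by (simp add: callD[OF c1] w e cols_def)
  qed (use bounds callD[OF c] in auto)
  then show ?thesis by (rule wp_mono) auto
qed

lemma wp_save_row:
  assumes c: "call st" and R: "rows R st" and a: "ireg st 49 = a * n + n * s" "a < s"
  shows "wp W (For 46 0 save_row) st (%t s'. t <= n * 5 + 2 & (\<forall>y<n. warr s' 10 y = R a y))"
proof -
  have "wp W (For 46 0 save_row) st (%t s'. t <= n * (3 + 2) + 2 &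
    warr s' 10 = (%q. if 0 <= q & q < 0 + n then R a (q - 0) else warr st 10 q) &
    loop_frame 46 save_row st s')"
  proof (rule wp_fill)
    fix j s1 assume j: "j < n" "ireg s1 46 = j"
      and sm: "loop_frame 46 save_row st s1"
    have c1: "call s1" by (rule call_same[OF c sm]) auto
    have e: "warr s1 6 = warr st 6" "ireg s1 49 = a * n + n * s" using sm a by (simp_all add: same_def)
    have w: "a * n + n * s + j < W" using iy[OF j(1) a(2)] ns by linarith
    have r: "warr st 6 (a * n + n * s + j) = R a j" using R j a by (simp add: rows_def ac_simps)
    show "wp W save_row s1 (%t s2. t <= 3 & warr s2 10 = (warr s1 10)(0 + j := R a j))"
      unfolding save_row_def by (simp add: w e j r)
  qed (use bounds callD[OF c] in auto)
  then show ?thesis by (rule wp_mono) auto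
qed

lemma wp_relax_cols:
  assumes c: "call st" and C: "cols C st" and R: "rows R st"
    and tc: "\<forall>x<n. warr st 9 x = tc x" and tr: "\<forall>y<n. warr st 10 y = tr y"
  shows "wp W (For 46 21 relax_col_entry) st (%t s'. t <= n * s * 12 + 2 &
     cols (%x b. min (C x b) (tc x + tr (Z b))) s' & rows R s')"
proof -
  let ?g = "%q. min (warr st 6 q) (tc (q div s) + tr (Z (q mod s)))"
  have "wp W (For 46 21 relax_col_entry) st (%t s'. t <= n * s * (10 + 2) + 2 &
    warr s' 6 = (%q. if 0 <= q & q < 0 + n * s then ?g (q - 0) else warr st 6 q) &
    loop_frame 46 relax_col_entry st s')"
  proof (rule wp_fill)
    fix j s1 assume j: "j < n * s" "ireg s1 46 = j"
      and sm: "loop_frame 46 relax_col_entry st s1"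
      and f: "warr s1 6 = (%q. if 0 <= q & q < 0 + j then ?g (q - 0) else warr st 6 q)"
    have c1: "call s1" by (rule call_same[OF c sm]) auto
    note dm = div_mod_s[OF j(1)]
    have e: "warr s1 9 (j div s) = tc (j div s)" "warr s1 10 (Z (j mod s)) = tr (Z (j mod s))" "warr s1 6 j = warr st 6 j"
      using sm tc tr dm Z f by (simp_all add: same_def)
    have w: "j div s < W" "j mod s < W" using dm ns bounds by linarith+
    show "wp W relax_col_entry s1 (%t s2. t <= 10 & warr s2 6 = (warr s1 6)(0 + j := ?g j))"
      unfolding relax_col_entry_def
      by (cases "tc (j div s) + tr (Z (j mod s)) < warr st 6 j")
        (auto simp: j callD[OF c1] w e dm min_def not_le fun_upd_idem)
  qed (use ns callD[OF c] in auto)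
  then show ?thesis
    by (rule wp_mono) (use ix ix[unfolded not_le[symmetric]] iy C R in \<open>auto simp: cols_def rows_def\<close>)
qed

lemma wp_relax_rows:
  assumes c: "call st" and C: "cols C st" and R: "rows R st"
    and tc: "\<forall>x<n. warr st 9 x = tc x" and tr: "\<forall>y<n. warr st 10 y = tr y"
  shows "wp W (For 46 21 relax_row_entry) st (%t s'. t <= n * s * 13 + 2 &
     cols C s' & rows (%b y. min (R b y) (tc (Z b) + tr y)) s')"
proof -
  let ?g = "%q. min (warr st 6 (n * s + q)) (tc (Z (q div n)) + tr (q mod n))"
  have "wp W (For 46 21 relax_row_entry) st (%t s'. t <= n * s * (11 + 2) + 2 &
    warr s' 6 = (%q. if n * s <= q & q < n * s + n * s then ?g (q - n * s) else warr st 6 q) &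
    loop_frame 46 relax_row_entry st s')"
  proof (rule wp_fill)
    fix j s1 assume j: "j < n * s" "ireg s1 46 = j"
      and sm: "loop_frame 46 relax_row_entry st s1"
      and f: "warr s1 6 = (%q. if n * s <= q & q < n * s + j then ?g (q - n * s) else warr st 6 q)"
    have c1: "call s1" by (rule call_same[OF c sm]) auto
    note dm = div_mod_n[OF j(1)]
    have e: "warr s1 9 (Z (j div n)) = tc (Z (j div n))" "warr s1 10 (j mod n) = tr (j mod n)" "warr s1 6 (j + n * s) = warr st 6 (j + n * s)"
      using sm tc tr dm Z f by (simp_all add: same_def)
    have w: "j div n < W" "j mod n < W" "j + n * s < W" using dm ns bounds j by linarith+
    show "wp W relax_row_entry s1 (%t s2. t <= 11 & warr s2 6 = (warr s1 6)(n * s + j := ?g j))"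
      unfolding relax_row_entry_def
      by (cases "tc (Z (j div n)) + tr (j mod n) < warr st 6 (j + n * s)")
        (auto simp: j callD[OF c1] w e dm min_def not_le fun_upd_idem add.commute[of "n * s"])
  qed (use ns callD[OF c] in auto)
  then show ?thesis
    by (rule wp_mono) (use ix[unfolded not_le[symmetric]] iy C R in \<open>auto simp: cols_def rows_def\<close>)
qed

text \<open>The \<open>loop_cost\<close> of pivot \<open>a\<close>, read off the diagonal entry in
  its column.\<close>

definition piv :: "(nat => nat => ereal) => nat => ereal" where
  "piv C a = (if C (Z a) a < 0 then -\<infinity> else 0)"

lemma wp_pivot:
  assumes c: "call st" and C: "cols C st" and R: "rows R st" and a: "ireg st 45 = a" "a < s"
  shows "wp W pivot st (%t s'. t <= n * s * 25 + n * 12 + 30 &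
     cols (%x b. min (C x b) (C x a + piv C a + R a (Z b))) s' &
     rows (%b y. min (R b y) (C (Z b) a + piv C a + R a y)) s')"
proof -
  let ?tc = "%x. C x a + piv C a"
  have main: "wp W pivot_loops s0
     (%t s'. t <= n * s * 25 + n * 12 + 8 &
     cols (%x b. min (C x b) (?tc x + R a (Z b))) s' & rows (%b y. min (R b y) (?tc (Z b) + R a y)) s')"
    if c0: "call s0" and r0: "warr s0 6 = warr st 6" "ireg s0 45 = a" "ireg s0 49 = a * n + n * s" "wreg s0 12 = piv C a" for s0
    unfolding pivot_loops_def wp_Seq
  proof (rule wp_frame[OF wp_save_col[OF c0 _ r0(2) a(2) r0(4)]])
    show "cols C s0" using C r0 by (simp add: cols_def)
    fix t1 s1 assume a1: "t1 <= n * 7 + 2 & (\<forall>x<n. warr s1 9 x = C x a + piv C a)" "frame (For 46 0 save_col) s0 s1"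
    have c1: "call s1" by (rule call_same[OF c0 a1(2)]) auto
    have r1: "cols C s1" "rows R s1" "ireg s1 49 = a * n + n * s" using C R a1(2) r0 by (auto simp: cols_def rows_def same_def)
    show "wp W (For 46 0 save_row) s1 (%t1' s1. wp W (For 46 21 relax_col_entry) s1 (%t1a s1. wp W (For 46 21 relax_row_entry) s1
      (%t2 s'. t1 + (t1' + (t1a + t2)) <= n * s * 25 + n * 12 + 8 &
     cols (%x b. min (C x b) (?tc x + R a (Z b))) s' & rows (%b y. min (R b y) (?tc (Z b) + R a y)) s')))"
    proof (rule wp_frame[OF wp_save_row[OF c1 r1(2,3) a(2)]])
      fix t2 s2 assume a2: "t2 <= n * 5 + 2 & (\<forall>y<n. warr s2 10 y = R a y)" "frame (For 46 0 save_row) s1 s2"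
      have c2: "call s2" by (rule call_same[OF c1 a2(2)]) auto
      have r2: "cols C s2" "rows R s2" "\<forall>x<n. warr s2 9 x = ?tc x" using r1 a1 a2(2) by (auto simp: cols_def rows_def same_def)
      show "wp W (For 46 21 relax_col_entry) s2 (%t1a s1. wp W (For 46 21 relax_row_entry) s1
        (%t2' s'. t1 + (t2 + (t1a + t2')) <= n * s * 25 + n * 12 + 8 &
       cols (%x b. min (C x b) (?tc x + R a (Z b))) s' & rows (%b y. min (R b y) (?tc (Z b) + R a y)) s'))"
      proof (rule wp_frame[OF wp_relax_cols[OF c2 r2(1,2,3) conjunct2[OF a2(1)]]])
        fix t3 s3 assume a3: "t3 <= n * s * 12 + 2 & cols (%x b. min (C x b) (?tc x + R a (Z b))) s3 & rows R s3"
          "frame (For 46 21 relax_col_entry) s2 s3"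
        have c3: "call s3" by (rule call_same[OF c2 a3(2)]) auto
        have r3: "\<forall>x<n. warr s3 9 x = ?tc x" "\<forall>y<n. warr s3 10 y = R a y" using r2 a2 a3(2) by (auto simp: same_def)
        show "wp W (For 46 21 relax_row_entry) s3
          (%t2' s'. t1 + (t2 + (t3 + t2')) <= n * s * 25 + n * 12 + 8 &
         cols (%x b. min (C x b) (?tc x + R a (Z b))) s' & rows (%b y. min (R b y) (?tc (Z b) + R a y)) s')"
          by (rule wp_mono[OF wp_relax_rows[OF c3 _ _ r3, of "%x b. min (C x b) (?tc x + R a (Z b))" R]])
            (use a1(1) a2(1) a3(1) in auto)
      qed
    qed
  qed
  have Za: "Z a < n" using Z a by simp
  have w: "Z a * s + a < W" "Z a * s < W" "a * n < W" "a * n + n * s < W"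
    using ix[OF Za a(2)] iy[OF n_pos a(2)] ns by linarith+
  have e: "iarr st 3 a = Z a" "warr st 6 (Z a * s + a) = C (Z a) a" using c C a Za by (auto simp: call_def cols_def)
  show ?thesis
    unfolding pivot_def
    apply (simp add: a(1) e callD[OF c] w)
    apply (intro conjI impI)
    subgoal
      by (rule wp_mono[OF main]; (rule call_same[OF c, of "{47,48,49}" "{12,13}" "{}" "{}"])?)
        (auto simp: same_def a piv_def)
    subgoal
      by (rule wp_mono[OF main]; (rule call_same[OF c, of "{47,48,49}" "{12,13}" "{}" "{}"])?)
        (auto simp: same_def a piv_def)
    done
qed

text \<open>\<open>T\<close> is the set of vertices on which the matrix is meaningful. It is taken
  empty for a slot of unspecified contents; the claims on the entries are then vacuous, whereas time
  and frame remain. For nonempty \<open>T\<close> the batch lies in \<open>T\<close>, so every entry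
  that is read is meaningful.\<close>

lemma wp_pivots:
  assumes w: "weights w" and c: "call st" and C: "cols C st" and R: "rows R st"
    and T: "T \<subseteq> {..<n}" "\<And>b. b < s ==> T \<noteq> {} ==> Z b \<in> T"
    and CR: "\<And>x b. x \<in> T ==> b < s ==> C x b = fw w V x (Z b)" "\<And>y b. y \<in> T ==> b < s ==> R b y = fw w V (Z b) y"
  shows "wp W (For 45 20 pivot) st (%t s'. t <= s * (n * s * 25 + n * 12 + 32) + 2 &
     (\<exists>C R. cols C s' & rows R s' & (\<forall>b<s. \<forall>x\<in>T. C x b = fw w (V \<union> Z ` {..<s}) x (Z b)) &
        (\<forall>b<s. \<forall>y\<in>T. R b y = fw w (V \<union> Z ` {..<s}) (Z b) y)))"
proof -
  interpret weights w by (rule w)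
  let ?I = "%a s1. \<exists>C R. cols C s1 & rows R s1 & (\<forall>b<s. \<forall>x\<in>T. C x b = fw w (V \<union> Z ` {..<a}) x (Z b)) &
        (\<forall>b<s. \<forall>y\<in>T. R b y = fw w (V \<union> Z ` {..<a}) (Z b) y)"
  have "wp W (For 45 20 pivot) st (%t s'. t <= s * (n * s * 25 + n * 12 + 30 + 2) + 2 & ?I s s' & ireg s' 45 = s &
     loop_frame 45 pivot st s')"
  proof (rule wp_For_const[where I = ?I])
    fix a s1 assume a: "a < s" "?I a s1" "ireg s1 45 = a"
      and sm: "loop_frame 45 pivot st s1"
    have c1: "call s1" by (rule call_same[OF c sm]) auto
    let ?V = "V \<union> Z ` {..<a}"
    obtain C R where CR: "cols C s1" "rows R s1" "\<And>b x. b < s ==> x \<in> T ==> C x b = fw w ?V x (Z b)"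
      "\<And>b y. b < s ==> y \<in> T ==> R b y = fw w ?V (Z b) y" using a(2) by blast
    have V: "V \<union> Z ` {..<Suc a} = insert (Z a) ?V" by (auto simp: less_Suc_eq)
    have pv: "piv C a = loop_cost ?V (Z a)" if "T \<noteq> {}"
      using CR T(2) a that by (simp add: piv_def loop_cost_def)
    show "wp W pivot s1 (%t s2. t <= n * s * 25 + n * 12 + 30 & ?I (Suc a) (set_i 45 (Suc a) s2))"
    proof (rule wp_mono[OF wp_pivot[OF c1 CR(1,2) a(3,1)]], elim conjE, intro conjI, assumption)
      fix t and s2 :: state
      assume s2: "cols (%x b. min (C x b) (C x a + piv C a + R a (Z b))) s2"
        "rows (%b y. min (R b y) (C (Z b) a + piv C a + R a y)) s2"
      show "?I (Suc a) (set_i 45 (Suc a) s2)"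
      proof (intro exI conjI allI ballI impI)
        show "cols (%x b. min (C x b) (C x a + piv C a + R a (Z b))) (set_i 45 (Suc a) s2)"
          "rows (%b y. min (R b y) (C (Z b) a + piv C a + R a y)) (set_i 45 (Suc a) s2)"
          using s2 by (simp_all add: cols_def rows_def)
      next
        fix b x assume bx: "b < s" "x \<in> T"
        then have "T \<noteq> {}" by auto
        with bx show "min (C x b) (C x a + piv C a + R a (Z b)) = fw w (V \<union> Z ` {..<Suc a}) x (Z b)"
          unfolding V fw_insert using CR(3,4) T(2) a(1) pv by simp
      next
        fix b y assume bt: "b < s" "y \<in> T"
        then have "T \<noteq> {}" by auto
        with bt show "min (R b y) (C (Z b) a + piv C a + R a y) = fw w (V \<union> Z ` {..<Suc a}) (Z b) y"
          unfolding V fw_insert using CR(3,4) T(2) a(1) pv by simp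
      qed
    qed
  next
    show "?I 0 (set_i 45 0 st)"
      using C R CR by (intro exI[of _ C] exI[of _ R]) (auto simp: cols_def rows_def)
  qed (use ns callD[OF c] in auto)
  then show ?thesis by (rule wp_mono) (simp add: add.commute)
qed

lemma wp_keys:
  assumes c: "call st" and r: "ireg st 49 = 2 * (n * s)"
  shows "wp W (For 46 49 split_key) st (%t s'. t <= 2 * (n * s) * 12 + 2 &
     (\<forall>q<2 * (n * s). iarr s' 9 q = ecls (warr st 6 q) & warr s' 8 q = ereal (real_of_ereal (warr st 6 q))))"
proof -
  let ?I = "%x s1. \<forall>q<x. iarr s1 9 q = ecls (warr st 6 q) & warr s1 8 q = ereal (real_of_ereal (warr st 6 q))"
  have "wp W (For 46 49 split_key) st (%t s'. t <= 2 * (n * s) * (10 + 2) + 2 & ?I (2 * (n * s)) s' & ireg s' 46 = 2 * (n * s) &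
     loop_frame 46 split_key st s')"
  proof (rule wp_For_const[where I = ?I])
    fix q s1 assume q: "q < 2 * (n * s)" "?I q s1" "ireg s1 46 = q"
      and sm: "loop_frame 46 split_key st s1"
    have e: "warr s1 6 = warr st 6" using sm by (simp add: same_def)
    have W: "0 < W" "Suc 0 < W" "3 < W" using bounds by auto
    show "wp W split_key s1 (%t s2. t <= 10 & ?I (Suc q) (set_i 46 (Suc q) s2))"
      unfolding split_key_def
      by (cases "warr st 6 q") (use q W in \<open>auto simp: e ecls_def less_Suc_eq zero_ereal_def\<close>)
  qed (use ns r callD[OF c] in auto)
  then show ?thesis by (rule wp_mono) simp
qed

text \<open>After the pivots, the strips hold the final values to and from the batch. The product of
  the strips accounts for the walks that meet the batch, the old entry for all others.\<close>

lemma wp_batch_pos: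
  assumes w: "weights w" and r: "regs st" "ireg st 19 = sb" "ireg st 20 = s" "\<And>b. b < s ==> iarr st 3 b = Z b"
    and T: "T \<subseteq> {..<n}" "\<And>b. b < s ==> T \<noteq> {} ==> Z b \<in> T"
    and F: "\<And>x y. x \<in> T ==> y \<in> T ==> warr st 3 (sb + (x * n + y)) = fw w V x y"
  shows "wp W batch st (%t s'. t <= batch_time n m K lg s &
     (\<forall>x\<in>T. \<forall>y\<in>T. warr s' 3 (sb + (x * n + y)) = fw w (V \<union> Z ` {..<s}) x y) &
     (\<forall>q. q < sb \<or> sb + n * n <= q --> warr s' 3 q = warr st 3 q))"
proof -
  interpret weights w by (rule w)
  let ?V = "V \<union> Z ` {..<s}"
  let ?Q = "%s'. (\<forall>x\<in>T. \<forall>y\<in>T. warr s' 3 (sb + (x * n + y)) = fw w ?V x y) &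
     (\<forall>q. q < sb \<or> sb + n * n <= q --> warr s' 3 q = warr st 3 q)"
  define st0 where "st0 = set_i 21 (n * s) st"
  have c0: "call st0" using r by (auto simp: call_def regs_def st0_def)
  have st0: "warr st0 = warr st" by (simp add: st0_def)
  have "wp W (For 46 21 load_col ;; For 46 21 load_row ;; For 45 20 pivot ;; IOp Add 49 21 21 ;; For 46 49 split_key ;; min_plus)
    st0 (%t s'. t + 2 <= batch_time n m K lg s & ?Q s')"
    unfolding wp_Seq
  proof (rule wp_frame[OF wp_load_cols[OF c0]])
    fix t1 s1 assume a1: "t1 <= n * s * 10 + 2 & cols (%x b. warr st0 3 (sb + (x * n + Z b))) s1" "frame (For 46 21 load_col) st0 s1"
    have c1: "call s1" by (rule call_same[OF c0 a1(2)]) auto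
    have e1: "warr s1 3 = warr st 3" using a1(2) by (simp add: same_def st0)
    show "wp W (For 46 21 load_row) s1 (%t1' s1. wp W (For 45 20 pivot) s1 (%t1a s1. wp W (IOp Add 49 21 21) s1
      (%t1b s1. wp W (For 46 49 split_key) s1 (%t1c s1. wp W min_plus s1
      (%t2 s'. t1 + (t1' + (t1a + (t1b + (t1c + t2)))) + 2 <= batch_time n m K lg s & ?Q s')))))"
    proof (rule wp_frame[OF wp_load_rows[OF c1 conjunct2[OF a1(1)]]])
      fix t2 s2 assume a2: "t2 <= n * s * 11 + 2 & cols (%x b. warr st0 3 (sb + (x * n + Z b))) s2 &
         rows (%b y. warr s1 3 (sb + (Z b * n + y))) s2" "frame (For 46 21 load_row) s1 s2"
      have c2: "call s2" by (rule call_same[OF c1 a2(2)]) auto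
      have e2: "warr s2 3 = warr st 3" using a2(2) e1 by (simp add: same_def)
      show "wp W (For 45 20 pivot) s2 (%t1a s1. wp W (IOp Add 49 21 21) s1
        (%t1b s1. wp W (For 46 49 split_key) s1 (%t1c s1. wp W min_plus s1
        (%t2' s'. t1 + (t2 + (t1a + (t1b + (t1c + t2')))) + 2 <= batch_time n m K lg s & ?Q s'))))"
      proof (rule wp_frame[OF wp_pivots[OF w c2 conjunct1[OF conjunct2[OF a2(1)]] conjunct2[OF conjunct2[OF a2(1)]] T, of V]])
        show "warr st0 3 (sb + (x * n + Z b)) = fw w V x (Z b)" if "x \<in> T" "b < s" for x b
          using F T(2) that by (auto simp: st0)
        show "warr s1 3 (sb + (Z b * n + y)) = fw w V (Z b) y" if "y \<in> T" "b < s" for y b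
          using F T(2) that by (auto simp: e1)
      next
        fix t3 s3
        assume a3: "t3 <= s * (n * s * 25 + n * 12 + 32) + 2 & (\<exists>C R. cols C s3 & rows R s3 &
           (\<forall>b<s. \<forall>x\<in>T. C x b = fw w ?V x (Z b)) & (\<forall>b<s. \<forall>y\<in>T. R b y = fw w ?V (Z b) y))" "frame (For 45 20 pivot) s2 s3"
        have c3: "call s3" by (rule call_same[OF c2 a3(2)]) auto
        have e3: "warr s3 3 = warr st 3" using a3(2) e2 by (simp add: same_def)
        obtain C R where CR: "cols C s3" "rows R s3"
           "\<And>b x. b < s ==> x \<in> T ==> C x b = fw w ?V x (Z b)" "\<And>b y. b < s ==> y \<in> T ==> R b y = fw w ?V (Z b) y"
          using a3(1) by blast
        interpret product W n s m K sb lg "warr s3 6"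
        proof
          have "(m + 1) ^ s <= (m + 1) ^ d" using s_le by (intro power_increasing) auto
          then show "(m + 1) ^ s <= K" using codes by simp
          have "s * m <= d * m" using s_le by simp
          then show "s * m < W" using bounds by linarith
        qed (use n_pos s_pos m_pos bounds ns sb m_lg in auto)
        define s3' where "s3' = set_i 49 (2 * (n * s)) s3"
        have c3': "call s3'" by (rule call_same[OF c3, of "{49}" "{}" "{}" "{}"]) (auto simp: same_def s3'_def)
        have "wp W (For 46 49 split_key) s3' (%t1c s1. wp W min_plus s1
            (%t2' s'. t1 + (t2 + (t3 + (1 + (t1c + t2')))) + 2 <= batch_time n m K lg s & ?Q s'))"
        proof (rule wp_frame[OF wp_keys[OF c3']])
          show "ireg s3' 49 = 2 * (n * s)" by (simp add: s3'_def)
          fix t4 s4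
          assume a4: "t4 <= 2 * (n * s) * 12 + 2 & (\<forall>q<2 * (n * s). iarr s4 9 q = ecls (warr s3' 6 q) &
             warr s4 8 q = ereal (real_of_ereal (warr s3' 6 q)))" "frame (For 46 49 split_key) s3' s4"
          have c4: "call s4" by (rule call_same[OF c3' a4(2)]) auto
          have e4: "warr s4 3 = warr st 3" "warr s4 6 = warr s3 6" using a4(2) e3 by (simp_all add: same_def s3'_def)
          have ctx: "ctx (set_i 75 2 s4)"
            using c4 a4(1) e4 by (auto simp: ctx_def call_def regs_def s3'_def)
          show "wp W min_plus s4 (%t2' s'. t1 + (t2 + (t3 + (1 + (t4 + t2')))) + 2 <= batch_time n m K lg s & ?Q s')"
          proof (rule wp_mono[OF wp_min_plus[OF ctx]], elim conjE, intro conjI)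
            fix t5 s5
            assume t5: "t5 <= ((n - 1) div m + 1) * (s * (vtime + 2) + 20 * (m * n) + 12) + 6"
              and s5: "warr s5 3 = relaxed (warr s4 3) ({..<n} \<times> {..<n})"
            show "t1 + (t2 + (t3 + (1 + (t4 + t5)))) + 2 <= batch_time n m K lg s"
              using t5 a1(1) a2(1) a3(1) a4(1) unfolding batch_time_def by linarith
            show "\<forall>q. q < sb \<or> sb + n * n <= q --> warr s5 3 q = warr st 3 q"
              using s5 by (simp add: e4 relaxed_outside)
            show "\<forall>x\<in>T. \<forall>y\<in>T. warr s5 3 (sb + (x * n + y)) = fw w ?V x y"
            proof (intro ballI)
              fix x y assume xy: "x \<in> T" "y \<in> T"
              then have lt: "x < n" "y < n" using T by auto
              have AR: "A x k = fw w ?V x (Z k)" "R k y = fw w ?V (Z k) y" if "k < s" for k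
                using CR xy lt that by (simp_all add: A_def R_def cols_def rows_def)
              have R': "product.R n s (warr s3 6) k y = fw w ?V (Z k) y" if "k < s" for k
                using CR(2,4) xy lt that unfolding product.R_def[OF product_axioms] by (simp add: rows_def)
              have A': "product.A s (warr s3 6) x k = fw w ?V x (Z k)" if "k < s" for k
                using CR(1,3) xy lt that unfolding product.A_def[OF product_axioms] by (simp add: cols_def)
              have "warr s5 3 (sb + (x * n + y)) =
                  min (fw w V x y) (MIN k\<in>{..<s}. product.A s (warr s3 6) x k + product.R n s (warr s3 6) k y)"
                using relaxed_all[OF lt, of "warr s4 3"] F[OF xy] by (simp add: s5 e4)
              also have "(MIN k\<in>{..<s}. product.A s (warr s3 6) x k + product.R n s (warr s3 6) k y) =
                  (MIN k\<in>{..<s}. fw w ?V x (Z k) + fw w ?V (Z k) y)"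
                by (intro arg_cong[where f = Min] image_cong) (simp_all add: A' R')
              also have "min (fw w V x y) \<dots> = fw w ?V x y"
              proof (rule antisym)
                let ?M = "MIN k\<in>{..<s}. fw w ?V x (Z k) + fw w ?V (Z k) y"
                show "min (fw w V x y) ?M <= fw w ?V x y"
                  by (rule fw_Un_cases) (auto intro!: min.coboundedI2 Min_le)
                have "fw w ?V x y <= ?M" using s_pos by (intro Min.boundedI) (auto intro!: fw_Un_le)
                then show "fw w ?V x y <= min (fw w V x y) ?M" by (auto intro: fw_mono)
              qed
              finally show "warr s5 3 (sb + (x * n + y)) = fw w ?V x y" .
            qed
          qed
        qed
        then show "wp W (IOp Add 49 21 21) s3
          (%t1b s1. wp W (For 46 49 split_key) s1 (%t1c s1. wp W min_plus s1
          (%t2' s'. t1 + (t2 + (t3 + (t1b + (t1c + t2')))) + 2 <= batch_time n m K lg s & ?Q s')))"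
          using ns by (simp add: callD[OF c3] s3'_def mult_2)
      qed
    qed
  qed
  then show ?thesis
    unfolding batch_def wp_Seq[of W "IOp Mul 21 0 20"] wp_If
    using ns s_pos r by (simp add: regsD[OF r(1)] st0_def del: wp_Seq)
qed

end

lemma (in machine) wp_batch:
  assumes w: "weights w" and r: "regs st" "ireg st 19 = sb" "ireg st 20 = s" "\<And>b. b < s ==> iarr st 3 b = Z b"
    and h: "s <= d" "sb + n * n < W" "T \<subseteq> {..<n}" "\<And>b. b < s ==> T \<noteq> {} ==> Z b \<in> T" "\<And>b. b < s ==> Z b < n"
    and F: "\<And>x y. x \<in> T ==> y \<in> T ==> warr st 3 (sb + (x * n + y)) = fw w V x y"
  shows "wp W batch st (%t s'. t <= batch_time n m K lg s + 3 &
     (\<forall>x\<in>T. \<forall>y\<in>T. warr s' 3 (sb + (x * n + y)) = fw w (V \<union> Z ` {..<s}) x y) &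
     (\<forall>q. q < sb \<or> sb + n * n <= q --> warr s' 3 q = warr st 3 q))"
proof (cases "s = 0")
  case True
  then show ?thesis using r F bounds unfolding batch_def by (simp add: regsD[OF r(1)])
next
  case False
  interpret batch_call W n d m K lg s sb Z by unfold_locales (use False h in auto)
  show ?thesis by (rule wp_mono[OF wp_batch_pos[OF w r h(3,4) F]]) auto
qed

section \<open>Inserting a vertex into all stored matrices\<close>

text \<open>A downward closed set of indices is an initial segment. For a sorted order, the number
  of vertices with a smaller time is therefore the place of a new one.\<close>

lemma initial_segment_card:
  fixes k :: nat
  assumes "\<And>i j. i <= j ==> j < k ==> P j ==> P i" "j < k"
  shows "P j \<longleftrightarrow> j < card {j. j < k & P j}"
proof -
  define c where "c = (LEAST j. \<not> (j < k & P j))"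
  have nc: "\<not> (c < k & P c)" unfolding c_def by (rule LeastI[of _ k]) simp
  have "j < k & P j" if "j < c" for j using not_less_Least[of j "%j. \<not> (j < k & P j)"] that by (auto simp: c_def)
  moreover have "j < c" if "j < k" "P j" for j
  proof (rule ccontr)
    assume "\<not> j < c"
    then have "c < k" "P c" using assms(1)[of c j] that by auto
    then show False using nc by simp
  qed
  ultimately have "{j. j < k & P j} = {..<c}" by auto
  then show ?thesis using assms(2) by auto
qed

definition wmin :: "nat => nat => com" where
  "wmin x y = If (WLess y x) (WMove x y) Skip"

lemma wmin_mods [simp]: "iw (wmin x y) = {}" "ww (wmin x y) = {x}" "iaw (wmin x y) = {}" "waw (wmin x y) = {}"
  by (auto simp: wmin_def)

lemma wp_wmin [simp]: "wp W (wmin x y) s Q \<longleftrightarrow> Q 2 (set_w x (min (wreg s x) (wreg s y)) s)"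
proof (cases "wreg s y < wreg s x")
  case True
  then have "min (wreg s x) (wreg s y) = wreg s y" by (simp add: min.absorb2 less_imp_le)
  then show ?thesis using True by (simp add: wmin_def numeral_2_eq_2)
next
  case False
  then have "min (wreg s x) (wreg s y) = wreg s x" by (simp add: min.absorb1 not_less)
  then show ?thesis using False by (simp add: wmin_def numeral_2_eq_2 set_w_def)
qed

definition locate :: com where
  "locate = ILoad 104 0 103 ;; WLoad 20 5 104 ;; If (WLess 20 21) (IOp Add 101 101 2) Skip"

definition extend_via :: com where
  "extend_via = If (ILess 110 105) Skip
    (ILoad 111 0 110 ;;
     IOp Add 112 106 111 ;; IOp Add 112 112 19 ;; WLoad 23 3 112 ;; IOp Mul 113 111 0 ;; IOp Add 114 113 100 ;;
     WLoad 24 4 114 ;; WAdd 23 23 24 ;; wmin 20 23 ;;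
     IOp Add 112 108 111 ;; WLoad 23 4 112 ;; IOp Add 112 113 103 ;; IOp Add 112 112 19 ;; WLoad 24 3 112 ;;
     WAdd 23 23 24 ;; wmin 22 23)"

definition extend_entry :: com where
  "extend_entry = IOp Mul 106 103 0 ;; IOp Add 107 106 100 ;; WLoad 20 4 107 ;; IOp Add 109 108 103 ;; WLoad 22 4 109 ;;
    For 110 10 extend_via ;; WStore 11 103 20 ;; WStore 12 103 22"

definition extend_diag :: com where
  "extend_diag = If (ILess 110 105) Skip
    (ILoad 111 0 110 ;; IOp Add 112 108 111 ;; WLoad 23 4 112 ;; WLoad 24 11 111 ;; WAdd 23 23 24 ;; wmin 20 23)"

definition write_entry :: com where
  "write_entry = IOp Mul 106 103 0 ;; IOp Add 107 106 100 ;; IOp Add 107 107 19 ;; WLoad 23 11 103 ;; WStore 3 107 23 ;;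
    IOp Add 107 108 103 ;; IOp Add 107 107 19 ;; WLoad 23 12 103 ;; WStore 3 107 23"

definition extend :: com where
  "extend = IOp Mul 19 102 16 ;; ILoad 105 1 102 ;; IOp Mul 108 100 0 ;; For 103 0 extend_entry ;;
    WConst 20 0 ;; For 110 10 extend_diag ;; For 103 0 write_entry ;;
    IOp Add 107 108 100 ;; IOp Add 107 107 19 ;; WStore 3 107 20"

definition push_slot :: com where
  "push_slot = extend ;;
    If (ILess 10 105) (IConst 20 0)
      (If (ILess 101 105) (IOp Sub 104 105 2 ;; ILoad 104 0 104) (IMove 104 100) ;; IStore 3 3 104 ;; IConst 20 1) ;;
    batch"

definition shift_order :: com where
  "shift_order = ILoad 104 0 103 ;; If (ILess 103 101) (IMove 105 103) (IOp Add 105 103 2) ;; IStore 11 105 104"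

definition copy_order :: com where
  "copy_order = ILoad 104 11 103 ;; IStore 0 103 104"

definition push :: com where
  "push = WLoad 21 5 100 ;; IConst 101 0 ;; For 103 10 locate ;; For 102 14 push_slot ;;
    For 103 10 shift_order ;; IStore 11 101 100 ;; IOp Add 10 10 2 ;; For 103 10 copy_order"

lemma push_mods [simp]:
  "iw locate = {101, 104}" "ww locate = {20}" "iaw locate = {}" "waw locate = {}"
  "iw extend_via = {111, 112, 113, 114}" "ww extend_via = {20, 22, 23, 24}" "iaw extend_via = {}" "waw extend_via = {}"
  "iw extend_entry = {106, 107, 109, 110, 111, 112, 113, 114}" "ww extend_entry = {20, 22, 23, 24}"
  "iaw extend_entry = {}" "waw extend_entry = {11, 12}"
  "iw extend_diag = {111, 112}" "ww extend_diag = {20, 23, 24}" "iaw extend_diag = {}" "waw extend_diag = {}"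
  "iw write_entry = {106, 107}" "ww write_entry = {23}" "iaw write_entry = {}" "waw write_entry = {3}"
  "iw extend = {19, 103, 105, 106, 107, 108, 109, 110, 111, 112, 113, 114}" "ww extend = {20, 22, 23, 24}"
  "iaw extend = {}" "waw extend = {3, 11, 12}"
  "iw shift_order = {104, 105}" "ww shift_order = {}" "iaw shift_order = {11}" "waw shift_order = {}"
  "iw copy_order = {104}" "ww copy_order = {}" "iaw copy_order = {0}" "waw copy_order = {}"
  by (auto simp: locate_def extend_via_def extend_entry_def extend_diag_def write_entry_def extend_def
      shift_order_def copy_order_def)

definition push_regs :: "nat set" where
  "push_regs = {19, 20, 21} \<union> {40..<76} \<union> {100..<115}"

lemma push_slot_mods:
  "iw push_slot \<subseteq> push_regs - {100, 101, 102}" "ww push_slot \<subseteq> {10, 11, 12, 13, 20, 22, 23, 24}"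
  "iaw push_slot \<subseteq> {3, 5, 6, 7, 8, 9, 10}" "waw push_slot \<subseteq> {3, 6, 8, 9, 10, 11, 12}"
  using batch_mods by (auto simp: push_slot_def push_regs_def)

lemma push_mods':
  "iw push \<subseteq> insert 10 (push_regs - {100})" "ww push \<subseteq> {10..<25}" "iaw push \<subseteq> {0, 3, 5, 6, 7, 8, 9, 10, 11}"
  "waw push \<subseteq> {3, 6, 8, 9, 10, 11, 12}"
proof -
  have "iw push_slot \<subseteq> insert 10 (push_regs - {100})" using push_slot_mods(1) by blast
  moreover have "{101, 102, 103, 104, 105} \<subseteq> insert 10 (push_regs - {100})" by (simp add: push_regs_def)
  ultimately show "iw push \<subseteq> insert 10 (push_regs - {100})" by (simp add: push_def)
  have "{10, 11, 12, 13, 20, 22, 23, 24} \<subseteq> {10..<25::nat}" by simp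
  with push_slot_mods(2) have "ww push_slot \<subseteq> {10..<25}" by (rule subset_trans)
  then show "ww push \<subseteq> {10..<25}" by (simp add: push_def)
  show "iaw push \<subseteq> {0, 3, 5, 6, 7, 8, 9, 10, 11}" using push_slot_mods(3) by (simp add: push_def) blast
  show "waw push \<subseteq> {3, 6, 8, 9, 10, 11, 12}" using push_slot_mods(4) by (simp add: push_def)
qed

lemma INF_atLeastLessThan_Suc:
  fixes f :: "nat => ereal"
  shows "r <= j ==> (INF i\<in>{r..<Suc j}. f i) = min (INF i\<in>{r..<j}. f i) (f j)"
    "\<not> r <= j ==> (INF i\<in>{r..<Suc j}. f i) = (INF i\<in>{r..<j}. f i)"
proof -
  assume "r <= j"
  then have "{r..<Suc j} = insert j {r..<j}" by auto
  then show "(INF i\<in>{r..<Suc j}. f i) = min (INF i\<in>{r..<j}. f i) (f j)" by (simp add: inf_min min.commute)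
next
  assume "\<not> r <= j"
  then have "{r..<Suc j} = {r..<j}" by auto
  then show "(INF i\<in>{r..<Suc j}. f i) = (INF i\<in>{r..<j}. f i)" by simp
qed

lemma set_drop_conv: "set (drop r xs) = (!) xs ` {r..<length xs}"
proof -
  have "set (drop r xs) = {drop r xs ! i |i. i < length xs - r}" by (simp add: set_conv_nth)
  also have "\<dots> = (!) xs ` {r..<length xs}"
  proof (intro equalityI subsetI)
    fix x assume "x \<in> {drop r xs ! i |i. i < length xs - r}"
    then obtain i where "x = xs ! (r + i)" "i < length xs - r" by auto
    then show "x \<in> (!) xs ` {r..<length xs}" by (intro image_eqI[of _ _ "r + i"]) auto
  next
    fix x assume "x \<in> (!) xs ` {r..<length xs}"
    then obtain i where "x = xs ! i" "r <= i" "i < length xs" by auto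
    then show "x \<in> {drop r xs ! i |i. i < length xs - r}" by (auto intro!: exI[of _ "i - r"])
  qed
  finally show ?thesis .
qed

text \<open>Integer array 0 holds the predicted order (its length is in register 10), integer array 1 the
  rank of the matrix in each slot, weight array 3 the matrices one after the other, weight array 4
  the edge weights and weight array 5 the predicted times.\<close>

locale pebbles = machine +
  fixes t :: nat
  assumes d2: "2 <= d" and n_le: "n <= d ^ t"
    and slotsW: "(t + 2) * (2 * d + 1) * (n * n) + n * n < W" and MW: "8 * d ^ (t + 2) + 8 < W"
    and slotsW': "(t + 2) * (2 * d + 1) < W"
begin

text \<open>Levels 0 to \<open>t + 1\<close>, each with a circular buffer of \<open>2 * d\<close>
  slots and one slot for its walker. Level \<open>t + 1\<close> only feeds level
  \<open>t\<close>.\<close>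

definition NS :: nat where "NS = (t + 2) * (2 * d + 1)"

text \<open>Register 7 is the number of levels stepped in one deletion, register 15 the period of
  the deletion counter; registers 17 and 18 are the numbers of slots of a buffer and of a
  level.\<close>

definition gregs :: "state => bool" where
  "gregs st \<longleftrightarrow> regs st & ireg st 5 = d & ireg st 6 = t & ireg st 7 = t div d + 1 & ireg st 14 = NS &
    ireg st 15 = 2 * d ^ (t + 2) & ireg st 16 = n * n & ireg st 17 = 2 * d & ireg st 18 = 2 * d + 1 &
    (\<forall>l\<le>t. iarr st 2 l = d ^ l)"

lemma gregsD:
  assumes "gregs st"
  shows "regs st" "ireg st 5 = d" "ireg st 6 = t" "ireg st 7 = t div d + 1" "ireg st 14 = NS"
    "ireg st 15 = 2 * d ^ (t + 2)" "ireg st 16 = n * n" "ireg st 17 = 2 * d" "ireg st 18 = 2 * d + 1"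
    "l <= t ==> iarr st 2 l = d ^ l" "ireg st 0 = n" "ireg st 2 = 1" "ireg st 3 = 0"
  using assms by (auto simp: gregs_def regs_def)

lemma gregs_same:
  "gregs st ==> same X Y A B st st' ==> X \<inter> {0, 2, 3, 5, 6, 7, 11, 12, 13, 14, 15, 16, 17, 18} = {} ==> 2 \<notin> A ==> gregs st'"
  unfolding gregs_def regs_def same_def by (auto simp: disjoint_iff)

lemma NSW: "NS < W" using slotsW' by (simp add: NS_def)

lemma slotW:
  assumes "\<sigma> < NS" shows "\<sigma> * (n * n) + n * n < W" "\<sigma> * (n * n) < W"
proof -
  have "\<sigma> * (n * n) <= NS * (n * n)" using assms by simp
  then show "\<sigma> * (n * n) + n * n < W" "\<sigma> * (n * n) < W" using slotsW unfolding NS_def by linarith+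
qed

definition data :: "(nat => nat => ereal) => nat list => state => bool" where
  "data w ord st \<longleftrightarrow> ireg st 10 = length ord & (\<forall>j<length ord. iarr st 0 j = ord ! j) & distinct ord &
    set ord \<subseteq> {..<n} & (\<forall>x\<in>set ord. \<forall>y\<in>set ord. warr st 4 (x * n + y) = w x y) &
    sorted_wrt (%x y. warr st 5 x < warr st 5 y) ord"

text \<open>Only the entries of present vertices are specified. A rank beyond the length of the
  order stands for the empty interior, so the matrix is then that of the edges.\<close>

definition matrix :: "(nat => nat => ereal) => nat list => state => nat => nat => bool" where
  "matrix w ord st \<sigma> r \<longleftrightarrow> (\<forall>x\<in>set ord. \<forall>y\<in>set ord. warr st 3 (\<sigma> * (n * n) + (x * n + y)) = fw w (set (drop r ord)) x y)"

definition good :: "(nat => nat => ereal) => nat list => state => nat => nat => bool" where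
  "good w ord st \<sigma> r \<longleftrightarrow> iarr st 1 \<sigma> = r & matrix w ord st \<sigma> r"

lemma data_length: "data w ord st ==> length ord <= n"
  unfolding data_def using card_mono[of "{..<n}" "set ord"] by (simp add: distinct_card)

lemma data_nth: "data w ord st ==> j < length ord ==> iarr st 0 j = ord ! j & ord ! j < n"
  unfolding data_def by (auto dest: nth_mem)

lemma slot_disjoint:
  assumes "\<sigma> \<noteq> \<sigma>'" "x < n" "y < n"
  shows "\<sigma>' * (n * n) + (x * n + y) < \<sigma> * (n * n) \<or> \<sigma> * (n * n) + n * n <= \<sigma>' * (n * n) + (x * n + y)"
proof -
  have xy: "x * n + y < n * n" using assms by (intro mult_add_less)
  show ?thesis
  proof (cases "\<sigma>' < \<sigma>")
    case True
    then have "Suc \<sigma>' * (n * n) <= \<sigma> * (n * n)" by (intro mult_le_mono1) simp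
    then show ?thesis using xy by simp
  next
    case False
    then have "Suc \<sigma> * (n * n) <= \<sigma>' * (n * n)" using assms by (intro mult_le_mono1) simp
    then show ?thesis by simp
  qed
qed

lemma matrix_cong:
  assumes "matrix w ord st \<sigma> r" "set ord \<subseteq> {..<n}" "\<And>x y. x < n ==> y < n ==>
    warr st' 3 (\<sigma> * (n * n) + (x * n + y)) = warr st 3 (\<sigma> * (n * n) + (x * n + y))"
  shows "matrix w ord st' \<sigma> r"
  using assms unfolding matrix_def by (metis lessThan_iff subsetD)

end

locale push_call = pebbles +
  fixes w :: "nat => nat => ereal" and ord :: "nat list" and x :: nat and st0 :: state
  assumes w: "weights w" and dat: "data w ord st0" and x: "x < n" "x \<notin> set ord"
    and wxx: "warr st0 4 (x * n + x) = w x x" and w_x: "w x x = \<infinity>" "\<And>y. y \<in> set ord ==> warr st0 4 (x * n + y) = w x y & warr st0 4 (y * n + x) = w y x"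
    and pr: "\<And>y. y \<in> set ord ==> warr st0 5 y \<noteq> warr st0 5 x"
begin

lemma ord_n: "j < length ord ==> ord ! j < n" using dat data_nth by blast
lemma len: "length ord < n"
proof -
  have "card (insert x (set ord)) <= card {..<n}" using dat x by (intro card_mono) (auto simp: data_def)
  then show ?thesis using dat x by (simp add: data_def distinct_card)
qed

section \<open>Inserting one vertex into the order and into every matrix\<close>

definition pctx :: "state => bool" where
  "pctx st \<longleftrightarrow> gregs st & ireg st 10 = length ord & ireg st 100 = x & (\<forall>j<length ord. iarr st 0 j = ord ! j) &
     iarr st 1 = iarr st0 1 & warr st 4 = warr st0 4 & warr st 5 = warr st0 5"

lemma pctxD:
  assumes "pctx st"
  shows "gregs st" "ireg st 10 = length ord" "ireg st 100 = x" "j < length ord ==> iarr st 0 j = ord ! j"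
    "iarr st 1 = iarr st0 1" "warr st 4 = warr st0 4" "warr st 5 = warr st0 5"
    "ireg st 0 = n" "ireg st 2 = 1" "ireg st 3 = 0"
  using assms by (auto simp: pctx_def gregs_def regs_def)

lemma pctx_same:
  "pctx st ==> same X Y A B st st' ==> X \<inter> {0, 2, 3, 5, 6, 7, 10, 11, 12, 13, 14, 15, 16, 17, 18, 100} = {} ==>
    A \<inter> {0, 1, 2} = {} ==> B \<inter> {4, 5} = {} ==> pctx st'"
  unfolding pctx_def gregs_def regs_def same_def by (auto simp: disjoint_iff)

definition index :: nat where
  "index = card {j. j < length ord & warr st0 5 (ord ! j) < warr st0 5 x}"

lemma index_le: "index <= length ord"
  unfolding index_def by (rule order_trans[OF card_mono[of "{..<length ord}"]]) auto

lemma less_index: "j < length ord ==> warr st0 5 (ord ! j) < warr st0 5 x \<longleftrightarrow> j < index"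
  unfolding index_def
proof (rule initial_segment_card)
  fix i j assume "i <= j" "j < length ord" "warr st0 5 (ord ! j) < warr st0 5 x"
  then show "warr st0 5 (ord ! i) < warr st0 5 x"
    using dat unfolding data_def sorted_wrt_iff_nth_less by (cases "i = j") (auto intro: less_trans[of _ "warr st0 5 (ord ! j)"])
qed

definition ord' :: "nat list" where
  "ord' = take index ord @ x # drop index ord"

lemma set_ord': "set ord' = insert x (set ord)"
proof -
  have "set ord = set (take index ord) \<union> set (drop index ord)" by (metis append_take_drop_id set_append)
  then show ?thesis by (auto simp: ord'_def)
qed

lemma length_ord': "length ord' = Suc (length ord)" using index_le by (simp add: ord'_def)

lemma distinct_ord': "distinct ord'"
  using dat x set_take_disj_set_drop_if_distinct[of ord index index]
  by (auto simp: ord'_def data_def dest: in_set_takeD in_set_dropD)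

lemma nth_ord': "j < Suc (length ord) ==>
  ord' ! j = (if j < index then ord ! j else if j = index then x else ord ! (j - 1))"
  using index_le by (auto simp: ord'_def nth_append nth_Cons' min_def)

lemma sorted_ord': "sorted_wrt (%x y. warr st0 5 x < warr st0 5 y) ord'"
proof -
  have s: "sorted_wrt (%x y. warr st0 5 x < warr st0 5 y) ord" using dat by (simp add: data_def)
  have l: "warr st0 5 y < warr st0 5 x" if "y \<in> set (take index ord)" for y
    using that less_index index_le by (auto simp: in_set_conv_nth)
  have r: "warr st0 5 x < warr st0 5 y" if y: "y \<in> set (drop index ord)" for y
  proof -
    from y obtain j where j: "j < length ord" "index <= j" "y = ord ! j" by (auto simp: set_drop_conv)
    then have "\<not> warr st0 5 y < warr st0 5 x" using less_index by auto
    moreover have "warr st0 5 y \<noteq> warr st0 5 x" using pr j by simp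
    ultimately show ?thesis by auto
  qed
  have "sorted_wrt (%x y. warr st0 5 x < warr st0 5 y) (take index ord @ drop index ord)" using s by simp
  then show ?thesis using l r unfolding ord'_def sorted_wrt_append
    by (auto intro: less_trans)
qed

text \<open>With the rank kept, the interior grows by exactly one vertex: the new one if it lies
  behind the rank, else the vertex at position \<open>r - 1\<close>, which the insertion shifts
  across the rank. This is why one pivot per matrix is enough.\<close>

lemma drop_ord':
  "r <= index ==> set (drop r ord') = insert x (set (drop r ord))"
  "index < r ==> r <= length ord ==> set (drop r ord') = insert (ord ! (r - 1)) (set (drop r ord))"
  "length ord < r ==> drop r ord' = []"
proof -
  assume "r <= index"
  then have "drop r ord' = drop r (take index ord) @ x # drop index ord"
    using index_le by (simp add: ord'_def)
  moreover have "drop r ord = drop r (take index ord) @ drop index ord"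
    using \<open>r <= index\<close> index_le drop_append[of r "take index ord" "drop index ord"] by simp
  ultimately show "set (drop r ord') = insert x (set (drop r ord))" by auto
next
  assume r: "index < r" "r <= length ord"
  have "drop r ord' = drop (r - 1) ord"
    using r index_le by (auto simp: ord'_def drop_Cons' add.commute)
  also have "\<dots> = ord ! (r - 1) # drop r ord" using r Cons_nth_drop_Suc[of "r - 1" ord] by simp
  finally show "set (drop r ord') = insert (ord ! (r - 1)) (set (drop r ord))" by simp
next
  assume "length ord < r" then show "drop r ord' = []" by (simp add: length_ord')
qed

lemma wp_locate:
  assumes p: "pctx st" and r: "wreg st 21 = warr st0 5 x" "ireg st 101 = 0"
  shows "wp W (For 103 10 locate) st (%t s'. t <= n * 7 + 2 & ireg s' 101 = index)"
proof -
  let ?P = "%j. warr st0 5 (ord ! j) < warr st0 5 x"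
  have lW: "length ord < W" using len bounds by simp
  have "wp W (For 103 10 locate) st (%t s'. t <= length ord * (5 + 2) + 2 &
     ireg s' 101 = card {j. j < length ord & ?P j} & ireg s' 103 = length ord &
     loop_frame 103 locate st s')"
  proof (rule wp_For_const[where I = "%k s1. ireg s1 101 = card {j. j < k & ?P j}"])
    fix k s1 assume k: "k < length ord" "ireg s1 101 = card {j. j < k & ?P j}" "ireg s1 103 = k"
      and sm: "loop_frame 103 locate st s1"
    have p1: "pctx s1" by (rule pctx_same[OF p sm]) auto
    have w21: "wreg s1 21 = warr st0 5 x" using sm r by (simp add: same_def)
    have cle: "card {j. j < k & ?P j} <= k" by (rule order_trans[OF card_mono[of "{..<k}"]]) auto
    have cS: "card {j. j < Suc k & ?P j} = card {j. j < k & ?P j} + of_bool (?P k)"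
    proof (cases "?P k")
      case True
      then have "{j. j < Suc k & ?P j} = insert k {j. j < k & ?P j}" by (auto simp: less_Suc_eq)
      then show ?thesis using True by simp
    next
      case False
      then have "{j. j < Suc k & ?P j} = {j. j < k & ?P j}" by (auto simp: less_Suc_eq)
      then show ?thesis using False by simp
    qed
    have b: "Suc (card {j. j < k & ?P j}) < W" using cle k lW by linarith
    show "wp W locate s1 (%t s2. t <= 5 & ireg (set_i 103 (Suc k) s2) 101 = card {j. j < Suc k & ?P j})"
      unfolding locate_def cS using b by (simp add: k(3) pctxD[OF p1] pctxD(4)[OF p1 k(1)] w21 k(2))
  qed (use lW pctxD[OF p] r in auto)
  then show ?thesis
    by (rule wp_mono) (use len mult_le_mono1[of "length ord" n 7] in \<open>auto simp: index_def\<close>)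
qed

text \<open>\<open>J\<close> is the progress of the scan. Starting at position \<open>r\<close>
  restricts the neighbour of \<open>x\<close> on the walk to the interior that belongs to rank
  \<open>r\<close>.\<close>

definition colv :: "nat => nat => (nat => ereal) => nat => nat => ereal" where
  "colv sb r F J y = (INF j\<in>{r..<J}. F (sb + (y * n + ord ! j)) + warr st0 4 (ord ! j * n + x))"
definition rowv :: "nat => nat => (nat => ereal) => nat => nat => ereal" where
  "rowv sb r F J y = (INF j\<in>{r..<J}. warr st0 4 (x * n + ord ! j) + F (sb + (ord ! j * n + y)))"

lemma wp_extend_entry:
  assumes p: "pctx st" and r: "ireg st 19 = sb" "ireg st 105 = r" "ireg st 108 = x * n" "ireg st 103 = y"
    and h: "sb + n * n < W" "y < n"
  shows "wp W extend_entry st (%t s'. t <= n * 22 + 20 &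
     warr s' 11 = (warr st 11)(y := min (warr st0 4 (y * n + x)) (colv sb r (warr st 3) (length ord) y)) &
     warr s' 12 = (warr st 12)(y := min (warr st0 4 (x * n + y)) (rowv sb r (warr st 3) (length ord) y)))"
proof -
  have lW: "length ord < W" using len bounds by simp
  define s0 where "s0 = set_w 22 (warr st0 4 (x * n + y)) (set_i 109 (x * n + y) (set_w 20 (warr st0 4 (y * n + x)) (set_i 107 (y * n + x) (set_i 106 (y * n) st))))"
  have p0: "pctx s0" by (rule pctx_same[OF p, of "{106,107,109}" "{20,22}" "{}" "{}"]) (auto simp: same_def s0_def)
  let ?F = "warr st 3"
  let ?I = "%J s1. wreg s1 20 = min (warr st0 4 (y * n + x)) (colv sb r ?F J y) &
     wreg s1 22 = min (warr st0 4 (x * n + y)) (rowv sb r ?F J y)"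
  have xn: "a * n + b < n * n" if "a < n" "b < n" for a b using that by (rule mult_add_less)
  have loop: "wp W (For 110 10 extend_via) s0 (%t s'. t <= length ord * (20 + 2) + 2 & ?I (length ord) s' & ireg s' 110 = length ord &
     loop_frame 110 extend_via s0 s')"
  proof (rule wp_For_const[where I = ?I])
    fix j s1 assume j: "j < length ord" "?I j s1" "ireg s1 110 = j"
      and sm: "loop_frame 110 extend_via s0 s1"
    have p1: "pctx s1" by (rule pctx_same[OF p0 sm]) auto
    have e: "ireg s1 19 = sb" "ireg s1 105 = r" "ireg s1 108 = x * n" "ireg s1 103 = y" "ireg s1 106 = y * n" "warr s1 3 = ?F"
      using sm r by (auto simp: same_def s0_def)
    have u: "ord ! j < n" using ord_n j by simp
    have ws: "y * n + ord ! j < W" "y * n + ord ! j + sb < W" "ord ! j * n < W" "ord ! j * n + x < W"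
      "x * n + ord ! j < W" "ord ! j * n + y < W" "ord ! j * n + y + sb < W"
      using xn[OF h(2) u] xn[OF u x(1)] xn[OF x(1) u] xn[OF u h(2)] h by linarith+
    show "wp W extend_via s1 (%t s2. t <= 20 & ?I (Suc j) (set_i 110 (Suc j) s2))"
    proof (cases "j < r")
      case True
      then show ?thesis unfolding extend_via_def using j(2)
        by (simp add: j(3) e colv_def rowv_def INF_atLeastLessThan_Suc)
    next
      case False
      then have rj: "r <= j" by simp
      have c: "colv sb r ?F (Suc j) y = min (colv sb r ?F j y) (?F (y * n + ord ! j + sb) + warr st0 4 (ord ! j * n + x))"
        "rowv sb r ?F (Suc j) y = min (rowv sb r ?F j y) (warr st0 4 (x * n + ord ! j) + ?F (ord ! j * n + y + sb))"
        unfolding colv_def rowv_def INF_atLeastLessThan_Suc(1)[OF rj] by (simp_all add: add.commute)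
      show ?thesis unfolding extend_via_def using False j(2)
        by (simp add: j(3) e pctxD[OF p1] pctxD(4)[OF p1 j(1)] ws c min.assoc)
    qed
  next
    show "?I 0 (set_i 110 0 s0)" by (simp add: s0_def colv_def rowv_def top_ereal_def)
  qed (use lW pctxD[OF p0] in auto)
  have ws: "y * n < W" "y * n + x < W" "x * n + y < W" using xn[OF h(2) x(1)] xn[OF x(1) h(2)] h by linarith+
  have ln: "length ord * 22 <= n * 22" using len by simp
  from loop show ?thesis
    unfolding extend_entry_def
    apply (simp add: r ws pctxD[OF p] flip: s0_def)
    apply (rule wp_mono, assumption)
    using r ln by (auto simp: same_def s0_def)
qed

text \<open>The column of \<open>x\<close> comes from \<open>fw_last_edge\<close> and its row from
  \<open>fw_first_edge\<close>, both over the old entries; the diagonal entry combines the edges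
  leaving \<open>x\<close> with the new column and the empty walk. The premise on the slot guards
  the values only.\<close>

lemma wp_extend:
  assumes p: "pctx st" and r: "ireg st 102 = \<sigma>" and h: "\<sigma> < NS"
  shows "wp W extend st (%t s'. t <= n * (n * 22 + 50) + 50 & ireg s' 19 = \<sigma> * (n * n) & ireg s' 105 = iarr st0 1 \<sigma> &
     (matrix w ord st \<sigma> (iarr st0 1 \<sigma>) --> (\<forall>a\<in>set ord'. \<forall>b\<in>set ord'. warr s' 3 (\<sigma> * (n * n) + (a * n + b)) =
         fw w (set (drop (iarr st0 1 \<sigma>) ord)) a b)) &
     (\<forall>q. q < \<sigma> * (n * n) \<or> \<sigma> * (n * n) + n * n <= q --> warr s' 3 q = warr st 3 q))"
proof -
  interpret weights w by (rule w)
  define sb where "sb = \<sigma> * (n * n)"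
  define rr where "rr = iarr st0 1 \<sigma>"
  define F where "F = warr st 3"
  have sbW: "sb + n * n < W" using slotW[OF h] by (simp add: sb_def)
  have lW: "length ord < W" "n < W" using len bounds by simp_all
  have xn: "a * n + b < n * n" if "a < n" "b < n" for a b using that by (rule mult_add_less)
  define s0 where "s0 = set_i 108 (x * n) (set_i 105 rr (set_i 19 sb st))"
  have p0: "pctx s0" by (rule pctx_same[OF p, of "{19,105,108}" "{}" "{}" "{}"]) (auto simp: same_def s0_def)
  define cv where "cv y = min (warr st0 4 (y * n + x)) (colv sb rr F (length ord) y)" for y
  define rv where "rv y = min (warr st0 4 (x * n + y)) (rowv sb rr F (length ord) y)" for y
  define dv where "dv = min 0 (INF j\<in>{rr..<length ord}. warr st0 4 (x * n + ord ! j) + cv (ord ! j))"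
  let ?I1 = "%y s1. \<forall>z<y. warr s1 11 z = cv z & warr s1 12 z = rv z"
  have l1: "wp W (For 103 0 extend_entry) s0 (%t s'. t <= n * (n * 22 + 20 + 2) + 2 & ?I1 n s' & ireg s' 103 = n &
     loop_frame 103 extend_entry s0 s')"
  proof (rule wp_For_const[where I = ?I1])
    fix y s1 assume y: "y < n" "?I1 y s1" "ireg s1 103 = y"
      and sm: "loop_frame 103 extend_entry s0 s1"
    have p1: "pctx s1" by (rule pctx_same[OF p0 sm]) auto
    have e: "ireg s1 19 = sb" "ireg s1 105 = rr" "ireg s1 108 = x * n" "warr s1 3 = F"
      using sm by (auto simp: same_def s0_def F_def)
    show "wp W extend_entry s1 (%t s2. t <= n * 22 + 20 & ?I1 (Suc y) (set_i 103 (Suc y) s2))"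
      by (rule wp_mono[OF wp_extend_entry[OF p1 e(1-3) y(3) sbW y(1)]])
        (use y(2) in \<open>auto simp: less_Suc_eq e(4) cv_def rv_def\<close>)
  qed (use lW pctxD[OF p0] in auto)
  let ?Q = "%t s'. t <= n * (n * 22 + 50) + 40 & ireg s' 19 = sb & ireg s' 105 = rr &
      (\<forall>a<n. \<forall>b<n. warr s' 3 (sb + (a * n + b)) = (if a = x & b = x then dv else if b = x then cv a else if a = x then rv b
         else F (sb + (a * n + b)))) &
      (\<forall>q. q < sb \<or> sb + n * n <= q --> warr s' 3 q = F q)"
  have main: "wp W (For 103 0 extend_entry ;; WConst 20 0 ;; For 110 10 extend_diag ;; For 103 0 write_entry ;;
    IOp Add 107 108 100 ;; IOp Add 107 107 19 ;; WStore 3 107 20) s0 ?Q"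
    unfolding wp_Seq[of _ "For 103 0 extend_entry"]
  proof (rule wp_mono[OF l1])
    fix t1 s1 assume a1: "t1 <= n * (n * 22 + 20 + 2) + 2 & ?I1 n s1 & ireg s1 103 = n &
     loop_frame 103 extend_entry s0 s1"
    define s1' where "s1' = set_w 20 0 s1"
    have p1: "pctx s1'" by (rule pctx_same[OF p0, of "insert 103 (iw extend_entry)" "insert 20 (ww extend_entry)" "{}" "{11,12}"])
        (use a1 in \<open>auto simp: same_def s1'_def\<close>)
    have e1: "ireg s1' 19 = sb" "ireg s1' 105 = rr" "ireg s1' 108 = x * n" "warr s1' 3 = F"
       "\<And>z. z < n ==> warr s1' 11 z = cv z" "\<And>z. z < n ==> warr s1' 12 z = rv z"
      using a1 by (auto simp: same_def s0_def F_def s1'_def)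
    let ?I2 = "%J s2. wreg s2 20 = min 0 (INF j\<in>{rr..<J}. warr st0 4 (x * n + ord ! j) + cv (ord ! j))"
    have l2: "wp W (For 110 10 extend_diag) s1' (%t s'. t <= length ord * (10 + 2) + 2 & ?I2 (length ord) s' & ireg s' 110 = length ord &
     loop_frame 110 extend_diag s1' s')"
    proof (rule wp_For_const[where I = ?I2])
      fix j s2 assume j: "j < length ord" "?I2 j s2" "ireg s2 110 = j"
        and sm: "loop_frame 110 extend_diag s1' s2"
      have p2: "pctx s2" by (rule pctx_same[OF p1 sm]) auto
      have u: "ord ! j < n" using ord_n j by simp
      have e: "ireg s2 105 = rr" "ireg s2 108 = x * n" "warr s2 11 (ord ! j) = cv (ord ! j)"
        using sm e1 u by (auto simp: same_def)
      have ws: "x * n + ord ! j < W" using xn[OF x(1) u] sbW by linarith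
      show "wp W extend_diag s2 (%t s2. t <= 10 & ?I2 (Suc j) (set_i 110 (Suc j) s2))"
      proof (cases "j < rr")
        case True
        then show ?thesis unfolding extend_diag_def using j(2)
          by (simp add: j(3) e INF_atLeastLessThan_Suc)
      next
        case False
        then have rj: "rr <= j" by simp
        show ?thesis unfolding extend_diag_def INF_atLeastLessThan_Suc(1)[OF rj] using False j(2)
          by (simp add: j(3) e pctxD[OF p2] pctxD(4)[OF p2 j(1)] ws min.assoc)
      qed
    next
      show "?I2 0 (set_i 110 0 s1')" by (simp add: s1'_def top_ereal_def)
    qed (use lW pctxD[OF p1] in auto)
    have "wp W (For 110 10 extend_diag ;; For 103 0 write_entry ;; IOp Add 107 108 100 ;; IOp Add 107 107 19 ;; WStore 3 107 20) s1'
      (%t2 s'. ?Q (t1 + (1 + t2)) s')"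
      unfolding wp_Seq[of _ "For 110 10 extend_diag"]
    proof (rule wp_mono[OF l2])
      fix t2 s2 assume a2: "t2 <= length ord * (10 + 2) + 2 & ?I2 (length ord) s2 & ireg s2 110 = length ord &
         loop_frame 110 extend_diag s1' s2"
      have p2: "pctx s2" by (rule pctx_same[OF p1 conjunct2[OF conjunct2[OF conjunct2[OF a2]]]]) auto
      have e2: "ireg s2 19 = sb" "ireg s2 105 = rr" "ireg s2 108 = x * n" "warr s2 3 = F" "wreg s2 20 = dv"
         "\<And>z. z < n ==> warr s2 11 z = cv z" "\<And>z. z < n ==> warr s2 12 z = rv z"
        using a2 e1 by (auto simp: same_def dv_def)
      \<comment> \<open>The diagonal entry is left open: round \<open>y = x\<close> stores a
        provisional value there, and the last store of the program replaces it.\<close>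
      let ?I3 = "%y s3. (\<forall>a<n. \<forall>b<n. warr s3 3 (sb + (a * n + b)) = (if a = x & b = x then warr s3 3 (sb + (x * n + x))
          else if b = x & a < y then cv a else if a = x & b < y then rv b
         else F (sb + (a * n + b)))) & (\<forall>q. q < sb \<or> sb + n * n <= q --> warr s3 3 q = F q)"
      have l3: "wp W (For 103 0 write_entry) s2 (%t s'. t <= n * (9 + 2) + 2 & ?I3 n s' & ireg s' 103 = n &
         loop_frame 103 write_entry s2 s')"
      proof (rule wp_For_const[where I = ?I3])
        fix y s3 assume y: "y < n" "?I3 y s3" "ireg s3 103 = y"
          and sm: "loop_frame 103 write_entry s2 s3"
        have p3: "pctx s3" by (rule pctx_same[OF p2 sm]) auto
        have e: "ireg s3 19 = sb" "ireg s3 108 = x * n" "warr s3 11 y = cv y" "warr s3 12 y = rv y"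
          using sm e2 y by (auto simp: same_def)
        have ws: "y * n < W" "y * n + x < W" "y * n + x + sb < W" "x * n + y < W" "x * n + y + sb < W"
          using xn[OF x(1) y(1)] xn[OF y(1) x(1)] sbW by linarith+
        have inj: "sb + (a * n + b) = c * n + e + sb \<longleftrightarrow> a = c & b = e" if "b < n" "e < n" for a b c e
          using mult_add_inj[of a n b c e] that by auto
        have out: "q \<noteq> a * n + b + sb" if "q < sb \<or> sb + n * n <= q" "a < n" "b < n" for q a b
          using xn[of a b] that by linarith
        have "wp W write_entry s3 (%t s4. t <= 9 & warr s4 3 = (warr s3 3)(y * n + x + sb := cv y, x * n + y + sb := rv y))"
          unfolding write_entry_def by (simp add: y(3) e pctxD[OF p3] ws)
        then show "wp W write_entry s3 (%t s4. t <= 9 & ?I3 (Suc y) (set_i 103 (Suc y) s4))"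
        proof (rule wp_mono, elim conjE, intro conjI)
          fix t4 and s4 :: state assume s4: "warr s4 3 = (warr s3 3)(y * n + x + sb := cv y, x * n + y + sb := rv y)"
          have y2: "\<And>a b. a < n ==> b < n ==> warr s3 3 (sb + (a * n + b)) = (if a = x & b = x then warr s3 3 (sb + (x * n + x))
            else if b = x & a < y then cv a else if a = x & b < y then rv b else F (sb + (a * n + b)))"
            using y(2) by blast
          show "\<forall>a<n. \<forall>b<n. warr (set_i 103 (Suc y) s4) 3 (sb + (a * n + b)) = (if a = x & b = x then warr (set_i 103 (Suc y) s4) 3 (sb + (x * n + x))
            else if b = x & a < Suc y then cv a else if a = x & b < Suc y then rv b else F (sb + (a * n + b)))"
          proof (intro allI impI)
            fix a b assume ab: "a < n" "b < n"
            show "warr (set_i 103 (Suc y) s4) 3 (sb + (a * n + b)) = (if a = x & b = x then warr (set_i 103 (Suc y) s4) 3 (sb + (x * n + x))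
            else if b = x & a < Suc y then cv a else if a = x & b < Suc y then rv b else F (sb + (a * n + b)))"
              using y2[OF ab] ab x(1) y(1) by (auto simp: s4 inj less_Suc_eq)
          qed
          show "\<forall>q. q < sb \<or> sb + n * n <= q --> warr (set_i 103 (Suc y) s4) 3 q = F q"
            using y(2) out x(1) y(1) by (auto simp: s4)
        qed
      qed (use lW pctxD[OF p2] e2 in auto)
      have ws: "x * n + x < W" "x * n + x + sb < W" using xn[OF x(1) x(1)] sbW by linarith+
      have ln: "length ord * 12 <= n * 12" using len by simp
      show "wp W (For 103 0 write_entry ;; IOp Add 107 108 100 ;; IOp Add 107 107 19 ;; WStore 3 107 20) s2
        (%t2' s'. ?Q (t1 + (1 + (t2 + t2'))) s')"
        unfolding wp_Seq[of _ "For 103 0 write_entry"]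
      proof (rule wp_mono[OF l3])
        fix t3 s3 assume a3: "t3 <= n * (9 + 2) + 2 & ?I3 n s3 & ireg s3 103 = n &
           loop_frame 103 write_entry s2 s3"
        have e3: "ireg s3 19 = sb" "ireg s3 105 = rr" "ireg s3 108 = x * n" "ireg s3 100 = x" "wreg s3 20 = dv"
          using a3 e2 pctxD[OF p2] by (auto simp: same_def)
        have inj: "sb + (a * n + b) = c * n + e + sb \<longleftrightarrow> a = c & b = e" if "b < n" "e < n" for a b c e
          using mult_add_inj[of a n b c e] that by auto
        have out: "q \<noteq> a * n + b + sb" if "q < sb \<or> sb + n * n <= q" "a < n" "b < n" for q a b
          using xn[of a b] that by linarith
        have tm: "t1 + (1 + (t2 + (t3 + 3))) <= n * (n * 22 + 50) + 40"
          using a1 a2 a3 ln by (auto simp: algebra_simps)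
        show "wp W (IOp Add 107 108 100 ;; IOp Add 107 107 19 ;; WStore 3 107 20) s3 (%t2' s'. ?Q (t1 + (1 + (t2 + (t3 + t2')))) s')"
          using tm a3 ws out x(1) by (simp add: e3 inj)
      qed
    qed
    then show "wp W (WConst 20 0 ;; For 110 10 extend_diag ;; For 103 0 write_entry ;;
      IOp Add 107 108 100 ;; IOp Add 107 107 19 ;; WStore 3 107 20) s1 (%t2 s'. ?Q (t1 + t2) s')"
      unfolding wp_Seq[of _ "WConst 20 0"] by (simp add: s1'_def del: wp_Seq)
  qed
  have fin: "(\<forall>a\<in>set ord'. \<forall>b\<in>set ord'. (if a = x & b = x then dv else if b = x then cv a else if a = x then rv b
         else F (sb + (a * n + b))) = fw w (set (drop rr ord)) a b)" if mt: "matrix w ord st \<sigma> rr"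
  proof (intro ballI)
    fix a b assume ab: "a \<in> set ord'" "b \<in> set ord'"
    let ?A = "set (drop rr ord)"
    have Fm: "F (sb + (a * n + b)) = fw w ?A a b" if "a \<in> set ord" "b \<in> set ord" for a b
      using mt that by (simp add: matrix_def F_def sb_def)
    have Asub: "u \<in> set ord" if "u \<in> ?A" for u using that by (rule in_set_dropD)
    have cvf: "cv a = fw w ?A a x" if a: "a \<in> set ord" for a
    proof -
      have "colv sb rr F (length ord) a = (INF u\<in>?A. fw w ?A a u + w u x)"
        unfolding colv_def set_drop_conv image_image
        by (intro INF_cong refl) (use Fm a w_x in \<open>auto simp flip: set_drop_conv\<close>)
      moreover have "a \<noteq> x" using a x by auto
      ultimately show ?thesis unfolding cv_def using fw_last_edge[of a x ?A] w_x(2)[OF a] by simp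
    qed
    have rvf: "rv b = fw w ?A x b" if b: "b \<in> set ord" for b
    proof -
      have "rowv sb rr F (length ord) b = (INF u\<in>?A. w x u + fw w ?A u b)"
        unfolding rowv_def set_drop_conv image_image
        by (intro INF_cong refl) (use Fm b w_x in \<open>auto simp flip: set_drop_conv\<close>)
      moreover have "x \<noteq> b" using b x by auto
      ultimately show ?thesis unfolding rv_def using fw_first_edge[of ?A x b] w_x(2)[OF b] by simp
    qed
    have dvf: "dv = fw w ?A x x"
    proof -
      have "(INF j\<in>{rr..<length ord}. warr st0 4 (x * n + ord ! j) + cv (ord ! j)) = (INF u\<in>?A. w x u + fw w ?A u x)"
        unfolding set_drop_conv image_image
        by (intro INF_cong refl) (use cvf w_x in \<open>auto simp flip: set_drop_conv\<close>)
      then show ?thesis unfolding dv_def fw_first_edge[of ?A x x] by (simp add: w_x)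
    qed
    show "(if a = x & b = x then dv else if b = x then cv a else if a = x then rv b
         else F (sb + (a * n + b))) = fw w ?A a b"
      using ab Fm cvf rvf dvf by (auto simp: set_ord')
  qed
  have ws: "\<sigma> * (n * n) < W" "x * n < W" using slotW(2)[OF h] xn[OF x(1) n_pos] sbW by linarith+
  have subs: "a < n" if "a \<in> set ord'" for a using that dat x by (auto simp: set_ord' data_def)
  have rre: "iarr st (Suc 0) \<sigma> = rr" using pctxD(5)[OF p] by (simp add: rr_def)
  have "wp W extend st (%t s'. ?Q (t - 3) s' & 3 <= t)"
    unfolding extend_def
    apply (simp only: wp_Seq[of _ "IOp Mul 19 102 16"] wp_Seq[of _ "ILoad 105 1 102"] wp_Seq[of _ "IOp Mul 108 100 0"] wp_atomic)
    apply (simp add: r gregsD[OF pctxD(1)[OF p]] pctxD[OF p] rre ws[folded sb_def] flip: sb_def s0_def del: wp_Seq)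
    apply (rule wp_mono[OF main])
    apply simp
    done
  then show ?thesis
  proof (rule wp_mono)
    fix t1 s1 assume q: "?Q (t1 - 3) s1 & 3 <= t1"
    show "t1 <= n * (n * 22 + 50) + 50 & ireg s1 19 = \<sigma> * (n * n) & ireg s1 105 = iarr st0 1 \<sigma> &
     (matrix w ord st \<sigma> (iarr st0 1 \<sigma>) --> (\<forall>a\<in>set ord'. \<forall>b\<in>set ord'. warr s1 3 (\<sigma> * (n * n) + (a * n + b)) =
         fw w (set (drop (iarr st0 1 \<sigma>) ord)) a b)) &
     (\<forall>q. q < \<sigma> * (n * n) \<or> \<sigma> * (n * n) + n * n <= q --> warr s1 3 q = warr st 3 q)"
    proof (intro conjI impI)
      assume mt: "matrix w ord st \<sigma> (iarr st0 1 \<sigma>)"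
      show "\<forall>a\<in>set ord'. \<forall>b\<in>set ord'. warr s1 3 (\<sigma> * (n * n) + (a * n + b)) = fw w (set (drop (iarr st0 1 \<sigma>) ord)) a b"
        using q fin mt subs unfolding sb_def[symmetric] rr_def[symmetric] by simp
    qed (use q in \<open>auto simp: sb_def rr_def F_def\<close>)
  qed
qed

end

context pebbles
begin

definition BT :: nat where "BT = batch_time n m K lg d + 3"

definition push_time :: nat where
  "push_time = NS * (n * (n * 22 + 50) + 72 + BT) + n * 30 + 60"

lemma gregs_regs: "gregs st ==> regs st" by (simp add: gregs_def)

lemma wp_batch':
  assumes w: "weights w" and r: "regs st" "ireg st 19 = \<sigma> * (n * n)" "ireg st 20 = s" "\<And>b. b < s ==> iarr st 3 b = Z b"
    and h: "s <= d" "\<sigma> < NS" "T \<subseteq> {..<n}" "\<And>b. b < s ==> T \<noteq> {} ==> Z b \<in> T" "\<And>b. b < s ==> Z b < n"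
    and F: "\<And>x y. x \<in> T ==> y \<in> T ==> warr st 3 (\<sigma> * (n * n) + (x * n + y)) = fw w V x y"
  shows "wp W batch st (%t s'. t <= BT &
     (\<forall>x\<in>T. \<forall>y\<in>T. warr s' 3 (\<sigma> * (n * n) + (x * n + y)) = fw w (V \<union> Z ` {..<s}) x y) &
     (\<forall>q. q < \<sigma> * (n * n) \<or> \<sigma> * (n * n) + n * n <= q --> warr s' 3 q = warr st 3 q))"
  by (rule wp_mono[OF wp_batch[OF w r h(1) slotW(1)[OF h(2)] h(3-5) F]])
    (use batch_time_mono[OF h(1), of n m K lg] in \<open>auto simp: BT_def\<close>)

end

context push_call
begin

lemma wp_push_slot:
  assumes p: "pctx st" and r: "ireg st 102 = \<sigma>" "ireg st 101 = index" and h: "\<sigma> < NS"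
  shows "wp W push_slot st (%t s'. t <= n * (n * 22 + 50) + 70 + BT &
     (matrix w ord st \<sigma> (iarr st0 1 \<sigma>) --> matrix w ord' s' \<sigma> (iarr st0 1 \<sigma>)) &
     (\<forall>q. q < \<sigma> * (n * n) \<or> \<sigma> * (n * n) + n * n <= q --> warr s' 3 q = warr st 3 q))"
  unfolding push_slot_def wp_Seq[of _ extend]
proof (rule wp_frame[OF wp_extend[OF p r(1) h]])
  fix t1 s1
  assume a1: "t1 <= n * (n * 22 + 50) + 50 & ireg s1 19 = \<sigma> * (n * n) & ireg s1 105 = iarr st0 1 \<sigma> &
     (matrix w ord st \<sigma> (iarr st0 1 \<sigma>) --> (\<forall>a\<in>set ord'. \<forall>b\<in>set ord'. warr s1 3 (\<sigma> * (n * n) + (a * n + b)) =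
         fw w (set (drop (iarr st0 1 \<sigma>) ord)) a b)) &
     (\<forall>q. q < \<sigma> * (n * n) \<or> \<sigma> * (n * n) + n * n <= q --> warr s1 3 q = warr st 3 q)"
    and fr: "frame extend st s1"
  define rr where "rr = iarr st0 1 \<sigma>"
  have p1: "pctx s1" by (rule pctx_same[OF p fr]) auto
  have e1: "ireg s1 19 = \<sigma> * (n * n)" "ireg s1 105 = rr" "ireg s1 101 = index" "ireg s1 10 = length ord" "ireg s1 100 = x"
    "ireg s1 2 = 1" "ireg s1 3 = 0"
    using a1 fr r pctxD[OF p1] by (auto simp: same_def rr_def)
  have W1: "0 < W" "Suc 0 < W" using bounds by simp_all
  \<comment> \<open>A slot of unspecified contents is treated with empty \<open>T\<close>.\<close>
  define T where "T = (if matrix w ord st \<sigma> rr then set ord' else {})"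
  have Tn: "T \<subseteq> {..<n}" using dat x by (auto simp: T_def set_ord' data_def)
  have F1: "warr s1 3 (\<sigma> * (n * n) + (a * n + b)) = fw w (set (drop rr ord)) a b" if "a \<in> T" "b \<in> T" for a b
    using a1 that by (auto simp: T_def rr_def split: if_splits)
  \<comment> \<open>The branches of the program differ only in the batch, which is empty or consists
    of one vertex \<open>z\<close>.\<close>
  have fin: "wp W batch s2 (%t s'. t <= BT & (matrix w ord st \<sigma> rr --> matrix w ord' s' \<sigma> rr) &
       (\<forall>q. q < \<sigma> * (n * n) \<or> \<sigma> * (n * n) + n * n <= q --> warr s' 3 q = warr st 3 q))"
    if s2: "same {20, 104} {} {3} {} s1 s2" "ireg s2 20 = s" "\<And>b. b < s ==> iarr s2 3 b = z" "s <= 1" "s = 1 ==> z \<in> set ord'"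
      "set (drop rr ord') = set (drop rr ord) \<union> (%_. z) ` {..<s}" for s2 s z
  proof -
    have p2: "pctx s2" by (rule pctx_same[OF p1 s2(1)]) auto
    have e2: "ireg s2 19 = \<sigma> * (n * n)" "warr s2 = warr s1" using s2(1) e1 by (auto simp: same_def)
    have zn: "z < n" if "0 < s" using s2(4,5) that dat x by (auto simp: set_ord' data_def)
    have "wp W batch s2 (%t s'. t <= BT &
     (\<forall>x\<in>T. \<forall>y\<in>T. warr s' 3 (\<sigma> * (n * n) + (x * n + y)) = fw w (set (drop rr ord) \<union> (%_. z) ` {..<s}) x y) &
     (\<forall>q. q < \<sigma> * (n * n) \<or> \<sigma> * (n * n) + n * n <= q --> warr s' 3 q = warr s2 3 q))"
    proof (rule wp_batch'[OF w gregs_regs[OF pctxD(1)[OF p2]] e2(1) s2(2,3) _ h Tn])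
      show "s <= d" using s2(4) d2 by simp
      show "z \<in> T" if "b < s" "T \<noteq> {}" for b using s2(4,5) that by (auto simp: T_def split: if_splits)
      show "z < n" if "b < s" for b using zn that by auto
      show "warr s2 3 (\<sigma> * (n * n) + (a * n + b)) = fw w (set (drop rr ord)) a b" if "a \<in> T" "b \<in> T" for a b
        using F1 that by (simp add: e2)
    qed
    then show ?thesis
      by (rule wp_mono) (use a1 in \<open>auto simp: e2 matrix_def T_def s2(6)\<close>)
  qed
  let ?Q = "%t s'. t1 + t <= n * (n * 22 + 50) + 70 + BT & (matrix w ord st \<sigma> rr --> matrix w ord' s' \<sigma> rr) &
     (\<forall>q. q < \<sigma> * (n * n) \<or> \<sigma> * (n * n) + n * n <= q --> warr s' 3 q = warr st 3 q)"
  have xo: "x \<in> set ord'" by (simp add: set_ord')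
  show "wp W (If (ILess 10 105) (IConst 20 0)
      (If (ILess 101 105) (IOp Sub 104 105 2 ;; ILoad 104 0 104) (IMove 104 100) ;; IStore 3 3 104 ;; IConst 20 1) ;;
    batch) s1 (%t2 s'. t1 + t2 <= n * (n * 22 + 50) + 70 + BT & (matrix w ord st \<sigma> (iarr st0 1 \<sigma>) --> matrix w ord' s' \<sigma> (iarr st0 1 \<sigma>)) &
     (\<forall>q. q < \<sigma> * (n * n) \<or> \<sigma> * (n * n) + n * n <= q --> warr s' 3 q = warr st 3 q))"
    unfolding rr_def[symmetric]
  proof (cases "length ord < rr")
    case True
    have "wp W batch (set_i 20 0 s1) (%t s'. t <= BT & (matrix w ord st \<sigma> rr --> matrix w ord' s' \<sigma> rr) &
       (\<forall>q. q < \<sigma> * (n * n) \<or> \<sigma> * (n * n) + n * n <= q --> warr s' 3 q = warr st 3 q))"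
      by (rule fin[of _ 0]) (use True drop_ord'(3) in \<open>auto simp: same_def\<close>)
    then show "wp W (If (ILess 10 105) (IConst 20 0)
      (If (ILess 101 105) (IOp Sub 104 105 2 ;; ILoad 104 0 104) (IMove 104 100) ;; IStore 3 3 104 ;; IConst 20 1) ;;
      batch) s1 ?Q"
      using True W1 by (simp add: e1) (erule wp_mono, use a1 in auto)
  next
    case False
    show "wp W (If (ILess 10 105) (IConst 20 0)
      (If (ILess 101 105) (IOp Sub 104 105 2 ;; ILoad 104 0 104) (IMove 104 100) ;; IStore 3 3 104 ;; IConst 20 1) ;;
      batch) s1 ?Q"
    proof (cases "index < rr")
      case T2: True
      have lt: "rr - 1 < length ord" using T2 False by simp
      have ia: "iarr s1 0 (rr - Suc 0) = ord ! (rr - Suc 0)" using pctxD(4)[OF p1 lt] by simp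
      have rW: "rr - Suc 0 < W" using lt len bounds by simp
      have "wp W batch (set_i 20 1 (set_i 104 (ord ! (rr - Suc 0)) (set_i 104 (rr - Suc 0) s1)\<lparr>iarr := (iarr s1)(3 := (iarr s1 3)(0 := ord ! (rr - Suc 0)))\<rparr>))
        (%t s'. t <= BT & (matrix w ord st \<sigma> rr --> matrix w ord' s' \<sigma> rr) &
         (\<forall>q. q < \<sigma> * (n * n) \<or> \<sigma> * (n * n) + n * n <= q --> warr s' 3 q = warr st 3 q))"
        by (rule fin[of _ 1 "ord ! (rr - 1)"]) (use drop_ord'(2)[OF T2] False lt in \<open>auto simp: same_def set_ord'\<close>)
      then show ?thesis
        using False T2 W1 rW by (simp add: e1 ia) (erule wp_mono, use a1 in auto)
    next
      case F2: False
      have "wp W batch (set_i 20 1 (set_i 104 x s1\<lparr>iarr := (iarr s1)(3 := (iarr s1 3)(0 := x))\<rparr>))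
        (%t s'. t <= BT & (matrix w ord st \<sigma> rr --> matrix w ord' s' \<sigma> rr) &
         (\<forall>q. q < \<sigma> * (n * n) \<or> \<sigma> * (n * n) + n * n <= q --> warr s' 3 q = warr st 3 q))"
        by (rule fin[of _ 1 x]) (use drop_ord'(1)[of rr] F2 in \<open>auto simp: same_def set_ord'\<close>)
      then show ?thesis
        using False F2 W1 by (simp add: e1) (erule wp_mono, use a1 in auto)
    qed
  qed
qed

lemma wp_push_slots:
  assumes p: "pctx st" and r: "ireg st 101 = index"
  shows "wp W (For 102 14 push_slot) st (%t s'. t <= NS * (n * (n * 22 + 50) + 72 + BT) + 2 &
     (\<forall>\<sigma><NS. matrix w ord st \<sigma> (iarr st0 1 \<sigma>) --> matrix w ord' s' \<sigma> (iarr st0 1 \<sigma>)))"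
proof -
  note ms = push_slot_mods
  \<comment> \<open>The second part keeps the slots not yet reached as they were, so that their
    premise still holds when their turn comes.\<close>
  let ?I = "%y s1. (\<forall>\<sigma><y. matrix w ord st \<sigma> (iarr st0 1 \<sigma>) --> matrix w ord' s1 \<sigma> (iarr st0 1 \<sigma>)) &
     (\<forall>q \<ge> y * (n * n). warr s1 3 q = warr st 3 q)"
  have nin: "a \<notin> iw push_slot" if "a < 19 \<or> a \<in> {100, 101, 102}" for a
    using ms(1) that by (auto simp: push_regs_def)
  have sub: "set ord' \<subseteq> {..<n}" using dat x by (auto simp: set_ord' data_def)
  have "wp W (For 102 14 push_slot) st (%t s'. t <= NS * (n * (n * 22 + 50) + 70 + BT + 2) + 2 & ?I NS s' & ireg s' 102 = NS &
     loop_frame 102 push_slot st s')"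
  proof (rule wp_For_const[where I = ?I])
    fix y s1 assume y: "y < NS" "?I y s1" "ireg s1 102 = y"
      and sm: "loop_frame 102 push_slot st s1"
    have sm': "same (push_regs - {100, 101}) {10..<25} {3, 5, 6, 7, 8, 9, 10} {3, 6, 8, 9, 10, 11, 12} st s1"
      by (rule same_mono[OF sm]) (use ms in \<open>auto simp: push_regs_def\<close>)
    have p1: "pctx s1" by (rule pctx_same[OF p sm']) (auto simp: push_regs_def)
    have r1: "ireg s1 101 = index" using sm' r by (auto simp: same_def)
    have mt: "matrix w ord s1 y rr" if "matrix w ord st y rr" for rr
      by (rule matrix_cong[OF that]) (use y(2) dat in \<open>auto simp: data_def\<close>)
    show "wp W push_slot s1 (%t s2. t <= n * (n * 22 + 50) + 70 + BT & ?I (Suc y) (set_i 102 (Suc y) s2))"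
    proof (rule wp_mono[OF wp_push_slot[OF p1 y(3) r1 y(1)]], elim conjE, intro conjI)
      fix t2 and s2 :: state
      assume a: "matrix w ord s1 y (iarr st0 1 y) --> matrix w ord' s2 y (iarr st0 1 y)"
        "\<forall>q. q < y * (n * n) \<or> y * (n * n) + n * n <= q --> warr s2 3 q = warr s1 3 q"
      show "\<forall>\<sigma><Suc y. matrix w ord st \<sigma> (iarr st0 1 \<sigma>) --> matrix w ord' (set_i 102 (Suc y) s2) \<sigma> (iarr st0 1 \<sigma>)"
      proof (intro allI impI)
        fix \<sigma> assume s: "\<sigma> < Suc y" "matrix w ord st \<sigma> (iarr st0 1 \<sigma>)"
        show "matrix w ord' (set_i 102 (Suc y) s2) \<sigma> (iarr st0 1 \<sigma>)"
        proof (cases "\<sigma> = y")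
          case True
          then show ?thesis using a(1) mt s by (simp add: matrix_def)
        next
          case False
          then have "matrix w ord' s1 \<sigma> (iarr st0 1 \<sigma>)" using s y(2) by simp
          then show ?thesis
            by (rule matrix_cong) (use sub a(2) slot_disjoint[of y \<sigma>] False in auto)
        qed
      qed
      show "\<forall>q\<ge>Suc y * (n * n). warr (set_i 102 (Suc y) s2) 3 q = warr st 3 q"
        using a(2) y(2) by simp
    qed
  qed (use NSW gregsD[OF pctxD(1)[OF p]] nin in auto)
  then show ?thesis by (rule wp_mono) (auto simp: ac_simps)
qed

lemma wp_shift_order:
  assumes p: "pctx st" and r: "ireg st 101 = index"
  shows "wp W (For 103 10 shift_order) st (%t s'. t <= n * 7 + 2 &
     (\<forall>j<length ord. iarr s' 11 (if j < index then j else Suc j) = ord ! j))"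
proof -
  have lW: "length ord < W" "n < W" using len bounds by simp_all
  have "wp W (For 103 10 shift_order) st (%t s'. t <= length ord * (5 + 2) + 2 &
     (\<forall>j<length ord. iarr s' 11 (if j < index then j else Suc j) = ord ! j) & ireg s' 103 = length ord &
     loop_frame 103 shift_order st s')"
  proof (rule wp_For_const[where I = "%k s1. \<forall>j<k. iarr s1 11 (if j < index then j else Suc j) = ord ! j"])
    fix k s1 assume k: "k < length ord" "\<forall>j<k. iarr s1 11 (if j < index then j else Suc j) = ord ! j" "ireg s1 103 = k"
      and sm: "loop_frame 103 shift_order st s1"
    have p1: "pctx s1" by (rule pctx_same[OF p sm]) auto
    have i1: "ireg s1 101 = index" using sm r by (simp add: same_def)
    have kW: "Suc k < W" using k len lW by simp
    have k2: "iarr s1 11 j = ord ! j" if "j < k" "k < index" for j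
      using k(2)[rule_format, OF that(1)] that by simp
    show "wp W shift_order s1 (%t s2. t <= 5 & (\<forall>j<Suc k. iarr (set_i 103 (Suc k) s2) 11 (if j < index then j else Suc j) = ord ! j))"
      unfolding shift_order_def using k(2) kW k2
      by (simp add: k(3) i1 pctxD[OF p1] pctxD(4)[OF p1 k(1)] less_Suc_eq)
  qed (use lW pctxD[OF p] r in auto)
  then show ?thesis by (rule wp_mono) (use len mult_le_mono1[of "length ord" n 7] in auto)
qed

theorem wp_push:
  assumes p: "pctx st0"
  shows "wp W push st0 (%t s'. t <= push_time & data w ord' s' & (\<forall>\<sigma><NS. \<forall>r. good w ord st0 \<sigma> r --> good w ord' s' \<sigma> r))"
proof -
  have lW: "length ord < W" "n < W" "Suc (length ord) < W" "0 < W" using len bounds by simp_all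
  define s0 where "s0 = set_i 101 0 (set_w 21 (warr st0 5 x) st0)"
  have p0: "pctx s0" by (rule pctx_same[OF p, of "{101}" "{21}" "{}" "{}"]) (auto simp: same_def s0_def)
  have e0: "warr s0 = warr st0" by (simp add: s0_def)
  note pm = push_slot_mods
  have "wp W (For 103 10 locate ;; For 102 14 push_slot ;; For 103 10 shift_order ;; IStore 11 101 100 ;; IOp Add 10 10 2 ;;
      For 103 10 copy_order) s0 (%t s'. t + 2 <= push_time & data w ord' s' & (\<forall>\<sigma><NS. \<forall>r. good w ord st0 \<sigma> r --> good w ord' s' \<sigma> r))"
    unfolding wp_Seq[of _ "For 103 10 locate"] wp_Seq[of _ "For 102 14 push_slot"] wp_Seq[of _ "For 103 10 shift_order"]
  proof (rule wp_frame[OF wp_locate[OF p0]])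
    show "wreg s0 21 = warr st0 5 x" "ireg s0 101 = 0" by (simp_all add: s0_def)
    fix t1 s1 assume a1: "t1 <= n * 7 + 2 & ireg s1 101 = index" and f1: "frame (For 103 10 locate) s0 s1"
    have p1: "pctx s1" by (rule pctx_same[OF p0 f1]) auto
    have e1: "warr s1 = warr st0" using f1 by (auto simp: same_def e0)
    show "wp W (For 102 14 push_slot) s1 (%t1' s1. wp W (For 103 10 shift_order) s1 (%t1a s1.
      wp W (IStore 11 101 100 ;; IOp Add 10 10 2 ;; For 103 10 copy_order) s1 (%t2 s'.
      t1 + (t1' + (t1a + t2)) + 2 <= push_time & data w ord' s' & (\<forall>\<sigma><NS. \<forall>r. good w ord st0 \<sigma> r --> good w ord' s' \<sigma> r))))"
    proof (rule wp_frame[OF wp_push_slots[OF p1 conjunct2[OF a1]]])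
      fix t2 s2 assume a2: "t2 <= NS * (n * (n * 22 + 50) + 72 + BT) + 2 &
         (\<forall>\<sigma><NS. matrix w ord s1 \<sigma> (iarr st0 1 \<sigma>) --> matrix w ord' s2 \<sigma> (iarr st0 1 \<sigma>))" and f2: "frame (For 102 14 push_slot) s1 s2"
      have f2': "same (push_regs - {100, 101}) {10..<25} {3, 5, 6, 7, 8, 9, 10} {3, 6, 8, 9, 10, 11, 12} s1 s2"
        by (rule same_mono[OF f2]) (use pm in \<open>auto simp: push_regs_def\<close>)
      have p2: "pctx s2" by (rule pctx_same[OF p1 f2']) (auto simp: push_regs_def)
      have i2: "ireg s2 101 = index" using a1 f2' by (auto simp: same_def)
      show "wp W (For 103 10 shift_order) s2 (%t1a s1.
        wp W (IStore 11 101 100 ;; IOp Add 10 10 2 ;; For 103 10 copy_order) s1 (%t2' s'.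
        t1 + (t2 + (t1a + t2')) + 2 <= push_time & data w ord' s' & (\<forall>\<sigma><NS. \<forall>r. good w ord st0 \<sigma> r --> good w ord' s' \<sigma> r)))"
      proof (rule wp_frame[OF wp_shift_order[OF p2 i2]])
        fix t3 s3 assume a3: "t3 <= n * 7 + 2 & (\<forall>j<length ord. iarr s3 11 (if j < index then j else Suc j) = ord ! j)"
          and f3: "frame (For 103 10 shift_order) s2 s3"
        have p3: "pctx s3" by (rule pctx_same[OF p2 f3]) auto
        have e3: "ireg s3 101 = index" "warr s3 = warr s2" using i2 f3 by (auto simp: same_def)
        define s3' where "s3' = set_i 10 (Suc (length ord)) (s3\<lparr>iarr := (iarr s3)(11 := (iarr s3 11)(index := x))\<rparr>)"
        have o3: "iarr s3' 11 j = ord' ! j" if "j < Suc (length ord)" for j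
        proof -
          have a3': "iarr s3 11 (if j < index then j else Suc j) = ord ! j" if "j < length ord" for j
            using a3 that by blast
          consider "j < index" | "j = index" | "index < j" by linarith
          then show ?thesis
          proof cases
            case 1
            then show ?thesis using a3'[of j] index_le that by (simp add: s3'_def nth_ord')
          next
            case 3
            then obtain i where "j = Suc i" "index <= i" by (cases j) auto
            then show ?thesis using a3'[of i] that by (simp add: s3'_def nth_ord')
          qed (use that in \<open>simp add: s3'_def nth_ord'\<close>)
        qed
        have e3': "ireg s3' 2 = 1" "ireg s3' 10 = Suc (length ord)" "iarr s3' 1 = iarr st0 1" "warr s3' = warr s2"
          using pctxD[OF p3] e3 by (auto simp: s3'_def)
        let ?I = "%k s. \<forall>j<k. iarr s 0 j = ord' ! j"
        have "wp W (For 103 10 copy_order) s3' (%t s'. t <= Suc (length ord) * (2 + 2) + 2 & ?I (Suc (length ord)) s' &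
            ireg s' 103 = Suc (length ord) & loop_frame 103 copy_order s3' s')"
        proof (rule wp_For_const[where I = ?I])
          fix k s4 assume k: "k < Suc (length ord)" "?I k s4" "ireg s4 103 = k"
            and sm: "loop_frame 103 copy_order s3' s4"
          have "iarr s4 11 k = ord' ! k" using sm o3[OF k(1)] by (simp add: same_def)
          then show "wp W copy_order s4 (%t s5. t <= 2 & ?I (Suc k) (set_i 103 (Suc k) s5))"
            unfolding copy_order_def using k by (simp add: less_Suc_eq)
        qed (use e3' lW in auto)
        then have "wp W (For 103 10 copy_order) s3' (%t s'. t1 + (t2 + (t3 + (2 + t))) + 2 <= push_time &
           data w ord' s' & (\<forall>\<sigma><NS. \<forall>r. good w ord st0 \<sigma> r --> good w ord' s' \<sigma> r))"
        proof (rule wp_mono)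
          fix t4 s4 assume a4: "t4 <= Suc (length ord) * (2 + 2) + 2 & ?I (Suc (length ord)) s4 &
            ireg s4 103 = Suc (length ord) & loop_frame 103 copy_order s3' s4"
          have e4: "warr s4 = warr s2" "iarr s4 1 = iarr st0 1" "ireg s4 10 = Suc (length ord)" "\<And>j. j < Suc (length ord) ==> iarr s4 0 j = ord' ! j"
            using a4 e3' by (auto simp: same_def)
          have tm: "t1 + (t2 + (t3 + (2 + t4))) + 2 <= push_time"
            using a1 a2 a3 a4 len unfolding push_time_def by (auto simp del: add_Suc_right)
          have wd: "warr s4 4 (a * n + b) = w a b" if "a \<in> set ord'" "b \<in> set ord'" for a b
            using that dat w_x pctxD[OF p2] wxx by (auto simp: e4 set_ord' data_def)
          have dat': "data w ord' s4"
            unfolding data_def using e4 wd distinct_ord' sorted_ord' length_ord' dat x pctxD[OF p2]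
            by (auto simp: set_ord' data_def)
          have "good w ord' s4 \<sigma> r" if "good w ord st0 \<sigma> r" "\<sigma> < NS" for \<sigma> r
            using that a2 e4(2) by (auto simp: good_def matrix_def e4(1) e1)
          then show "t1 + (t2 + (t3 + (2 + t4))) + 2 <= push_time & data w ord' s4 & (\<forall>\<sigma><NS. \<forall>r. good w ord st0 \<sigma> r --> good w ord' s4 \<sigma> r)"
            using tm dat' by blast
        qed
        then show "wp W (IStore 11 101 100 ;; IOp Add 10 10 2 ;; For 103 10 copy_order) s3 (%t2' s'.
          t1 + (t2 + (t3 + t2')) + 2 <= push_time & data w ord' s' & (\<forall>\<sigma><NS. \<forall>r. good w ord st0 \<sigma> r --> good w ord' s' \<sigma> r))"
          using lW by (simp add: pctxD[OF p3] e3 s3'_def)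
      qed
    qed
  qed
  then show ?thesis
    unfolding push_def wp_Seq[of _ "WLoad 21 5 100"] wp_Seq[of _ "IConst 101 0"]
    using lW by (simp add: pctxD(3)[OF p] s0_def del: wp_Seq)
qed

end

section \<open>Moving a matrix to a smaller rank\<close>

definition copy_cell :: com where
  "copy_cell = IOp Add 164 161 163 ;; WLoad 20 3 164 ;; IOp Add 164 162 163 ;; WStore 3 164 20"

definition copy_matrix :: "nat => nat => com" where
  "copy_matrix a b = IOp Mul 161 a 16 ;; IOp Mul 162 b 16 ;; For 163 16 copy_cell"

definition place :: com where
  "place = IOp Mod 159 147 158 ;; If (IEq 159 3)
    (IOp Div 160 147 158 ;; IOp Mod 160 160 17 ;; IOp Add 160 160 144 ;; copy_matrix 145 160 ;;
     ILoad 153 1 145 ;; IStore 1 160 153) Skip"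

text \<open>The source is a buffer slot of the next level, whose spacing is one phase
  \<open>L\<close> of this level. It lies two phases beyond the start of the current tick, of which
  \<open>e mod d\<close> deletions are already over; hence the correction of the rank.\<close>

definition restart :: com where
  "restart = IConst 149 2 ;; IOp Div 148 141 142 ;; IOp Add 148 148 149 ;; IOp Mod 148 148 17 ;; IOp Add 148 148 144 ;;
    IOp Add 148 148 18 ;; copy_matrix 148 145 ;; IOp Mul 150 142 143 ;; IOp Add 150 150 150 ;; IOp Mod 151 8 5 ;;
    IOp Sub 150 150 151 ;; IStore 1 145 150"

definition load_elem :: com where
  "load_elem = IOp Add 157 154 156 ;; ILoad 157 0 157 ;; IStore 3 156 157"

text \<open>Both ends of the interval of ranks are cut off at the length of the order, so that
  beyond it the batch shrinks, possibly to nothing.\<close>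

definition advance :: com where
  "advance = ILoad 152 1 145 ;; IOp Sub 153 152 143 ;; IStore 1 145 153 ;;
    IMove 154 153 ;; If (ILess 10 154) (IMove 154 10) Skip ;; IMove 155 152 ;; If (ILess 10 155) (IMove 155 10) Skip ;;
    IOp Sub 20 155 154 ;; For 156 20 load_elem ;; IOp Mul 19 145 16 ;; batch"

text \<open>The position in register 147 is computed from the clock \<open>\<tau>\<close>, so
  walkers need no state apart from matrix and rank. After a restart the walker stands on a multiple
  of the spacing, so its first position is placed before it moves.\<close>

definition step :: com where
  "step = IOp Mul 144 140 18 ;; IOp Add 145 144 17 ;; IOp Div 158 142 5 ;;
    IOp Div 147 141 142 ;; IOp Add 147 147 2 ;; IOp Mul 147 147 142 ;; IOp Add 147 147 147 ;; IOp Sub 147 147 141 ;;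
    IOp Mod 146 141 142 ;; If (IEq 146 3) (restart ;; place) Skip ;;
    advance ;; IOp Sub 147 147 2 ;; place"

lemma step_mods [simp]:
  "iw copy_cell = {164}" "ww copy_cell = {20}" "iaw copy_cell = {}" "waw copy_cell = {3}"
  "iw (copy_matrix a b) = {161, 162, 163, 164}" "ww (copy_matrix a b) = {20}" "iaw (copy_matrix a b) = {}" "waw (copy_matrix a b) = {3}"
  "iw place = {153, 159, 160, 161, 162, 163, 164}" "ww place = {20}" "iaw place = {1}" "waw place = {3}"
  "iw restart = {148, 149, 150, 151, 161, 162, 163, 164}" "ww restart = {20}" "iaw restart = {1}" "waw restart = {3}"
  "iw load_elem = {157}" "ww load_elem = {}" "iaw load_elem = {3}" "waw load_elem = {}"
  by (auto simp: copy_cell_def copy_matrix_def place_def restart_def load_elem_def)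

definition step_regs :: "nat set" where
  "step_regs = {19, 20, 21} \<union> {40..<76} \<union> {144..<165}"

lemma advance_mods:
  "iw advance \<subseteq> {19, 20, 21} \<union> {40..<76} \<union> {152..<158}" "ww advance \<subseteq> {10, 11, 12, 13, 20}"
  "iaw advance \<subseteq> {1, 3, 5, 6, 7, 8, 9, 10}" "waw advance \<subseteq> {3, 6, 8, 9, 10}"
  using batch_mods by (auto simp: advance_def)

lemma step_mods':
  "iw step \<subseteq> step_regs" "ww step \<subseteq> {10, 11, 12, 13, 20}"
  "iaw step \<subseteq> {1, 3, 5, 6, 7, 8, 9, 10}" "waw step \<subseteq> {3, 6, 8, 9, 10}"
proof -
  have "{19, 20, 21} \<union> {40..<76} \<union> {152..<158} \<subseteq> step_regs" by (auto simp: step_regs_def)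
  then have "iw advance \<subseteq> step_regs" using advance_mods(1) by (rule subset_trans[rotated])
  moreover have "{144, 145, 146, 147, 148, 149, 150, 151, 153, 158, 159, 160, 161, 162, 163, 164} \<subseteq> step_regs"
    by (simp add: step_regs_def)
  ultimately show "iw step \<subseteq> step_regs" by (simp add: step_def)
qed (use advance_mods in \<open>simp_all add: step_def\<close>)

context pebbles
begin

section \<open>Addresses of slots; copying, restarting and advancing matrices\<close>

definition dd :: nat where "dd = 2 * d"
definition sd :: nat where "sd = 2 * d + 1"
definition base :: "nat => nat" where "base l = l * sd"
definition slot :: "nat => nat => nat" where "slot l j = base l + j"
definition walker :: "nat => nat" where "walker l = base l + dd"

lemma dd: "2 < dd" "0 < dd" "dd < sd" using d2 by (auto simp: dd_def sd_def)

lemma slot_less: "l <= t + 1 ==> j < dd ==> slot l j < NS"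
  using mult_add_less[of l "t + 2" j sd] by (simp add: slot_def NS_def base_def sd_def dd_def)

lemma walker_less: "l <= t + 1 ==> walker l < NS"
  using mult_add_less[of l "t + 2" dd sd] by (simp add: walker_def NS_def base_def sd_def dd_def)

lemma slot_eq: "j < dd ==> j' < dd ==> slot l j = slot l' j' \<longleftrightarrow> l = l' & j = j'"
  using mult_add_inj[of l sd j l' j'] dd(3) by (auto simp: slot_def base_def)

lemma walker_eq: "walker l = walker l' \<longleftrightarrow> l = l'"
  using mult_add_inj[of l sd dd l' dd] dd(3) by (auto simp: walker_def base_def)

lemma slot_walker: "j < dd ==> slot l j \<noteq> walker l'"
  using mult_add_inj[of l sd j l' dd] dd(3) by (auto simp: slot_def walker_def base_def)

definition keeps :: "nat set => state => state => bool" where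
  "keeps X st st' \<longleftrightarrow> (\<forall>\<sigma><NS. \<sigma> \<notin> X --> iarr st' 1 \<sigma> = iarr st 1 \<sigma> &
     (\<forall>x<n. \<forall>y<n. warr st' 3 (\<sigma> * (n * n) + (x * n + y)) = warr st 3 (\<sigma> * (n * n) + (x * n + y))))"

lemma keeps_good:
  "keeps X st st' ==> good w ord st \<sigma> r ==> set ord \<subseteq> {..<n} ==> \<sigma> < NS ==> \<sigma> \<notin> X ==> good w ord st' \<sigma> r"
  unfolding keeps_def good_def by (auto elim!: matrix_cong)

lemma keeps_trans: "keeps X st st' ==> keeps Y st' st'' ==> keeps (X \<union> Y) st st''"
  by (auto simp: keeps_def)

lemma keeps_mono: "keeps X st st' ==> X \<subseteq> Y ==> keeps Y st st'"
  by (auto simp: keeps_def)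

lemma n2: "n * n < W" using bounds by simp
lemma d_less: "d < W"
proof -
  have "d <= n * d" using n_pos by (cases n) auto
  then show ?thesis using bounds by linarith
qed

lemma wp_copy_matrix:
  assumes g: "gregs st" and r: "ireg st a = \<sigma>" "ireg st b = \<sigma>'" "\<sigma> < NS" "\<sigma>' < NS" "\<sigma> \<noteq> \<sigma>'"
    and ab: "b \<noteq> 161" "a < 164" "b < 161"
  shows "wp W (copy_matrix a b) st (%t s'. t <= n * n * 6 + 4 &
     (\<forall>q<n * n. warr s' 3 (\<sigma>' * (n * n) + q) = warr st 3 (\<sigma> * (n * n) + q)) &
     (\<forall>q. q < \<sigma>' * (n * n) \<or> \<sigma>' * (n * n) + n * n <= q --> warr s' 3 q = warr st 3 q))"
proof -
  let ?s0 = "set_i 162 (\<sigma>' * (n * n)) (set_i 161 (\<sigma> * (n * n)) st)"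
  have disj: "\<sigma>' * (n * n) + n * n <= \<sigma> * (n * n) \<or> \<sigma> * (n * n) + n * n <= \<sigma>' * (n * n)"
  proof (cases "\<sigma>' < \<sigma>")
    case True
    then have "Suc \<sigma>' * (n * n) <= \<sigma> * (n * n)" by (intro mult_le_mono1) simp
    then show ?thesis by simp
  next
    case False
    then have "Suc \<sigma> * (n * n) <= \<sigma>' * (n * n)" using r by (intro mult_le_mono1) simp
    then show ?thesis by simp
  qed
  have "wp W (For 163 16 copy_cell) ?s0 (%t s'. t <= n * n * (4 + 2) + 2 &
    warr s' 3 = (%q. if \<sigma>' * (n * n) <= q & q < \<sigma>' * (n * n) + n * n then warr st 3 (\<sigma> * (n * n) + (q - \<sigma>' * (n * n))) else warr ?s0 3 q) &
    loop_frame 163 copy_cell ?s0 s')"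
  proof (rule wp_fill)
    fix j s1 assume j: "j < n * n" "ireg s1 163 = j"
      and sm: "loop_frame 163 copy_cell ?s0 s1"
      and f: "warr s1 3 = (%q. if \<sigma>' * (n * n) <= q & q < \<sigma>' * (n * n) + j then warr st 3 (\<sigma> * (n * n) + (q - \<sigma>' * (n * n))) else warr ?s0 3 q)"
    have e: "ireg s1 161 = \<sigma> * (n * n)" "ireg s1 162 = \<sigma>' * (n * n)" using sm by (auto simp: same_def)
    have v: "warr s1 3 (\<sigma> * (n * n) + j) = warr st 3 (\<sigma> * (n * n) + j)"
    proof -
      have "\<not> (\<sigma>' * (n * n) <= \<sigma> * (n * n) + j & \<sigma> * (n * n) + j < \<sigma>' * (n * n) + j)" using disj j by linarith
      then show ?thesis by (simp only: f if_False set_i_sel)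
    qed
    have ws: "\<sigma> * (n * n) + j < W" "\<sigma>' * (n * n) + j < W" using slotW(1)[OF r(3)] slotW(1)[OF r(4)] j by linarith+
    show "wp W copy_cell s1 (%t s2. t <= 4 & warr s2 3 = (warr s1 3)(\<sigma>' * (n * n) + j := warr st 3 (\<sigma> * (n * n) + j)))"
      unfolding copy_cell_def by (simp add: j(2) e v ws)
  qed (use n2 gregsD[OF g] in auto)
  then show ?thesis
    unfolding copy_matrix_def
    using slotW(2)[OF r(3)] slotW(2)[OF r(4)] ab by (simp add: r gregsD[OF g]) (erule wp_mono, auto)
qed

definition sctx :: "(nat => nat => ereal) => nat list => nat => nat => state => bool" where
  "sctx w ord l sp st \<longleftrightarrow> gregs st & data w ord st & ireg st 144 = base l & ireg st 145 = walker l & ireg st 158 = sp"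

lemma data_same:
  "data w ord st ==> same X Y A B st st' ==> 10 \<notin> X ==> 0 \<notin> A ==> B \<inter> {4, 5} = {} ==> data w ord st'"
  unfolding data_def same_def by (auto simp: disjoint_iff)

lemma sctx_same:
  "sctx w ord l sp st ==> same X Y A B st st' ==>
    X \<inter> {0, 2, 3, 5, 6, 7, 10, 11, 12, 13, 14, 15, 16, 17, 18, 144, 145, 158} = {} ==> A \<inter> {0, 2} = {} ==> B \<inter> {4, 5} = {} ==>
    sctx w ord l sp st'"
  unfolding sctx_def by (auto intro: gregs_same data_same simp: disjoint_iff) (auto simp: same_def)

lemma sctxD:
  assumes "sctx w ord l sp st"
  shows "gregs st" "data w ord st" "ireg st 144 = base l" "ireg st 145 = walker l" "ireg st 158 = sp"
    "ireg st 2 = 1" "ireg st 3 = 0" "ireg st 16 = n * n" "ireg st 17 = dd" "ireg st 18 = sd" "ireg st 5 = d"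
    "set ord \<subseteq> {..<n}"
  using assms by (auto simp: sctx_def gregs_def regs_def data_def dd_def sd_def)

lemma copied_good:
  assumes "matrix w ord st \<sigma> r" "set ord \<subseteq> {..<n}"
    "\<forall>q<n * n. warr s' 3 (\<sigma>' * (n * n) + q) = warr st 3 (\<sigma> * (n * n) + q)"
  shows "matrix w ord s' \<sigma>' r"
  unfolding matrix_def
proof (intro ballI)
  fix x y assume xy: "x \<in> set ord" "y \<in> set ord"
  then have "x * n + y < n * n" using assms(2) by (intro mult_add_less) auto
  then show "warr s' 3 (\<sigma>' * (n * n) + (x * n + y)) = fw w (set (drop r ord)) x y"
    using assms xy by (auto simp: matrix_def)
qed

lemma outside_keeps:
  assumes "\<forall>q. q < \<sigma>' * (n * n) \<or> \<sigma>' * (n * n) + n * n <= q --> warr s' 3 q = warr st 3 q"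
    "\<And>\<sigma>. \<sigma> \<noteq> \<sigma>' ==> iarr s' 1 \<sigma> = iarr st 1 \<sigma>"
  shows "keeps {\<sigma>'} st s'"
  unfolding keeps_def
proof (intro allI impI conjI)
  fix \<sigma> x y assume "\<sigma> \<notin> {\<sigma>'}" "x < n" "y < n"
  then show "warr s' 3 (\<sigma> * (n * n) + (x * n + y)) = warr st 3 (\<sigma> * (n * n) + (x * n + y))"
    using assms(1) slot_disjoint[of \<sigma>' \<sigma> x y] by blast
qed (use assms(2) in auto)

definition slot_if :: "nat => nat => nat => nat set" where
  "slot_if l sp pos = (if sp dvd pos then {slot l ((pos div sp) mod dd)} else {})"

lemma wp_place:
  assumes c: "sctx w ord l sp st" and r: "ireg st 147 = pos" "good w ord st (walker l) r" and h: "l <= t" "0 < sp" "pos < W"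
  shows "wp W place st (%t s'. t <= n * n * 6 + 15 & good w ord s' (walker l) r &
    (\<forall>\<sigma>\<in>slot_if l sp pos. good w ord s' \<sigma> r) & keeps (slot_if l sp pos) st s')"
proof -
  define j where "j = (pos div sp) mod dd"
  have j: "j < dd" using dd by (simp add: j_def)
  have ws: "pos mod sp < W" "pos div sp < W" "j < W" "j + base l < W"
    using h(3) mod_less_eq_dividend[of pos sp] div_le_dividend[of pos sp] j slot_less[OF trans_le_add1[OF h(1)] j] NSW
    unfolding slot_def by linarith+
  have sl: "j + base l = slot l j" by (simp add: slot_def)
  show ?thesis
  proof (cases "sp dvd pos")
    case False
    then have "pos mod sp \<noteq> 0" by (simp add: dvd_eq_mod_eq_0)
    then show ?thesis unfolding place_def
      using ws r(2) False by (simp add: sctxD[OF c] r(1) slot_if_def keeps_def good_def matrix_def)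
  next
    case True
    then have m0: "pos mod sp = 0" by simp
    define s0 where "s0 = set_i 160 (slot l j) (set_i 160 j (set_i 160 (pos div sp) (set_i 159 0 st)))"
    have c0: "sctx w ord l sp s0" by (rule sctx_same[OF c, of "{159,160}" "{}" "{}" "{}"]) (auto simp: same_def s0_def)
    have cp: "wp W (copy_matrix 145 160) s0 (%t s'. t <= n * n * 6 + 4 &
     (\<forall>q<n * n. warr s' 3 (slot l j * (n * n) + q) = warr s0 3 (walker l * (n * n) + q)) &
     (\<forall>q. q < slot l j * (n * n) \<or> slot l j * (n * n) + n * n <= q --> warr s' 3 q = warr s0 3 q))"
      by (rule wp_copy_matrix[OF sctxD(1)[OF c0]])
        (use sctxD[OF c0] slot_less[of l j] walker_less[of l] h j slot_walker[of j l l] in \<open>auto simp: s0_def\<close>)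
    have e0: "warr s0 = warr st" "iarr s0 = iarr st" by (simp_all add: s0_def)
    have W0: "0 < W" using n2 by simp
    have rk: "iarr st (Suc 0) (walker l) = r" using r(2) by (simp add: good_def)
    have "wp W (copy_matrix 145 160) s0 (%t s'. t <= n * n * 6 + 4 &
      good w ord (s'\<lparr>iarr := (iarr s')(1 := (iarr s' 1)(slot l j := r))\<rparr>) (walker l) r &
      good w ord (s'\<lparr>iarr := (iarr s')(1 := (iarr s' 1)(slot l j := r))\<rparr>) (slot l j) r &
      keeps {slot l j} st (s'\<lparr>iarr := (iarr s')(1 := (iarr s' 1)(slot l j := r))\<rparr>) &
      iarr s' = iarr st & ireg s' 145 = walker l & ireg s' 160 = slot l j)"
    proof (rule wp_frame[OF cp])
      fix t1 s1
      assume a: "t1 <= n * n * 6 + 4 &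
       (\<forall>q<n * n. warr s1 3 (slot l j * (n * n) + q) = warr s0 3 (walker l * (n * n) + q)) &
       (\<forall>q. q < slot l j * (n * n) \<or> slot l j * (n * n) + n * n <= q --> warr s1 3 q = warr s0 3 q)" "frame (copy_matrix 145 160) s0 s1"
      let ?s = "s1\<lparr>iarr := (iarr s1)(1 := (iarr s1 1)(slot l j := r))\<rparr>"
      have i1: "iarr s1 = iarr st" "ireg s1 145 = walker l" "ireg s1 160 = slot l j"
        using a(2) sctxD[OF c0] by (auto simp: same_def e0 s0_def)
      have k: "keeps {slot l j} st ?s" by (rule outside_keeps) (use a(1) e0 i1 in auto)
      have gw: "good w ord ?s (walker l) r"
        by (rule keeps_good[OF k r(2) sctxD(12)[OF c]]) (use walker_less[of l] h j slot_walker[of j l l] in auto)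
      have "matrix w ord s1 (slot l j) r"
        by (rule copied_good[of _ _ s0 "walker l"]) (use a(1) r(2) sctxD(12)[OF c] in \<open>auto simp: good_def matrix_def e0\<close>)
      then have gs: "good w ord ?s (slot l j) r" by (simp add: good_def matrix_def)
      show "t1 <= n * n * 6 + 4 & good w ord ?s (walker l) r & good w ord ?s (slot l j) r & keeps {slot l j} st ?s &
        iarr s1 = iarr st & ireg s1 145 = walker l & ireg s1 160 = slot l j"
        using a(1) k gw gs i1 by blast
    qed
    then show ?thesis unfolding place_def
      by (simp add: sctxD[OF c] r(1) m0 ws ws(4)[unfolded sl] sl slot_if_def True W0 flip: j_def s0_def)
        (erule wp_mono, use rk in \<open>auto simp: good_def matrix_def keeps_def\<close>)
  qed
qed

lemma wp_restart:
  assumes c: "sctx w ord l sp st" and r: "ireg st 141 = \<tau>" "ireg st 142 = L" "ireg st 143 = u" "ireg st 8 = e"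
    and h: "l <= t" "0 < L" "\<tau> < W" "2 * (L * u) < W" "\<tau> div L + 2 < W"
    and src: "matrix w ord st (slot (l + 1) ((\<tau> div L + 2) mod dd)) R" and R: "R = 2 * (L * u) - e mod d"
  shows "wp W restart st (%t s'. t <= n * n * 6 + 20 & good w ord s' (walker l) R & keeps {walker l} st s')"
proof -
  define j where "j = (\<tau> div L + 2) mod dd"
  have j: "j < dd" using dd by (simp add: j_def)
  have sl: "j + base l + sd = slot (l + 1) j" by (simp add: slot_def base_def)
  have sW: "slot (l + 1) j < W" "walker l < W" using slot_less[of "l + 1" j] walker_less[of l] h j NSW by auto
  have ws: "j + base l < W" "j < W" "\<tau> div L < W" "L * u < W" "e mod d < W" "2 < W"
    using sW h sl d2 bounds mod_less_divisor[of d e] n2 MW NSW d_less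
    div_le_dividend[of \<tau> L] unfolding mult_2 by linarith+
  define s0 where "s0 = set_i 148 (slot (Suc l) j) (set_i 148 (j + base l) (set_i 148 j (set_i 148 (\<tau> div L + 2)
     (set_i 148 (\<tau> div L) (set_i 149 2 st)))))"
  have c0: "sctx w ord l sp s0" by (rule sctx_same[OF c, of "{148,149}" "{}" "{}" "{}"]) (auto simp: same_def s0_def)
  have cp: "wp W (copy_matrix 148 145) s0 (%t s'. t <= n * n * 6 + 4 &
     (\<forall>q<n * n. warr s' 3 (walker l * (n * n) + q) = warr s0 3 (slot (l + 1) j * (n * n) + q)) &
     (\<forall>q. q < walker l * (n * n) \<or> walker l * (n * n) + n * n <= q --> warr s' 3 q = warr s0 3 q))"
    by (rule wp_copy_matrix[OF sctxD(1)[OF c0]])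
      (use sctxD[OF c0] slot_less[of "l + 1" j] walker_less[of l] h j slot_walker[of j "l + 1" l] in \<open>auto simp: s0_def\<close>)
  have e0: "warr s0 = warr st" "iarr s0 = iarr st" by (simp_all add: s0_def)
  have "wp W (copy_matrix 148 145) s0 (%t s'. t <= n * n * 6 + 4 &
      good w ord (s'\<lparr>iarr := (iarr s')(1 := (iarr s' 1)(walker l := R))\<rparr>) (walker l) R &
      keeps {walker l} st (s'\<lparr>iarr := (iarr s')(1 := (iarr s' 1)(walker l := R))\<rparr>) &
      ireg s' 145 = walker l & ireg s' 142 = L & ireg s' 143 = u & ireg s' 8 = e & ireg s' 5 = d)"
  proof (rule wp_frame[OF cp])
    fix t1 s1
    assume a: "t1 <= n * n * 6 + 4 &
     (\<forall>q<n * n. warr s1 3 (walker l * (n * n) + q) = warr s0 3 (slot (l + 1) j * (n * n) + q)) &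
     (\<forall>q. q < walker l * (n * n) \<or> walker l * (n * n) + n * n <= q --> warr s1 3 q = warr s0 3 q)" "frame (copy_matrix 148 145) s0 s1"
    let ?s = "s1\<lparr>iarr := (iarr s1)(1 := (iarr s1 1)(walker l := R))\<rparr>"
    have i1: "iarr s1 = iarr st" "ireg s1 145 = walker l" "ireg s1 142 = L" "ireg s1 143 = u" "ireg s1 8 = e" "ireg s1 5 = d"
      using a(2) sctxD[OF c0] r by (auto simp: same_def e0 s0_def)
    have k: "keeps {walker l} st ?s" by (rule outside_keeps) (use a(1) e0 i1 in auto)
    have "matrix w ord s1 (walker l) R"
      by (rule copied_good[of _ _ s0 "slot (l + 1) j"]) (use a(1) src sctxD(12)[OF c] in \<open>auto simp: j_def matrix_def e0\<close>)
    then have gw: "good w ord ?s (walker l) R" by (simp add: good_def matrix_def)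
    show "t1 <= n * n * 6 + 4 & good w ord ?s (walker l) R & keeps {walker l} st ?s &
       ireg s1 145 = walker l & ireg s1 142 = L & ireg s1 143 = u & ireg s1 8 = e & ireg s1 5 = d"
      using a(1) k gw i1 by blast
  qed
  then show ?thesis unfolding restart_def
    using ws h sW
    by (simp add: sctxD[OF c] r sl flip: j_def s0_def del: add_2_eq_Suc' add_2_eq_Suc)
      (erule wp_mono, auto simp: R good_def matrix_def keeps_def mult_2)
qed

lemma wp_advance:
  assumes w: "weights w" and c: "sctx w ord l sp st" and g: "good w ord st (walker l) r"
    and u: "ireg st 143 = u" "u <= d" "u <= r" and h: "l <= t" "r < W"
  shows "wp W advance st (%t s'. t <= d * 5 + 20 + BT & good w ord s' (walker l) (r - u) & keeps {walker l} st s')"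
proof -
  have dat: "data w ord st" using sctxD[OF c] by simp
  have k: "ireg st 10 = length ord" using dat by (simp add: data_def)
  define lo where "lo = min (r - u) (length ord)"
  define hi where "hi = min r (length ord)"
  define s where "s = hi - lo"
  define s0 where "s0 = set_i 20 s (set_i 155 hi (set_i 155 r (set_i 154 lo (set_i 154 (r - u)
     (set_i 153 (r - u) (set_i 152 r st)\<lparr>iarr := (iarr st)(1 := (iarr st 1)(walker l := r - u))\<rparr>)))))"
  have s: "s <= u" "s <= d" "lo + s = hi" "hi <= length ord" using u by (auto simp: s_def lo_def hi_def min_def)
  have ln: "length ord <= n" using data_length[OF dat] .
  have ws: "s < W" "hi < W" "lo < W" "r - u < W" using s ln bounds h by auto
  have c0: "sctx w ord l sp s0" by (rule sctx_same[OF c, of "{20,152,153,154,155}" "{}" "{1}" "{}"]) (auto simp: same_def s0_def)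
  have e0: "ireg s0 20 = s" "ireg s0 154 = lo" "warr s0 = warr st" "iarr s0 1 = (iarr st 1)(walker l := r - u)"
    by (simp_all add: s0_def)
  have main: "wp W (For 156 20 load_elem ;; IOp Mul 19 145 16 ;; batch) s0
    (%t s'. t <= d * 5 + 5 + BT & good w ord s' (walker l) (r - u) & keeps {walker l} st s')"
    unfolding wp_Seq
  proof -
    let ?I = "%j s1. \<forall>b<j. iarr s1 3 b = ord ! (lo + b)"
    have "wp W (For 156 20 load_elem) s0 (%t s'. t <= s * (3 + 2) + 2 & ?I s s' & ireg s' 156 = s &
      loop_frame 156 load_elem s0 s')"
    proof (rule wp_For_const[where I = ?I])
      fix j s1 assume j: "j < s" "?I j s1" "ireg s1 156 = j"
        and sm: "loop_frame 156 load_elem s0 s1"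
      have c1: "sctx w ord l sp s1" by (rule sctx_same[OF c0 sm]) auto
      have e1: "ireg s1 154 = lo" using sm e0 by (auto simp: same_def)
      have lj: "lo + j < length ord" using j s by linarith
      then have o: "iarr s1 0 (lo + j) = ord ! (lo + j)" using sctxD(2)[OF c1] by (simp add: data_def)
      have "lo + j < W" using lj ln bounds by linarith
      then show "wp W load_elem s1 (%t s2. t <= 3 & ?I (Suc j) (set_i 156 (Suc j) s2))"
        unfolding load_elem_def using j(2) by (simp add: j(3) e1 o less_Suc_eq)
    qed (use ws e0 sctxD[OF c0] in auto)
    then show "wp W (For 156 20 load_elem) s0 (%t1 s1. wp W (IOp Mul 19 145 16) s1 (%t1a s1. wp W batch s1 (%t2 s'.
      t1 + (t1a + t2) <= d * 5 + 5 + BT & good w ord s' (walker l) (r - u) & keeps {walker l} st s')))"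
    proof (rule wp_mono)
      fix t1 s1 assume a1: "t1 <= s * (3 + 2) + 2 & ?I s s1 & ireg s1 156 = s &
        loop_frame 156 load_elem s0 s1"
      define s1' where "s1' = set_i 19 (walker l * (n * n)) s1"
      have sm: "same {19, 156, 157} {} {3} {} s0 s1'" using a1 by (auto simp: same_def s1'_def)
      have c1: "sctx w ord l sp s1'" by (rule sctx_same[OF c0 sm]) auto
      have e1: "ireg s1' 20 = s" "warr s1' = warr st" "iarr s1' 1 = (iarr st 1)(walker l := r - u)" "ireg s1 145 = walker l" "ireg s1 16 = n * n"
        using sm e0 sctxD[OF c1] by (auto simp: same_def s1'_def)
      let ?Z = "%b. ord ! (lo + b)"
      have wl: "walker l < NS" using walker_less h by simp
      have Zs: "?Z b \<in> set ord" if "b < s" for b using that s by simp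
      \<comment> \<open>Lowering the rank by \<open>u\<close> adds to the interior the vertices at
        positions \<open>lo\<close> to \<open>hi - 1\<close>. Ranks beyond the length are cut off on
        both sides of the equation.\<close>
      have V: "set (drop r ord) \<union> ?Z ` {..<s} = set (drop (r - u) ord)"
      proof -
        have 1: "set (drop r ord) = (!) ord ` {hi..<length ord}"
        proof (cases "r <= length ord")
          case True then show ?thesis by (simp add: set_drop_conv hi_def)
        next
          case False then show ?thesis by (simp add: hi_def)
        qed
        have 2: "set (drop (r - u) ord) = (!) ord ` {lo..<length ord}"
        proof (cases "r - u <= length ord")
          case True then show ?thesis by (simp add: set_drop_conv lo_def)
        next
          case False then show ?thesis by (simp add: lo_def)
        qed
        have 3: "?Z ` {..<s} = (!) ord ` {lo..<hi}"
        proof -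
          have "(!) ord ` {lo..<hi} = (!) ord ` ((+) lo ` {0..<s})" using s(3)[symmetric] by (simp add: image_add_atLeastLessThan add.commute)
          then show ?thesis by (simp add: image_image atLeast0LessThan)
        qed
        have "{hi..<length ord} \<union> {lo..<hi} = {lo..<length ord}" using s by auto
        then show ?thesis unfolding 1 2 3 by (metis image_Un)
      qed
      have "wp W batch s1' (%t s'. t <= BT &
         (\<forall>x\<in>set ord. \<forall>y\<in>set ord. warr s' 3 (walker l * (n * n) + (x * n + y)) = fw w (set (drop r ord) \<union> ?Z ` {..<s}) x y) &
         (\<forall>q. q < walker l * (n * n) \<or> walker l * (n * n) + n * n <= q --> warr s' 3 q = warr s1' 3 q))"
      proof (rule wp_batch'[OF w gregs_regs[OF sctxD(1)[OF c1]] _ e1(1) _ s(2) wl sctxD(12)[OF c1]])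
        show "ireg s1' 19 = walker l * (n * n)" by (simp add: s1'_def)
        show "iarr s1' 3 b = ?Z b" if "b < s" for b using that a1 by (simp add: s1'_def)
        show "?Z b \<in> set ord" if "b < s" for b using Zs that .
        show "?Z b < n" if "b < s" for b using Zs[OF that] sctxD(12)[OF c] by auto
        show "warr s1' 3 (walker l * (n * n) + (x * n + y)) = fw w (set (drop r ord)) x y" if "x \<in> set ord" "y \<in> set ord" for x y
          using g that by (simp add: good_def matrix_def e1)
      qed
      then have "wp W batch s1' (%t2 s'. t1 + (1 + t2) <= d * 5 + 5 + BT & good w ord s' (walker l) (r - u) & keeps {walker l} st s')"
      proof (rule wp_same[where X = UNIV and Y = UNIV and A = "{5, 6, 7, 8, 9, 10}" and B = UNIV])
        fix t2 s2
        assume a2: "t2 <= BT & (\<forall>x\<in>set ord. \<forall>y\<in>set ord. warr s2 3 (walker l * (n * n) + (x * n + y)) =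
            fw w (set (drop r ord) \<union> ?Z ` {..<s}) x y) &
         (\<forall>q. q < walker l * (n * n) \<or> walker l * (n * n) + n * n <= q --> warr s2 3 q = warr s1' 3 q)"
          and f2: "same UNIV UNIV {5, 6, 7, 8, 9, 10} UNIV s1' s2"
        have rk: "iarr s2 1 = (iarr st 1)(walker l := r - u)" using f2 e1 by (simp add: same_def)
        have "good w ord s2 (walker l) (r - u)" using a2 rk unfolding V by (simp add: good_def matrix_def)
        moreover have "keeps {walker l} st s2" by (rule outside_keeps) (use a2 rk e1 in auto)
        moreover have "t1 + (1 + t2) <= d * 5 + 5 + BT" using a1 a2 s by auto
        ultimately show "t1 + (1 + t2) <= d * 5 + 5 + BT & good w ord s2 (walker l) (r - u) & keeps {walker l} st s2" by blast
      qed (use batch_mods in auto)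
      then show "wp W (IOp Mul 19 145 16) s1 (%t1a s1. wp W batch s1 (%t2 s'.
        t1 + (t1a + t2) <= d * 5 + 5 + BT & good w ord s' (walker l) (r - u) & keeps {walker l} st s'))"
        using slotW(2)[OF wl] by (simp add: e1 s1'_def)
    qed
  qed
  have rk: "iarr st (Suc 0) (walker l) = r" using g by (simp add: good_def)
  have eq: "(if length ord < r - u then length ord else r - u) = lo" "(if length ord < r then length ord else r) = hi"
    by (auto simp: lo_def hi_def)
  define s9 where "s9 = set_i 153 (r - u) (set_i 152 r st)\<lparr>iarr := (iarr st)(Suc 0 := (iarr st (Suc 0))(walker l := r - u))\<rparr>"
  have ifs: "wp W (If (ILess 10 a) (IMove a 10) Skip) st' Q \<longleftrightarrow> Q 2 (set_i a (min (ireg st' a) (ireg st' 10)) st')" for a st' Q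
  proof (cases "ireg st' 10 < ireg st' a")
    case False
    then have "min (ireg st' a) (ireg st' 10) = ireg st' a" by simp
    then show ?thesis using False by (simp add: set_i_def numeral_2_eq_2)
  qed (simp add: numeral_2_eq_2)
  show ?thesis
    unfolding advance_def
    apply (simp only: wp_Seq[of _ "ILoad 152 1 145"] wp_Seq[of _ "IOp Sub 153 152 143"] wp_Seq[of _ "IStore 1 145 153"]
      wp_Seq[of _ "IMove 154 153"] wp_Seq[of _ "If (ILess 10 154) (IMove 154 10) Skip"] wp_Seq[of _ "IMove 155 152"]
      wp_Seq[of _ "If (ILess 10 155) (IMove 155 10) Skip"] wp_Seq[of _ "IOp Sub 20 155 154"] ifs)
    apply (simp add: sctxD[OF c] rk u(1) k ws flip: lo_def hi_def s_def del: wp_Seq wp_If)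
    apply (rule wp_mono[OF main[unfolded s0_def One_nat_def]])
    apply auto
    done
qed

definition step_time :: nat where "step_time = n * n * 18 + d * 5 + 120 + BT"

text \<open>At a restart two positions may be placed, one before and one after the advance. Should
  both fall into the same slot, the later copy stays; the set difference expresses this without a
  case distinction.\<close>

lemma wp_step:
  assumes w: "weights w" and g: "gregs st" "data w ord st"
    and r: "ireg st 140 = l" "ireg st 141 = \<tau>" "ireg st 142 = L" "ireg st 143 = u" "ireg st 8 = e"
    and h: "l <= t" "0 < L" "d dvd L" "u <= d" "2 * ((\<tau> div L + 1) * L) < W" "2 * (L * u) < W" "\<tau> div L + 2 < W" "\<tau> < W"
    and pos: "pos = 2 * ((\<tau> div L + 1) * L) - \<tau>" and sp: "sp = L div d"
    and r0: "\<tau> mod L = 0 ==> matrix w ord st (slot (l + 1) ((\<tau> div L + 2) mod dd)) rk & rk = 2 * (L * u) - e mod d"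
      "\<tau> mod L \<noteq> 0 ==> good w ord st (walker l) rk" "u <= rk" "rk < W"
  shows "wp W step st (%t s'. t <= step_time & good w ord s' (walker l) (rk - u) &
     (\<forall>\<sigma>\<in>slot_if l sp (pos - 1). good w ord s' \<sigma> (rk - u)) &
     (\<tau> mod L = 0 --> (\<forall>\<sigma>\<in>slot_if l sp pos - slot_if l sp (pos - 1). good w ord s' \<sigma> rk)) &
     keeps ({walker l} \<union> slot_if l sp (pos - 1) \<union> (if \<tau> mod L = 0 then slot_if l sp pos else {})) st s')"
proof -
  have sp0: "0 < sp" using h d2 by (auto simp: sp elim!: dvdE)
  have posW: "pos < W" using h by (simp add: pos)
  define s0 where "s0 = set_i 146 (\<tau> mod L) (set_i 147 pos (set_i 147 ((\<tau> div L + 1) * L + (\<tau> div L + 1) * L) (set_i 147 ((\<tau> div L + 1) * L)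
     (set_i 147 (\<tau> div L + 1) (set_i 147 (\<tau> div L) (set_i 158 sp (set_i 145 (walker l) (set_i 144 (base l) st))))))))"
  have sm0: "same {144, 145, 146, 147, 158} {} {} {} st s0" by (auto simp: same_def s0_def)
  have c0: "sctx w ord l sp s0" using gregs_same[OF g(1) sm0] data_same[OF g(2) sm0] by (auto simp: sctx_def s0_def)
  have e0: "warr s0 = warr st" "iarr s0 = iarr st" "ireg s0 147 = pos" "ireg s0 141 = \<tau>" "ireg s0 142 = L" "ireg s0 143 = u" "ireg s0 8 = e"
    "ireg s0 146 = \<tau> mod L" "ireg s0 3 = 0"
    using r gregsD[OF g(1)] by (simp_all add: s0_def)
  let ?X = "if \<tau> mod L = 0 then slot_if l sp pos else {}"
  have sub: "set ord \<subseteq> {..<n}" using sctxD[OF c0] by simp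
  have sl_less: "\<sigma> < NS & \<sigma> \<noteq> walker l" if "\<sigma> \<in> slot_if l sp p" for \<sigma> p
    using that slot_less[of l] slot_walker[of _ l l] h dd by (auto simp: slot_if_def split: if_splits)
  have wl: "walker l < NS" using walker_less h by simp
  have two: "wp W (advance ;; IOp Sub 147 147 2 ;; place) s1 (%t s'. t <= n * n * 6 + d * 5 + 40 + BT & good w ord s' (walker l) (rk - u) &
     (\<forall>\<sigma>\<in>slot_if l sp (pos - 1). good w ord s' \<sigma> (rk - u)) & keeps ({walker l} \<union> slot_if l sp (pos - 1)) s1 s')"
    if c1: "sctx w ord l sp s1" and g1: "good w ord s1 (walker l) rk" and e1: "ireg s1 147 = pos" "ireg s1 143 = u" for s1
    unfolding wp_Seq
  proof (rule wp_same[OF wp_advance[OF w c1 g1 e1(2) h(4) r0(3) h(1) r0(4)] advance_mods])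
    fix t2 s2 assume a2: "t2 <= d * 5 + 20 + BT & good w ord s2 (walker l) (rk - u) & keeps {walker l} s1 s2"
      and f2: "same ({19, 20, 21} \<union> {40..<76} \<union> {152..<158}) {10, 11, 12, 13, 20} {1, 3, 5, 6, 7, 8, 9, 10} {3, 6, 8, 9, 10} s1 s2"
    define s2' where "s2' = set_i 147 (pos - 1) s2"
    have sm: "same ({19, 20, 21} \<union> {40..<76} \<union> {147} \<union> {152..<158}) {10, 11, 12, 13, 20} {1, 3, 5, 6, 7, 8, 9, 10} {3, 6, 8, 9, 10} s1 s2'"
      using f2 by (auto simp: same_def s2'_def)
    have c2: "sctx w ord l sp s2'" by (rule sctx_same[OF c1 sm]) auto
    have e2: "ireg s2 147 = pos" "ireg s2 2 = 1" using f2 e1 sctxD[OF c1] by (auto simp: same_def)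
    have g2: "good w ord s2' (walker l) (rk - u)" using a2 by (simp add: s2'_def good_def matrix_def)
    have k2: "keeps {walker l} s1 s2'" using a2 by (simp add: s2'_def keeps_def)
    have p147: "ireg s2' 147 = pos - 1" "pos - 1 < W" using posW by (simp_all add: s2'_def)
    note pW = p147(2) note p147 = p147(1)
    have "wp W place s2' (%t s'. t2 + (1 + t) <= n * n * 6 + d * 5 + 40 + BT & good w ord s' (walker l) (rk - u) &
       (\<forall>\<sigma>\<in>slot_if l sp (pos - 1). good w ord s' \<sigma> (rk - u)) & keeps ({walker l} \<union> slot_if l sp (pos - 1)) s1 s')"
      by (rule wp_mono[OF wp_place[OF c2 p147 g2 h(1) sp0 pW]])
        (use a2 keeps_trans[OF k2] in auto)
    then show "wp W (IOp Sub 147 147 2) s2 (%t1 s1'. wp W place s1' (%t2' s'. t2 + (t1 + t2') <= n * n * 6 + d * 5 + 40 + BT &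
       good w ord s' (walker l) (rk - u) &
       (\<forall>\<sigma>\<in>slot_if l sp (pos - 1). good w ord s' \<sigma> (rk - u)) & keeps ({walker l} \<union> slot_if l sp (pos - 1)) s1 s'))"
      using posW by (simp add: e2 s2'_def)
  qed
  have main: "wp W (If (IEq 146 3) (restart ;; place) Skip ;; (advance ;; IOp Sub 147 147 2 ;; place)) s0
    (%t s'. t + 20 <= step_time & good w ord s' (walker l) (rk - u) &
     (\<forall>\<sigma>\<in>slot_if l sp (pos - 1). good w ord s' \<sigma> (rk - u)) &
     (\<tau> mod L = 0 --> (\<forall>\<sigma>\<in>slot_if l sp pos - slot_if l sp (pos - 1). good w ord s' \<sigma> rk)) &
     keeps ({walker l} \<union> slot_if l sp (pos - 1) \<union> ?X) st s')"
  proof (cases "\<tau> mod L = 0")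
    case False
    have g0: "good w ord s0 (walker l) rk" using r0(2)[OF False] by (simp add: good_def matrix_def e0)
    have "wp W (advance ;; IOp Sub 147 147 2 ;; place) s0 (%t s'. Suc 1 + t + 20 <= step_time & good w ord s' (walker l) (rk - u) &
     (\<forall>\<sigma>\<in>slot_if l sp (pos - 1). good w ord s' \<sigma> (rk - u)) & keeps ({walker l} \<union> slot_if l sp (pos - 1)) st s')"
      by (rule wp_mono[OF two[OF c0 g0 e0(3,6)]]) (auto simp: step_time_def keeps_def e0)
    then show ?thesis using False unfolding wp_Seq[of _ "If (IEq 146 3) (restart ;; place) Skip"] by (simp add: e0 del: wp_Seq)
  next
    case True
    have R: "matrix w ord s0 (slot (l + 1) ((\<tau> div L + 2) mod dd)) rk" "rk = 2 * (L * u) - e mod d"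
      using r0(1)[OF True] by (simp_all add: matrix_def e0)
    have "wp W (restart ;; place) s0 (%t1 s1. wp W (advance ;; IOp Sub 147 147 2 ;; place) s1
      (%t s'. Suc t1 + t + 20 <= step_time & good w ord s' (walker l) (rk - u) &
     (\<forall>\<sigma>\<in>slot_if l sp (pos - 1). good w ord s' \<sigma> (rk - u)) &
     (\<forall>\<sigma>\<in>slot_if l sp pos - slot_if l sp (pos - 1). good w ord s' \<sigma> rk) &
     keeps ({walker l} \<union> slot_if l sp (pos - 1) \<union> slot_if l sp pos) st s'))"
      unfolding wp_Seq[of _ restart]
    proof (rule wp_frame[OF wp_restart[OF c0 e0(4-7) h(1,2,8,6,7) R]])
      fix t1 s1 assume a1: "t1 <= n * n * 6 + 20 & good w ord s1 (walker l) rk & keeps {walker l} s0 s1" and f1: "frame restart s0 s1"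
      have c1: "sctx w ord l sp s1" by (rule sctx_same[OF c0 f1]) auto
      have e1: "ireg s1 147 = pos" "ireg s1 143 = u" using f1 e0 by (auto simp: same_def)
      show "wp W place s1 (%t2 s2. wp W (advance ;; IOp Sub 147 147 2 ;; place) s2
        (%t s'. Suc (t1 + t2) + t + 20 <= step_time & good w ord s' (walker l) (rk - u) &
       (\<forall>\<sigma>\<in>slot_if l sp (pos - 1). good w ord s' \<sigma> (rk - u)) &
       (\<forall>\<sigma>\<in>slot_if l sp pos - slot_if l sp (pos - 1). good w ord s' \<sigma> rk) &
       keeps ({walker l} \<union> slot_if l sp (pos - 1) \<union> slot_if l sp pos) st s'))"
      proof (rule wp_frame[OF wp_place[OF c1 e1(1) conjunct1[OF conjunct2[OF a1]] h(1) sp0 posW]])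
        fix t2 s2 assume a2: "t2 <= n * n * 6 + 15 & good w ord s2 (walker l) rk &
          (\<forall>\<sigma>\<in>slot_if l sp pos. good w ord s2 \<sigma> rk) & keeps (slot_if l sp pos) s1 s2" and f2: "frame place s1 s2"
        have c2: "sctx w ord l sp s2" by (rule sctx_same[OF c1 f2]) auto
        have e2: "ireg s2 147 = pos" "ireg s2 143 = u" using f2 e1 by (auto simp: same_def)
        have k2: "keeps ({walker l} \<union> slot_if l sp pos) st s2"
          using keeps_trans[of "{walker l}" s0 s1 "slot_if l sp pos" s2] a1 a2 by (simp add: keeps_def e0)
        show "wp W (advance ;; IOp Sub 147 147 2 ;; place) s2
          (%t s'. Suc (t1 + t2) + t + 20 <= step_time & good w ord s' (walker l) (rk - u) &
         (\<forall>\<sigma>\<in>slot_if l sp (pos - 1). good w ord s' \<sigma> (rk - u)) &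
         (\<forall>\<sigma>\<in>slot_if l sp pos - slot_if l sp (pos - 1). good w ord s' \<sigma> rk) &
         keeps ({walker l} \<union> slot_if l sp (pos - 1) \<union> slot_if l sp pos) st s')"
        proof (rule wp_mono[OF two[OF c2 conjunct1[OF conjunct2[OF a2]] e2]], intro conjI)
          fix t3 s3
          assume a3: "t3 <= n * n * 6 + d * 5 + 40 + BT & good w ord s3 (walker l) (rk - u) &
             (\<forall>\<sigma>\<in>slot_if l sp (pos - 1). good w ord s3 \<sigma> (rk - u)) & keeps ({walker l} \<union> slot_if l sp (pos - 1)) s2 s3"
          show "Suc (t1 + t2) + t3 + 20 <= step_time" using a1 a2 a3 by (simp add: step_time_def)
          show "\<forall>\<sigma>\<in>slot_if l sp pos - slot_if l sp (pos - 1). good w ord s3 \<sigma> rk"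
          proof
            fix \<sigma> assume s: "\<sigma> \<in> slot_if l sp pos - slot_if l sp (pos - 1)"
            show "good w ord s3 \<sigma> rk"
              by (rule keeps_good[of "{walker l} \<union> slot_if l sp (pos - 1)" s2]) (use a2 a3 s sub sl_less[of \<sigma> pos] in auto)
          qed
          show "keeps ({walker l} \<union> slot_if l sp (pos - 1) \<union> slot_if l sp pos) st s3"
            by (rule keeps_mono[OF keeps_trans[OF k2]]) (use a3 in auto)
        qed (blast | simp)+
      qed
    qed
    then show ?thesis using True unfolding wp_Seq[of _ "If (IEq 146 3) (restart ;; place) Skip"]
      by (simp add: e0 del: wp_Seq)
  qed
  have ws: "base l < W" "walker l < W" "sp < W" "\<tau> div L < W" "\<tau> div L + 1 < W" "(\<tau> div L + 1) * L < W"
    "(\<tau> div L + 1) * L + (\<tau> div L + 1) * L < W" "\<tau> mod L < W"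
  proof -
    show "walker l < W" using wl NSW by simp
    then show "base l < W" by (simp add: walker_def)
    have "L <= (\<tau> div L + 1) * L" by simp
    then have "L < W" using h by linarith
    then show "sp < W" unfolding sp using div_le_dividend[of L d] by (rule le_less_trans[rotated])
    show "\<tau> mod L < W" using mod_less_divisor[OF h(2), of \<tau>] \<open>L < W\<close> by linarith
  qed (use h in linarith)+
  have bd: "l * sd = base l" "base l + dd = walker l" by (simp_all add: base_def walker_def)
  have r17: "ireg st 17 = dd" "ireg st 18 = sd" "ireg st 5 = d" "ireg st 2 = 1" using gregsD[OF g(1)] by (simp_all add: dd_def sd_def)
  have p2: "(\<tau> div L + 1) * L + (\<tau> div L + 1) * L - \<tau> = pos" by (simp only: pos mult_2)
  have ad: "\<tau> div L + Suc 0 = \<tau> div L + 1" by simp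
  show ?thesis
    unfolding step_def
    apply (simp only: wp_Seq[of _ "IOp Mul 144 140 18"] wp_Seq[of _ "IOp Add 145 144 17"] wp_Seq[of _ "IOp Div 158 142 5"]
      wp_Seq[of _ "IOp Div 147 141 142"] wp_Seq[of _ "IOp Add 147 147 2"] wp_Seq[of _ "IOp Mul 147 147 142"]
      wp_Seq[of _ "IOp Add 147 147 147"] wp_Seq[of _ "IOp Sub 147 147 141"] wp_Seq[of _ "IOp Mod 146 141 142"] wp_atomic
      iop_val.simps set_i_sel fun_upd_same)
    apply (simp only: fun_upd_apply r r17 bd p2 ws posW sp[symmetric] if_True if_False simp_thms numeral_eq_iff num.simps)
    apply (simp only: s0_def[symmetric])
    apply (rule wp_mono[OF main])
    apply auto
    done
qed

end

section \<open>Deleting the first vertex of the order\<close>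

text \<open>Register 9 is the next level to be stepped in the current block of \<open>d\<close>
  deletions. It descends from \<open>t\<close>, and 0 means that the block is done.\<close>

definition step_level :: com where
  "step_level = If (ILess 3 9)
    (IMove 140 9 ;; IOp Div 141 8 5 ;; ILoad 142 2 9 ;; IMove 143 5 ;; step ;; IOp Sub 9 9 2) Skip"

definition step_base :: com where
  "step_base = IConst 140 0 ;; IMove 141 8 ;; IMove 142 5 ;; IConst 143 1 ;; step"

definition lower_rank :: com where
  "lower_rank = ILoad 174 1 172 ;; IOp Sub 174 174 2 ;; IStore 1 172 174"

definition shift_left :: com where
  "shift_left = IOp Add 174 172 2 ;; ILoad 174 0 174 ;; IStore 0 172 174"

text \<open>The slots of level \<open>t + 1\<close> are exempt from the lowering of ranks: their
  rank \<open>n\<close> denotes the empty interior whatever the order.\<close>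

definition pop_tail :: com where
  "pop_tail = IOp Add 8 8 2 ;; If (IEq 8 15) (IConst 8 0) Skip ;; IOp Mod 171 8 5 ;; If (IEq 171 3) (IMove 9 6) Skip ;;
    IOp Sub 173 14 18 ;; IOp Sub 10 10 2 ;; For 172 173 lower_rank ;; For 172 10 shift_left"

definition pop :: com where
  "pop = For 170 7 step_level ;; step_base ;; pop_tail"

lemma pop_mods [simp]:
  "iw lower_rank = {174}" "ww lower_rank = {}" "iaw lower_rank = {1}" "waw lower_rank = {}"
  "iw shift_left = {174}" "ww shift_left = {}" "iaw shift_left = {0}" "waw shift_left = {}"
  by (auto simp: lower_rank_def shift_left_def)

lemma step_level_mods:
  "iw step_level \<subseteq> step_regs \<union> {9, 140, 141, 142, 143}" "ww step_level \<subseteq> {10, 11, 12, 13, 20}"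
  "iaw step_level \<subseteq> {1, 3, 5, 6, 7, 8, 9, 10}" "waw step_level \<subseteq> {3, 6, 8, 9, 10}"
  "iw step_base \<subseteq> step_regs \<union> {140, 141, 142, 143}" "ww step_base \<subseteq> {10, 11, 12, 13, 20}"
  "iaw step_base \<subseteq> {1, 3, 5, 6, 7, 8, 9, 10}" "waw step_base \<subseteq> {3, 6, 8, 9, 10}"
  using step_mods' by (auto simp: step_level_def step_base_def)

text \<open>The rank of a slot of unspecified contents is decremented like the others. That the
  result is a word follows from the fact that all cells hold words.\<close>

definition words_ok :: "nat => state => bool" where
  "words_ok W s \<longleftrightarrow> (\<forall>x. ireg s x < W) & (\<forall>a i. iarr s a i < W)"

lemma exec_words_ok: "exec W c s t s' ==> words_ok W s ==> words_ok W s'"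
  by (induction rule: exec.induct) (auto simp: words_ok_def)

lemma wp_words_ok: "wp W c s P ==> words_ok W s ==> wp W c s (%t s'. P t s' & words_ok W s')"
  unfolding wp_def using exec_words_ok by blast

lemma mod_neq:
  fixes q q' m :: nat
  assumes "q < q' + m" "q' < q + m" "q \<noteq> q'"
  shows "q mod m \<noteq> q' mod m"
proof
  assume "q mod m = q' mod m"
  then have "q <= q' ==> m dvd q' - q" "q' <= q ==> m dvd q - q'"
    by (metis mod_eq_dvd_iff_nat)+
  then show False using assms dvd_imp_le[of m "q' - q"] dvd_imp_le[of m "q - q'"] by linarith
qed

text \<open>With \<open>1 <= t\<close>, the level that feeds level 0 is a regular one and not the
  constant level \<open>t + 1\<close>.\<close>

locale queue = pebbles + assumes t1: "1 <= t"
begin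

text \<open>Deletions are counted modulo \<open>2 d\<^bsup>t + 2\<^esup>\<close>. A tick \<open>\<tau>\<close> of level \<open>l\<close> lasts \<open>un l\<close> deletions, and a
  phase \<open>Lv l\<close> ticks. During the phase that ends at \<open>Uv l \<tau>\<close>, the walker of level \<open>l\<close> descends from
  position \<open>Uv l \<tau> + Lv l\<close> to \<open>Uv l \<tau>\<close> (positions count ticks from the start of the counter) and drops
  a copy at each multiple of \<open>spc l\<close>; these copies serve the next phase.\<close>

definition Lv :: "nat => nat" where "Lv l = (if l = 0 then d else d ^ l)"
definition un :: "nat => nat" where "un l = (if l = 0 then 1 else d)"
definition spc :: "nat => nat" where "spc l = Lv l div d"
definition Uv :: "nat => nat => nat" where "Uv l \<tau> = (\<tau> div Lv l + 1) * Lv l"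
text \<open>The position of the walker is the mirror image of \<open>\<tau>\<close> at the end of
  the phase: it descends by one tick while time ascends by one.\<close>

definition wk :: "nat => nat => nat" where "wk l \<tau> = 2 * Uv l \<tau> - \<tau>"

text \<open>The first alternative covers the copies that serve the current phase, dropped by the
  walker in the phase before. The second covers those dropped so far for the next phase; at the
  start of a phase there are none.\<close>

definition valid :: "nat => nat => nat => bool" where
  "valid l \<tau> q \<longleftrightarrow> (\<tau> <= q * spc l & q * spc l <= Uv l \<tau>) \<or>
    (\<tau> mod Lv l \<noteq> 0 & wk l \<tau> <= q * spc l & q * spc l <= Uv l \<tau> + Lv l)"

text \<open>Positions are absolute, and the current rank is the position in deletions minus the
  \<open>e\<close> deletions made. The guard \<open>e <= q * d ^ l\<close> keeps this subtraction
  from being truncated for positions already passed.\<close>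

definition level_ok :: "(nat => nat => ereal) => nat list => nat => state => nat => nat => bool" where
  "level_ok w ord e st l \<tau> \<longleftrightarrow> (\<forall>q. valid l \<tau> q & e <= q * d ^ l --> good w ord st (slot l (q mod dd)) (q * d ^ l - e)) &
    (\<tau> mod Lv l \<noteq> 0 --> good w ord st (walker l) (wk l \<tau> * un l - e))"

lemma Lv_spc: "Lv l = spc l * d" "0 < spc l" "spc l * un l = d ^ l" "2 <= Lv l" "dd * spc l = 2 * Lv l" "d dvd Lv l"
proof -
  have "d dvd Lv l" by (auto simp: Lv_def dvd_power)
  then show 1: "Lv l = spc l * d" "d dvd Lv l" by (simp_all add: spc_def)
  show "dd * spc l = 2 * Lv l" using 1 by (simp add: dd_def)
  have "d <= Lv l" using d2 self_le_power[of d l] by (auto simp: Lv_def)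
  then show "2 <= Lv l" using d2 by simp
  then show "0 < spc l" using 1 by (cases "spc l") auto
  show "spc l * un l = d ^ l"
  proof (cases l)
    case 0 then show ?thesis using d2 by (simp add: spc_def un_def Lv_def)
  next
    case (Suc k) then show ?thesis using d2 by (simp add: spc_def un_def Lv_def)
  qed
qed

lemma Uv_bounds: "\<tau> < Uv l \<tau>" "Uv l \<tau> <= \<tau> + Lv l" "Lv l dvd Uv l \<tau>"
proof -
  have *: "\<tau> = \<tau> div Lv l * Lv l + \<tau> mod Lv l" by (rule div_mult_mod_eq[symmetric])
  have "\<tau> mod Lv l < Lv l" using Lv_spc(4)[of l] by simp
  with * show "\<tau> < Uv l \<tau>" "Uv l \<tau> <= \<tau> + Lv l" unfolding Uv_def add_mult_distrib mult_1 by linarith+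
qed (simp add: Uv_def)

lemma Uv_start: "\<tau> mod Lv l = 0 ==> Uv l \<tau> = \<tau> + Lv l"
  unfolding Uv_def by (simp add: add.commute mod_eq_0_iff_dvd)

lemma Uv_Suc_same: "Suc \<tau> mod Lv l \<noteq> 0 ==> Uv l (Suc \<tau>) = Uv l \<tau>"
  unfolding Uv_def by (simp add: div_Suc)

lemma Uv_Suc_new: "Suc \<tau> mod Lv l = 0 ==> Uv l \<tau> = Suc \<tau> & Uv l (Suc \<tau>) = Suc \<tau> + Lv l & \<tau> mod Lv l \<noteq> 0"
proof -
  assume a: "Suc \<tau> mod Lv l = 0"
  have "Suc \<tau> div Lv l = Suc (\<tau> div Lv l)" using a by (simp add: div_Suc)
  moreover have e: "Suc \<tau> div Lv l * Lv l = Suc \<tau>" using a by (metis add.right_neutral div_mult_mod_eq)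
  ultimately have "Uv l \<tau> = Suc \<tau>" by (simp add: Uv_def)
  moreover have "\<tau> mod Lv l \<noteq> 0"
  proof
    assume "\<tau> mod Lv l = 0"
    then have "Suc \<tau> mod Lv l = 1 mod Lv l" by (metis One_nat_def Suc_eq_plus1 mod_add_left_eq add_0)
    then show False using a Lv_spc(4)[of l] by simp
  qed
  ultimately show ?thesis using Uv_start[OF a] by simp
qed

lemma wk_ge: "Uv l \<tau> < wk l \<tau>" "wk l \<tau> <= Uv l \<tau> + Lv l" "wk l \<tau> + \<tau> = 2 * Uv l \<tau>"
  using Uv_bounds(1)[of \<tau> l] Uv_bounds(2)[of l \<tau>] by (auto simp: wk_def)

lemma valid_range: "valid l \<tau> q ==> \<tau> <= q * spc l & q * spc l <= Uv l \<tau> + Lv l"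
  using Uv_bounds[of \<tau> l] wk_ge[of l \<tau>] by (auto simp: valid_def)

text \<open>A tick makes valid only what the walker drops: the position that it reaches and, in the
  first tick of a phase, the one where it starts. When a phase ends, the copies of the second
  alternative become those of the first.\<close>

lemma valid_Suc:
  assumes "valid l (Suc \<tau>) q"
  shows "q * spc l = wk l \<tau> - 1 \<or> (\<tau> mod Lv l = 0 & q * spc l = wk l \<tau>) \<or> valid l \<tau> q"
    "Suc \<tau> <= q * spc l" "q * spc l <= Uv l \<tau> + Lv l"
proof -
  show "Suc \<tau> <= q * spc l" using valid_range[OF assms] by simp
  have "(q * spc l = wk l \<tau> - 1 \<or> (\<tau> mod Lv l = 0 & q * spc l = wk l \<tau>) \<or> valid l \<tau> q) & q * spc l <= Uv l \<tau> + Lv l"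
  proof (cases "Suc \<tau> mod Lv l = 0")
    case True
    note N = Uv_Suc_new[OF True]
    have "Suc \<tau> <= q * spc l" "q * spc l <= Suc \<tau> + Lv l" using assms True N by (auto simp: valid_def)
    \<comment> \<open>In the last tick of a phase the walker is one above the end, which it reaches
      with this tick.\<close>
    moreover have "wk l \<tau> = Suc (Suc \<tau>)" using N by (simp add: wk_def)
    ultimately show ?thesis using N by (auto simp: valid_def)
  next
    case False
    note S = Uv_Suc_same[OF False]
    have wkS: "wk l (Suc \<tau>) = wk l \<tau> - 1" using S by (simp add: wk_def)
    from assms consider "Suc \<tau> <= q * spc l" "q * spc l <= Uv l \<tau>" | "wk l \<tau> - 1 <= q * spc l" "q * spc l <= Uv l \<tau> + Lv l"
      using S wkS by (auto simp: valid_def)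
    then show ?thesis
    proof cases
      case 1 then show ?thesis by (auto simp: valid_def)
    next
      case 2
      show ?thesis
      proof (cases "\<tau> mod Lv l = 0")
        case True
        then have "wk l \<tau> = Uv l \<tau> + Lv l" using Uv_start[OF True] by (simp add: wk_def)
        then show ?thesis using 2 True by auto
      next
        case F: False
        then show ?thesis using 2 by (auto simp: valid_def)
      qed
    qed
  qed
  then show "q * spc l = wk l \<tau> - 1 \<or> (\<tau> mod Lv l = 0 & q * spc l = wk l \<tau>) \<or> valid l \<tau> q" "q * spc l <= Uv l \<tau> + Lv l" by auto
qed

text \<open>All positions in use lie in a window shorter than two phases, that is, than
  \<open>2 * d\<close> spacings. This is the reason for the size of the circular buffers.\<close>

lemma close_mod:
  assumes "Suc \<tau> <= q * spc l" "q * spc l <= Uv l \<tau> + Lv l" "Suc \<tau> <= q' * spc l" "q' * spc l <= Uv l \<tau> + Lv l" "q \<noteq> q'"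
  shows "q mod dd \<noteq> q' mod dd"
proof -
  have W: "Uv l \<tau> + Lv l < Suc \<tau> + dd * spc l" using Uv_bounds(2)[of l \<tau>] Lv_spc(5)[of l] by linarith
  have "q * spc l < (q' + dd) * spc l" "q' * spc l < (q + dd) * spc l"
    using W assms by (auto simp: add_mult_distrib)
  then have "q < q' + dd" "q' < q + dd" using Lv_spc(2)[of l] by auto
  then show ?thesis using assms(5) by (intro mod_neq)
qed

text \<open>A position valid after the tick is either one of those just dropped or an old one; by
  \<open>close_mod\<close> the slot of an old one is not hit by a new copy.\<close>

lemma level_step:
  assumes ok: "level_ok w ord e st l \<tau>" and sub: "set ord \<subseteq> {..<n}" and l: "l <= t"
    and rk: "rk = wk l \<tau> * un l - e" "un l + e <= wk l \<tau> * un l"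
    and post: "good w ord s' (walker l) (rk - un l)"
      "\<forall>\<sigma>\<in>slot_if l (spc l) (wk l \<tau> - 1). good w ord s' \<sigma> (rk - un l)"
      "\<tau> mod Lv l = 0 --> (\<forall>\<sigma>\<in>slot_if l (spc l) (wk l \<tau>) - slot_if l (spc l) (wk l \<tau> - 1). good w ord s' \<sigma> rk)"
      "keeps ({walker l} \<union> slot_if l (spc l) (wk l \<tau> - 1) \<union> (if \<tau> mod Lv l = 0 then slot_if l (spc l) (wk l \<tau>) else {})) st s'"
  shows "level_ok w ord e s' l (Suc \<tau>)"
  unfolding level_ok_def
proof (intro conjI allI impI)
  fix q assume q: "valid l (Suc \<tau>) q & e <= q * d ^ l"
  let ?sp = "spc l"
  note v = valid_Suc[OF conjunct1[OF q]]
  have qd: "q * d ^ l = q * ?sp * un l" using Lv_spc(3)[of l] by (simp add: mult.assoc)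
  have wkge: "Suc \<tau> <= wk l \<tau> - 1" "wk l \<tau> - 1 <= Uv l \<tau> + Lv l" "wk l \<tau> <= Uv l \<tau> + Lv l" "Suc \<tau> <= wk l \<tau>"
    using wk_ge[of l \<tau>] Uv_bounds(1)[of \<tau> l] by auto
  have sl: "slot_if l ?sp (q' * ?sp) = {slot l (q' mod dd)}" for q'
    using Lv_spc(2)[of l] by (simp add: slot_if_def)
  have ne: "slot l (q mod dd) \<notin> slot_if l ?sp p" if p: "Suc \<tau> <= p" "p <= Uv l \<tau> + Lv l" "q * ?sp \<noteq> p" for p
  proof
    assume a: "slot l (q mod dd) \<in> slot_if l ?sp p"
    then obtain q' where q': "p = q' * ?sp" by (auto simp: slot_if_def mult.commute elim!: dvdE split: if_splits)
    then have "slot l (q mod dd) = slot l (q' mod dd)" using a sl[of q'] by simp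
    then have "q mod dd = q' mod dd" using slot_eq dd by simp
    then show False using close_mod[of \<tau> q l q'] v p q' by auto
  qed
  show "good w ord s' (slot l (q mod dd)) (q * d ^ l - e)"
  proof (cases "q * ?sp = wk l \<tau> - 1")
    case True
    then have "good w ord s' (slot l (q mod dd)) (rk - un l)" using post(2) sl[of q] by simp
    moreover have "rk - un l = q * d ^ l - e" unfolding qd True rk by (simp add: diff_mult_distrib)
    ultimately show ?thesis by simp
  next
    case F1: False
    show ?thesis
    proof (cases "\<tau> mod Lv l = 0 & q * ?sp = wk l \<tau>")
      case True
      then have "slot l (q mod dd) \<in> slot_if l ?sp (wk l \<tau>) - slot_if l ?sp (wk l \<tau> - 1)"
        using sl[of q] ne[OF wkge(1,2) F1] by simp
      then have "good w ord s' (slot l (q mod dd)) rk" using bspec[OF mp[OF post(3) conjunct1[OF True]]] by blast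
      moreover have "rk = q * d ^ l - e" unfolding qd using True rk by simp
      ultimately show ?thesis by simp
    next
      case F2: False
      have old: "good w ord st (slot l (q mod dd)) (q * d ^ l - e)"
        using v(1) F1 F2 q ok by (auto simp: level_ok_def)
      have "slot l (q mod dd) \<notin> {walker l} \<union> slot_if l ?sp (wk l \<tau> - 1) \<union> (if \<tau> mod Lv l = 0 then slot_if l ?sp (wk l \<tau>) else {})"
        using ne[OF wkge(1,2) F1] ne[OF wkge(4,3)] F2 slot_walker[of "q mod dd" l l] dd by auto
      then show ?thesis using keeps_good[OF post(4) old sub] slot_less[of l "q mod dd"] l dd by auto
    qed
  qed
next
  assume "Suc \<tau> mod Lv l \<noteq> 0"
  then have "wk l (Suc \<tau>) = wk l \<tau> - 1" using Uv_Suc_same by (simp add: wk_def)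
  then have "wk l (Suc \<tau>) * un l - e = rk - un l" using rk by (simp add: diff_mult_distrib)
  then show "good w ord s' (walker l) (wk l (Suc \<tau>) * un l - e)" using post(1) by simp
qed

lemma level_keep:
  assumes ok: "level_ok w ord e st l' \<tau>'" and sub: "set ord \<subseteq> {..<n}" and l: "l' <= t" "l' \<noteq> l"
    and k: "keeps ({walker l} \<union> slot_if l sp p \<union> (if b then slot_if l sp p' else {})) st s'"
  shows "level_ok w ord e s' l' \<tau>'"
proof -
  let ?X = "{walker l} \<union> slot_if l sp p \<union> (if b then slot_if l sp p' else {})"
  have ne: "slot l' j \<notin> ?X" if "j < dd" for j
    using l slot_eq[OF that, of _ l' l] slot_walker[OF that, of l' l] dd by (auto simp: slot_if_def split: if_splits)
  have new: "walker l' \<notin> ?X"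
    using l walker_eq[of l' l] slot_walker[of _ l l', THEN not_sym] dd by (auto simp: slot_if_def split: if_splits)
  show ?thesis
    using ok keeps_good[OF k _ sub slot_less[of l'] ne] keeps_good[OF k _ sub walker_less[of l'] new] l dd
    unfolding level_ok_def by auto
qed

lemma top_keep:
  assumes k: "keeps ({walker l} \<union> slot_if l sp p \<union> (if b then slot_if l sp p' else {})) st s'" and l: "l <= t"
    and g: "\<forall>j<dd. good w ord st (slot (t + 1) j) n" and sub: "set ord \<subseteq> {..<n}"
  shows "\<forall>j<dd. good w ord s' (slot (t + 1) j) n"
proof (intro allI impI)
  fix j assume j: "j < dd"
  have "slot (t + 1) j \<notin> {walker l} \<union> slot_if l sp p \<union> (if b then slot_if l sp p' else {})"
    using l slot_eq[OF j, of _ "t + 1" l] slot_walker[OF j, of "t + 1" l] dd by (auto simp: slot_if_def split: if_splits)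
  then show "good w ord s' (slot (t + 1) j) n" using keeps_good[OF k _ sub] g j slot_less[of "t + 1" j] by auto
qed

text \<open>Levels are stepped in descending order, so level \<open>l + 1\<close> has clock
  \<open>Suc E\<close> already. Its phase ends at a multiple of \<open>Lv l\<close> beyond
  \<open>E\<close>. If the wanted position \<open>E + 2 * Lv l\<close> is not later than this end,
  it serves the current phase; otherwise the end is \<open>E + Lv l\<close>, and the walker, now at
  \<open>E + 2 * Lv l - 1\<close>, has just passed it.\<close>

lemma source_level:
  assumes ok: "level_ok w ord e st (l + 1) (Suc E)" and l: "1 <= l" and E: "E = e div d" "E mod Lv l = 0"
  shows "good w ord st (slot (l + 1) ((E div Lv l + 2) mod dd)) (2 * (Lv l * d) - e mod d)"
proof -
  let ?q = "E div Lv l + 2"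
  have sp: "spc (l + 1) = Lv l" using l d2 by (simp add: spc_def Lv_def)
  have El: "E div Lv l * Lv l = E" using E(2) by (simp add: mod_eq_0_iff_dvd)
  have qs: "?q * spc (l + 1) = E + 2 * Lv l" using El by (simp only: sp add_mult_distrib)
  have LL: "Lv l <= Lv (l + 1)" "Lv l dvd Lv (l + 1)" using Lv_spc(1)[of "l + 1"] sp d2 by auto
  have nz: "Suc E mod Lv (l + 1) \<noteq> 0"
  proof
    assume "Suc E mod Lv (l + 1) = 0"
    then have "Lv l dvd Suc E" using LL(2) by (meson dvd_trans mod_eq_0_iff_dvd)
    moreover have "Lv l dvd E" using E(2) by (simp add: mod_eq_0_iff_dvd)
    ultimately have "Lv l dvd 1" by (metis Suc_eq_plus1 dvd_add_right_iff)
    then show False using Lv_spc(4)[of l] by simp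
  qed
  let ?U = "Uv (l + 1) (Suc E)"
  have Ud: "Lv l dvd ?U" using Uv_bounds(3)[of "l + 1" "Suc E"] LL(2) dvd_trans by blast
  have vq: "valid (l + 1) (Suc E) ?q"
  proof (cases "E + 2 * Lv l <= ?U")
    case True
    then show ?thesis using Lv_spc(4)[of l] unfolding valid_def qs by auto
  next
    case False
    have "E < ?U" using Uv_bounds(1)[of "Suc E" "l + 1"] by simp
    moreover have "Lv l dvd ?U - E" using Ud E(2) by (simp add: mod_eq_0_iff_dvd)
    then obtain k where k: "?U - E = Lv l * k" by (auto elim: dvdE)
    moreover have "k < 2"
    proof (rule ccontr)
      assume "\<not> k < 2"
      then have "Lv l * 2 <= Lv l * k" by (intro mult_le_mono2) simp
      then show False using k False Lv_spc(4)[of l] by linarith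
    qed
    ultimately have "k = 1" by (cases k) auto
    then have U: "?U = E + Lv l" using k \<open>E < ?U\<close> by simp
    then have "wk (l + 1) (Suc E) <= E + 2 * Lv l" by (simp add: wk_def)
    then show ?thesis using nz U LL unfolding valid_def qs by auto
  qed
  have qd: "?q * d ^ (l + 1) = E * d + 2 * (Lv l * d)"
  proof -
    have "d ^ (l + 1) = Lv l * d" using l by (simp add: Lv_def)
    then have "?q * d ^ (l + 1) = ?q * Lv l * d" by (simp only: mult.assoc)
    also have "?q * Lv l = E + 2 * Lv l" using qs sp by simp
    finally show ?thesis by (simp add: algebra_simps)
  qed
  have ed: "e = E * d + e mod d" using E(1) by simp
  have lt: "e mod d < 2 * (Lv l * d)"
  proof -
    have "e mod d < d" using d2 by simp
    also have "d <= 2 * (Lv l * d)" using Lv_spc(4)[of l] by (cases "Lv l") auto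
    finally show ?thesis .
  qed
  have "?q * d ^ (l + 1) - e = 2 * (Lv l * d) - e mod d" "e <= ?q * d ^ (l + 1)" using qd ed lt by linarith+
  moreover from this(2) vq have "good w ord st (slot (l + 1) (?q mod dd)) (?q * d ^ (l + 1) - e)"
    using ok unfolding level_ok_def by blast
  ultimately show ?thesis by (simp only:)
qed

lemma source_base:
  assumes ok: "level_ok w ord e st 1 \<tau>" and E: "e mod d = 0" "\<tau> = e div d \<or> \<tau> = Suc (e div d)"
  shows "good w ord st (slot 1 ((e div d + 2) mod dd)) (2 * d)"
proof -
  let ?E = "e div d"
  have sp: "spc (Suc 0) = Suc 0" "Lv (Suc 0) = d" using d2 by (simp_all add: spc_def Lv_def)
  have "valid 1 \<tau> (?E + 2)"
    using E(2)
  proof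
    assume t: "\<tau> = ?E"
    show ?thesis
    proof (cases "?E + 2 <= Uv 1 ?E")
      case True then show ?thesis using t by (simp add: valid_def sp)
    next
      case False
      then have U: "Uv 1 ?E = ?E + 1" using Uv_bounds(1)[of ?E 1] by simp
      have "?E mod d \<noteq> 0" using Uv_start[of ?E 1] U sp d2 by auto
      then show ?thesis using U t d2 by (simp add: valid_def sp wk_def)
    qed
  next
    assume t: "\<tau> = Suc ?E"
    have "?E + 2 <= Uv 1 (Suc ?E)" using Uv_bounds(1)[of "Suc ?E" 1] by simp
    then show ?thesis using t by (simp add: valid_def sp)
  qed
  moreover have "e = ?E * d" using E(1) by (metis add.right_neutral div_mult_mod_eq)
  then have "(?E + 2) * d ^ 1 - e = 2 * d" "e <= (?E + 2) * d ^ 1" by (simp_all add: add_mult_distrib)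
  ultimately show ?thesis using ok unfolding level_ok_def by metis
qed

text \<open>Levels above the pointer \<open>p\<close> have made their step of the current block, the
  others have not; level 0 runs on its own clock. Level \<open>t + 1\<close> keeps rank
  \<open>n\<close>, hence the empty interior.\<close>

definition levels :: "(nat => nat => ereal) => nat list => nat => nat => nat => state => bool" where
  "levels w ord e \<tau> p st \<longleftrightarrow> (\<forall>l\<le>t. level_ok w ord e st l (if l = 0 then \<tau> else e div d + of_bool (p < l))) &
    (\<forall>j<dd. good w ord st (slot (t + 1) j) n)"

lemma levelsD:
  "levels w ord e \<tau> p st ==> l <= t ==> level_ok w ord e st l (if l = 0 then \<tau> else e div d + of_bool (p < l))"
  by (simp add: levels_def)

text \<open>Each deletion moves the pointer down by \<open>t div d + 1\<close>. Within a block this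
  adds up to more than \<open>t\<close>, and truncation holds the pointer at 0 when the levels are
  done early.\<close>

definition ptr_of :: "nat => nat" where "ptr_of e = t - (t div d + 1) * (e mod d)"

definition pinv :: "(nat => nat => ereal) => nat list => nat => state => bool" where
  "pinv w ord e st \<longleftrightarrow> gregs st & data w ord st & ireg st 8 = e & e < 2 * d ^ (t + 2) & ireg st 9 = ptr_of e &
    levels w ord e e (ptr_of e) st"

text \<open>Used for level \<open>t\<close>, whose walker starts at a rank of at least
  \<open>n\<close> and may take the matrix of rank \<open>n\<close>.\<close>

lemma matrix_beyond:
  assumes "matrix w ord st \<sigma> r" "length ord <= r" "length ord <= r'"
  shows "matrix w ord st \<sigma> r'"
  using assms by (simp add: matrix_def)

lemma Lv_le: "l <= t ==> Lv l * un l <= d ^ (t + 1)"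
proof -
  assume l: "l <= t"
  have "Lv l * un l = d ^ (max 1 (l + 1))" by (auto simp: Lv_def un_def)
  also have "\<dots> <= d ^ (t + 1)" using l d2 by (intro power_increasing) auto
  finally show ?thesis .
qed

section \<open>One tick of one level\<close>

lemma step_bounds:
  assumes l: "l <= t" and \<tau>: "\<tau> * un l <= e" "e < 2 * d ^ (t + 2)"
  shows "2 * ((\<tau> div Lv l + 1) * Lv l) < W" "2 * (Lv l * un l) < W" "\<tau> div Lv l + 2 < W" "\<tau> < W" "wk l \<tau> * un l < W"
proof -
  have u1: "1 <= un l" using d2 by (auto simp: un_def)
  have dle: "d ^ (t + 1) <= d ^ (t + 2)" using d2 by (intro power_increasing) auto
  have L: "Lv l * un l <= d ^ (t + 2)" using Lv_le[OF l] dle by linarith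
  have te: "\<tau> <= \<tau> * un l" "Lv l <= Lv l * un l" using u1 by simp_all
  have U: "Uv l \<tau> <= \<tau> + Lv l" by (rule Uv_bounds(2))
  show "2 * ((\<tau> div Lv l + 1) * Lv l) < W" using U te \<tau> L MW unfolding Uv_def by linarith
  show "2 * (Lv l * un l) < W" using L MW by linarith
  have "\<tau> div Lv l <= \<tau>" by (rule div_le_dividend)
  then show "\<tau> div Lv l + 2 < W" "\<tau> < W" using te \<tau> MW by linarith+
  have "wk l \<tau> <= 2 * (\<tau> + Lv l)" using U by (simp add: wk_def)
  then have "wk l \<tau> * un l <= 2 * (\<tau> + Lv l) * un l" by (intro mult_le_mono1)
  also have "\<dots> = 2 * (\<tau> * un l) + 2 * (Lv l * un l)" by (simp add: algebra_simps)
  finally show "wk l \<tau> * un l < W" using \<tau> L MW by linarith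
qed

text \<open>The walker is at least two ticks ahead of \<open>\<tau>\<close>, whereas
  \<open>e\<close> lies within tick \<open>\<tau>\<close>; so neither its rank nor the next one
  suffers from truncated subtraction.\<close>

lemma wk_big:
  assumes "e < (\<tau> + 1) * un l"
  shows "un l + e <= wk l \<tau> * un l"
proof -
  have "\<tau> + 2 <= wk l \<tau>" using wk_ge(1)[of l \<tau>] Uv_bounds(1)[of \<tau> l] by linarith
  then have "(\<tau> + 2) * un l <= wk l \<tau> * un l" by (rule mult_le_mono1)
  then show ?thesis using assms by (simp add: algebra_simps)
qed

lemma start_rank:
  assumes "\<tau> mod Lv l = 0" "e = \<tau> * un l + e mod d"
  shows "wk l \<tau> * un l - e = 2 * (Lv l * un l) - e mod d"
proof -
  have "wk l \<tau> = \<tau> + 2 * Lv l" using Uv_start[OF assms(1)] by (simp add: wk_def)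
  then have "wk l \<tau> * un l = \<tau> * un l + 2 * (Lv l * un l)" by (simp add: algebra_simps)
  then show ?thesis using assms(2) by linarith
qed

lemma wp_step_at:
  assumes w: "weights w" and g: "gregs st" "data w ord st"
    and r: "ireg st 140 = l" "ireg st 141 = \<tau>" "ireg st 142 = Lv l" "ireg st 143 = un l" "ireg st 8 = e"
    and l: "l <= t" and e: "e < 2 * d ^ (t + 2)" "\<tau> * un l <= e" "e < (\<tau> + 1) * un l"
    and ok: "level_ok w ord e st l \<tau>" and others: "\<And>l'. l' <= t ==> l' \<noteq> l ==> level_ok w ord e st l' (T l')"
    and top: "\<forall>j<dd. good w ord st (slot (t + 1) j) n"
    and src: "\<tau> mod Lv l = 0 ==> matrix w ord st (slot (l + 1) ((\<tau> div Lv l + 2) mod dd)) (wk l \<tau> * un l - e) & e = \<tau> * un l + e mod d"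
  shows "wp W step st (%t' s'. t' <= step_time & level_ok w ord e s' l (Suc \<tau>) &
     (\<forall>l'\<le>t. l' \<noteq> l --> level_ok w ord e s' l' (T l')) & (\<forall>j<dd. good w ord s' (slot (t + 1) j) n))"
proof -
  have sub: "set ord \<subseteq> {..<n}" using g by (simp add: data_def)
  note sb = step_bounds[OF l e(2,1)]
  note wb = wk_big[OF e(3)]
  have ud: "un l <= d" using d2 by (simp add: un_def)
  have pos: "wk l \<tau> = 2 * ((\<tau> div Lv l + 1) * Lv l) - \<tau>" by (simp add: wk_def Uv_def)
  have L0: "0 < Lv l" using Lv_spc(4)[of l] by simp
  define rk where "rk = wk l \<tau> * un l - e"
  have "wp W step st (%t' s'. t' <= step_time & good w ord s' (walker l) (rk - un l) &
     (\<forall>\<sigma>\<in>slot_if l (spc l) (wk l \<tau> - 1). good w ord s' \<sigma> (rk - un l)) &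
     (\<tau> mod Lv l = 0 --> (\<forall>\<sigma>\<in>slot_if l (spc l) (wk l \<tau>) - slot_if l (spc l) (wk l \<tau> - 1). good w ord s' \<sigma> rk)) &
     keeps ({walker l} \<union> slot_if l (spc l) (wk l \<tau> - 1) \<union> (if \<tau> mod Lv l = 0 then slot_if l (spc l) (wk l \<tau>) else {})) st s')"
  proof (rule wp_step[OF w g r l L0 Lv_spc(6) ud sb(1-4) pos spc_def])
    show "matrix w ord st (slot (l + 1) ((\<tau> div Lv l + 2) mod dd)) rk & rk = 2 * (Lv l * un l) - e mod d" if "\<tau> mod Lv l = 0"
      using src[OF that] start_rank[OF that conjunct2[OF src[OF that]]] unfolding rk_def by blast
    show "good w ord st (walker l) rk" if "\<tau> mod Lv l \<noteq> 0" using ok that by (simp add: level_ok_def rk_def)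
    show "un l <= rk" using wb by (simp add: rk_def)
    show "rk < W" using sb(5) by (simp add: rk_def)
  qed
  then show ?thesis
  proof (rule wp_mono)
    fix t' s'
    assume a: "t' <= step_time & good w ord s' (walker l) (rk - un l) &
     (\<forall>\<sigma>\<in>slot_if l (spc l) (wk l \<tau> - 1). good w ord s' \<sigma> (rk - un l)) &
     (\<tau> mod Lv l = 0 --> (\<forall>\<sigma>\<in>slot_if l (spc l) (wk l \<tau>) - slot_if l (spc l) (wk l \<tau> - 1). good w ord s' \<sigma> rk)) &
     keeps ({walker l} \<union> slot_if l (spc l) (wk l \<tau> - 1) \<union> (if \<tau> mod Lv l = 0 then slot_if l (spc l) (wk l \<tau>) else {})) st s'"
    then have k: "keeps ({walker l} \<union> slot_if l (spc l) (wk l \<tau> - 1) \<union> (if \<tau> mod Lv l = 0 then slot_if l (spc l) (wk l \<tau>) else {})) st s'"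
      by blast
    have "level_ok w ord e s' l (Suc \<tau>)"
      using a by (elim conjE) (rule level_step[OF ok sub l rk_def wb]; assumption)
    moreover have "\<forall>l'\<le>t. l' \<noteq> l --> level_ok w ord e s' l' (T l')"
      using level_keep[OF others sub _ _ k] by blast
    moreover have "\<forall>j<dd. good w ord s' (slot (t + 1) j) n" by (rule top_keep[OF k l top sub])
    ultimately show "t' <= step_time & level_ok w ord e s' l (Suc \<tau>) &
     (\<forall>l'\<le>t. l' \<noteq> l --> level_ok w ord e s' l' (T l')) & (\<forall>j<dd. good w ord s' (slot (t + 1) j) n)" using a by blast
  qed
qed

lemma div_d: "e div d * d <= e" "e < (e div d + 1) * d" "e = e div d * d + e mod d"
proof -
  show *: "e = e div d * d + e mod d" by (rule div_mult_mod_eq[symmetric])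
  have "e mod d < d" using d2 by simp
  then show "e div d * d <= e" "e < (e div d + 1) * d" using * unfolding add_mult_distrib mult_1 by linarith+
qed

lemma wp_step_level:
  assumes w: "weights w" and g: "gregs st" "data w ord st" and r: "ireg st 8 = e" "ireg st 9 = p"
    and e: "e < 2 * d ^ (t + 2)" "p <= t" and lv: "levels w ord e e p st"
  shows "wp W step_level st (%t' s'. t' <= step_time + 10 & ireg s' 9 = p - 1 & levels w ord e e (p - 1) s')"
proof (cases "p = 0")
  case True
  then show ?thesis using lv unfolding step_level_def by (simp add: r gregsD[OF g(1)])
next
  case False
  define s0 where "s0 = set_i 143 d (set_i 142 (d ^ p) (set_i 141 (e div d) (set_i 140 p st)))"
  have sm: "same {140, 141, 142, 143} {} {} {} st s0" by (auto simp: same_def s0_def)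
  have g0: "gregs s0" "data w ord s0" by (rule gregs_same[OF g(1) sm], simp_all, rule data_same[OF g(2) sm], simp_all)
  have Lp: "Lv p = d ^ p" "un p = d" using False by (simp_all add: Lv_def un_def)
  have ge: "good w ord s0 \<sigma> r \<longleftrightarrow> good w ord st \<sigma> r" for \<sigma> r by (simp add: good_def matrix_def s0_def)
  have oke: "level_ok w ord e s0 l \<tau> \<longleftrightarrow> level_ok w ord e st l \<tau>" for l \<tau> by (simp add: level_ok_def ge)
  let ?T = "%l'. if l' = 0 then e else e div d + of_bool (p < l')"
  have step: "wp W step s0 (%t' s'. t' <= step_time & level_ok w ord e s' p (Suc (e div d)) &
     (\<forall>l'\<le>t. l' \<noteq> p --> level_ok w ord e s' l' (?T l')) & (\<forall>j<dd. good w ord s' (slot (t + 1) j) n))"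
  proof (rule wp_step_at[OF w g0])
    show "ireg s0 140 = p" "ireg s0 141 = e div d" "ireg s0 142 = Lv p" "ireg s0 143 = un p" "ireg s0 8 = e"
      using r by (simp_all add: s0_def Lp)
    show "p <= t" "e < 2 * d ^ (t + 2)" by fact+
    show "e div d * un p <= e" "e < (e div d + 1) * un p" using div_d[of e] by (simp_all only: Lp)
    show "level_ok w ord e s0 p (e div d)" using lv e False by (auto simp: oke levels_def)
    show "level_ok w ord e s0 l' (?T l')" if "l' <= t" "l' \<noteq> p" for l' using lv that by (auto simp: oke levels_def)
    show "\<forall>j<dd. good w ord s0 (slot (t + 1) j) n" using lv by (simp add: ge levels_def)
    assume m0: "e div d mod Lv p = 0"
    have ee: "e = e div d * un p + e mod d" using div_d(3)[of e] by (simp only: Lp)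
    have rk: "wk p (e div d) * un p - e = 2 * (Lv p * d) - e mod d" using start_rank[OF m0 ee] by (simp only: Lp)
    have jd: "(e div d div Lv p + 2) mod dd < dd" using dd by simp
    have "matrix w ord s0 (slot (p + 1) ((e div d div Lv p + 2) mod dd)) (2 * (Lv p * d) - e mod d)"
    \<comment> \<open>Level \<open>t\<close> restarts from the edge weights: its initial rank is at
      least \<open>n\<close>, as \<open>n <= d ^ t\<close>.\<close>
    proof (cases "p = t")
      case True
      have m: "matrix w ord s0 (slot (t + 1) ((e div d div Lv p + 2) mod dd)) n"
        using lv jd by (simp add: levels_def good_def matrix_def s0_def)
      have len: "length ord <= n" using data_length[OF g(2)] .
      have "n <= Lv p" using n_le True unfolding Lp by simp
      moreover have "Lv p <= Lv p * d" using d2 by simp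
      moreover have "e mod d < d" using d2 by simp
      moreover have "d <= Lv p * d" using Lv_spc(4)[of p] by (cases "Lv p") auto
      ultimately have "n <= 2 * (Lv p * d) - e mod d" by linarith
      then show ?thesis using matrix_beyond[OF m] len True by simp
    next
      case F: False
      then have "level_ok w ord e st (p + 1) (Suc (e div d))" using levelsD[OF lv, of "p + 1"] e by simp
      from source_level[OF this _ refl m0] False show ?thesis by (simp add: good_def matrix_def s0_def)
    qed
    then show "matrix w ord s0 (slot (p + 1) ((e div d div Lv p + 2) mod dd)) (wk p (e div d) * un p - e) & e = e div d * un p + e mod d"
      using rk ee by (simp only: simp_thms)
  qed
  have sub: "p - 1 < l' \<longleftrightarrow> p <= l'" for l' using False by linarith
  have "wp W (step ;; IOp Sub 9 9 2) s0 (%t' s'. t' + 6 <= step_time + 10 & ireg s' 9 = p - 1 & levels w ord e e (p - 1) s')"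
    unfolding wp_Seq
  proof (rule wp_same[OF step step_mods'])
    fix t' s' assume a: "t' <= step_time & level_ok w ord e s' p (Suc (e div d)) &
       (\<forall>l'\<le>t. l' \<noteq> p --> level_ok w ord e s' l' (?T l')) & (\<forall>j<dd. good w ord s' (slot (t + 1) j) n)"
      and f: "same step_regs {10, 11, 12, 13, 20} {1, 3, 5, 6, 7, 8, 9, 10} {3, 6, 8, 9, 10} s0 s'"
    have e9: "ireg s' 9 = p" "ireg s' 2 = 1" using f r gregsD[OF g(1)] by (auto simp: same_def s0_def step_regs_def)
    have oke': "level_ok w ord e (set_i 9 x s') l \<tau> \<longleftrightarrow> level_ok w ord e s' l \<tau>" for l \<tau> x by (simp add: level_ok_def good_def matrix_def)
    have "levels w ord e e (p - 1) (set_i 9 (p - 1) s')"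
      unfolding levels_def oke'
    proof (intro conjI allI impI)
      fix l assume l: "l <= t"
      show "level_ok w ord e s' l (if l = 0 then e else e div d + of_bool (p - 1 < l))"
      proof (cases "l = p")
        case True then show ?thesis using a False by simp
      next
        case F: False
        then have eq: "(p - 1 < l) = (p < l)" using False by linarith
        have "level_ok w ord e s' l (if l = 0 then e else e div d + of_bool (p < l))" using a l F by blast
        then show ?thesis unfolding eq .
      qed
    next
      fix j assume "j < dd" then show "good w ord (set_i 9 (p - 1) s') (slot (t + 1) j) n" using a by (simp add: good_def matrix_def)
    qed
    moreover have "p - 1 < W" using e(2) slotsW' by (simp add: less_imp_diff_less)
    ultimately show "wp W (IOp Sub 9 9 2) s' (%t2 s2. t' + t2 + 6 <= step_time + 10 & ireg s2 9 = p - 1 & levels w ord e e (p - 1) s2)"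
      using a by (simp add: e9)
  qed
  moreover have "e div d < W" using div_le_dividend[of e d] e(1) MW by linarith
  moreover have "iarr st 2 p = d ^ p" using gregsD(10)[OF g(1) e(2)] .
  ultimately show ?thesis
    unfolding step_level_def wp_If wp_Seq[of _ "IMove 140 9"] wp_Seq[of _ "IOp Div 141 8 5"] wp_Seq[of _ "ILoad 142 2 9"] wp_Seq[of _ "IMove 143 5"]
    using False by (simp add: r gregsD[OF g(1)] s0_def del: wp_Seq) (erule wp_mono, simp)
qed

lemma wp_step_levels:
  assumes w: "weights w" and g: "gregs st" "data w ord st" and r: "ireg st 8 = e" "ireg st 9 = ptr_of e"
    and e: "e < 2 * d ^ (t + 2)" and lv: "levels w ord e e (ptr_of e) st"
  shows "wp W (For 170 7 step_level) st (%t' s'. t' <= (t div d + 1) * (step_time + 12) + 2 &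
    ireg s' 9 = ptr_of e - (t div d + 1) & levels w ord e e (ptr_of e - (t div d + 1)) s')"
proof -
  let ?c = "t div d + 1"
  let ?I = "%i s1. ireg s1 9 = ptr_of e - i & levels w ord e e (ptr_of e - i) s1"
  have nin: "a \<notin> iw step_level" if "a \<in> {2, 7, 8, 170}" for a using step_level_mods(1) that by (auto simp: step_regs_def)
  have "t + 2 <= (t + 2) * (2 * d + 1)" by simp
  then have cW: "?c < W" using div_le_dividend[of t d] slotsW' by linarith
  have "wp W (For 170 7 step_level) st (%t' s'. t' <= ?c * (step_time + 10 + 2) + 2 & ?I ?c s' & ireg s' 170 = ?c &
    loop_frame 170 step_level st s')"
  proof (rule wp_For_const[where I = ?I])
    fix i s1 assume i: "i < ?c" "?I i s1" "ireg s1 170 = i"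
      and sm: "loop_frame 170 step_level st s1"
    have sm': "same (insert 170 (step_regs \<union> {9, 140, 141, 142, 143})) {10, 11, 12, 13, 20} {1, 3, 5, 6, 7, 8, 9, 10} {3, 6, 8, 9, 10} st s1"
      by (rule same_mono[OF sm]) (use step_level_mods in auto)
    have g1: "gregs s1" by (rule gregs_same[OF g(1) sm']) (auto simp: step_regs_def)
    have d1: "data w ord s1" by (rule data_same[OF g(2) sm']) (auto simp: step_regs_def)
    have e1: "ireg s1 8 = e" using sm' r by (auto simp: same_def step_regs_def)
    have pt: "ptr_of e - i <= t" by (simp add: ptr_of_def)
    have lv': "levels w ord e e p (set_i 170 x s2) \<longleftrightarrow> levels w ord e e p s2" for p x s2
      by (simp add: levels_def level_ok_def good_def matrix_def)
    show "wp W step_level s1 (%t s2. t <= step_time + 10 & ?I (Suc i) (set_i 170 (Suc i) s2))"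
      by (rule wp_mono[OF wp_step_level[OF w g1 d1 e1 conjunct1[OF i(2)] e pt conjunct2[OF i(2)]]]) (simp add: lv')
  next
    show "?I 0 (set_i 170 0 st)" using r lv by (simp add: levels_def level_ok_def good_def matrix_def)
  qed (use nin cW gregsD[OF g(1)] in auto)
  then show ?thesis by (rule wp_mono) (simp add: add.commute)
qed

lemma wp_step_base:
  assumes w: "weights w" and g: "gregs st" "data w ord st" and r: "ireg st 8 = e"
    and e: "e < 2 * d ^ (t + 2)" and lv: "levels w ord e e p st"
  shows "wp W step_base st (%t' s'. t' <= step_time + 4 & levels w ord e (Suc e) p s')"
proof -
  define s0 where "s0 = set_i 143 1 (set_i 142 d (set_i 141 e (set_i 140 0 st)))"
  have sm: "same {140, 141, 142, 143} {} {} {} st s0" by (auto simp: same_def s0_def)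
  have g0: "gregs s0" "data w ord s0" by (rule gregs_same[OF g(1) sm], simp_all, rule data_same[OF g(2) sm], simp_all)
  have L0: "Lv 0 = d" "un 0 = 1" by (simp_all add: Lv_def un_def)
  have ge: "good w ord s0 \<sigma> r \<longleftrightarrow> good w ord st \<sigma> r" for \<sigma> r by (simp add: good_def matrix_def s0_def)
  have oke: "level_ok w ord e s0 l \<tau> \<longleftrightarrow> level_ok w ord e st l \<tau>" for l \<tau> by (simp add: level_ok_def ge)
  let ?T = "%l'. if l' = 0 then e else e div d + of_bool (p < l')"
  have step: "wp W step s0 (%t' s'. t' <= step_time & level_ok w ord e s' 0 (Suc e) &
     (\<forall>l'\<le>t. l' \<noteq> 0 --> level_ok w ord e s' l' (?T l')) & (\<forall>j<dd. good w ord s' (slot (t + 1) j) n))"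
  proof (rule wp_step_at[OF w g0])
    show "ireg s0 140 = 0" "ireg s0 141 = e" "ireg s0 142 = Lv 0" "ireg s0 143 = un 0" "ireg s0 8 = e"
      using r by (simp_all add: s0_def L0)
    show "e * un 0 <= e" "e < (e + 1) * un 0" by (simp_all add: L0)
    show "level_ok w ord e s0 0 e" using lv by (auto simp: oke levels_def)
    show "level_ok w ord e s0 l' (?T l')" if "l' <= t" "l' \<noteq> 0" for l' using lv that by (auto simp: oke levels_def)
    show "\<forall>j<dd. good w ord s0 (slot (t + 1) j) n" using lv by (simp add: ge levels_def)
    assume m0: "e mod Lv 0 = 0"
    then have md: "e mod d = 0" by (simp add: L0)
    have ee: "e = e * un 0 + e mod d" using md by (simp add: L0)
    have rk: "wk 0 e * un 0 - e = 2 * d" using start_rank[OF m0 ee] md by (simp add: L0)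
    have "level_ok w ord e st 1 (if (1::nat) = 0 then e else e div d + of_bool (p < 1))" using lv t1 unfolding levels_def by blast
    then have "level_ok w ord e st 1 (e div d + of_bool (p < 1))" by simp
    from source_base[OF this md] have "good w ord st (slot 1 ((e div d + 2) mod dd)) (2 * d)" by auto
    then show "matrix w ord s0 (slot (0 + 1) ((e div Lv 0 + 2) mod dd)) (wk 0 e * un 0 - e) & e = e * un 0 + e mod d"
      using ee unfolding rk by (simp add: good_def matrix_def s0_def L0)
  qed (use e in auto)
  have "wp W step s0 (%t' s'. t' <= step_time & levels w ord e (Suc e) p s')"
    by (rule wp_mono[OF step]) (auto simp: levels_def)
  moreover have "0 < W" "Suc 0 < W" using bounds by auto
  ultimately show ?thesis unfolding step_base_def
    by (simp add: r gregsD[OF g(1)] s0_def)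
qed

text \<open>Removing the head of the order while lowering the rank leaves \<open>drop r\<close>
  unchanged, so the entries stay as they are.\<close>

lemma level_pop:
  assumes ok: "level_ok w (v # vs) e st l \<tau>" and l: "l <= t" and wb: "\<tau> mod Lv l \<noteq> 0 ==> e < wk l \<tau> * un l"
    and rk: "\<forall>\<sigma><(t + 1) * sd. iarr s' 1 \<sigma> = iarr st 1 \<sigma> - 1" and F: "warr s' 3 = warr st 3"
  shows "level_ok w vs (Suc e) s' l \<tau>"
proof -
  have g: "good w vs s' \<sigma> (r - 1)" if "good w (v # vs) st \<sigma> r" "1 <= r" "\<sigma> < (t + 1) * sd" for \<sigma> r
    using that rk by (cases r) (auto simp: good_def matrix_def F)
  have sl: "slot l j < (t + 1) * sd" "walker l < (t + 1) * sd" if "j < dd" for j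
    using mult_add_less[of l "t + 1" _ sd] l that dd by (auto simp: slot_def walker_def base_def)
  show ?thesis unfolding level_ok_def
  proof (intro conjI allI impI)
    fix q assume q: "valid l \<tau> q & Suc e <= q * d ^ l"
    then have "good w (v # vs) st (slot l (q mod dd)) (q * d ^ l - e)" using ok by (simp add: level_ok_def)
    moreover have "1 <= q * d ^ l - e" using q by linarith
    ultimately show "good w vs s' (slot l (q mod dd)) (q * d ^ l - Suc e)" using g[OF _ _ sl(1)] dd by fastforce
  next
    assume t: "\<tau> mod Lv l \<noteq> 0"
    then have "good w (v # vs) st (walker l) (wk l \<tau> * un l - e)" using ok by (simp add: level_ok_def)
    from g[OF this _ sl(2)[OF dd(2)]] wb[OF t] show "good w vs s' (walker l) (wk l \<tau> * un l - Suc e)" by simp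
  qed
qed

text \<open>On every level the period \<open>2 * d ^ (t + 2)\<close> is a whole number of phases,
  and it shifts \<open>q\<close> by the multiple \<open>k\<close> of the buffer size
  \<open>2 * d\<close>. The copies valid at the end of the period are therefore in the slots
  expected at its start. The wrap keeps the counter a word for update sequences of any
  length.\<close>

lemma level_wrap:
  assumes ok: "level_ok w ord (2 * d ^ (t + 2)) st l \<tau>" and l: "l <= t" and \<tau>: "\<tau> * un l = 2 * d ^ (t + 2)"
  shows "level_ok w ord 0 st l 0"
  unfolding level_ok_def
proof (intro conjI allI impI)
  let ?M = "2 * d ^ (t + 2)"
  fix q assume "valid l 0 q & 0 <= q * d ^ l"
  then have q: "q * spc l <= Lv l" by (auto simp: valid_def Uv_def)
  define k where "k = 2 * d ^ (t + 2 - l)"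
  have kM: "k * d ^ l = ?M" using l by (simp add: k_def flip: power_add)
  have un0: "0 < un l" using d2 by (simp add: un_def)
  have ks: "k * spc l = \<tau>"
  proof -
    have "k * spc l * un l = \<tau> * un l" using kM \<tau> Lv_spc(3)[of l] by (simp add: mult.assoc)
    then show ?thesis using un0 by simp
  qed
  have kd: "dd dvd k"
  proof -
    have "t + 2 - l = Suc (t + 1 - l)" using l by simp
    then show ?thesis by (simp add: k_def dd_def)
  qed
  have t0: "\<tau> mod Lv l = 0"
  proof -
    obtain j where "k = dd * j" using kd by (elim dvdE)
    then have "\<tau> = j * (dd * spc l)" using ks by (simp add: ac_simps)
    then show ?thesis unfolding Lv_spc(5) by simp
  qed
  have "valid l \<tau> (k + q)" unfolding valid_def add_mult_distrib ks Uv_start[OF t0] using q by simp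
  moreover have "?M <= (k + q) * d ^ l" "(k + q) * d ^ l - ?M = q * d ^ l" using kM by (simp_all add: add_mult_distrib)
  ultimately have "good w ord st (slot l ((k + q) mod dd)) (q * d ^ l)" using ok unfolding level_ok_def by metis
  moreover have "(k + q) mod dd = q mod dd" using kd by (auto elim!: dvdE)
  ultimately show "good w ord st (slot l (q mod dd)) (q * d ^ l - 0)" by simp
qed simp

lemma M_div: "2 * d ^ (t + 2) mod d = 0" "2 * d ^ (t + 2) div d * d = 2 * d ^ (t + 2)"
proof -
  have "d dvd 2 * d ^ (t + 2)" by (simp add: dvd_mult)
  then show "2 * d ^ (t + 2) mod d = 0" "2 * d ^ (t + 2) div d * d = 2 * d ^ (t + 2)" by simp_all
qed

section \<open>The deletion counter and the removal of the first vertex\<close>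

definition next_e :: "nat => nat" where "next_e e = (if Suc e = 2 * d ^ (t + 2) then 0 else Suc e)"

lemma ptr_of_0: "e mod d = 0 ==> ptr_of e = t" by (simp add: ptr_of_def)

lemma levels_pop:
  assumes lv: "levels w (v # vs) e (Suc e) (ptr_of e - (t div d + 1)) st" and e: "e < 2 * d ^ (t + 2)"
    and rk: "\<forall>\<sigma><(t + 1) * sd. iarr s' 1 \<sigma> = iarr st 1 \<sigma> - 1" "\<forall>\<sigma>\<ge>(t + 1) * sd. iarr s' 1 \<sigma> = iarr st 1 \<sigma>"
    and F: "warr s' 3 = warr st 3" and len: "length vs < n"
  shows "levels w vs (next_e e) (next_e e) (ptr_of (next_e e)) s'"
proof -
  let ?p = "ptr_of e - (t div d + 1)"
  have top: "\<forall>j<dd. good w vs s' (slot (t + 1) j) n"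
  proof (intro allI impI)
    fix j assume j: "j < dd"
    have "good w (v # vs) st (slot (t + 1) j) n" using lv j by (simp add: levels_def)
    moreover have "(t + 1) * sd <= slot (t + 1) j" by (simp add: slot_def base_def)
    ultimately show "good w vs s' (slot (t + 1) j) n" using rk(2) len by (simp add: good_def matrix_def F)
  qed
  define T where "T l = (if l = 0 then Suc e else e div d + of_bool (?p < l))" for l
  have Tu: "T l * un l <= Suc e \<or> e < T l * un l" "e < (T l + 1) * un l" for l
    using div_d[of e] by (auto simp: T_def un_def)
  have ok1: "level_ok w vs (Suc e) s' l (T l)" if l: "l <= t" for l
  proof (rule level_pop[OF _ l _ rk(1) F])
    show "level_ok w (v # vs) e st l (T l)" unfolding T_def by (rule levelsD[OF lv l])
    have "un l + e <= wk l (T l) * un l" by (rule wk_big[OF Tu(2)])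
    moreover have "1 <= un l" using d2 by (simp add: un_def)
    ultimately show "e < wk l (T l) * un l" by linarith
  qed
  \<comment> \<open>The clocks after the steps are those prescribed for \<open>Suc e\<close>. Inside
    a block only the pointer moves; at its end the pointer has arrived at 0, so all levels agree on
    \<open>Suc e div d\<close>, and the pointer is reset to \<open>t\<close>.\<close>
  have T': "T l = (if l = 0 then Suc e else Suc e div d + of_bool (ptr_of (Suc e) < l))" if l: "l <= t" for l
  proof (cases "Suc e mod d = 0")
    case True
    then have sd: "Suc e div d = Suc (e div d)" by (simp add: div_Suc)
    have "e mod d = d - 1" using True d2 by (metis One_nat_def diff_Suc_1 mod_Suc nat.simps(3))
    have "t < (t div d + 1) * d" using div_d(2)[of t] .
    moreover have "ptr_of e - (t div d + 1) = t - (t div d + 1) * d"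
    proof -
      have "(t div d + 1) * d = (t div d + 1) * (e mod d) + (t div d + 1)"
        using \<open>e mod d = d - 1\<close> d2 by (cases d) (auto simp: algebra_simps)
      then show ?thesis unfolding ptr_of_def by linarith
    qed
    ultimately have "?p = 0" by linarith
    then show ?thesis using ptr_of_0[OF True] l sd by (auto simp: T_def)
  next
    case False
    then have "Suc e div d = e div d" "Suc e mod d = Suc (e mod d)" by (auto simp: div_Suc mod_Suc split: if_splits)
    moreover from this(2) have "ptr_of (Suc e) = ?p" unfolding ptr_of_def by (simp add: algebra_simps)
    ultimately show ?thesis by (simp add: T_def)
  qed
  show ?thesis
  proof (cases "Suc e = 2 * d ^ (t + 2)")
    case False
    then show ?thesis using top ok1 T' by (simp add: levels_def next_e_def)
  next
    case True
    have ne: "next_e e = 0" using True by (simp add: next_e_def)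
    have pt: "ptr_of (Suc e) = t" unfolding True by (rule ptr_of_0[OF M_div(1)])
    have "level_ok w vs 0 s' l 0" if l: "l <= t" for l
    proof (rule level_wrap[OF _ l])
      show "level_ok w vs (2 * d ^ (t + 2)) s' l (T l)" using ok1[OF l] unfolding True .
      show "T l * un l = 2 * d ^ (t + 2)"
        using T'[OF l] pt l M_div(2) unfolding True by (auto simp: un_def)
    qed
    then show ?thesis using top by (simp add: levels_def ne ptr_of_0)
  qed
qed

definition pop_time :: nat where
  "pop_time = (t div d + 1) * (step_time + 12) + step_time + NS * 6 + n * 6 + 60"

lemma wp_pop_tail:
  assumes wo: "words_ok W st" and g: "gregs st" "data w (v # vs) st" and r: "ireg st 8 = e" "ireg st 9 = ptr_of e - (t div d + 1)"
    and e: "e < 2 * d ^ (t + 2)" and lv: "levels w (v # vs) e (Suc e) (ptr_of e - (t div d + 1)) st"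
  shows "wp W pop_tail st (%t' s'. t' <= NS * 6 + n * 6 + 30 & pinv w vs (next_e e) s')"
proof -
  let ?p = "ptr_of e - (t div d + 1)"
  have len: "length vs < n" using data_length[OF g(2)] by simp
  have eW: "Suc e < W" using e MW by linarith
  have ptr': "(if next_e e mod d = 0 then t else ?p) = ptr_of (next_e e)"
  proof (cases "next_e e mod d = 0")
    case True then show ?thesis by (simp add: ptr_of_0)
  next
    case False
    then have "next_e e = Suc e" by (auto simp: next_e_def split: if_splits)
    then have "Suc e mod d = Suc (e mod d)" using False by (auto simp: mod_Suc)
    then have "ptr_of (Suc e) = ?p" unfolding ptr_of_def by (simp add: algebra_simps)
    then show ?thesis using False \<open>next_e e = Suc e\<close> by simp
  qed
  have NSs: "NS - sd = (t + 1) * sd" by (simp add: NS_def sd_def)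
  have NSW': "(t + 1) * sd < W" using NSW NSs by linarith
  let ?Q = "%t' s'. t' <= NS * 6 + n * 6 + 20 & pinv w vs (next_e e) s'"
  have main: "wp W (For 172 173 lower_rank ;; For 172 10 shift_left) s0 ?Q"
    if sm0: "same {8, 9, 10, 171, 173} {} {} {} st s0"
      and s0r: "ireg s0 8 = next_e e" "ireg s0 9 = ptr_of (next_e e)" "ireg s0 10 = length vs" "ireg s0 173 = NS - sd" for s0
    unfolding wp_Seq
  proof -
    have g0: "gregs s0" by (rule gregs_same[OF g(1) sm0]) auto
    have s0a: "warr s0 = warr st" "iarr s0 = iarr st" using sm0 by (auto simp: same_def)
    let ?I = "%i s1. \<forall>\<sigma>. iarr s1 1 \<sigma> = (if \<sigma> < i then iarr st 1 \<sigma> - 1 else iarr st 1 \<sigma>)"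
    have l1: "wp W (For 172 173 lower_rank) s0 (%t' s'. t' <= (t + 1) * sd * (3 + 2) + 2 & ?I ((t + 1) * sd) s' & ireg s' 172 = (t + 1) * sd &
      loop_frame 172 lower_rank s0 s')"
    proof (rule wp_For_const[where I = ?I])
      fix i s1 assume i: "i < (t + 1) * sd" "?I i s1" "ireg s1 172 = i"
        and sm: "loop_frame 172 lower_rank s0 s1"
      have r2: "ireg s1 2 = 1" using sm gregsD[OF g0] by (simp add: same_def)
      have b: "iarr st 1 i - 1 < W" using wo by (simp add: words_ok_def less_imp_diff_less)
      have "wp W lower_rank s1 (%t' s2. t' <= 3 & iarr s2 1 = (iarr s1 1)(i := iarr st 1 i - 1))"
        unfolding lower_rank_def using i(2) b by (simp add: i(3) r2)
      then show "wp W lower_rank s1 (%t' s2. t' <= 3 & ?I (Suc i) (set_i 172 (Suc i) s2))"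
        by (rule wp_mono) (use i(2) in \<open>auto simp: less_Suc_eq\<close>)
    next
      show "?I 0 (set_i 172 0 s0)" by (simp add: s0a)
    qed (use NSW' NSs gregsD[OF g0] s0r in auto)
    show "wp W (For 172 173 lower_rank) s0 (%t1 s1. wp W (For 172 10 shift_left) s1 (%t2 s2. ?Q (t1 + t2) s2))"
    proof (rule wp_mono[OF l1])
      fix t1 s1
      assume a1: "t1 <= (t + 1) * sd * (3 + 2) + 2 & ?I ((t + 1) * sd) s1 & ireg s1 172 = (t + 1) * sd &
        loop_frame 172 lower_rank s0 s1"
      then have sm1: "loop_frame 172 lower_rank s0 s1" by blast
      have g1: "gregs s1" by (rule gregs_same[OF g0 sm1]) auto
      have e1: "ireg s1 10 = length vs" "ireg s1 8 = next_e e" "ireg s1 9 = ptr_of (next_e e)" "warr s1 = warr st" "iarr s1 0 = iarr st 0"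
        using sm1 s0r s0a by (auto simp: same_def)
      have o: "iarr st 0 (Suc j) = vs ! j" if "j < length vs" for j using g(2) that by (auto simp: data_def)
      let ?J = "%i s. (\<forall>j<i. iarr s 0 j = vs ! j) & (\<forall>j\<ge>i. iarr s 0 j = iarr st 0 j)"
      have l2: "wp W (For 172 10 shift_left) s1 (%t' s'. t' <= length vs * (3 + 2) + 2 & ?J (length vs) s' & ireg s' 172 = length vs &
        loop_frame 172 shift_left s1 s')"
      proof (rule wp_For_const[where I = ?J])
        fix i s2 assume i: "i < length vs" "?J i s2" "ireg s2 172 = i"
          and sm: "loop_frame 172 shift_left s1 s2"
        have r2: "ireg s2 2 = 1" using sm gregsD[OF g1] by (simp add: same_def)
        have oi: "iarr s2 0 (Suc i) = vs ! i" using i o by simp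
        have iW: "Suc i < W" using i len bounds by simp
        show "wp W shift_left s2 (%t' s3. t' <= 3 & ?J (Suc i) (set_i 172 (Suc i) s3))"
          unfolding shift_left_def using i(2) iW by (simp add: i(3) r2 oi less_Suc_eq)
      qed (use len bounds e1 gregsD[OF g1] in auto)
      show "wp W (For 172 10 shift_left) s1 (%t2 s2. ?Q (t1 + t2) s2)"
      proof (rule wp_mono[OF l2])
        fix t2 s2
        assume a2: "t2 <= length vs * (3 + 2) + 2 & ?J (length vs) s2 & ireg s2 172 = length vs &
          loop_frame 172 shift_left s1 s2"
        then have sm2: "loop_frame 172 shift_left s1 s2" by blast
        have g2: "gregs s2" by (rule gregs_same[OF g1 sm2]) auto
        have e2: "ireg s2 10 = length vs" "ireg s2 8 = next_e e" "ireg s2 9 = ptr_of (next_e e)" "warr s2 = warr st" "iarr s2 1 = iarr s1 1"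
          using sm2 e1 by (auto simp: same_def)
        have dat: "data w vs s2" using g(2) a2 e2 by (auto simp: data_def)
        have lvs: "levels w vs (next_e e) (next_e e) (ptr_of (next_e e)) s2"
          by (rule levels_pop[OF lv e]) (use a1 e2 len in auto)
        have ne: "next_e e < 2 * d ^ (t + 2)" using e d2 by (auto simp: next_e_def)
        have "NS = (t + 1) * sd + sd" by (simp add: NS_def sd_def)
        moreover have "t1 <= (t + 1) * sd * 5 + 2" "t2 <= length vs * 5 + 2" using a1 a2 by simp_all
        ultimately have "t1 + t2 <= NS * 6 + n * 6 + 20" using len by linarith
        then show "?Q (t1 + t2) s2" using g2 dat e2 lvs ne by (auto simp: pinv_def)
      qed
    qed
  qed
  have W0: "0 < W" "NS - sd < W" "length vs < W" "next_e e mod d < W"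
    using NSW len bounds less_trans[OF mod_less_divisor[OF d_pos] d_less] by auto
  have M: "ireg st 15 = 2 * d ^ (t + 2)" "ireg st 5 = d" "ireg st 6 = t" "ireg st 14 = NS" "ireg st 18 = sd" "ireg st 2 = 1" "ireg st 3 = 0"
    "ireg st 10 = Suc (length vs)"
    using gregsD[OF g(1)] g(2) by (simp_all add: sd_def data_def)
  let ?pre = "IOp Add 8 8 2 ;; If (IEq 8 15) (IConst 8 0) Skip ;; IOp Mod 171 8 5 ;; If (IEq 171 3) (IMove 9 6) Skip ;;
    IOp Sub 173 14 18 ;; IOp Sub 10 10 2"
  define N where "N = 2 * d ^ (t + 2)"
  have M': "ireg st 15 = N" and ne: "next_e e = (if Suc e = N then 0 else Suc e)" using M(1) by (simp_all add: N_def next_e_def)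
  have pre: "wp W ?pre st (%t1 s0. t1 <= 8 & same {8, 9, 10, 171, 173} {} {} {} st s0 &
      ireg s0 8 = next_e e & ireg s0 9 = ptr_of (next_e e) & ireg s0 10 = length vs & ireg s0 173 = NS - sd)"
    using W0 eW ptr' r unfolding ne
    by (simp add: M(2-) M' same_def split: if_splits)
  have "wp W pop_tail st Q \<longleftrightarrow> wp W (?pre ;; (For 172 173 lower_rank ;; For 172 10 shift_left)) st Q" for Q
    unfolding pop_tail_def by (simp only: wp_Seq add.assoc)
  moreover have "wp W (?pre ;; (For 172 173 lower_rank ;; For 172 10 shift_left)) st (%t' s'. t' <= NS * 6 + n * 6 + 30 & pinv w vs (next_e e) s')"
    unfolding wp_Seq[of _ ?pre]
  proof (rule wp_mono[OF pre])
    fix t1 :: nat and s1 assume a: "t1 <= 8 & same {8, 9, 10, 171, 173} {} {} {} st s1 &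
      ireg s1 8 = next_e e & ireg s1 9 = ptr_of (next_e e) & ireg s1 10 = length vs & ireg s1 173 = NS - sd"
    show "wp W (For 172 173 lower_rank ;; For 172 10 shift_left) s1 (%t2 s2. t1 + t2 <= NS * 6 + n * 6 + 30 & pinv w vs (next_e e) s2)"
      by (rule wp_mono[OF main]) (use a in auto)
  qed
  ultimately show ?thesis by blast
qed

theorem wp_pop:
  assumes w: "weights w" and wo: "words_ok W st" and p: "pinv w (v # vs) e st"
  shows "wp W pop st (%t' s'. t' <= pop_time & pinv w vs (next_e e) s')"
proof -
  have g: "gregs st" "data w (v # vs) st" and r: "ireg st 8 = e" "ireg st 9 = ptr_of e" and e: "e < 2 * d ^ (t + 2)"
    and lv: "levels w (v # vs) e e (ptr_of e) st" using p by (auto simp: pinv_def)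
  have nin: "same (insert 170 (step_regs \<union> {9, 140, 141, 142, 143})) {10, 11, 12, 13, 20} {1, 3, 5, 6, 7, 8, 9, 10} {3, 6, 8, 9, 10} st s1"
    if "frame (For 170 7 step_level) st s1" for s1
    by (rule same_mono[OF that]) (use step_level_mods in auto)
  have nin': "same (step_regs \<union> {140, 141, 142, 143}) {10, 11, 12, 13, 20} {1, 3, 5, 6, 7, 8, 9, 10} {3, 6, 8, 9, 10} s1 s2"
    if "frame step_base s1 s2" for s1 s2
    by (rule same_mono[OF that]) (use step_level_mods in auto)
  show ?thesis
    unfolding pop_def wp_Seq
  proof (rule wp_frame[OF wp_words_ok[OF wp_step_levels[OF w g r e lv] wo]])
    fix t1 s1
    assume a1: "(t1 <= (t div d + 1) * (step_time + 12) + 2 & ireg s1 9 = ptr_of e - (t div d + 1) &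
      levels w (v # vs) e e (ptr_of e - (t div d + 1)) s1) & words_ok W s1" and f1: "frame (For 170 7 step_level) st s1"
    note f1 = nin[OF f1]
    have g1: "gregs s1" by (rule gregs_same[OF g(1) f1]) (auto simp: step_regs_def)
    have d1: "data w (v # vs) s1" by (rule data_same[OF g(2) f1]) (auto simp: step_regs_def)
    have r1: "ireg s1 8 = e" using f1 r by (auto simp: same_def step_regs_def)
    have lv1: "levels w (v # vs) e e (ptr_of e - (t div d + 1)) s1" using a1 by blast
    show "wp W step_base s1 (%t1a s1. wp W pop_tail s1 (%t2 s2. t1 + (t1a + t2) <= pop_time & pinv w vs (next_e e) s2))"
    proof (rule wp_frame[OF wp_words_ok[OF wp_step_base[OF w g1 d1 r1 e lv1] conjunct2[OF a1]]])
      fix t2 s2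
      assume a2: "(t2 <= step_time + 4 & levels w (v # vs) e (Suc e) (ptr_of e - (t div d + 1)) s2) & words_ok W s2"
        and f2: "frame step_base s1 s2"
      note f2 = nin'[OF f2]
      have g2: "gregs s2" by (rule gregs_same[OF g1 f2]) (auto simp: step_regs_def)
      have d2: "data w (v # vs) s2" by (rule data_same[OF d1 f2]) (auto simp: step_regs_def)
      have r2: "ireg s2 8 = e" "ireg s2 9 = ptr_of e - (t div d + 1)" using f2 r1 a1 by (auto simp: same_def step_regs_def)
      show "wp W pop_tail s2 (%t2' s'. t1 + (t2 + t2') <= pop_time & pinv w vs (next_e e) s')"
        by (rule wp_mono[OF wp_pop_tail[OF conjunct2[OF a2] g2 d2 r2 e]]) (use a1 a2 in \<open>auto simp: pop_time_def\<close>)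
    qed
  qed
qed

end

section \<open>Insertions and deletions\<close>

definition write_cell :: com where
  "write_cell = IOp Add 181 180 182 ;; WLoad 20 3 181 ;; WStore 2 182 20"

text \<open>At level 0 the spacing is one deletion and slot numbers start at 0, so the copy of rank
  0, at absolute position \<open>e\<close>, is in slot \<open>e mod (2 * d)\<close>.\<close>

definition write_distances :: com where
  "write_distances = IOp Mod 180 8 17 ;; IOp Mul 180 180 16 ;; For 182 16 write_cell"

definition copy_edge :: com where
  "copy_edge = WLoad 20 0 182 ;; IOp Add 181 180 182 ;; WStore 4 181 20 ;; WLoad 20 1 182 ;;
    IOp Mul 181 182 0 ;; IOp Add 181 181 1 ;; WStore 4 181 20"

definition insertion :: com where
  "insertion = IOp Mul 180 1 0 ;; For 182 0 copy_edge ;; WStore 5 1 0 ;; IMove 100 1 ;; push ;; write_distances"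

definition compare_vertex :: com where
  "compare_vertex = ILoad 181 0 182 ;; If (IEq 181 1) (IMove 180 182) Skip"

definition pop_earlier :: com where
  "pop_earlier = ILoad 181 0 3 ;; IStore 4 182 181 ;; pop"

definition push_back :: com where
  "push_back = ILoad 100 4 182 ;; push"

text \<open>Integer array 4 remembers the vertices removed ahead of the deleted one. Their edges and
  predicted times are still in weight arrays 4 and 5, so that \<open>push\<close> restores each of
  them to its place in the order.\<close>

definition deletion :: com where
  "deletion = For 182 10 compare_vertex ;; For 182 180 pop_earlier ;; pop ;; For 182 180 push_back ;; write_distances"

lemma update_mods [simp]:
  "iw write_cell = {181}" "ww write_cell = {20}" "iaw write_cell = {}" "waw write_cell = {2}"
  "iw write_distances = {180, 181, 182}" "ww write_distances = {20}" "iaw write_distances = {}" "waw write_distances = {2}"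
  "iw copy_edge = {181}" "ww copy_edge = {20}" "iaw copy_edge = {}" "waw copy_edge = {4}"
  "iw compare_vertex = {180, 181}" "ww compare_vertex = {}" "iaw compare_vertex = {}" "waw compare_vertex = {}"
  by (auto simp: write_cell_def write_distances_def copy_edge_def compare_vertex_def)

definition pop_regs :: "nat set" where
  "pop_regs = step_regs \<union> {8, 9, 10} \<union> {140, 141, 142, 143} \<union> {170, 171, 172, 173, 174}"

lemma pop_mods':
  "iw pop \<subseteq> pop_regs" "ww pop \<subseteq> {10..<25}" "iaw pop \<subseteq> {0, 1, 3, 5, 6, 7, 8, 9, 10}" "waw pop \<subseteq> {3, 6, 8, 9, 10, 11, 12}"
proof -
  have "step_regs \<union> {9, 140, 141, 142, 143} \<subseteq> pop_regs" "step_regs \<union> {140, 141, 142, 143} \<subseteq> pop_regs" by (auto simp: pop_regs_def)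
  then have "iw step_level \<subseteq> pop_regs" "iw step_base \<subseteq> pop_regs" using step_level_mods(1,5) by (meson subset_trans)+
  moreover have "{170, 8, 171, 9, 173, 10, 172, 174} \<subseteq> pop_regs" by (simp add: pop_regs_def)
  ultimately show "iw pop \<subseteq> pop_regs" by (simp add: pop_def pop_tail_def)
  have "{10, 11, 12, 13, 20} \<subseteq> {10..<25::nat}" by simp
  then have "ww step_level \<subseteq> {10..<25}" "ww step_base \<subseteq> {10..<25}" using step_level_mods(2,6) by (meson subset_trans)+
  then show "ww pop \<subseteq> {10..<25}" by (simp add: pop_def pop_tail_def)
  show "iaw pop \<subseteq> {0, 1, 3, 5, 6, 7, 8, 9, 10}" using step_level_mods(3,7) by (simp add: pop_def pop_tail_def) blast
  show "waw pop \<subseteq> {3, 6, 8, 9, 10, 11, 12}" using step_level_mods(4,8) by (simp add: pop_def pop_tail_def) blast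
qed

lemma pop_regs_notin:
  "x \<notin> pop_regs" if "x \<in> {0, 1, 2, 3, 4, 5, 6, 7, 11, 12, 13, 14, 15, 16, 17, 18, 100, 180, 181, 182}"
  using that by (auto simp: pop_regs_def step_regs_def)

lemma push_regs_notin:
  "x \<notin> insert 10 (push_regs - {100})" if "x \<in> {0, 1, 2, 3, 4, 5, 6, 7, 8, 9, 11, 12, 13, 14, 15, 16, 17, 18, 100, 180, 181, 182}"
  using that by (auto simp: push_regs_def)

lemma update_mods':
  "iw pop_earlier \<subseteq> insert 181 pop_regs" "ww pop_earlier \<subseteq> {10..<25}" "iaw pop_earlier \<subseteq> {0, 1, 3, 4, 5, 6, 7, 8, 9, 10}"
  "waw pop_earlier \<subseteq> {3, 6, 8, 9, 10, 11, 12}"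
  "iw push_back \<subseteq> insert 100 (insert 10 (push_regs - {100}))" "ww push_back \<subseteq> {10..<25}"
  "iaw push_back \<subseteq> {0, 3, 5, 6, 7, 8, 9, 10, 11}" "waw push_back \<subseteq> {3, 6, 8, 9, 10, 11, 12}"
  using pop_mods' push_mods' by (simp_all add: pop_earlier_def push_back_def) blast+

lemma flag_kept:
  "frame insertion s s' ==> ireg s' 4 = ireg s 4" "frame deletion s s' ==> ireg s' 4 = ireg s 4 & warr s' 5 = warr s 5"
proof -
  have "4 \<notin> iw insertion" using push_mods'(1) push_regs_notin[of 4] by (auto simp: insertion_def)
  then show "frame insertion s s' ==> ireg s' 4 = ireg s 4" by (simp add: same_def)
  have "4 \<notin> iw deletion" "5 \<notin> waw deletion" using update_mods' pop_mods' pop_regs_notin[of 4] push_regs_notin[of 4]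
    by (auto simp: deletion_def)
  then show "frame deletion s s' ==> ireg s' 4 = ireg s 4 & warr s' 5 = warr s 5" by (simp add: same_def)
qed

context queue
begin

lemma good_weights_cong:
  assumes "good w ord st \<sigma> r" "\<And>x y. x \<in> set ord ==> y \<in> set ord ==> w x y = w' x y"
  shows "good w' ord st \<sigma> r"
proof -
  have "fw w (set (drop r ord)) x y = fw w' (set (drop r ord)) x y" if "x \<in> set ord" "y \<in> set ord" for x y
    using that by (intro fw_cong assms(2)) (auto dest: in_set_dropD)
  then show ?thesis using assms(1) by (simp add: good_def matrix_def)
qed

lemma levels_good:
  assumes "levels w ord e \<tau> p st" "\<And>\<sigma> r. \<sigma> < NS ==> good w ord st \<sigma> r ==> good w' ord' st' \<sigma> r"
  shows "levels w' ord' e \<tau> p st'"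
proof -
  have "level_ok w' ord' e st' l \<tau>'" if "level_ok w ord e st l \<tau>'" "l <= t" for l \<tau>'
    using that assms(2) slot_less[of l] walker_less[of l] mod_less_divisor[OF dd(2)] unfolding level_ok_def by simp
  then show ?thesis using assms slot_less[of "t + 1"] unfolding levels_def by simp
qed

text \<open>Only weights between vertices of \<open>ord\<close> matter. This permits the change from
  \<open>w\<close> to \<open>w'\<close>: an update alters weights at its own vertex, which is not
  yet, or no longer, in the order.\<close>

lemma pinv_transfer:
  assumes p: "pinv w ord e st"
    and r: "\<And>x. x \<in> {0, 2, 3, 5, 6, 7, 8, 9, 10, 11, 12, 13, 14, 15, 16, 17, 18} ==> ireg st' x = ireg st x"
    and a: "\<And>a. a \<in> {0, 1, 2} ==> iarr st' a = iarr st a" "warr st' 3 = warr st 3"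
    and w: "\<And>x y. x \<in> set ord ==> y \<in> set ord ==> warr st' 4 (x * n + y) = warr st 4 (x * n + y)"
      "\<And>x. x \<in> set ord ==> warr st' 5 x = warr st 5 x"
      "\<And>x y. x \<in> set ord ==> y \<in> set ord ==> w x y = w' x y"
  shows "pinv w' ord e st'"
proof -
  have g: "gregs st'" using p r a unfolding pinv_def gregs_def regs_def by simp
  have "sorted_wrt (%x y. warr st 5 x < warr st 5 y) ord" using p by (simp add: pinv_def data_def)
  then have s: "sorted_wrt (%x y. warr st' 5 x < warr st' 5 y) ord" using w(2) by (auto elim: sorted_wrt_mono_rel[rotated])
  then have dt: "data w' ord st'" using p r a w unfolding pinv_def data_def by simp
  have "good w' ord st' \<sigma> r" if "good w ord st \<sigma> r" for \<sigma> r
    using good_weights_cong[OF that w(3)] a(1)[of 1] a(2) unfolding good_def matrix_def by simp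
  then have "levels w' ord e e (ptr_of e) st'" using levels_good p unfolding pinv_def by blast
  then show ?thesis using g dt p r unfolding pinv_def by simp
qed

lemma pinv_same:
  assumes "pinv w ord e st" "same X Y A B st st'" "X \<inter> ({0, 2, 3} \<union> {5..18}) = {}" "A \<inter> {0, 1, 2} = {}" "B \<inter> {3, 4, 5} = {}"
  shows "pinv w ord e st'"
proof (rule pinv_transfer[OF assms(1)])
  fix x :: nat assume "x \<in> {0, 2, 3, 5, 6, 7, 8, 9, 10, 11, 12, 13, 14, 15, 16, 17, 18}"
  then have "x \<in> {0, 2, 3} \<union> {5..18}" by auto
  then have "x \<notin> X" using assms(3) by blast
  then show "ireg st' x = ireg st x" by (rule sameD(1)[OF assms(2)])
next
  fix a :: nat assume "a \<in> {0, 1, 2}"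
  then have "a \<notin> A" using assms(4) by blast
  then show "iarr st' a = iarr st a" by (rule sameD(3)[OF assms(2)])
next
  have B: "3 \<notin> B" "4 \<notin> B" "5 \<notin> B" using assms(5) by auto
  show "warr st' 3 = warr st 3" by (rule sameD(4)[OF assms(2) B(1)])
  show "warr st' 4 (x * n + y) = warr st 4 (x * n + y)" for x y using sameD(4)[OF assms(2) B(2)] by simp
  show "warr st' 5 x = warr st 5 x" for x using sameD(4)[OF assms(2) B(3)] by simp
qed simp

lemma wp_push_pinv:
  assumes w: "weights w" and p: "pinv w ord e st" and x: "x < n" "x \<notin> set ord" and r: "ireg st 100 = x"
    and wx: "warr st 4 (x * n + x) = w x x" "w x x = \<infinity>"
      "\<And>y. y \<in> set ord ==> warr st 4 (x * n + y) = w x y & warr st 4 (y * n + x) = w y x"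
    and pr: "\<And>y. y \<in> set ord ==> warr st 5 y \<noteq> warr st 5 x"
  shows "wp W push st (%t' s'. t' <= push_time & (\<exists>ord'. pinv w ord' e s' & set ord' = insert x (set ord)))"
proof -
  interpret push_call W n d m K lg t w ord x st
    by (intro push_call.intro push_call_axioms.intro pebbles_axioms) (use assms in \<open>auto simp: pinv_def\<close>)
  have g: "gregs st" and dt: "data w ord st" using p by (auto simp: pinv_def)
  have px: "pctx st" using g dt r by (auto simp: pctx_def data_def)
  show ?thesis
  proof (rule wp_frame[OF wp_push[OF px]])
    fix t' s' assume a: "t' <= push_time & data w ord' s' & (\<forall>\<sigma><NS. \<forall>r. good w ord st \<sigma> r --> good w ord' s' \<sigma> r)"
      and "frame push st s'"
    then have f: "same (insert 10 (push_regs - {100})) {10..<25} {0, 3, 5, 6, 7, 8, 9, 10, 11} {3, 6, 8, 9, 10, 11, 12} st s'"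
      using same_mono push_mods' by blast
    have "gregs s'" by (rule gregs_same[OF g f]) (use push_regs_notin in blast, simp)
    moreover have "ireg s' 8 = ireg st 8" "ireg s' 9 = ireg st 9" using f push_regs_notin by (auto simp: same_def)
    moreover have "levels w ord' e e (ptr_of e) s'" by (rule levels_good[of w ord _ _ _ st]) (use p a in \<open>auto simp: pinv_def\<close>)
    ultimately have "pinv w ord' e s'" using p a unfolding pinv_def by simp
    then show "t' <= push_time & (\<exists>ord'. pinv w ord' e s' & set ord' = insert x (set ord))" using a set_ord' by blast
  qed
qed

definition dist_time :: nat where "dist_time = n * n * 5 + 4"

lemma wp_write_distances:
  assumes p: "pinv w ord e st"
  shows "wp W write_distances st (%t' s'. t' <= dist_time & pinv w ord e s' &
    (\<forall>x\<in>set ord. \<forall>y\<in>set ord. warr s' 2 (x * n + y) = fw w (set ord) x y))"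
proof -
  have g: "gregs st" and dt: "data w ord st" and r: "ireg st 8 = e" and lv: "levels w ord e e (ptr_of e) st"
    using p by (auto simp: pinv_def)
  define \<sigma> where "\<sigma> = e mod dd"
  have \<sigma>: "\<sigma> < dd" "slot 0 \<sigma> = \<sigma>" using dd(2) by (simp_all add: \<sigma>_def slot_def base_def)
  then have sN: "\<sigma> < NS" using slot_less[of 0 \<sigma>] by simp
  have "spc 0 = 1" using d2 by (simp add: spc_def Lv_def)
  then have "valid 0 e e" using Uv_bounds(1)[of e 0] by (simp add: valid_def)
  moreover have "level_ok w ord e st 0 e" using levelsD[OF lv, of 0] by simp
  ultimately have "good w ord st \<sigma> 0" unfolding level_ok_def using \<sigma> by (force simp: \<sigma>_def)
  then have mt: "warr st 3 (\<sigma> * (n * n) + (x * n + y)) = fw w (set ord) x y" if "x \<in> set ord" "y \<in> set ord" for x y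
    using that by (simp add: good_def matrix_def)
  let ?s = "set_i 180 (\<sigma> * (n * n)) (set_i 180 \<sigma> st)"
  let ?I = "%i s. \<forall>q<i. warr s 2 q = warr st 3 (\<sigma> * (n * n) + q)"
  have loop: "wp W (For 182 16 write_cell) ?s (%t' s'. t' <= n * n * (3 + 2) + 2 & ?I (n * n) s' & ireg s' 182 = n * n &
      loop_frame 182 write_cell ?s s')"
  proof (rule wp_For_const[where I = ?I])
    fix i s1 assume i: "i < n * n" "?I i s1" "ireg s1 182 = i"
      and sm: "loop_frame 182 write_cell ?s s1"
    have h: "ireg s1 180 = \<sigma> * (n * n)" "warr s1 3 = warr st 3" using sm by (auto simp: same_def)
    have "\<sigma> * (n * n) + i < W" using i(1) slotW[OF sN] by linarith
    then show "wp W write_cell s1 (%t' s2. t' <= 3 & ?I (Suc i) (set_i 182 (Suc i) s2))"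
      unfolding write_cell_def using i(2) by (simp add: h i(3) less_Suc_eq)
  qed (use gregsD[OF g] n2 in auto)
  have sW: "\<sigma> < W" "\<sigma> * (n * n) < W" using slotW[OF sN] sN NSW by auto
  have m17: "ireg st 17 = dd" "ireg st 16 = n * n" using gregsD[OF g] by (auto simp: dd_def)
  have "wp W write_distances st (%t' s'. t' <= dist_time & (\<forall>q<n * n. warr s' 2 q = warr st 3 (\<sigma> * (n * n) + q)))"
    unfolding write_distances_def using sW m17 r
    by (simp add: \<sigma>_def[symmetric]) (rule wp_mono[OF loop], simp add: dist_time_def)
  then show ?thesis
  proof (rule wp_frame)
    fix t' s' assume a: "t' <= dist_time & (\<forall>q<n * n. warr s' 2 q = warr st 3 (\<sigma> * (n * n) + q))" and f: "frame write_distances st s'"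
    have "pinv w ord e s'" by (rule pinv_same[OF p f]) auto
    moreover have "warr s' 2 (x * n + y) = fw w (set ord) x y" if "x \<in> set ord" "y \<in> set ord" for x y
    proof -
      have "x < n" "y < n" using that dt by (auto simp: data_def)
      then have "x * n + y < n * n" by (intro mult_add_less)
      then show ?thesis using a mt[OF that] by simp
    qed
    ultimately show "t' <= dist_time & pinv w ord e s' & (\<forall>x\<in>set ord. \<forall>y\<in>set ord. warr s' 2 (x * n + y) = fw w (set ord) x y)"
      using a by simp
  qed
qed

definition ins_time :: nat where "ins_time = n * 9 + 2 + push_time + dist_time + 3"

text \<open>The entry of \<open>v\<close> with itself is written from both arrays, hence the premise
  that they agree there.\<close>

lemma wp_copy_edges:
  assumes r: "ireg st 0 = n" "ireg st 1 = v" "ireg st 2 = 1" "ireg st 180 = v * n" and v: "v < n" and eq: "warr st 0 v = warr st 1 v"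
  shows "wp W (For 182 0 copy_edge) st (%t' s'. t' <= n * 9 + 2 & (\<forall>a<n. \<forall>b<n. warr s' 4 (a * n + b) =
    (if a = v then warr st 0 b else if b = v then warr st 1 a else warr st 4 (a * n + b))))"
proof -
  let ?I = "%i s. \<forall>a<n. \<forall>b<n. warr s 4 (a * n + b) =
    (if a = v & b < i then warr st 0 b else if b = v & a < i then warr st 1 a else warr st 4 (a * n + b))"
  have "wp W (For 182 0 copy_edge) st (%t' s'. t' <= n * (7 + 2) + 2 & ?I n s' & ireg s' 182 = n &
      loop_frame 182 copy_edge st s')"
  proof (rule wp_For_const[where I = ?I])
    fix i s1 assume i: "i < n" "?I i s1" "ireg s1 182 = i"
      and sm: "loop_frame 182 copy_edge st s1"
    have h: "ireg s1 180 = v * n" "ireg s1 0 = n" "ireg s1 1 = v" "warr s1 0 = warr st 0" "warr s1 1 = warr st 1"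
      using sm r by (auto simp: same_def)
    have b: "v * n + i < W" "i * n + v < W" using mult_add_less[of v n i n] mult_add_less[of i n v n] i(1) v n2 by auto
    have "wp W copy_edge s1 (%t' s2. t' <= 7 & warr s2 4 = (warr s1 4)(v * n + i := warr st 0 i, i * n + v := warr st 1 i))"
      unfolding copy_edge_def using b by (simp add: h[unfolded One_nat_def] i(3))
    then show "wp W copy_edge s1 (%t' s2. t' <= 7 & ?I (Suc i) (set_i 182 (Suc i) s2))"
    proof (rule wp_mono)
      fix t' :: nat and s2 :: state assume a: "t' <= 7 & warr s2 4 = (warr s1 4)(v * n + i := warr st 0 i, i * n + v := warr st 1 i)"
      have "warr s2 4 (a * n + b) = (if a = v & b < Suc i then warr st 0 b else if b = v & a < Suc i then warr st 1 a else warr st 4 (a * n + b))"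
        if ab: "a < n" "b < n" for a b
      proof -
        have e1: "a * n + b = v * n + i \<longleftrightarrow> a = v & b = i" and e2: "a * n + b = i * n + v \<longleftrightarrow> a = i & b = v"
          using ab v i(1) mult_add_inj[of a n b v i] mult_add_inj[of a n b i v] by auto
        have "warr s2 4 (a * n + b) = (if a = i & b = v then warr st 1 i else if a = v & b = i then warr st 0 i else warr s1 4 (a * n + b))"
          using a e1 e2 by simp
        also have "\<dots> = (if a = v & b < Suc i then warr st 0 b else if b = v & a < Suc i then warr st 1 a else warr st 4 (a * n + b))"
          using i(2) ab eq by (auto simp: less_Suc_eq)
        finally show ?thesis .
      qed
      then show "t' <= 7 & ?I (Suc i) (set_i 182 (Suc i) s2)" using a by simp
    qed
  qed (use r bounds in auto)
  then show ?thesis by (rule wp_mono) auto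
qed

theorem wp_insertion:
  fixes w0 and st :: state
  defines "w \<equiv> %x y. if x = ireg st 1 then warr st 0 y else if y = ireg st 1 then warr st 1 x else w0 x y"
  assumes w: "weights w" and p: "pinv w0 ord e st" and v: "ireg st 1 = v" "v < n" "v \<notin> set ord"
    and vv: "warr st 0 v = \<infinity>" "warr st 1 v = \<infinity>" and pr: "\<And>y. y \<in> set ord ==> warr st 5 y \<noteq> wreg st 0"
  shows "wp W insertion st (%t' s'. t' <= ins_time & warr s' 5 = (warr st 5)(v := wreg st 0) & (\<exists>ord'. pinv w ord' e s' & set ord' = insert v (set ord) &
     (\<forall>x\<in>set ord'. \<forall>y\<in>set ord'. warr s' 2 (x * n + y) = fw w (set ord') x y)))"
proof -
  have g: "gregs st" and dt: "data w0 ord st" using p by (auto simp: pinv_def)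
  have w': "w = (%x y. if x = v then warr st 0 y else if y = v then warr st 1 x else w0 x y)" unfolding w_def v(1) ..
  let ?s = "set_i 180 (v * n) st"
  have vn: "v * n < W" using mult_add_less[of v n v n] v n2 by linarith
  have r0: "ireg st 0 = n" using gregsD[OF g] by simp
  have ordn: "x < n" if "x \<in> set ord" for x using that dt by (auto simp: data_def)
  have ce: "wp W (For 182 0 copy_edge) ?s (%t' s'. t' <= n * 9 + 2 & (\<forall>a<n. \<forall>b<n. warr s' 4 (a * n + b) =
    (if a = v then warr st 0 b else if b = v then warr st 1 a else warr st 4 (a * n + b))))"
    by (rule wp_mono[OF wp_copy_edges[of ?s v]]) (use gregsD[OF g] v vv in auto)
  have 1: "wp W (IOp Mul 180 1 0 ;; For 182 0 copy_edge) st (%t' s'. t' <= n * 9 + 3 & (\<forall>a<n. \<forall>b<n. warr s' 4 (a * n + b) =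
    (if a = v then warr st 0 b else if b = v then warr st 1 a else warr st 4 (a * n + b))))"
    unfolding wp_Seq by (simp add: v(1)[unfolded One_nat_def] r0 vn) (rule wp_mono[OF ce], simp)
  have assoc: "wp W insertion st Q \<longleftrightarrow> wp W ((IOp Mul 180 1 0 ;; For 182 0 copy_edge) ;; (WStore 5 1 0 ;; IMove 100 1 ;; push ;; write_distances)) st Q" for Q
    unfolding insertion_def by (simp only: wp_Seq add.assoc)
  show ?thesis
    unfolding assoc wp_Seq[of _ "IOp Mul 180 1 0 ;; For 182 0 copy_edge"]
  proof (rule wp_frame[OF 1])
    fix t1 :: nat and s1
    assume a1: "t1 <= n * 9 + 3 & (\<forall>a<n. \<forall>b<n. warr s1 4 (a * n + b) =
      (if a = v then warr st 0 b else if b = v then warr st 1 a else warr st 4 (a * n + b)))"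
      and f1: "frame (IOp Mul 180 1 0 ;; For 182 0 copy_edge) st s1"
    have f1: "same {180, 181, 182} {20} {} {4} st s1" by (rule same_mono[OF f1]) auto
    have k1: "ireg s1 1 = v" "wreg s1 0 = wreg st 0" "warr s1 5 = warr st 5" using f1 v by (auto simp: same_def)
    define s2 where "s2 = set_i 100 v (s1\<lparr>warr := (warr s1)(5 := (warr s1 5)(v := wreg st 0))\<rparr>)"
    have W2: "warr s2 5 = (warr st 5)(v := wreg st 0)" "warr s2 4 = warr s1 4" "ireg s2 100 = v" using k1 by (auto simp: s2_def)
    have p2: "pinv w ord e s2"
    proof (rule pinv_transfer[OF p])
      fix x y assume xy: "x \<in> set ord" "y \<in> set ord"
      then have "x < n" "y < n" "x \<noteq> v" "y \<noteq> v" using v ordn by auto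
      then show "warr s2 4 (x * n + y) = warr st 4 (x * n + y)" "w0 x y = w x y" using a1 by (auto simp: W2 w')
    next
      fix x assume "x \<in> set ord" then show "warr s2 5 x = warr st 5 x" using v by (auto simp: W2)
    qed (use f1 in \<open>auto simp: same_def s2_def\<close>)
    have pu: "wp W push s2 (%t' s'. t' <= push_time & (\<exists>ord'. pinv w ord' e s' & set ord' = insert v (set ord)))"
    proof (rule wp_push_pinv[OF w p2 v(2,3) W2(3)])
      show "warr s2 4 (v * n + v) = w v v" using a1 v(2) unfolding W2 w' by simp
      show "w v v = \<infinity>" using vv by (simp add: w')
      fix y assume y: "y \<in> set ord"
      then have "y \<noteq> v" using v by blast
      then show "warr s2 4 (v * n + y) = w v y & warr s2 4 (y * n + v) = w y v" "warr s2 5 y \<noteq> warr s2 5 v"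
        using a1 v(2) y ordn[OF y] pr unfolding W2 w' by auto
    qed
    have "wp W (push ;; write_distances) s2 (%t2 s'. t2 <= push_time + dist_time & warr s' 5 = warr s2 5 & (\<exists>ord'. pinv w ord' e s' & set ord' = insert v (set ord) &
     (\<forall>x\<in>set ord'. \<forall>y\<in>set ord'. warr s' 2 (x * n + y) = fw w (set ord') x y)))"
      unfolding wp_Seq
    proof (rule wp_frame[OF pu])
      fix t3 s3 assume a3: "t3 <= push_time & (\<exists>ord'. pinv w ord' e s3 & set ord' = insert v (set ord))" and f3: "frame push s2 s3"
      then obtain ord' where o: "pinv w ord' e s3" "set ord' = insert v (set ord)" by blast
      have k3: "warr s3 5 = warr s2 5" using f3 push_mods'(4) by (auto simp: same_def)
      show "wp W write_distances s3 (%t2 s'. t3 + t2 <= push_time + dist_time & warr s' 5 = warr s2 5 & (\<exists>ord'. pinv w ord' e s' & set ord' = insert v (set ord) &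
         (\<forall>x\<in>set ord'. \<forall>y\<in>set ord'. warr s' 2 (x * n + y) = fw w (set ord') x y)))"
      proof (rule wp_frame[OF wp_write_distances[OF o(1)]])
        fix t4 s4 assume a4: "t4 <= dist_time & pinv w ord' e s4 & (\<forall>x\<in>set ord'. \<forall>y\<in>set ord'. warr s4 2 (x * n + y) = fw w (set ord') x y)"
          and f4: "frame write_distances s3 s4"
        have "warr s4 5 = warr s2 5" using f4 k3 by (simp add: same_def)
        then show "t3 + t4 <= push_time + dist_time & warr s4 5 = warr s2 5 & (\<exists>ord'. pinv w ord' e s4 & set ord' = insert v (set ord) &
         (\<forall>x\<in>set ord'. \<forall>y\<in>set ord'. warr s4 2 (x * n + y) = fw w (set ord') x y))" using a3 a4 o(2) by (intro conjI exI[of _ ord']) auto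
      qed
    qed
    then have "wp W (push ;; write_distances) s2 (%t2 s'. t1 + (1 + (1 + t2)) <= ins_time & warr s' 5 = (warr st 5)(v := wreg st 0) & (\<exists>ord'. pinv w ord' e s' & set ord' = insert v (set ord) &
     (\<forall>x\<in>set ord'. \<forall>y\<in>set ord'. warr s' 2 (x * n + y) = fw w (set ord') x y)))"
      by (rule wp_mono) (use a1 W2(1) in \<open>simp add: ins_time_def\<close>)
    then show "wp W (WStore 5 1 0 ;; IMove 100 1 ;; push ;; write_distances) s1 (%t2 s'. t1 + t2 <= ins_time &
      warr s' 5 = (warr st 5)(v := wreg st 0) & (\<exists>ord'. pinv w ord' e s' & set ord' = insert v (set ord) &
     (\<forall>x\<in>set ord'. \<forall>y\<in>set ord'. warr s' 2 (x * n + y) = fw w (set ord') x y)))"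
      unfolding wp_Seq[of _ "WStore 5 1 0"] wp_Seq[of _ "IMove 100 1"] wp_atomic
      by (simp add: s2_def k1[unfolded One_nat_def])
  qed
qed

definition del_time :: "nat => nat" where
  "del_time r = n * 5 + 2 + (r * (pop_time + 4) + 2) + pop_time + (r * (push_time + 3) + 2) + dist_time"

lemma words_ok_set_i: "words_ok W s ==> k < W ==> words_ok W (set_i x k s)"
  by (simp add: words_ok_def)

lemma wp_find:
  assumes dt: "data w ord st" and r: "r < length ord" "ireg st 1 = ord ! r" "ireg st 2 = 1"
  shows "wp W (For 182 10 compare_vertex) st (%t' s'. t' <= n * 5 + 2 & ireg s' 180 = r)"
proof -
  let ?I = "%i s. r < i --> ireg s 180 = r"
  have len: "length ord <= n" by (rule data_length[OF dt])
  have "wp W (For 182 10 compare_vertex) st (%t' s'. t' <= length ord * (3 + 2) + 2 & ?I (length ord) s' & ireg s' 182 = length ord &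
    loop_frame 182 compare_vertex st s')"
  proof (rule wp_For_const[where I = ?I])
    fix i s1 assume i: "i < length ord" "?I i s1" "ireg s1 182 = i"
      and sm: "loop_frame 182 compare_vertex st s1"
    have h: "ireg s1 1 = ord ! r" "iarr s1 0 i = ord ! i" using sm r dt i(1) by (auto simp: same_def data_def)
    have "ord ! i = ord ! r \<longleftrightarrow> i = r" using dt i(1) r(1) by (simp add: data_def nth_eq_iff_index_eq)
    then show "wp W compare_vertex s1 (%t' s2. t' <= 3 & ?I (Suc i) (set_i 182 (Suc i) s2))"
      unfolding compare_vertex_def using i(2) by (auto simp: h[unfolded One_nat_def] i(3) less_Suc_eq)
  qed (use dt len r bounds in \<open>auto simp: data_def\<close>)
  then show ?thesis
  proof (rule wp_mono)
    fix t' :: nat and s' assume "t' <= length ord * (3 + 2) + 2 & ?I (length ord) s' & ireg s' 182 = length ord &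
      loop_frame 182 compare_vertex st s'"
    then show "t' <= n * 5 + 2 & ireg s' 180 = r" using len r(1) by auto
  qed
qed

lemma wp_pop_earlier:
  assumes w: "weights w" and wo: "words_ok W st" and p: "pinv w ord e st" and r: "r <= length ord" "ireg st 180 = r"
  shows "wp W (For 182 180 pop_earlier) st (%t' s'. t' <= r * (pop_time + 4) + 2 & words_ok W s' &
    (\<exists>e. pinv w (drop r ord) e s') & (\<forall>j<r. iarr s' 4 j = ord ! j))"
proof -
  let ?I = "%i s. words_ok W s & (\<exists>e. pinv w (drop i ord) e s) & (\<forall>j<i. iarr s 4 j = ord ! j)"
  have dt: "data w ord st" and g: "gregs st" using p by (auto simp: pinv_def)
  have rW: "r < W" using r(1) data_length[OF dt] bounds by linarith
  have "wp W (For 182 180 pop_earlier) st (%t' s'. t' <= r * (pop_time + 2 + 2) + 2 & ?I r s' & ireg s' 182 = r &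
    loop_frame 182 pop_earlier st s')"
  proof (rule wp_For_const[where I = ?I])
    show "182 \<notin> iw pop_earlier" "180 \<notin> iw pop_earlier" "2 \<notin> iw pop_earlier"
      using update_mods'(1) pop_regs_notin[of 182] pop_regs_notin[of 180] pop_regs_notin[of 2] by auto
    show "?I 0 (set_i 182 0 st)" using words_ok_set_i[OF wo, of 0] rW pinv_same[OF p, of "{182}" "{}" "{}" "{}" "set_i 182 0 st"]
      by (auto simp: same_def)
  next
    fix i s1 assume i: "i < r" "?I i s1" "ireg s1 182 = i"
      and sm: "loop_frame 182 pop_earlier st s1"
    obtain e1 where p1: "pinv w (drop i ord) e1 s1" using i(2) by blast
    have dr: "drop i ord = ord ! i # drop (Suc i) ord" using i(1) r(1) by (simp add: Cons_nth_drop_Suc)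
    have h: "iarr s1 0 0 = ord ! i" "ireg s1 3 = 0" using p1 gregsD[of s1] unfolding dr pinv_def data_def by auto
    define s2 where "s2 = set_i 181 (ord ! i) s1 \<lparr>iarr := (iarr s1)(4 := (iarr s1 4)(i := ord ! i))\<rparr>"
    have "ord ! i < n" using i(1) r(1) data_nth[OF dt, of i] by simp
    then have oW: "ord ! i < W" using bounds by linarith
    have wo2: "words_ok W s2" using i(2) oW by (auto simp: words_ok_def s2_def)
    have p2: "pinv w (ord ! i # drop (Suc i) ord) e1 s2"
      unfolding dr[symmetric] by (rule pinv_same[OF p1, of "{181}" "{}" "{4}" "{}"]) (auto simp: same_def s2_def)
    have a2: "iarr s2 4 j = ord ! j" if "j < Suc i" for j using that i(2) by (auto simp: s2_def less_Suc_eq)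
    have "wp W pop s2 (%t' s3. t' <= pop_time & ?I (Suc i) (set_i 182 (Suc i) s3))"
    proof (rule wp_frame[OF wp_words_ok[OF wp_pop[OF w wo2 p2] wo2]])
      fix t3 s3 assume a3: "(t3 <= pop_time & pinv w (drop (Suc i) ord) (next_e e1) s3) & words_ok W s3" and f3: "frame pop s2 s3"
      have "pinv w (drop (Suc i) ord) (next_e e1) (set_i 182 (Suc i) s3)"
        by (rule pinv_same[of _ _ _ s3 "{182}" "{}" "{}" "{}"]) (use a3 in \<open>auto simp: same_def\<close>)
      moreover have "iarr s3 4 = iarr s2 4" using f3 pop_mods'(3) by (auto simp: same_def)
      moreover have "words_ok W (set_i 182 (Suc i) s3)" using a3 i(1) rW by (intro words_ok_set_i) auto
      ultimately show "t3 <= pop_time & ?I (Suc i) (set_i 182 (Suc i) s3)" using a3 a2 by auto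
    qed
    then have "wp W pop s2 (%t' s3. 1 + (1 + t') <= pop_time + 2 & ?I (Suc i) (set_i 182 (Suc i) s3))"
      by (rule wp_mono) auto
    then show "wp W pop_earlier s1 (%t' s2. t' <= pop_time + 2 & ?I (Suc i) (set_i 182 (Suc i) s2))"
      unfolding pop_earlier_def wp_Seq[of _ "ILoad 181 0 3"] wp_Seq[of _ "IStore 4 182 181"] wp_atomic
      by (simp add: h i(3) s2_def)
  qed (use r rW gregsD[OF g] in auto)
  moreover have eq: "pop_time + 4 = pop_time + 2 + 2" by simp
  ultimately show ?thesis unfolding eq by - (erule wp_mono, blast)
qed

lemma wp_push_back:
  assumes w: "weights w" and wx: "\<And>x. x \<in> set ord ==> w x x = \<infinity>" and p: "pinv w (drop (Suc r) ord) e st"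
    and dt: "distinct ord" "set ord \<subseteq> {..<n}" and r: "r < length ord" "ireg st 180 = r"
    and a: "\<And>j. j < r ==> iarr st 4 j = ord ! j"
    and w4: "\<And>x y. x \<in> set ord ==> y \<in> set ord ==> warr st 4 (x * n + y) = w x y"
    and w5: "\<And>x y. x \<in> set ord ==> y \<in> set ord ==> x \<noteq> y ==> warr st 5 x \<noteq> warr st 5 y"
  shows "wp W (For 182 180 push_back) st (%t' s'. t' <= r * (push_time + 3) + 2 &
    (\<exists>e ord'. pinv w ord' e s' & set ord' = set ord - {ord ! r}))"
proof -
  let ?I = "%i s. \<exists>e ord'. pinv w ord' e s & set ord' = set (drop (Suc r) ord) \<union> set (take i ord)"
  have g: "gregs st" using p by (auto simp: pinv_def)
  have "length ord <= n" using card_mono[OF _ dt(2)] distinct_card[OF dt(1)] by simp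
  then have rW: "r < W" using r(1) bounds by linarith
  have "wp W (For 182 180 push_back) st (%t' s'. t' <= r * (push_time + 1 + 2) + 2 & ?I r s' & ireg s' 182 = r &
    loop_frame 182 push_back st s')"
  proof (rule wp_For_const[where I = ?I])
    show "182 \<notin> iw push_back" "180 \<notin> iw push_back" "2 \<notin> iw push_back"
      using update_mods'(5) push_regs_notin[of 182] push_regs_notin[of 180] push_regs_notin[of 2] by auto
    have "pinv w (drop (Suc r) ord) e (set_i 182 0 st)"
      by (rule pinv_same[OF p, of "{182}" "{}" "{}" "{}"]) (auto simp: same_def)
    then show "?I 0 (set_i 182 0 st)" by force
  next
    fix i s1 assume i: "i < r" "?I i s1" "ireg s1 182 = i"
      and sm: "loop_frame 182 push_back st s1"
    obtain e1 ord1 where p1: "pinv w ord1 e1 s1" and o1: "set ord1 = set (drop (Suc r) ord) \<union> set (take i ord)" using i(2) by blast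
    let ?x = "ord ! i"
    have k: "iarr s1 4 = iarr st 4" "warr s1 4 = warr st 4" "warr s1 5 = warr st 5" using sm update_mods'(7,8) by (auto simp: same_def)
    have il: "i < length ord" using i(1) r(1) by simp
    have xs: "?x \<in> set ord" using il by simp
    have xd: "?x \<notin> set (drop (Suc r) ord)" using dt(1) il i(1) by (auto simp: set_drop_conv nth_eq_iff_index_eq)
    have xt: "?x \<notin> set (take i ord)" using dt(1) il by (auto simp: in_set_conv_nth nth_eq_iff_index_eq)
    have sub: "set ord1 \<subseteq> set ord" using o1 by (auto dest: in_set_dropD in_set_takeD)
    have nin: "?x \<notin> set ord1" using o1 xd xt by blast
    let ?s = "set_i 100 ?x s1"
    have ps: "pinv w ord1 e1 ?s" by (rule pinv_same[OF p1, of "{100}" "{}" "{}" "{}"]) (auto simp: same_def)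
    have "wp W push ?s (%t' s'. t' <= push_time & (\<exists>ord'. pinv w ord' e1 s' & set ord' = insert ?x (set ord1)))"
    proof (rule wp_push_pinv[OF w ps _ nin])
      show "?x < n" using xs dt(2) by auto
      show "w ?x ?x = \<infinity>" by (rule wx[OF xs])
      show "warr ?s 4 (?x * n + ?x) = w ?x ?x" using w4[OF xs xs] k by simp
      fix y assume y: "y \<in> set ord1"
      then have ys: "y \<in> set ord" "y \<noteq> ?x" using sub nin by auto
      show "warr ?s 4 (?x * n + y) = w ?x y & warr ?s 4 (y * n + ?x) = w y ?x" using w4[OF xs ys(1)] w4[OF ys(1) xs] k by simp
      show "warr ?s 5 y \<noteq> warr ?s 5 ?x" using w5[OF ys(1) xs ys(2)] k by simp
    qed simp
    then have "wp W push ?s (%t' s'. 1 + t' <= push_time + 1 & ?I (Suc i) (set_i 182 (Suc i) s'))"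
    proof (rule wp_mono)
      fix t' s' assume b: "t' <= push_time & (\<exists>ord'. pinv w ord' e1 s' & set ord' = insert ?x (set ord1))"
      then obtain ord' where o': "pinv w ord' e1 s'" "set ord' = insert ?x (set ord1)" by blast
      have "pinv w ord' e1 (set_i 182 (Suc i) s')" by (rule pinv_same[OF o'(1), of "{182}" "{}" "{}" "{}"]) (auto simp: same_def)
      moreover have "set ord' = set (drop (Suc r) ord) \<union> set (take (Suc i) ord)" using o' o1 il by (auto simp: take_Suc_conv_app_nth)
      ultimately show "1 + t' <= push_time + 1 & ?I (Suc i) (set_i 182 (Suc i) s')" using b by auto
    qed
    then show "wp W push_back s1 (%t' s2. t' <= push_time + 1 & ?I (Suc i) (set_i 182 (Suc i) s2))"
      unfolding push_back_def wp_Seq wp_atomic using k a[OF i(1)] by (simp add: i(3))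
  qed (use r rW gregsD[OF g] in auto)
  moreover have eq': "set ord - {ord ! r} = set (drop (Suc r) ord) \<union> set (take r ord)"
  proof -
    have eq: "ord = take r ord @ ord ! r # drop (Suc r) ord" using r(1) by (rule id_take_nth_drop)
    have "distinct (take r ord @ ord ! r # drop (Suc r) ord)" using dt(1) eq by simp
    moreover have "set ord = set (take r ord @ ord ! r # drop (Suc r) ord)" using eq by simp
    ultimately show ?thesis by auto
  qed
  moreover have eq: "push_time + 3 = push_time + 1 + 2" by simp
  ultimately show ?thesis unfolding eq eq' by - (erule wp_mono, blast)
qed

theorem wp_deletion:
  assumes w: "weights w" and wx: "\<And>x. x \<in> set ord ==> w x x = \<infinity>" and wo: "words_ok W st" and p: "pinv w ord e st"
    and r: "r < length ord" "ireg st 1 = ord ! r"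
  shows "wp W deletion st (%t' s'. t' <= del_time r & (\<exists>e' ord'. pinv w ord' e' s' & set ord' = set ord - {ord ! r} &
    (\<forall>x\<in>set ord'. \<forall>y\<in>set ord'. warr s' 2 (x * n + y) = fw w (set ord') x y)))"
proof -
  have dt: "data w ord st" and g: "gregs st" using p by (auto simp: pinv_def)
  let ?F = "For 182 10 compare_vertex" and ?E = "For 182 180 pop_earlier" and ?B = "For 182 180 push_back"
  let ?P = "%s'. \<exists>e' ord'. pinv w ord' e' s' & set ord' = set ord - {ord ! r} &
    (\<forall>x\<in>set ord'. \<forall>y\<in>set ord'. warr s' 2 (x * n + y) = fw w (set ord') x y)"
  have one: "ireg st 2 = 1" using gregsD[OF g] by simp
  have srt: "warr st 5 x \<noteq> warr st 5 y" if xy: "x \<in> set ord" "y \<in> set ord" "x \<noteq> y" for x y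
  proof -
    obtain i j where ij: "i < length ord" "j < length ord" "x = ord ! i" "y = ord ! j" using xy by (auto simp: in_set_conv_nth)
    then have "i \<noteq> j" using xy(3) by blast
    then have "i < j \<or> j < i" by linarith
    moreover have "warr st 5 (ord ! i) < warr st 5 (ord ! j)" if "i < j" "j < length ord" for i j
      using dt that by (auto simp: data_def sorted_wrt_iff_nth_less)
    ultimately show ?thesis using ij by force
  qed
  show ?thesis
    unfolding deletion_def wp_Seq
  proof (rule wp_frame[OF wp_words_ok[OF wp_find[OF dt r one] wo]])
    fix t1 :: nat and s1 assume a1: "(t1 <= n * 5 + 2 & ireg s1 180 = r) & words_ok W s1" and f1: "frame ?F st s1"
    have f1: "same {180, 181, 182} {} {} {} st s1" by (rule same_mono[OF f1]) auto
    have p1: "pinv w ord e s1" by (rule pinv_same[OF p f1]) auto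
    have k1: "warr s1 = warr st" using f1 by (auto simp: same_def)
    show "wp W ?E s1 (%t2 s2. wp W pop s2 (%t3 s3. wp W ?B s3 (%t4 s4. wp W write_distances s4 (%t5 s5.
      t1 + (t2 + (t3 + (t4 + t5))) <= del_time r & ?P s5))))"
    proof (rule wp_frame[OF wp_pop_earlier[OF w _ p1]])
      show "words_ok W s1" "r <= length ord" "ireg s1 180 = r" using a1 r by auto
      fix t2 :: nat and s2 assume a2: "t2 <= r * (pop_time + 4) + 2 & words_ok W s2 & (\<exists>e. pinv w (drop r ord) e s2) & (\<forall>j<r. iarr s2 4 j = ord ! j)"
        and f2: "frame ?E s1 s2"
      have f2: "same (insert 182 (insert 181 pop_regs)) {10..<25} {0, 1, 3, 4, 5, 6, 7, 8, 9, 10} {3, 6, 8, 9, 10, 11, 12} s1 s2"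
        by (rule same_mono[OF f2]) (use update_mods'(1-4) in auto)
      have k2: "ireg s2 180 = r" "warr s2 4 = warr st 4" "warr s2 5 = warr st 5"
        using f2 a1 k1 pop_regs_notin[of 180] by (auto simp: same_def)
      obtain e2 where p2: "pinv w (ord ! r # drop (Suc r) ord) e2 s2" using a2 r(1) by (auto simp: Cons_nth_drop_Suc)
      have wo2: "words_ok W s2" using a2 by blast
      show "wp W pop s2 (%t3 s3. wp W ?B s3 (%t4 s4. wp W write_distances s4 (%t5 s5. t1 + (t2 + (t3 + (t4 + t5))) <= del_time r & ?P s5)))"
      proof (rule wp_frame[OF wp_pop[OF w wo2 p2]])
        fix t3 :: nat and s3 assume a3: "t3 <= pop_time & pinv w (drop (Suc r) ord) (next_e e2) s3" and f3: "frame pop s2 s3"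
        have f3: "same pop_regs {10..<25} {0, 1, 3, 5, 6, 7, 8, 9, 10} {3, 6, 8, 9, 10, 11, 12} s2 s3"
          by (rule same_mono[OF f3]) (use pop_mods' in auto)
        have k3: "ireg s3 180 = r" "warr s3 4 = warr st 4" "warr s3 5 = warr st 5" "iarr s3 4 = iarr s2 4"
          using f3 k2 pop_regs_notin[of 180] by (auto simp: same_def)
        have w4: "warr s3 4 (x * n + y) = w x y" if "x \<in> set ord" "y \<in> set ord" for x y
          using dt that k3 by (auto simp: data_def)
        have p3: "pinv w (drop (Suc r) ord) (next_e e2) s3" using a3 by blast
        have b: "wp W ?B s3 (%t' s'. t' <= r * (push_time + 3) + 2 & (\<exists>e ord'. pinv w ord' e s' & set ord' = set ord - {ord ! r}))"
          by (rule wp_push_back[OF w wx p3]) (use dt r k3 a2 w4 srt in \<open>auto simp: data_def\<close>)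
        show "wp W ?B s3 (%t4 s4. wp W write_distances s4 (%t5 s5. t1 + (t2 + (t3 + (t4 + t5))) <= del_time r & ?P s5))"
        proof (rule wp_mono[OF b])
          fix t4 :: nat and s4 assume a4: "t4 <= r * (push_time + 3) + 2 & (\<exists>e ord'. pinv w ord' e s4 & set ord' = set ord - {ord ! r})"
          then obtain e4 ord4 where o4: "pinv w ord4 e4 s4" "set ord4 = set ord - {ord ! r}" by blast
          show "wp W write_distances s4 (%t5 s5. t1 + (t2 + (t3 + (t4 + t5))) <= del_time r & ?P s5)"
          proof (rule wp_mono[OF wp_write_distances[OF o4(1)]])
            fix t5 s5 assume a5: "t5 <= dist_time & pinv w ord4 e4 s5 &
              (\<forall>x\<in>set ord4. \<forall>y\<in>set ord4. warr s5 2 (x * n + y) = fw w (set ord4) x y)"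
            have "t1 + (t2 + (t3 + (t4 + t5))) <= del_time r" using a1 a2 a3 a4 a5 unfolding del_time_def by linarith
            moreover have "?P s5" using a5 o4(2) by blast
            ultimately show "t1 + (t2 + (t3 + (t4 + t5))) <= del_time r & ?P s5" by blast
          qed
        qed
      qed
    qed
  qed
qed

end

section \<open>Choice of the parameters\<close>

context queue
begin

text \<open>Without vertices every matrix is right, and only the ranks have to be set up.\<close>

lemma pinv_empty:
  assumes g: "gregs st" and r: "ireg st 8 = 0" "ireg st 9 = t" "ireg st 10 = 0"
    and rk: "\<And>l j. l <= t ==> j < 2 * d ==> iarr st 1 (l * (2 * d + 1) + j) = j * d ^ l"
      "\<And>j. j < 2 * d ==> iarr st 1 ((t + 1) * (2 * d + 1) + j) = n"
  shows "pinv w [] 0 st"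
proof -
  have ok: "level_ok w [] 0 st l 0" if l: "l <= t" for l
    unfolding level_ok_def
  proof (intro conjI allI impI)
    fix q assume "valid l 0 q & 0 <= q * d ^ l"
    then have "q * spc l <= Uv l 0" by (simp add: valid_def)
    also have "\<dots> = d * spc l" using Uv_start[of 0 l] Lv_spc(1)[of l] by (simp add: mult.commute)
    finally have "q <= d" using Lv_spc(2)[of l] by simp
    then have q: "q < 2 * d" using d2 by simp
    then show "good w [] st (slot l (q mod dd)) (q * d ^ l - 0)"
      using rk(1)[OF l q] by (simp add: good_def matrix_def slot_def base_def dd_def sd_def)
  qed simp
  have "ptr_of 0 = t" by (simp add: ptr_of_def)
  then have "levels w [] 0 0 (ptr_of 0) st"
    using ok rk(2) by (simp add: levels_def good_def matrix_def slot_def base_def dd_def sd_def)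
  moreover have "0 < 2 * d ^ (t + 2)" using d2 by simp
  ultimately show ?thesis using g r \<open>ptr_of 0 = t\<close> by (simp add: pinv_def data_def)
qed

end

text \<open>Both rest on \<open>d + 1 <= d ^ 2\<close>. The first bounds the number of levels in
  terms of \<open>d\<close>; the second shows that the test value for the next base is at most the
  cube of the current one, so that computing it does not leave the words.\<close>

lemma pow_base_le:
  fixes d :: nat assumes "2 <= d" shows "(d + 1) ^ (8 * (d + 1)) <= d ^ (16 * (d + 1))" "(d + 1) ^ (8 * (d + 1)) <= (d ^ (8 * d)) ^ 3"
proof -
  have "d + 1 <= 2 * d" using assms by simp
  also have "\<dots> <= d ^ 2" using assms by (simp add: power2_eq_square)
  finally have "(d + 1) ^ (8 * (d + 1)) <= (d ^ 2) ^ (8 * (d + 1))" by (rule power_mono) simp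
  also have "\<dots> = d ^ (16 * (d + 1))" by (simp only: power_mult[symmetric]) simp
  finally show *: "(d + 1) ^ (8 * (d + 1)) <= d ^ (16 * (d + 1))" .
  have "d ^ (16 * (d + 1)) <= d ^ (8 * d * 3)" using assms by (intro power_increasing) auto
  then show "(d + 1) ^ (8 * (d + 1)) <= (d ^ (8 * d)) ^ 3" using * by (simp only: power_mult[symmetric])
qed

text \<open>The alternative \<open>d = 2\<close> is for \<open>n\<close> below
  \<open>2 ^ 16\<close>, where no base from 2 on satisfies the second alternative.\<close>

locale tuned =
  fixes n d t :: nat
  assumes n2: "2 <= n" and d_ge: "2 <= d" and d_small: "d = 2 \<or> d ^ (8 * d) <= n" and d_large: "n < (d + 1) ^ (8 * (d + 1))"
    and t_ge: "1 <= t" and t_large: "n <= d ^ t" and t_small: "d ^ (t - 1) < n"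
begin

text \<open>The factor \<open>2 ^ k\<close> absorbs the case \<open>d = 2\<close> of small
  \<open>n\<close>; otherwise \<open>d ^ k\<close> itself is at most \<open>n\<close>.\<close>

lemma pow_le:
  assumes "k <= 8 * d" shows "d ^ k <= 2 ^ k * n"
  using d_small
proof
  assume "d ^ (8 * d) <= n"
  moreover have "d ^ k <= d ^ (8 * d)" using assms d_ge by (intro power_increasing) auto
  moreover have "1 * n <= 2 ^ k * n" by (intro mult_le_mono) auto
  ultimately show ?thesis by linarith
next
  assume "d = 2"
  then show ?thesis using n2 by (simp)
qed

lemma d_le_n: "d <= n"
  using d_small
proof
  assume a: "d ^ (8 * d) <= n"
  have "d ^ 1 <= d ^ (8 * d)" using d_ge by (intro power_increasing) auto
  then show ?thesis using a by simp
qed (use n2 in simp)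

text \<open>By the choice of \<open>d\<close> and \<open>t\<close>, \<open>d ^ (t - 1)\<close> is
  below \<open>(d + 1) ^ (8 * (d + 1))\<close>, hence below \<open>d ^ (16 * (d + 1))\<close>; the
  exponents are compared, and \<open>16 * (d + 1) <= 24 * d\<close> from \<open>d = 2\<close>
  on.\<close>

lemma t_le: "t <= 24 * d"
proof -
  have "d ^ (t - 1) < d ^ (16 * (d + 1))" using t_small d_large pow_base_le(1)[OF d_ge] by linarith
  then have "t - 1 < 16 * (d + 1)" using d_ge by (simp add: power_strict_increasing_iff)
  then have "t <= 16 * (d + 1)" by simp
  then show ?thesis using d_ge by simp
qed

text \<open>In general the left side is at most \<open>d ^ (4 * d + 2)\<close>, within the exponent
  \<open>8 * d\<close>. The constant 324 is the value \<open>2 * 2 * 9 ^ 2\<close> for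
  \<open>d = 2\<close>.\<close>

lemma codes_le: "d * d * (d ^ 3 + 1) ^ d <= 324 * n"
  using d_small
proof
  assume a: "d ^ (8 * d) <= n"
  have "d ^ 3 + 1 <= 2 * d ^ 3" using d_ge by simp
  also have "\<dots> <= d * d ^ 3" using d_ge by (intro mult_le_mono1)
  finally have "(d ^ 3 + 1) ^ d <= (d ^ 4) ^ d" by (intro power_mono) (simp_all add: numeral_eq_Suc)
  also have "\<dots> = d ^ (4 * d)" by (simp only: power_mult)
  finally have "d * d * (d ^ 3 + 1) ^ d <= d * d * d ^ (4 * d)" by simp
  also have "\<dots> = d ^ (4 * d + 2)" by (simp add: power_add power2_eq_square)
  also have "\<dots> <= d ^ (8 * d)" using d_ge by (intro power_increasing) auto
  finally show ?thesis using a by linarith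
next
  assume "d = 2" then show ?thesis using n2 by simp
qed

lemma codes_le': "(d ^ 3 + 1) ^ d <= 81 * n"
proof -
  have "4 * (d ^ 3 + 1) ^ d <= d * d * (d ^ 3 + 1) ^ d" using mult_le_mono[OF d_ge d_ge] by (intro mult_le_mono1) simp
  then show ?thesis using codes_le by linarith
qed

lemma pow_t: "d ^ t <= d * n" "d ^ (t + 2) <= n ^ 4" "t < n ^ 2"
proof -
  have "d ^ t = d * d ^ (t - 1)" using t_ge by (cases t) auto
  then show 1: "d ^ t <= d * n" using t_small by simp
  have "d ^ (t + 2) = d ^ t * (d * d)" by (simp add: power_add power2_eq_square)
  also have "\<dots> <= (n * n) * (n * n)" using 1 d_le_n by (intro mult_le_mono) (auto intro: order_trans[OF 1] mult_le_mono)
  finally show "d ^ (t + 2) <= n ^ 4" by (simp add: numeral_eq_Suc mult.assoc)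
  have "t < 2 ^ t" by (rule less_exp)
  also have "\<dots> <= d ^ t" using d_ge by (intro power_mono) auto
  also have "\<dots> <= n ^ 2" using 1 d_le_n by (simp add: power2_eq_square order_trans)
  finally show "t < n ^ 2" .
qed

text \<open>All quantities are a constant times a small power of \<open>n\<close>. Half of the
  exponent 40 is for the power and, as \<open>2 <= n\<close>, the other half for the
  constant.\<close>

lemma const_le: "c * n ^ k < n ^ 40" if "c < 2 ^ 20" "k <= 20"
proof -
  have "c * n ^ k < 2 ^ 20 * n ^ k" using that n2 by (intro mult_strict_right_mono) auto
  also have "\<dots> <= n ^ 20 * n ^ 20" using that n2 by (intro mult_le_mono power_mono power_increasing) auto
  finally show ?thesis by (simp add: power_add[symmetric])
qed

lemma NS_le: "(t + 2) * (2 * d + 1) <= 75 * (d * d)" "d * d <= 4 * n"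
proof -
  have "(t + 2) * (2 * d + 1) <= (25 * d) * (3 * d)" using t_le d_ge by (intro mult_le_mono) auto
  then show "(t + 2) * (2 * d + 1) <= 75 * (d * d)" by simp
  show "d * d <= 4 * n" using pow_le[of 2] d_ge by (simp add: power2_eq_square)
qed

lemma m_le: "d ^ 3 <= 8 * n" using pow_le[of 3] d_ge by simp

lemma queue: "queue (n ^ 40) n d (d ^ 3) ((d ^ 3 + 1) ^ d) (3 * d) t"
proof
  have NS: "(t + 2) * (2 * d + 1) <= 300 * n" using NS_le by linarith
  show "0 < n" "0 < d" "0 < d ^ 3" using n2 d_ge by auto
  have dn: "n * d <= n * n" using d_le_n by simp
  have "2 * (n * d) <= 2 * n ^ 2" using dn by (simp add: power2_eq_square)
  then show "2 * (n * d) < n ^ 40" using const_le[of 2 2] by simp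
  have "d * d ^ 3 <= n * (8 * n)" using d_le_n m_le by (intro mult_le_mono)
  then show "d * d ^ 3 < n ^ 40" using const_le[of 8 2] by (simp add: power2_eq_square)
  have "n * d ^ 3 + n <= n * (8 * n) + n * n" using m_le n2 by (intro add_mono mult_le_mono) auto
  then show "n * d ^ 3 + n < n ^ 40" using const_le[of 9 2] by (simp add: power2_eq_square)
  show "2 * d ^ 3 + 7 < n ^ 40" using m_le n2 const_le[of 20 1] by simp
  show "(d ^ 3 + 1) ^ d < n ^ 40" using codes_le' const_le[of 81 1] by simp
  show "n + 1 < n ^ 40" using n2 const_le[of 2 1] by simp
  show "n * n < n ^ 40" using const_le[of 1 2] by (simp add: power2_eq_square)
  show "(d ^ 3 + 1) ^ d <= (d ^ 3 + 1) ^ d" ..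
  \<comment> \<open>The depth \<open>3 * d\<close> of the binary search is a crude logarithm of
    \<open>d ^ 3\<close>, from \<open>d < 2 ^ d\<close>; the tile height already pays for
    it.\<close>
  have "d ^ 3 < (2 ^ d) ^ 3" by (rule power_strict_mono) auto
  then show "d ^ 3 < 2 ^ (3 * d)" by (simp add: power_mult[symmetric] mult.commute)
  show "2 <= d" "n <= d ^ t" "1 <= t" using d_ge t_large t_ge by auto
  have "(t + 2) * (2 * d + 1) * (n * n) + n * n <= 300 * n * (n * n) + n * (n * n)"
    by (rule add_mono[OF mult_le_mono1[OF NS]]) (use n2 in simp)
  then show "(t + 2) * (2 * d + 1) * (n * n) + n * n < n ^ 40" using const_le[of 301 3] by (simp add: power3_eq_cube mult.assoc)
  show "(t + 2) * (2 * d + 1) < n ^ 40" using NS const_le[of 300 1] by simp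
  have "1 <= n ^ 4" using n2 by simp
  moreover have "16 * n ^ 4 < n ^ 40" by (rule const_le) auto
  ultimately show "8 * d ^ (t + 2) + 8 < n ^ 40" using pow_t(2) by linarith
qed

end

sublocale tuned \<subseteq> queue "n ^ 40" n d "d ^ 3" "(d ^ 3 + 1) ^ d" "3 * d" t
  by (rule queue)

section \<open>Initialization: computing the parameters on the machine\<close>

definition next_power :: com where
  "next_power = IOp Mul 181 181 182"

definition grow_base :: com where
  "grow_base = If (ILess 0 181) Skip (IOp Add 5 5 2 ;; IOp Add 182 5 2 ;; IConst 183 8 ;; IOp Mul 183 183 182 ;;
    IConst 181 1 ;; For 184 183 next_power)"

definition grow_levels :: com where
  "grow_levels = If (ILess 185 0) (IOp Add 6 6 2 ;; IOp Mul 185 185 5) Skip"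

definition next_code :: com where
  "next_code = IOp Mul 13 13 12"

definition store_power :: com where
  "store_power = IStore 2 180 187 ;; IOp Mul 187 187 5"

definition store_rank :: com where
  "store_rank = IOp Div 181 180 18 ;; IOp Mod 182 180 18 ;; ILoad 183 2 181 ;; IOp Mul 183 183 182 ;;
    If (ILess 6 181) (IMove 183 0) Skip ;; IStore 1 180 183"

text \<open>The constant \<open>3 ^ 24\<close> is the test value
  \<open>(d + 1) ^ (8 * (d + 1))\<close> of the initial base \<open>d = 2\<close>.\<close>

definition choose_base :: com where
  "choose_base = IConst 2 1 ;; IConst 5 2 ;; IConst 181 (3 ^ 24) ;; For 180 0 grow_base"

definition choose_levels :: com where
  "choose_levels = IConst 6 0 ;; IConst 185 1 ;; For 180 0 grow_levels"

definition set_constants :: com where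
  "set_constants = IOp Div 7 6 5 ;; IOp Add 7 7 2 ;; IOp Add 17 5 5 ;; IOp Add 18 17 2 ;; IOp Add 186 6 2 ;; IOp Add 186 186 2 ;;
    IOp Mul 14 186 18 ;; IOp Mul 15 185 5 ;; IOp Mul 15 15 5 ;; IOp Add 15 15 15 ;; IOp Mul 16 0 0 ;; IOp Mul 11 5 5 ;;
    IOp Mul 11 11 5 ;; IOp Add 12 11 2 ;; IConst 3 0 ;; IConst 4 1 ;; IConst 8 0 ;; IMove 9 6 ;; IConst 10 0 ;; IConst 187 1 ;; IConst 13 1"

definition initialize :: com where
  "initialize = choose_base ;; choose_levels ;; set_constants ;; For 180 5 next_code ;; For 180 186 store_power ;; For 180 14 store_rank"

lemma init_mods [simp]:
  "iw next_power = {181}" "iw grow_base = {5, 181, 182, 183, 184}" "iw grow_levels = {6, 185}" "iw next_code = {13}"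
  "iw store_power = {187}" "iw store_rank = {181, 182, 183}"
  "ww next_power = {}" "ww grow_base = {}" "ww grow_levels = {}" "ww next_code = {}" "ww store_power = {}" "ww store_rank = {}"
  "waw next_power = {}" "waw grow_base = {}" "waw grow_levels = {}" "waw next_code = {}" "waw store_power = {}" "waw store_rank = {}"
  "iaw next_power = {}" "iaw grow_base = {}" "iaw grow_levels = {}" "iaw next_code = {}" "iaw store_power = {2}" "iaw store_rank = {1}"
  by (auto simp: next_power_def grow_base_def grow_levels_def next_code_def store_power_def store_rank_def)

lemma init_frame:
  assumes "frame initialize s s'"
  shows "ireg s' 0 = ireg s 0" "ireg s' 1 = ireg s 1" "wreg s' = wreg s" "warr s' = warr s"
  using assms by (auto simp: same_def initialize_def choose_base_def choose_levels_def set_constants_def)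

definition base_for :: "nat => nat => bool" where
  "base_for n d \<longleftrightarrow> 2 <= d & (d = 2 \<or> d ^ (8 * d) <= n) & n < (d + 1) ^ (8 * (d + 1))"

lemma wp_choose_base:
  assumes n: "2 <= n" and r: "ireg st 0 = n"
  shows "wp (n ^ 40) choose_base st (%t' s'. t' <= n * (3 * n + 41) + 5 & ireg s' 2 = 1 & base_for n (ireg s' 5))"
proof -
  define W where "W = n ^ 40"
  have two: "2 ^ k <= n ^ k" for k using n by (intro power_mono) auto
  have big: "k <= n ^ 39 ==> k < W" for k using n unfolding W_def by (intro le_less_trans[of k "n ^ 39"] power_strict_increasing) auto
  \<comment> \<open>Constants of the program must be words even for \<open>n = 2\<close>. The
    largest, \<open>3 ^ 24\<close>, is below \<open>2 ^ 39\<close>, which fits the word size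
    \<open>n ^ 40\<close>.\<close>
  have c: "k < W" if "k <= 2 ^ 39" for k using that two[of 39] by (intro big) linarith
  have nW: "n + 8 < W"
  proof -
    have "8 <= n ^ 3" "n <= n ^ 3" using two[of 3] n by (auto intro: self_le_power)
    then have "n + 8 <= 2 * n ^ 3" by linarith
    also have "\<dots> <= n * n ^ 3" using n by (intro mult_le_mono1)
    also have "\<dots> = n ^ 4" by (simp add: numeral_eq_Suc)
    also have "\<dots> <= n ^ 39" using n by (intro power_increasing) auto
    finally show ?thesis by (rule big)
  qed
  let ?s = "set_i 181 (3 ^ 24) (set_i 5 2 (set_i 2 1 st))"
  define I where "I = (%(j::nat) (s::state). 2 <= ireg s 5 & (ireg s 5 = 2 \<or> ireg s 5 ^ (8 * ireg s 5) <= n) &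
     ireg s 181 = (ireg s 5 + 1) ^ (8 * (ireg s 5 + 1)) & (n < ireg s 181 \<or> 2 + j <= ireg s 5))"
  have "wp W (For 180 0 grow_base) ?s (%t' s'. t' <= n * (3 * n + 39 + 2) + 2 & I n s' & ireg s' 180 = n &
    loop_frame 180 grow_base ?s s')"
  proof (rule wp_For_const)
    fix j s1 assume j: "j < n" "I j s1" "ireg s1 180 = j"
      and sm: "loop_frame 180 grow_base ?s s1"
    have h: "ireg s1 0 = n" "ireg s1 2 = 1" using sm r by (auto simp: same_def)
    show "wp W grow_base s1 (%t' s2. t' <= 3 * n + 39 & I (Suc j) (set_i 180 (Suc j) s2))"
    proof (cases "n < ireg s1 181")
      case True
      then show ?thesis unfolding grow_base_def using j(2) by (simp add: h I_def)
    next
      case False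
      define D where "D = ireg s1 5 + 1"
      have D: "3 <= D" "D ^ (8 * D) <= n" "2 + j < D" using j(2) False by (auto simp: I_def D_def)
      have "(2::nat) ^ (8 * D) <= D ^ (8 * D)" using D by (intro power_mono) auto
      \<comment> \<open>The base only grows while its power is at most \<open>n\<close>, so
        \<open>8 * D\<close> is logarithmic in \<open>n\<close>; the linear bound is enough for the
        inner loop.\<close>
      then have D8: "8 * D <= n" using less_exp[of "8 * D"] D(2) by linarith
      \<comment> \<open>The new test value is at most the cube of the old one, which did not exceed
        \<open>n\<close>.\<close>
      have top: "(D + 1) ^ (8 * (D + 1)) <= n ^ 3"
        using order_trans[OF pow_base_le(2)[of D] power_mono[OF D(2), of 3]] D(1) by simp
      also have "\<dots> <= n ^ 39" using n by (intro power_increasing) auto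
      finally have P: "(D + 1) ^ k < W" if "k <= 8 * (D + 1)" for k
        using power_increasing[OF that, of "D + 1"] by (intro big) simp
      define s2 where "s2 = set_i 181 1 (set_i 183 (8 * (D + 1)) (set_i 183 8 (set_i 182 (D + 1) (set_i 5 D s1))))"
      let ?J = "%i s. ireg s 181 = (D + 1) ^ i"
      have inner: "wp W (For 184 183 next_power) s2 (%t' s'. t' <= 8 * (D + 1) * (1 + 2) + 2 & ?J (8 * (D + 1)) s' &
        ireg s' 184 = 8 * (D + 1) & loop_frame 184 next_power s2 s')"
      proof (rule wp_For_const[where I = ?J])
        fix i s3 assume i: "i < 8 * (D + 1)" "?J i s3" "ireg s3 184 = i"
          and sm3: "loop_frame 184 next_power s2 s3"
        have "ireg s3 182 = D + 1" using sm3 by (simp add: same_def s2_def)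
        then show "wp W next_power s3 (%t' s4. t' <= 1 & ?J (Suc i) (set_i 184 (Suc i) s4))"
          unfolding next_power_def using P[of "Suc i"] i by (simp add: mult.commute)
      qed (use h D8 nW in \<open>auto simp: s2_def\<close>)
      have b: "D < W" "D + 1 < W" "8 < W" "8 * (D + 1) < W" "1 < W" using D8 nW by auto
      have "wp W (For 184 183 next_power) s2 (%t' s'. t' + 6 <= 3 * n + 39 & I (Suc j) (set_i 180 (Suc j) s'))"
      proof (rule wp_mono[OF inner])
        fix t' :: nat and s' assume a: "t' <= 8 * (D + 1) * (1 + 2) + 2 & ?J (8 * (D + 1)) s' & ireg s' 184 = 8 * (D + 1) &
          loop_frame 184 next_power s2 s'"
        then have d5: "ireg s' 5 = D" by (auto simp: same_def s2_def)
        have "t' <= 24 * D + 26" using a by simp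
        then have "t' + 6 <= 3 * n + 39" using D8 by linarith
        then show "t' + 6 <= 3 * n + 39 & I (Suc j) (set_i 180 (Suc j) s')"
          using a D unfolding I_def by (simp add: d5)
      qed
      then show ?thesis
        unfolding grow_base_def wp_If using False b
        by (simp add: h D_def s2_def add.commute)
    qed
  next
    show "I 0 (set_i 180 0 ?s)" by (simp add: I_def)
  qed (use r nW in auto)
  then have 1: "wp W (For 180 0 grow_base) ?s (%t' s'. Suc (Suc (Suc t')) <= n * (3 * n + 41) + 5 & ireg s' 2 = 1 & base_for n (ireg s' 5))"
  proof (rule wp_mono)
    fix t' :: nat and s' assume a: "t' <= n * (3 * n + 39 + 2) + 2 & I n s' & ireg s' 180 = n &
      loop_frame 180 grow_base ?s s'"
    \<comment> \<open>If the base has grown in each of the \<open>n\<close> rounds, it exceeds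
      \<open>n\<close> by itself, and so does the test value.\<close>
    have "n < (ireg s' 5 + 1) ^ (8 * (ireg s' 5 + 1))" if "2 + n <= ireg s' 5"
    proof -
      have "ireg s' 5 + 1 <= (ireg s' 5 + 1) ^ (8 * (ireg s' 5 + 1))" by (rule self_le_power) auto
      then show ?thesis using that by linarith
    qed
    then have "base_for n (ireg s' 5)" using a unfolding I_def base_for_def by auto
    moreover have "ireg s' 2 = 1" using a by (simp add: same_def)
    moreover have "t' <= n * (3 * n + 41) + 2" using a by (simp add: add.commute)
    ultimately show "Suc (Suc (Suc t')) <= n * (3 * n + 41) + 5 & ireg s' 2 = 1 & base_for n (ireg s' 5)" by simp
  qed
  have "3 ^ 24 < W" "1 < W" "2 < W" by (rule c, simp)+
  then show ?thesis
    unfolding choose_base_def wp_Seq W_def[symmetric] using 1 by simp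
qed

lemma wp_choose_levels:
  assumes n: "2 <= n" and r: "ireg st 0 = n" "ireg st 2 = 1" and d: "base_for n (ireg st 5)"
  shows "wp (n ^ 40) choose_levels st (%t' s'. t' <= n * 5 + 4 & tuned n (ireg st 5) (ireg s' 6) & ireg s' 185 = ireg st 5 ^ ireg s' 6)"
proof -
  define d where "d = ireg st 5"
  define W where "W = n ^ 40"
  have d2: "2 <= d" using d by (simp add: d_def base_for_def)
  have dn: "d <= n"
  proof (cases "d = 2")
    case False
    then have "d ^ (8 * d) <= n" using d by (simp add: d_def base_for_def)
    moreover have "d ^ 1 <= d ^ (8 * d)" using d2 by (intro power_increasing) auto
    ultimately show ?thesis by simp
  qed (use n in simp)
  have "n ^ 2 < W" unfolding W_def using n by (intro power_strict_increasing) auto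
  then have nW: "n * n < W" by (simp add: power2_eq_square)
  have "n + 1 <= 2 * n" using n by simp
  also have "\<dots> <= n * n" using n by (intro mult_le_mono1)
  finally have nW': "n + 1 < W" using nW by simp
  let ?s = "set_i 185 1 (set_i 6 0 st)"
  define I where "I = (%(j::nat) (s::state). ireg s 185 = d ^ ireg s 6 & (ireg s 6 = 0 \<or> d ^ (ireg s 6 - 1) < n) & ireg s 6 <= j & (n <= ireg s 185 \<or> ireg s 6 = j))"
  have "wp W (For 180 0 grow_levels) ?s (%t' s'. t' <= n * (3 + 2) + 2 & I n s' & ireg s' 180 = n &
    loop_frame 180 grow_levels ?s s')"
  proof (rule wp_For_const)
    fix j s1 assume j: "j < n" "I j s1" "ireg s1 180 = j"
      and sm: "loop_frame 180 grow_levels ?s s1"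
    have h: "ireg s1 0 = n" "ireg s1 2 = 1" "ireg s1 5 = d" using sm r by (auto simp: same_def d_def)
    show "wp W grow_levels s1 (%t' s2. t' <= 3 & I (Suc j) (set_i 180 (Suc j) s2))"
    proof (cases "ireg s1 185 < n")
      case True
      have "d ^ ireg s1 6 * d <= n * n" using True j(2) dn by (intro mult_le_mono) (auto simp: I_def)
      then have "d ^ ireg s1 6 * d < W" "Suc (ireg s1 6) < W" using nW nW' j by (auto simp: I_def)
      then show ?thesis unfolding grow_levels_def using True j(2) by (simp add: h I_def mult.commute)
    next
      case False
      then show ?thesis unfolding grow_levels_def using j(2) by (simp add: h I_def)
    qed
  next
    show "I 0 (set_i 180 0 ?s)" by (simp add: I_def)
  qed (use r nW' in auto)
  then have 1: "wp W (For 180 0 grow_levels) ?s (%t' s'. Suc (Suc t') <= n * 5 + 4 & tuned n d (ireg s' 6) & ireg s' 185 = d ^ ireg s' 6)"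
  proof (rule wp_mono)
    fix t' :: nat and s' assume a: "t' <= n * (3 + 2) + 2 & I n s' & ireg s' 180 = n &
      loop_frame 180 grow_levels ?s s'"
    have "n < 2 ^ n" by (rule less_exp)
    also have "2 ^ n <= d ^ n" using d2 by (intro power_mono) auto
    finally have big: "n <= d ^ ireg s' 6" using a unfolding I_def by auto
    moreover have "ireg s' 6 \<noteq> 0" using big n by (intro notI) simp
    ultimately have "tuned n d (ireg s' 6)" using a d n unfolding I_def by unfold_locales (auto simp: base_for_def d_def)
    then show "Suc (Suc t') <= n * 5 + 4 & tuned n d (ireg s' 6) & ireg s' 185 = d ^ ireg s' 6" using a unfolding I_def by auto
  qed
  have "0 < W" "1 < W" using nW' by auto
  then show ?thesis
    unfolding choose_levels_def wp_Seq W_def[symmetric] d_def[symmetric] using 1 by simp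
qed

context tuned
begin

lemma wp_set_constants:
  assumes r: "ireg st 0 = n" "ireg st 2 = 1" "ireg st 5 = d" "ireg st 6 = t" "ireg st 185 = d ^ t"
  shows "wp (n ^ 40) set_constants st (%t' s. t' <= 21 & ireg s 0 = n & ireg s 2 = 1 & ireg s 3 = 0 & ireg s 4 = 1 & ireg s 5 = d & ireg s 6 = t &
    ireg s 7 = t div d + 1 & ireg s 8 = 0 & ireg s 9 = t & ireg s 10 = 0 & ireg s 11 = d ^ 3 & ireg s 12 = d ^ 3 + 1 & ireg s 13 = 1 &
    ireg s 14 = NS & ireg s 15 = 2 * d ^ (t + 2) & ireg s 16 = n * n & ireg s 17 = 2 * d & ireg s 18 = 2 * d + 1 &
    ireg s 186 = t + 2 & ireg s 187 = 1)"
proof -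
  define W where "W = n ^ 40"
  define X where "X = d ^ t"
  have NSeq: "NS = Suc (Suc t) * Suc (d + d)" by (simp add: NS_def)
  have NSW': "Suc (Suc t) * Suc (d + d) < W" using NSW NSeq by (simp add: W_def)
  have "Suc (Suc t) * 1 <= Suc (Suc t) * Suc (d + d)" "1 * Suc (d + d) <= Suc (Suc t) * Suc (d + d)" by (intro mult_le_mono; simp)+
  from this[THEN le_less_trans[OF _ NSW']] have tW: "Suc (Suc t) < W" "Suc (d + d) < W" by simp_all
  have Xeq: "d ^ (t + 2) = X * d * d" by (simp add: X_def power_add power2_eq_square)
  have XW: "X * d * d + X * d * d < W" using MW unfolding W_def[symmetric] Xeq by linarith
  have "X * d * 1 <= X * d * d" using d_ge by (intro mult_le_mono) auto
  then have XW': "X * d < W" "X * d * d < W" using XW by linarith+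
  have m: "d * d * d = d ^ 3" by (simp add: numeral_eq_Suc)
  have dW: "Suc (d * d * d) < W" using bounds(4) unfolding m by (simp add: W_def)
  have "d * d * 1 <= d * d * d" using d_ge by (intro mult_le_mono) auto
  then have dW': "d * d * d < W" "d * d < W" using dW by linarith+
  have tdW: "Suc (t div d) < W" using tW(1) div_le_dividend[of t d] by linarith
  have nW: "n * n < W" using bounds(7) by (simp add: W_def)
  show ?thesis
    unfolding W_def[symmetric] set_constants_def NSeq Xeq m[symmetric]
    using r(1-4) r(5)[folded X_def] NSW' tW XW XW' dW dW' tdW nW by (simp add: mult_2)
qed

lemma wp_initialize_tail:
  assumes r: "ireg st 0 = n" "ireg st 2 = 1" "ireg st 5 = d" "ireg st 6 = t" "ireg st 185 = d ^ t"
  shows "wp (n ^ 40) (set_constants ;; For 180 5 next_code ;; For 180 186 store_power ;; For 180 14 store_rank) st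
    (%t' s'. t' <= 3903 * n + 30 & ireg s' 4 = 1 & pinv w [] 0 s')"
proof -
  define W where "W = n ^ 40"
  define R where "R = {0, 2, 3, 4, 5, 6, 7, 8, 9, 10, 11, 12, 14, 15, 16, 17, 18 :: nat}"
  have NS300: "NS <= 300 * n" using NS_le by (simp add: NS_def)
  have "Suc (Suc t) * 1 <= NS" unfolding NS_def by (intro mult_le_mono) auto
  then have tN: "t + 2 <= NS" by simp
  have NSW': "NS < W" using NSW by (simp add: W_def)
  show ?thesis
    unfolding W_def[symmetric] wp_Seq
  proof (rule wp_mono[OF wp_set_constants[OF r, folded W_def]])
    fix t1 :: nat and s1 :: state
    assume a1: "t1 <= 21 & ireg s1 0 = n & ireg s1 2 = 1 & ireg s1 3 = 0 & ireg s1 4 = 1 & ireg s1 5 = d & ireg s1 6 = t &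
      ireg s1 7 = t div d + 1 & ireg s1 8 = 0 & ireg s1 9 = t & ireg s1 10 = 0 & ireg s1 11 = d ^ 3 & ireg s1 12 = d ^ 3 + 1 & ireg s1 13 = 1 &
      ireg s1 14 = NS & ireg s1 15 = 2 * d ^ (t + 2) & ireg s1 16 = n * n & ireg s1 17 = 2 * d & ireg s1 18 = 2 * d + 1 &
      ireg s1 186 = t + 2 & ireg s1 187 = 1"
    let ?I = "%i s. ireg s 13 = (d ^ 3 + 1) ^ i"
    have l1: "wp W (For 180 5 next_code) s1 (%t' s'. t' <= d * (1 + 2) + 2 & ?I d s' & ireg s' 180 = d &
      loop_frame 180 next_code s1 s')"
    proof (rule wp_For_const[where I = ?I])
      fix i s2 assume i: "i < d" "?I i s2" "ireg s2 180 = i"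
        and sm: "loop_frame 180 next_code s1 s2"
      have h: "ireg s2 12 = d ^ 3 + 1" using sm a1 by (simp add: same_def)
      have "(d ^ 3 + 1) ^ Suc i <= (d ^ 3 + 1) ^ d" using i(1) by (intro power_increasing) auto
      then have "(d ^ 3 + 1) ^ i * (d ^ 3 + 1) < W" using bounds(5) by (simp add: W_def mult.commute)
      then show "wp W next_code s2 (%t' s3. t' <= 1 & ?I (Suc i) (set_i 180 (Suc i) s3))"
        unfolding next_code_def by (simp add: i(2) h mult.commute)
    qed (use a1 d_less in \<open>auto simp: W_def\<close>)
    show "wp W (For 180 5 next_code) s1 (%t2 s2. wp W (For 180 186 store_power) s2 (%t3 s3. wp W (For 180 14 store_rank) s3
      (%t4 s4. t1 + (t2 + (t3 + t4)) <= 3903 * n + 30 & ireg s4 4 = 1 & pinv w [] 0 s4)))"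
    proof (rule wp_mono[OF l1])
      fix t2 :: nat and s2 :: state
      assume a2: "t2 <= d * (1 + 2) + 2 & ?I d s2 & ireg s2 180 = d &
        loop_frame 180 next_code s1 s2"
      have R2: "ireg s2 x = ireg s1 x" if "x \<in> R \<union> {186, 187}" for x using a2 that by (auto simp: same_def R_def)
      let ?J = "%i s. ireg s 187 = d ^ i & (\<forall>l<i. iarr s 2 l = d ^ l)"
      have l2: "wp W (For 180 186 store_power) s2 (%t' s'. t' <= (t + 2) * (2 + 2) + 2 & ?J (t + 2) s' & ireg s' 180 = t + 2 &
        loop_frame 180 store_power s2 s')"
      proof (rule wp_For_const[where I = ?J])
        fix i s3 assume i: "i < t + 2" "?J i s3" "ireg s3 180 = i"
          and sm: "loop_frame 180 store_power s2 s3"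
        have h: "ireg s3 5 = d" using sm a1 R2[of 5] by (simp add: same_def R_def)
        have "d ^ Suc i <= d ^ (t + 2)" using i(1) d_ge by (intro power_increasing) auto
        then have "d ^ i * d < W" using MW unfolding W_def power_Suc2 by linarith
        then show "wp W store_power s3 (%t' s4. t' <= 2 & ?J (Suc i) (set_i 180 (Suc i) s4))"
          unfolding store_power_def using i(2) by (simp add: h i(3) less_Suc_eq mult.commute)
      qed (use a1 R2[of 2] R2[of 186] R2[of 187] tN NSW' in \<open>auto simp: R_def\<close>)
      show "wp W (For 180 186 store_power) s2 (%t3 s3. wp W (For 180 14 store_rank) s3
        (%t4 s4. t1 + (t2 + (t3 + t4)) <= 3903 * n + 30 & ireg s4 4 = 1 & pinv w [] 0 s4))"
      proof (rule wp_mono[OF l2])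
        fix t3 :: nat and s3 :: state
        assume a3: "t3 <= (t + 2) * (2 + 2) + 2 & ?J (t + 2) s3 & ireg s3 180 = t + 2 &
          loop_frame 180 store_power s2 s3"
        have R3: "ireg s3 x = ireg s1 x" if "x \<in> R" for x using a3 that R2[of x] by (auto simp: same_def R_def)
        have k3: "ireg s3 13 = (d ^ 3 + 1) ^ d" using a2 a3 by (auto simp: same_def)
        define rk where "rk = (%\<sigma>. if t < \<sigma> div sd then n else d ^ (\<sigma> div sd) * (\<sigma> mod sd))"
        let ?K = "%i s. \<forall>\<sigma><i. iarr s 1 \<sigma> = rk \<sigma>"
        have l3: "wp W (For 180 14 store_rank) s3 (%t' s'. t' <= NS * (7 + 2) + 2 & ?K NS s' & ireg s' 180 = NS &
          loop_frame 180 store_rank s3 s')"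
        proof (rule wp_For_const[where I = ?K])
          fix i s4 assume i: "i < NS" "?K i s4" "ireg s4 180 = i"
            and sm: "loop_frame 180 store_rank s3 s4"
          have h: "ireg s4 18 = sd" "ireg s4 6 = t" "ireg s4 0 = n" "iarr s4 2 = iarr s3 2"
            using sm R3[of 18] R3[of 6] R3[of 0] a1 by (auto simp: same_def R_def sd_def)
          have "i < (t + 2) * sd" using i(1) by (simp add: NS_def sd_def)
          then have ql: "i div sd < t + 2" by (rule less_mult_imp_div_less)
          then have tb: "iarr s3 2 (i div sd) = d ^ (i div sd)" using a3 by blast
          have "d ^ (i div sd) * (i mod sd) <= d ^ (t + 1) * (2 * d)"
            using ql d_ge mod_less_divisor[of sd i] by (intro mult_le_mono power_increasing) (auto simp: sd_def)
          also have "\<dots> = 2 * d ^ (t + 2)" by simp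
          finally have b: "d ^ (i div sd) * (i mod sd) < W" using MW unfolding W_def by linarith
          have b': "i div sd < W" "i mod sd < W" using i(1) NSW' div_le_dividend[of i sd] mod_less_eq_dividend[of i sd] by linarith+
          have "wp W store_rank s4 (%t' s5. t' <= 7 & iarr s5 1 = (iarr s4 1)(i := rk i))"
            unfolding store_rank_def rk_def using b b' tb by (simp add: h i(3))
          then show "wp W store_rank s4 (%t' s5. t' <= 7 & ?K (Suc i) (set_i 180 (Suc i) s5))"
            by (rule wp_mono) (use i(2) in \<open>simp add: less_Suc_eq\<close>)
        qed (use a1 R3[of 2] R3[of 14] NSW' in \<open>auto simp: R_def\<close>)
        show "wp W (For 180 14 store_rank) s3 (%t4 s4. t1 + (t2 + (t3 + t4)) <= 3903 * n + 30 & ireg s4 4 = 1 & pinv w [] 0 s4)"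
        proof (rule wp_mono[OF l3])
          fix t4 :: nat and s4 :: state
          assume a4: "t4 <= NS * (7 + 2) + 2 & ?K NS s4 & ireg s4 180 = NS &
            loop_frame 180 store_rank s3 s4"
          have R4: "ireg s4 x = ireg s1 x" if "x \<in> R" for x using a4 that R3[of x] by (auto simp: same_def R_def)
          have k4: "ireg s4 13 = (d ^ 3 + 1) ^ d" "iarr s4 2 = iarr s3 2" using a4 k3 by (auto simp: same_def)
          have g4: "gregs s4" unfolding gregs_def regs_def k4 using R4 a1 a3 by (simp add: R_def)
          have rank: "iarr s4 1 (l * (2 * d + 1) + j) = rk (l * sd + j)" if "l <= t + 1" "j < 2 * d" for l j
          proof -
            have "l * sd + j < (t + 2) * sd" using that by (intro mult_add_less) (auto simp: sd_def)
            then show ?thesis using a4 unfolding NS_def sd_def by blast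
          qed
          have "pinv w [] 0 s4"
          proof (rule pinv_empty[OF g4])
            show "ireg s4 8 = 0" "ireg s4 9 = t" "ireg s4 10 = 0" using R4 a1 by (auto simp: R_def)
            show "iarr s4 1 (l * (2 * d + 1) + j) = j * d ^ l" if "l <= t" "j < 2 * d" for l j
            proof -
              have "j < sd" using that by (simp add: sd_def)
              then have "(l * sd + j) div sd = l" "(l * sd + j) mod sd = j" by simp_all
              then show ?thesis using rank[of l j] that unfolding rk_def by simp
            qed
            show "iarr s4 1 ((t + 1) * (2 * d + 1) + j) = n" if "j < 2 * d" for j
            proof -
              have "j < sd" using that by (simp add: sd_def)
              then have dv: "(u * sd + j) div sd = u" for u by simp
              have "iarr s4 1 ((t + 1) * (2 * d + 1) + j) = rk ((t + 1) * sd + j)" by (rule rank) (use that in auto)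
              also have "\<dots> = n" unfolding rk_def dv by simp
              finally show ?thesis .
            qed
          qed
          moreover have "ireg s4 4 = 1" using R4[of 4] a1 by (simp add: R_def)
          moreover have "t1 + (t2 + (t3 + t4)) <= 3903 * n + 30"
          proof -
            have "t1 <= 21" "t2 <= d * 3 + 2" "t3 <= (t + 2) * 4 + 2" "t4 <= NS * 9 + 2" using a1 a2 a3 a4 by simp_all
            moreover have "d * 3 <= n * 3" "(t + 2) * 4 <= 300 * n * 4" "NS * 9 <= 300 * n * 9"
              by (rule mult_le_mono1, fact d_le_n, rule mult_le_mono1, fact order_trans[OF tN NS300], rule mult_le_mono1, fact NS300)
            ultimately show ?thesis by arith
          qed
          ultimately show "t1 + (t2 + (t3 + t4)) <= 3903 * n + 30 & ireg s4 4 = 1 & pinv w [] 0 s4" by blast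
        qed
      qed
    qed
  qed
qed

end

theorem wp_initialize:
  assumes n: "2 <= n" and r: "ireg st 0 = n"
  shows "wp (n ^ 40) initialize st (%t' s'. t' <= 4000 * (n * n) & ireg s' 4 = 1 &
    (\<exists>d t. tuned n d t & queue.pinv n d (d ^ 3) ((d ^ 3 + 1) ^ d) t w [] 0 s'))"
  unfolding initialize_def wp_Seq[of _ choose_base] wp_Seq[of _ choose_levels]
proof (rule wp_frame[OF wp_choose_base[OF n r]])
  fix t1 :: nat and s1 :: state
  assume a1: "t1 <= n * (3 * n + 41) + 5 & ireg s1 2 = 1 & base_for n (ireg s1 5)" and f1: "frame choose_base st s1"
  have r1: "ireg s1 0 = n" "ireg s1 2 = 1" "base_for n (ireg s1 5)" using f1 a1 r by (auto simp: same_def choose_base_def)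
  let ?T = "set_constants ;; For 180 5 next_code ;; For 180 186 store_power ;; For 180 14 store_rank"
  let ?Q = "%s'. ireg s' 4 = 1 & (\<exists>d t. tuned n d t & queue.pinv n d (d ^ 3) ((d ^ 3 + 1) ^ d) t w [] 0 s')"
  show "wp (n ^ 40) choose_levels s1 (%t2 s2. wp (n ^ 40) ?T s2 (%t3 s3. t1 + (t2 + t3) <= 4000 * (n * n) & ?Q s3))"
  proof (rule wp_frame[OF wp_choose_levels[OF n r1]])
    fix t2 :: nat and s2 :: state
    assume a2: "t2 <= n * 5 + 4 & tuned n (ireg s1 5) (ireg s2 6) & ireg s2 185 = ireg s1 5 ^ ireg s2 6"
      and f2: "frame choose_levels s1 s2"
    interpret tuned n "ireg s1 5" "ireg s2 6" using a2 by blast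
    have r2: "ireg s2 0 = n" "ireg s2 2 = 1" "ireg s2 5 = ireg s1 5" using f2 r1 by (auto simp: same_def choose_levels_def)
    have ar: "t1 + (t2 + t3) <= 4000 * (n * n)" if "t3 <= 3903 * n + 30" for t3
    proof -
      have "2 * n <= n * n" using n by (intro mult_le_mono1)
      moreover have "t1 <= 3 * (n * n) + 41 * n + 5" using a1 by (simp add: algebra_simps)
      ultimately show ?thesis using a2 that n by linarith
    qed
    show "wp (n ^ 40) ?T s2 (%t3 s3. t1 + (t2 + t3) <= 4000 * (n * n) & ?Q s3)"
      by (rule wp_mono[OF wp_initialize_tail[where w = w]]) (use r2 a2 ar in auto)
  qed
qed

section \<open>Running times\<close>

context tuned
begin

text \<open>There are \<open>q\<close> tiles with \<open>q * m <= 9 * n\<close>, so each share of a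
  tile has to be of order \<open>m * n\<close>. The ranking is by
  \<open>d * d * m <= 32 * n\<close>, the classification of columns by \<open>m = d ^ 3\<close>, and
  the tests of classes by \<open>d * d * K <= 324 * n\<close>.\<close>

lemma batch_le: "BT <= 94000 * (n * n)"
proof -
  define m where "m = d ^ 3"
  define K where "K = (m + 1) ^ d"
  define q where "q = (n - 1) div m + 1"
  define V where "V = via_time n d m K (3 * d)"
  have dd: "4 <= d * d" using mult_le_mono[OF d_ge d_ge] by simp
  have m: "m = d * (d * d)" by (simp add: m_def power3_eq_cube mult.assoc)
  have dm: "d <= m" using dd d_ge unfolding m by simp
  have K1: "1 <= K" by (simp add: K_def)
  have Kn: "K <= 81 * n" using codes_le' by (simp add: K_def m_def)
  have dK: "d * d * K <= 324 * n" using codes_le by (simp add: K_def m_def)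
  have d5: "d * d * m <= 32 * n" using pow_le[of 5] d_ge by (simp add: m_def numeral_eq_Suc mult.assoc)
  have n1: "1 <= n" using n2 by simp
  have "q * m <= (n - 1) + m" by (simp add: q_def)
  then have qm: "q * m <= 9 * n" using m_le by (simp add: m_def)
  have "d * (V + 2) <= m * (10368 * n)"
  proof -
    have "m * (m * 40 + 12) + 5 <= 57 * (m * m)"
    proof -
      have "m <= m * m" "1 <= m * m" using dm d_ge by auto
      then show ?thesis unfolding add_mult_distrib2 by linarith
    qed
    then have "d * (d * (m * (m * 40 + 12) + 5)) <= d * (d * (57 * (m * m)))" by (intro mult_le_mono) auto
    also have "\<dots> = m * (57 * (d * d * m))" by (simp add: mult_ac)
    also have "\<dots> <= m * (57 * (32 * n))" using d5 by (intro mult_le_mono2)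
    finally have 1: "d * (d * (m * (m * 40 + 12) + 5)) <= m * (1824 * n)" by simp
    have "d * (K * 3) <= m * (81 * n * 3)" using dm Kn by (intro mult_le_mono) auto
    then have 2: "d * (K * 3) <= m * (243 * n)" by simp
    have "d * (3 * d * 60 + 12) + 10 <= 189 * (d * d)"
    proof -
      have "2 * d <= d * d" using d_ge by (intro mult_le_mono1)
      moreover have "d * (3 * d * 60 + 12) = 180 * (d * d) + 12 * d" by (simp add: algebra_simps)
      ultimately show ?thesis using dd by linarith
    qed
    then have "d * (n * (d * (3 * d * 60 + 12) + 10)) <= d * (n * (189 * (d * d)))" by (intro mult_le_mono) auto
    also have "\<dots> = m * (189 * n)" unfolding m by (simp add: mult_ac)
    finally have 3: "d * (n * (d * (3 * d * 60 + 12) + 10)) <= m * (189 * n)" .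
    have "d * (K * (d * 12 + 17) + 4) <= 25 * (d * d * K)"
    proof -
      have "K * (d * 12 + 17) <= K * (21 * d)" using d_ge by (intro mult_le_mono) auto
      moreover have "1 <= K * d" using K1 d_ge by simp
      ultimately have "K * (d * 12 + 17) + 4 <= 25 * (d * K)" unfolding mult.commute[of d K] by linarith
      then have "d * (K * (d * 12 + 17) + 4) <= d * (25 * (d * K))" by (intro mult_le_mono order_refl)
      then show ?thesis by (simp add: mult_ac)
    qed
    then have "d * (K * (d * 12 + 17) + 4) <= 25 * (324 * n)" using dK by linarith
    then have "m * (d * (K * (d * 12 + 17) + 4)) <= m * (25 * (324 * n))" by (rule mult_le_mono2)
    then have 4: "d * (m * (K * (d * 12 + 17) + 4)) <= m * (8100 * n)" by (simp add: mult_ac)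
    have 5: "d * 12 <= m * (12 * n)" using mult_le_mono[OF dm mult_le_mono[OF order_refl n1, of 12]] by simp
    have "d * (V + 2) = d * (d * (m * (m * 40 + 12) + 5)) + d * (K * 3) + d * (n * (d * (3 * d * 60 + 12) + 10)) +
       d * (m * (K * (d * 12 + 17) + 4)) + d * 12"
      by (simp add: V_def via_time_def add_mult_distrib2)
    also have "\<dots> <= m * (1824 * n) + m * (243 * n) + m * (189 * n) + m * (8100 * n) + m * (12 * n)"
      using 1 2 3 4 5 by linarith
    finally show ?thesis by simp
  qed
  moreover have "20 * (m * n) + 12 <= m * (32 * n)"
  proof -
    have "1 <= m * n" using dm d_ge n1 by simp
    then show ?thesis by simp
  qed
  ultimately have "d * (V + 2) + (20 * (m * n) + 12) <= m * (10368 * n) + m * (32 * n)" by (rule add_mono)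
  moreover have "m * (10368 * n) + m * (32 * n) = m * (10400 * n)" by simp
  ultimately have "d * (V + 2) + 20 * (m * n) + 12 <= m * (10400 * n)" by (simp only: add.assoc)
  then have "q * (d * (V + 2) + 20 * (m * n) + 12) <= q * (m * (10400 * n))" by (rule mult_le_mono2)
  also have "\<dots> = (q * m) * (10400 * n)" by simp
  also have "\<dots> <= (9 * n) * (10400 * n)" using qm by (rule mult_le_mono1)
  finally have A: "q * (d * (V + 2) + 20 * (m * n) + 12) <= 93600 * (n * n)" by simp
  have B: "n * d * 50 <= 50 * (n * n)" using d_le_n by simp
  have nn: "n <= n * n" "4 <= n * n" using mult_le_mono[OF n2 n2] n1 by auto
  have "d * (n * d * 25 + n * 12 + 32) = n * (d * d) * 25 + (n * d) * 12 + d * 32" by (simp add: algebra_simps)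
  also have "\<dots> <= n * (4 * n) * 25 + (n * n) * 12 + n * 32"
    by (intro add_mono mult_le_mono1 mult_le_mono2 NS_le(2) d_le_n)
  also have "\<dots> <= 144 * (n * n)" using nn by simp
  finally have C: "d * (n * d * 25 + n * 12 + 32) <= 144 * (n * n)" .
  have "BT = n * d * 50 + d * (n * d * 25 + n * 12 + 32) + q * (d * (V + 2) + 20 * (m * n) + 12) + 30 + 3"
    unfolding BT_def batch_time_def V_def q_def K_def m_def by (rule refl)
  also have "\<dots> <= 94000 * (n * n)" using A B C nn by linarith
  finally show ?thesis .
qed

lemma square_ge: "2 * n <= n * n" "4 <= n * n"
  using mult_le_mono1[OF n2, of n] mult_le_mono[OF n2 n2] by auto

lemma NS_ge: "1 <= NS" "NS <= 300 * n" using NS_le by (auto simp: NS_def)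

lemma step_le: "step_time <= 94100 * (n * n)"
proof -
  have "step_time = n * n * 18 + d * 5 + 120 + BT" by (rule step_time_def)
  then show ?thesis using batch_le square_ge d_le_n by linarith
qed

text \<open>As \<open>t <= 24 * d\<close>, at most 25 levels besides level 0 are stepped in a
  deletion, each for the price of a batch.\<close>

lemma pop_le: "pop_time <= 2450000 * (n * n)"
proof -
  have "t div d <= 24" using div_le_mono[OF t_le, of d] d_ge by simp
  then have "(t div d + 1) * (step_time + 12) <= 25 * (94100 * (n * n) + 12)" using step_le by (intro mult_le_mono) auto
  then have "pop_time <= 25 * (94100 * (n * n) + 12) + step_time + NS * 6 + n * 6 + 60"
    unfolding pop_time_def by (intro add_mono order_refl)
  moreover have "NS * 6 <= 300 * n * 6" by (rule mult_le_mono1[OF NS_ge(2)])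
  moreover have "25 * (94100 * (n * n) + 12) = 2352500 * (n * n) + 300" by simp
  ultimately show ?thesis using step_le square_ge by linarith
qed

lemma push_le: "push_time <= NS * (94200 * (n * n))"
proof -
  have "n * (n * 22 + 50) + 72 + BT <= 94100 * (n * n)"
  proof -
    have "n * (n * 22 + 50) = n * n * 22 + n * 50" by (simp add: algebra_simps)
    then show ?thesis using batch_le square_ge by linarith
  qed
  then have "NS * (n * (n * 22 + 50) + 72 + BT) <= NS * (94100 * (n * n))" by (rule mult_le_mono2)
  moreover have "n * 30 + 60 <= 1 * (100 * (n * n))" using square_ge by linarith
  moreover have "1 * (100 * (n * n)) <= NS * (100 * (n * n))" using NS_ge by (intro mult_le_mono1)
  ultimately have "push_time <= NS * (94100 * (n * n)) + NS * (100 * (n * n))" unfolding push_time_def by linarith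
  also have "\<dots> = NS * (94200 * (n * n))" by (simp add: algebra_simps)
  finally show ?thesis .
qed

lemma dist_le: "dist_time <= 6 * (n * n)" using square_ge by (simp add: dist_time_def)

text \<open>The summand \<open>4000 * (n * n)\<close> is the initialization, which is part of the
  first insertion.\<close>

lemma ins_le: "ins_time + 4000 * (n * n) + 3 <= NS * (99000 * (n * n))"
proof -
  have "1 * (4100 * (n * n)) <= NS * (4100 * (n * n))" using NS_ge by (intro mult_le_mono1)
  then have "ins_time + 4000 * (n * n) + 3 <= NS * (94200 * (n * n)) + NS * (4100 * (n * n))"
    unfolding ins_time_def using push_le dist_le square_ge by linarith
  also have "\<dots> <= NS * (99000 * (n * n))" by (simp add: algebra_simps)
  finally show ?thesis .
qed

lemma del_le: "del_time r <= 2550000 * (n * n) * (r * NS + 1)"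
proof -
  have "1 * (2450010 * (n * n)) <= NS * (2450010 * (n * n))" using NS_ge by (intro mult_le_mono1)
  then have "pop_time + 4 + (push_time + 3) <= NS * (94200 * (n * n)) + NS * (2450010 * (n * n))"
    using pop_le push_le square_ge by linarith
  also have "\<dots> <= NS * (2550000 * (n * n))" by (simp add: algebra_simps)
  finally have "r * (pop_time + 4 + (push_time + 3)) <= r * (NS * (2550000 * (n * n)))" by (rule mult_le_mono2)
  moreover have "del_time r = n * 5 + 6 + pop_time + dist_time + r * (pop_time + 4 + (push_time + 3))"
  proof -
    have "n * 5 + 2 + (r * (p + 4) + 2) + p + (r * (q + 3) + 2) + D = n * 5 + 6 + p + D + r * (p + 4 + (q + 3))" for p q D :: nat
      by (simp add: algebra_simps)
    then show ?thesis unfolding del_time_def .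
  qed
  moreover have "n * 5 + 6 + pop_time + dist_time <= 2550000 * (n * n)" using pop_le dist_le square_ge by linarith
  ultimately have "del_time r <= 2550000 * (n * n) + r * (NS * (2550000 * (n * n)))" by linarith
  also have "\<dots> = 2550000 * (n * n) * (r * NS + 1)" by (simp add: algebra_simps)
  finally show ?thesis .
qed

section \<open>Time bounds in terms of the logarithm\<close>

lemma log_ge_1: "1 <= log 2 (real n)" using n2 by simp

text \<open>From \<open>2 ^ (8 * d) <= d ^ (8 * d) <= n\<close> the base is at most logarithmic, and
  the number of slots is of order \<open>d * d\<close>. For \<open>d = 2\<close> the bound on
  \<open>d\<close> uses that the logarithm is at least 1.\<close>

lemma NS_log: "real NS <= 300 * (log 2 (real n))\<^sup>2"
proof -
  have "real d <= 2 * log 2 (real n)"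
    using d_small
  proof
    assume a: "d ^ (8 * d) <= n"
    have "2 ^ (8 * d) <= d ^ (8 * d)" using d_ge by (intro power_mono) auto
    then have "2 ^ (8 * d) <= n" using a by linarith
    then have "2 powr real (8 * d) <= real n"
      by (subst powr_realpow) (simp_all add: of_nat_power[symmetric] del: of_nat_power)
    then have "real (8 * d) <= log 2 (real n)" using n2 by (simp add: le_log_iff)
    then show ?thesis using log_ge_1 by simp
  qed (use log_ge_1 in simp)
  then have "real d * real d <= (2 * log 2 (real n)) * (2 * log 2 (real n))" by (intro mult_mono) auto
  moreover have "real NS <= 75 * (real d * real d)" using NS_le(1) unfolding NS_def by (metis of_nat_le_iff of_nat_mult of_nat_numeral)
  ultimately show ?thesis by (simp add: power2_eq_square)
qed

lemma ins_real: "t' <= ins_time + 4000 * (n * n) + 3 ==> real t' <= 10 ^ 9 * (real n ^ 2 * (log 2 (real n))\<^sup>2)"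
proof -
  assume "t' <= ins_time + 4000 * (n * n) + 3"
  then have "t' <= NS * (99000 * (n * n))" using ins_le by linarith
  then have "real t' <= real NS * (99000 * (real n * real n))" by (metis of_nat_le_iff of_nat_mult of_nat_numeral)
  also have "\<dots> <= (300 * (log 2 (real n))\<^sup>2) * (99000 * (real n * real n))" using NS_log by (intro mult_right_mono) auto
  also have "\<dots> = 29700000 * (real n ^ 2 * (log 2 (real n))\<^sup>2)" by (simp add: power2_eq_square)
  also have "\<dots> <= 10 ^ 9 * (real n ^ 2 * (log 2 (real n))\<^sup>2)" by (intro mult_right_mono) auto
  finally show ?thesis .
qed

lemma del_real:
  assumes "t' <= del_time r" "r <= \<eta>"
  shows "real t' <= 10 ^ 9 * (real n ^ 2 * (real \<eta> * (log 2 (real n))\<^sup>2 + 1))"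
proof -
  have "t' <= 2550000 * (n * n) * (r * NS + 1)" using assms(1) del_le[of r] by linarith
  then have "real t' <= real (2550000 * (n * n) * (r * NS + 1))" by (simp only: of_nat_le_iff)
  also have "\<dots> = 2550000 * real n ^ 2 * (real r * real NS + 1)" by (simp add: power2_eq_square algebra_simps)
  also have "\<dots> <= 2550000 * real n ^ 2 * (real \<eta> * (300 * (log 2 (real n))\<^sup>2) + 1)"
    using NS_log assms(2) by (intro mult_left_mono add_right_mono mult_mono) auto
  also have "\<dots> <= 2550000 * real n ^ 2 * (300 * (real \<eta> * (log 2 (real n))\<^sup>2 + 1))"
    by (intro mult_left_mono) auto
  also have "\<dots> = 765000000 * (real n ^ 2 * (real \<eta> * (log 2 (real n))\<^sup>2 + 1))" by simp
  also have "\<dots> <= 10 ^ 9 * (real n ^ 2 * (real \<eta> * (log 2 (real n))\<^sup>2 + 1))" by (intro mult_right_mono) auto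
  finally show ?thesis .
qed

end

section \<open>Update sequences\<close>

lemma deletion_posD:
  assumes "deletion_pos us i = enat k"
  shows "us ! k = Delete (vertex (us ! i))" "\<And>l. i < l ==> l < k ==> k < length us ==> us ! l \<noteq> Delete (vertex (us ! i))"
proof -
  let ?A = "enat ` {k. i < k & k < length us & us ! k = Delete (vertex (us ! i))}"
  have "?A \<noteq> {}"
  proof
    assume "?A = {}"
    then have "deletion_pos us i = \<infinity>" unfolding deletion_pos_def by (simp add: Inf_enat_def)
    then show False using assms by simp
  qed
  then obtain a where "a \<in> ?A" by blast
  then have "Inf ?A \<in> ?A" by (rule wellorder_InfI)
  then show "us ! k = Delete (vertex (us ! i))" using assms unfolding deletion_pos_def by auto
  fix l assume l: "i < l" "l < k" "k < length us"
  show "us ! l \<noteq> Delete (vertex (us ! i))"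
  proof
    assume "us ! l = Delete (vertex (us ! i))"
    then have "deletion_pos us i <= enat l" unfolding deletion_pos_def using l by (intro Inf_lower) auto
    then show False using assms l by simp
  qed
qed

lemma pred_time_present:
  assumes "valid_updates n us" "j < k" "k <= length us" "is_Insert (us ! j)"
    "\<And>l. j < l ==> l < k ==> us ! l \<noteq> Delete (vertex (us ! j))"
  shows "vertex (us ! j) \<in> verts (graph_after us k) & pred_time (graph_after us k) (vertex (us ! j)) = predicted (us ! j)"
  using assms(2,3,5)
proof (induction k)
  case (Suc k)
  have k: "k < length us" using Suc.prems by simp
  show ?case
  proof (cases "j = k")
    case True
    then show ?thesis using assms(4) k by (cases "us ! k") (auto simp: graph_after_Suc)
  next
    case False
    then have ih: "vertex (us ! j) \<in> verts (graph_after us k)" "pred_time (graph_after us k) (vertex (us ! j)) = predicted (us ! j)"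
      using Suc by auto
    have "valid_update n (graph_after us k) (us ! k)" using assms(1) k by (simp add: valid_updates_def)
    moreover have "us ! k \<noteq> Delete (vertex (us ! j))" using Suc.prems False by simp
    ultimately show ?thesis using ih k by (cases "us ! k") (auto simp: graph_after_Suc)
  qed
qed simp

text \<open>A present vertex stems from an insertion whose name has not been deleted since. If it is
  predicted before \<open>x\<close>, it differs from \<open>x\<close>, so its deletion comes after
  position \<open>k\<close>. The insertions counted by the error thus cover these vertices.\<close>

lemma earlier_predicted_le_error:
  assumes v: "valid_updates n us" and k: "k < length us" and i: "i < k" "is_Insert (us ! i)" "deletion_pos us i = enat k"
  defines "G \<equiv> graph_after us k" and "x \<equiv> vertex (us ! i)"
  shows "card {y \<in> verts G. pred_time G y < pred_time G x} <= prediction_error us i"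
proof -
  let ?J = "{j. j < length us & is_Insert (us ! j) & enat j < deletion_pos us i &
      predicted (us ! j) < predicted (us ! i) & deletion_pos us i < deletion_pos us j}"
  note del = deletion_posD[OF i(3)]
  have px: "pred_time G x = predicted (us ! i)"
    unfolding G_def x_def using pred_time_present[OF v i(1) _ i(2)] del(2) k by auto
  have "{y \<in> verts G. pred_time G y < pred_time G x} \<subseteq> (%j. vertex (us ! j)) ` ?J"
  proof
    fix y assume "y \<in> {y \<in> verts G. pred_time G y < pred_time G x}"
    then have y: "y \<in> verts G" "pred_time G y < pred_time G x" by auto
    obtain j where j: "j < k" "is_Insert (us ! j)" "vertex (us ! j) = y" "\<forall>l. j < l & l < k --> us ! l \<noteq> Delete y"
      using present_inserted[OF v less_imp_le[OF k]] y(1) unfolding G_def by blast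
    have py: "pred_time G y = predicted (us ! j)"
      using pred_time_present[OF v j(1) _ j(2)] j k unfolding G_def by auto
    have "x \<noteq> y" using y(2) by auto
    have "enat (Suc k) <= deletion_pos us j"
      unfolding deletion_pos_def
    proof (rule Inf_greatest)
      fix z assume "z \<in> enat ` {l. j < l & l < length us & us ! l = Delete (vertex (us ! j))}"
      then obtain l where l: "z = enat l" "j < l" "us ! l = Delete y" using j(3) by auto
      then have "k <= l" using j(4) by (metis not_le)
      moreover have "l \<noteq> k" using l(3) del(1) \<open>x \<noteq> y\<close> by (auto simp: x_def)
      ultimately show "enat (Suc k) <= z" using l(1) by simp
    qed
    then have "deletion_pos us i < deletion_pos us j" unfolding i(3) by (rule less_le_trans[rotated]) simp
    then have "j \<in> ?J" using j k i(3) y(2) px py by auto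
    then show "y \<in> (%j. vertex (us ! j)) ` ?J" using j(3) by blast
  qed
  then show ?thesis unfolding prediction_error_def by (rule surj_card_le[rotated]) simp
qed

text \<open>The edges supplied with an insertion go to and from vertices present before, and the new
  vertex is not among them.\<close>

lemma loop_free:
  assumes "valid_updates n us" "k <= length us"
  shows "weight (graph_after us k) x x = None"
  using assms(2)
proof (induction k)
  case (Suc k)
  then have "valid_update n (graph_after us k) (us ! k)" using assms(1) by (simp add: valid_updates_def)
  with Suc show ?case by (cases "us ! k") (auto simp: graph_after_Suc)
qed (simp add: graph_after_def empty_graph_def)

section \<open>The algorithm\<close>

text \<open>Register 3 is always 0, while register 4 is 0 at the start and 1 from the first
  insertion on; so the test triggers the initialization exactly once.\<close>

definition ins_program :: com where
  "ins_program = If (IEq 3 4) initialize Skip ;; insertion"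

abbreviation cells :: "graph => nat => nat => ereal" where
  "cells G \<equiv> %x y. edge_cell (weight G x y)"

definition running :: "nat => graph => state => bool" where
  "running n G st \<longleftrightarrow> ireg st 4 = 1 & (\<exists>d t ord e. tuned n d t & queue.pinv n d (d ^ 3) ((d ^ 3 + 1) ^ d) t (cells G) ord e st &
     set ord = verts G & (\<forall>x\<in>verts G. warr st 5 x = ereal (pred_time G x)))"

text \<open>The first alternative is the state before the first insertion, where \<open>n\<close> is
  not yet known to the machine. The bound on words is kept apart, since it concerns all
  cells.\<close>

definition invariant :: "nat => graph => state => bool" where
  "invariant n G st \<longleftrightarrow> words_ok (n ^ 40) st & (ireg st 3 = 0 & ireg st 4 = 0 & verts G = {} \<or> running n G st)"

lemma weights_cells: "weights (cells G)"
proof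
  show "cells G x y \<noteq> -\<infinity>" for x y by (cases "weight G x y") auto
qed

lemma stores_distancesI:
  assumes "set ord = verts G" "\<forall>x\<in>set ord. \<forall>y\<in>set ord. warr s 2 (x * n + y) = fw (cells G) (set ord) x y"
  shows "stores_distances n G s"
  using assms by (auto simp: stores_distances_def distance_eq_fw)

lemma words_feed:
  assumes "words_ok W st" "n < W" "vertex u < W" shows "words_ok W (feed n u st)"
  using assms by (cases u) (auto simp: words_ok_def)

lemma n_less_words: "2 <= n ==> n < n ^ 40" for n :: nat
  using power_strict_increasing[of 1 40 n] by simp

lemma wp_insert:
  assumes n: "2 <= n" and inv: "invariant n G st" and v: "valid_update n G (Insert v p f g)"
  defines "G' \<equiv> apply_update (Insert v p f g) G"
  shows "wp (n ^ 40) ins_program (feed n (Insert v p f g) st) (%t' s'. invariant n G' s' & stores_distances n G' s' &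
    real t' <= 10 ^ 9 * (real n ^ 2 * (log 2 (real n)) ^ 2))"
proof -
  define s0 where "s0 = feed n (Insert v p f g) st"
  have s0: "ireg s0 0 = n" "ireg s0 1 = v" "wreg s0 0 = ereal p" "warr s0 0 = (%u. edge_cell (f u))" "warr s0 1 = (%u. edge_cell (g u))"
    "ireg s0 3 = ireg st 3" "ireg s0 4 = ireg st 4" "warr s0 5 = warr st 5"
    by (simp_all add: s0_def)
  have vn: "v < n" "v \<notin> verts G" "f v = None" "g v = None" "p \<notin> pred_time G ` verts G" using v by auto
  have wo0: "words_ok (n ^ 40) s0" unfolding s0_def
    by (rule words_feed) (use inv n_less_words[OF n] vn in \<open>auto simp: invariant_def\<close>)
  define P where "P = (%t' s1. t' <= 4000 * (n * n) + 2 & ireg s1 1 = v & wreg s1 0 = ereal p & warr s1 0 = (%u. edge_cell (f u)) &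
    warr s1 1 = (%u. edge_cell (g u)) & running n G s1)"
  have "wp (n ^ 40) (If (IEq 3 4) initialize Skip) s0 P"
  proof (cases "ireg st 3 = 0 & ireg st 4 = 0 & verts G = {}")
    case True
    have "wp (n ^ 40) initialize s0 (%t'. P (Suc t'))"
    proof (rule wp_frame[OF wp_initialize[OF n s0(1), of "cells G"]])
      fix t' s1 assume a: "t' <= 4000 * (n * n) & ireg s1 4 = 1 & (\<exists>d t. tuned n d t & queue.pinv n d (d ^ 3) ((d ^ 3 + 1) ^ d) t (cells G) [] 0 s1)"
        and f: "frame initialize s0 s1"
      then have "running n G s1" unfolding running_def using True by auto
      then show "P (Suc t') s1" using a init_frame[OF f] s0 by (auto simp: P_def)
    qed
    then show ?thesis using True by (simp add: s0)
  next
    case False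
    then have r: "running n G st" using inv by (auto simp: invariant_def)
    then obtain d t ord e where h: "ireg st 4 = 1" "tuned n d t" "queue.pinv n d (d ^ 3) ((d ^ 3 + 1) ^ d) t (cells G) ord e st"
      "set ord = verts G" "\<forall>x\<in>verts G. warr st 5 x = ereal (pred_time G x)" unfolding running_def by blast
    interpret tuned n d t by (rule h(2))
    have g: "gregs st" using h(3) unfolding pinv_def by blast
    have "pinv (cells G) ord e s0"
      by (rule pinv_transfer[OF h(3)]) (use gregsD[OF g] in \<open>auto simp: s0_def\<close>)
    then have "running n G s0" unfolding running_def using h s0 by auto
    then show ?thesis using h(1) gregsD(13)[OF g] s0 by (simp add: P_def)
  qed
  then have "wp (n ^ 40) ins_program s0 (%t' s'. (running n G' s' & stores_distances n G' s' &
    real t' <= 10 ^ 9 * (real n ^ 2 * (log 2 (real n)) ^ 2)))"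
    unfolding ins_program_def wp_Seq
  proof (rule wp_mono)
    fix t1 s1 assume P: "P t1 s1"
    then obtain d t ord e where h: "ireg s1 4 = 1" "tuned n d t" "queue.pinv n d (d ^ 3) ((d ^ 3 + 1) ^ d) t (cells G) ord e s1"
      "set ord = verts G" "\<forall>x\<in>verts G. warr s1 5 x = ereal (pred_time G x)" unfolding running_def P_def by blast
    interpret tuned n d t by (rule h(2))
    have k: "ireg s1 1 = v" "wreg s1 0 = ereal p" "warr s1 0 = (%u. edge_cell (f u))" "warr s1 1 = (%u. edge_cell (g u))"
      "t1 <= 4000 * (n * n) + 2" using P by (auto simp: P_def)
    have w: "(%x y. if x = ireg s1 1 then warr s1 0 y else if y = ireg s1 1 then warr s1 1 x else cells G x y) = cells G'"
      unfolding k by (intro ext) (simp add: G'_def)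
    have ins: "wp (n ^ 40) insertion s1 (%t' s'. t' <= ins_time & warr s' 5 = (warr s1 5)(v := wreg s1 0) &
      (\<exists>ord'. pinv (cells G') ord' e s' & set ord' = insert v (set ord) &
       (\<forall>x\<in>set ord'. \<forall>y\<in>set ord'. warr s' 2 (x * n + y) = fw (cells G') (set ord') x y)))"
      by (rule wp_insertion[where ?w0.0 = "cells G" and ord = ord and st = s1 and v = v and e = e, unfolded w])
        (use h k vn weights_cells in auto)
    show "wp (n ^ 40) insertion s1 (%t2 s'. running n G' s' & stores_distances n G' s' &
      real (t1 + t2) <= 10 ^ 9 * (real n ^ 2 * (log 2 (real n)) ^ 2))"
    proof (rule wp_frame[OF ins])
      fix t2 s2 assume a: "t2 <= ins_time & warr s2 5 = (warr s1 5)(v := wreg s1 0) &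
        (\<exists>ord'. pinv (cells G') ord' e s2 & set ord' = insert v (set ord) &
         (\<forall>x\<in>set ord'. \<forall>y\<in>set ord'. warr s2 2 (x * n + y) = fw (cells G') (set ord') x y))"
        and f: "frame insertion s1 s2"
      then obtain ord' where o: "pinv (cells G') ord' e s2" "set ord' = insert v (set ord)"
        "\<forall>x\<in>set ord'. \<forall>y\<in>set ord'. warr s2 2 (x * n + y) = fw (cells G') (set ord') x y" by blast
      have V: "set ord' = verts G'" using o(2) h(4) by (simp add: G'_def)
      have "\<forall>x\<in>verts G'. warr s2 5 x = ereal (pred_time G' x)" using a h(5) k by (auto simp: G'_def)
      then have "running n G' s2" unfolding running_def using flag_kept(1)[OF f] h(1,2) o(1) V by auto
      moreover have "stores_distances n G' s2" by (rule stores_distancesI[OF V o(3)])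
      moreover have "real (t1 + t2) <= 10 ^ 9 * (real n ^ 2 * (log 2 (real n)) ^ 2)"
        by (rule ins_real) (use a k in auto)
      ultimately show "running n G' s2 & stores_distances n G' s2 & real (t1 + t2) <= 10 ^ 9 * (real n ^ 2 * (log 2 (real n)) ^ 2)"
        by blast
    qed
  qed
  from wp_words_ok[OF this wo0] show ?thesis unfolding s0_def
    by (rule wp_mono) (auto simp: invariant_def)
qed

lemma wp_delete:
  assumes n: "2 <= n" and inv: "invariant n G st" and v: "v \<in> verts G" and lf: "\<And>x. weight G x x = None"
    and \<eta>: "card {y \<in> verts G. pred_time G y < pred_time G v} <= \<eta>"
  defines "G' \<equiv> apply_update (Delete v) G"
  shows "wp (n ^ 40) deletion (feed n (Delete v) st) (%t' s'. invariant n G' s' & stores_distances n G' s' &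
    real t' <= 10 ^ 9 * (real n ^ 2 * (real \<eta> * (log 2 (real n)) ^ 2 + 1)))"
proof -
  define s0 where "s0 = feed n (Delete v) st"
  obtain d t ord e where h: "ireg st 4 = 1" "tuned n d t" "queue.pinv n d (d ^ 3) ((d ^ 3 + 1) ^ d) t (cells G) ord e st"
      "set ord = verts G" "\<forall>x\<in>verts G. warr st 5 x = ereal (pred_time G x)"
    using inv v unfolding invariant_def running_def by blast
  interpret tuned n d t by (rule h(2))
  have g: "gregs st" and dt: "data (cells G) ord st" using h(3) unfolding pinv_def by blast+
  have vn: "v < n" using dt v h(4) by (auto simp: data_def)
  have wo0: "words_ok (n ^ 40) s0" unfolding s0_def
    by (rule words_feed) (use inv n_less_words[OF n] vn in \<open>auto simp: invariant_def\<close>)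
  have p0: "pinv (cells G) ord e s0"
    by (rule pinv_transfer[OF h(3)]) (use gregsD[OF g] in \<open>auto simp: s0_def\<close>)
  obtain r where r: "r < length ord" "ord ! r = v" using v h(4) by (metis in_set_conv_nth)
  \<comment> \<open>The order is sorted by predicted time, so the \<open>r\<close> vertices in front
    of \<open>v\<close> are present vertices predicted before \<open>v\<close>.\<close>
  have r\<eta>: "r <= \<eta>"
  proof -
    have "set (take r ord) \<subseteq> {y \<in> verts G. pred_time G y < pred_time G v}"
    proof
      fix y assume "y \<in> set (take r ord)"
      then obtain i where i: "i < r" "y = ord ! i" using r(1) by (auto simp: in_set_conv_nth)
      have "warr st 5 (ord ! i) < warr st 5 (ord ! r)"
        using dt i r(1) by (auto simp: data_def sorted_wrt_iff_nth_less)
      moreover have "y \<in> verts G" using i r(1) h(4) by auto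
      ultimately show "y \<in> {y \<in> verts G. pred_time G y < pred_time G v}" using h(5) v r(2) i(2) by auto
    qed
    moreover have "finite (verts G)" using h(4) by (metis List.finite_set)
    ultimately have "card (set (take r ord)) <= card {y \<in> verts G. pred_time G y < pred_time G v}" by (intro card_mono) auto
    moreover have "card (set (take r ord)) = r" using dt r(1) by (simp add: data_def distinct_card)
    ultimately show ?thesis using \<eta> by linarith
  qed
  have del: "wp (n ^ 40) deletion s0 (%t' s'. t' <= del_time r & (\<exists>e' ord'. pinv (cells G) ord' e' s' & set ord' = set ord - {ord ! r} &
    (\<forall>x\<in>set ord'. \<forall>y\<in>set ord'. warr s' 2 (x * n + y) = fw (cells G) (set ord') x y)))"
    by (rule wp_deletion[OF weights_cells _ wo0 p0 r(1)]) (use lf r(2) in \<open>auto simp: s0_def\<close>)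
  have "wp (n ^ 40) deletion s0 (%t' s'. running n G' s' & stores_distances n G' s' &
    real t' <= 10 ^ 9 * (real n ^ 2 * (real \<eta> * (log 2 (real n)) ^ 2 + 1)))"
  proof (rule wp_frame[OF del])
    fix t' s' assume a: "t' <= del_time r & (\<exists>e' ord'. pinv (cells G) ord' e' s' & set ord' = set ord - {ord ! r} &
      (\<forall>x\<in>set ord'. \<forall>y\<in>set ord'. warr s' 2 (x * n + y) = fw (cells G) (set ord') x y))" and f: "frame deletion s0 s'"
    then obtain e' ord' where o: "pinv (cells G) ord' e' s'" "set ord' = set ord - {v}"
      "\<forall>x\<in>set ord'. \<forall>y\<in>set ord'. warr s' 2 (x * n + y) = fw (cells G) (set ord') x y" unfolding r(2) by blast
    have V: "set ord' = verts G'" using o(2) h(4) by (simp add: G'_def)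
    have eq: "cells G x y = cells G' x y" if "x \<in> set ord'" "y \<in> set ord'" for x y using that o(2) by (auto simp: G'_def)
    have "pinv (cells G') ord' e' s'" by (rule pinv_transfer[OF o(1)]) (use eq in auto)
    moreover have "\<forall>x\<in>verts G'. warr s' 5 x = ereal (pred_time G' x)" using flag_kept(2)[OF f] h(5) by (auto simp: G'_def s0_def)
    moreover have "ireg s' 4 = 1" using flag_kept(2)[OF f] h(1) by (simp add: s0_def)
    ultimately have "running n G' s'" unfolding running_def using h(2) V by blast
    moreover have "fw (cells G) (set ord') x y = fw (cells G') (set ord') x y" if "x \<in> set ord'" "y \<in> set ord'" for x y
      using that by (intro fw_cong eq) auto
    then have "stores_distances n G' s'" using o(3) by (intro stores_distancesI[OF V]) simp
    moreover have "real t' <= 10 ^ 9 * (real n ^ 2 * (real \<eta> * (log 2 (real n)) ^ 2 + 1))"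
      by (rule del_real[OF _ r\<eta>]) (use a in auto)
    ultimately show "running n G' s' & stores_distances n G' s' & real t' <= 10 ^ 9 * (real n ^ 2 * (real \<eta> * (log 2 (real n)) ^ 2 + 1))"
      by blast
  qed
  from wp_words_ok[OF this wo0] show ?thesis unfolding s0_def
    by (rule wp_mono) (auto simp: invariant_def)
qed

lemma update_step:
  assumes n: "2 <= n" and us: "valid_updates n us" and k: "k < length us" and inv: "invariant n (graph_after us k) st"
  shows "\<exists>s' t'. exec (n ^ 40) (if is_Insert (us ! k) then ins_program else deletion) (feed n (us ! k) st) t' s' &
    invariant n (graph_after us (Suc k)) s' & stores_distances n (graph_after us (Suc k)) s' &
    (is_Insert (us ! k) --> real t' <= 10 ^ 9 * (real n ^ 2 * (log 2 (real n)) ^ 2)) &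
    (\<forall>i < k. is_Insert (us ! i) & deletion_pos us i = enat k -->
      real t' <= 10 ^ 9 * (real n ^ 2 * (real (prediction_error us i) * (log 2 (real n)) ^ 2 + 1)))"
proof -
  have v: "valid_update n (graph_after us k) (us ! k)" using us k by (simp add: valid_updates_def)
  show ?thesis
  proof (cases "us ! k")
    case (Insert v p f g)
    have "us ! k \<noteq> Delete x" for x using Insert by simp
    then have "deletion_pos us i \<noteq> enat k" for i using deletion_posD(1) by blast
    then show ?thesis
      using wp_insert[OF n inv v[unfolded Insert]] Insert unfolding wp_def graph_after_Suc[OF k] by auto
  next
    case (Delete v)
    let ?G = "graph_after us k"
    obtain i where i: "i < k" "is_Insert (us ! i)" "vertex (us ! i) = v" "deletion_pos us i = enat k"
      using deletion_of_inserted[OF us k Delete] by blast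
    \<comment> \<open>Two insertions deleted at the same position bear the same name; the later one
      would have inserted a name that was still present.\<close>
    have same: "j = i" if j: "j < k" "is_Insert (us ! j)" "deletion_pos us j = enat k" for j
    proof (rule ccontr)
      assume "j \<noteq> i"
      have vj: "vertex (us ! j) = v" using deletion_posD(1)[OF j(3)] Delete by simp
      have *: False if a: "a < b" "b < k" "vertex (us ! a) = v" "vertex (us ! b) = v" "is_Insert (us ! a)" "is_Insert (us ! b)"
        "deletion_pos us a = enat k" for a b
      proof -
        have "vertex (us ! a) \<in> verts (graph_after us b)"
          using pred_time_present[OF us a(1) _ a(5)] deletion_posD(2)[OF a(7)] a(2) k by auto
        moreover have "valid_update n (graph_after us b) (us ! b)" using us a(2) k by (simp add: valid_updates_def)
        ultimately show False using a by (cases "us ! b") auto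
      qed
      show False using *[of i j] *[of j i] i j vj \<open>j \<noteq> i\<close> by linarith
    qed
    have "card {y \<in> verts ?G. pred_time ?G y < pred_time ?G v} <= prediction_error us i"
      using earlier_predicted_le_error[OF us k i(1,2,4)] i(3) by simp
    moreover have "v \<in> verts ?G" using v Delete by simp
    moreover have "weight ?G x x = None" for x using loop_free[OF us] k by simp
    ultimately have "wp (n ^ 40) deletion (feed n (Delete v) st) (%t' s'. invariant n (apply_update (Delete v) ?G) s' &
      stores_distances n (apply_update (Delete v) ?G) s' &
      real t' <= 10 ^ 9 * (real n ^ 2 * (real (prediction_error us i) * (log 2 (real n)) ^ 2 + 1)))"
      using wp_delete[OF n inv] by blast
    then obtain t' s' where e: "exec (n ^ 40) deletion (feed n (Delete v) st) t' s'" "invariant n (apply_update (Delete v) ?G) s'"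
      "stores_distances n (apply_update (Delete v) ?G) s'"
      "real t' <= 10 ^ 9 * (real n ^ 2 * (real (prediction_error us i) * (log 2 (real n)) ^ 2 + 1))"
      unfolding wp_def by blast
    show ?thesis
      unfolding graph_after_Suc[OF k] Delete
      by (intro exI[of _ s'] exI[of _ t']) (use e same in auto)
  qed
qed

theorem theorem1p6:
  "\<exists>(ins :: com) (del :: com) (c :: nat) (C :: real).
    \<forall>n \<ge> 2. \<forall>us. valid_updates n us \<longrightarrow>
      (\<exists>(S :: nat \<Rightarrow> state) (T :: nat \<Rightarrow> nat).
        S 0 = init_state \<and>
        (\<forall>k < length us.
          exec (n ^ c) (if is_Insert (us ! k) then ins else del)
            (feed n (us ! k) (S k)) (T k) (S (Suc k)) \<and>
          stores_distances n (graph_after us (Suc k)) (S (Suc k)) \<and>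
          (is_Insert (us ! k) \<longrightarrow>
            real (T k) \<le> C * (real n ^ 2 * (log 2 (real n)) ^ 2)) \<and>
          (\<forall>i < k. is_Insert (us ! i) \<and> deletion_pos us i = enat k \<longrightarrow>
            real (T k) \<le> C * (real n ^ 2 *
              (real (prediction_error us i) * (log 2 (real n)) ^ 2 + 1)))))"
proof (rule exI[of _ ins_program], rule exI[of _ deletion], rule exI[of _ 40], rule exI[of _ "10 ^ 9"], intro allI impI)
  fix n us assume n: "2 <= n" and us: "valid_updates n us"
  define Q where "Q = (%k s t' s'. exec (n ^ 40) (if is_Insert (us ! k) then ins_program else deletion) (feed n (us ! k) s) t' s' &
    invariant n (graph_after us (Suc k)) s' & stores_distances n (graph_after us (Suc k)) s' &
    (is_Insert (us ! k) --> real t' <= 10 ^ 9 * (real n ^ 2 * (log 2 (real n)) ^ 2)) &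
    (\<forall>i < k. is_Insert (us ! i) & deletion_pos us i = enat k -->
      real t' <= 10 ^ 9 * (real n ^ 2 * (real (prediction_error us i) * (log 2 (real n)) ^ 2 + 1))))"
  \<comment> \<open>The states are chosen recursively. Up to the length of the sequence the
    invariant provides a successor with all required properties; beyond it the choice is
    arbitrary.\<close>
  define S where "S = rec_nat init_state (%k s. SOME s'. \<exists>t'. Q k s t' s')"
  define T where "T = (%k. SOME t'. Q k (S k) t' (S (Suc k)))"
  have S0: "S 0 = init_state" and SS: "S (Suc k) = (SOME s'. \<exists>t'. Q k (S k) t' s')" for k by (simp_all add: S_def)
  have step: "\<exists>t'. Q k (S k) t' (S (Suc k))" if "k < length us" "invariant n (graph_after us k) (S k)" for k
    unfolding SS using update_step[OF n us that] unfolding Q_def by (rule someI_ex)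
  have inv: "k <= length us ==> invariant n (graph_after us k) (S k)" for k
  proof (induction k)
    case 0
    show ?case using n by (simp add: S0 invariant_def init_state_def words_ok_def graph_after_def empty_graph_def)
  next
    case (Suc k)
    then show ?case using step[of k] by (auto simp: Q_def)
  qed
  have "Q k (S k) (T k) (S (Suc k))" if "k < length us" for k
    unfolding T_def by (rule someI_ex) (use step[OF that] inv that in auto)
  then show "\<exists>(S :: nat => state) (T :: nat => nat).
        S 0 = init_state &
        (\<forall>k < length us.
          exec (n ^ 40) (if is_Insert (us ! k) then ins_program else deletion)
            (feed n (us ! k) (S k)) (T k) (S (Suc k)) &
          stores_distances n (graph_after us (Suc k)) (S (Suc k)) &
          (is_Insert (us ! k) -->
            real (T k) <= 10 ^ 9 * (real n ^ 2 * (log 2 (real n)) ^ 2)) &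
          (\<forall>i < k. is_Insert (us ! i) & deletion_pos us i = enat k -->
            real (T k) <= 10 ^ 9 * (real n ^ 2 *
              (real (prediction_error us i) * (log 2 (real n)) ^ 2 + 1))))"
    using S0 unfolding Q_def by (intro exI[of _ S] exI[of _ T]) blast
qed

end
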